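(* Let $0<\alpha<2$ and $\lambda>0$, let $\sigma$ be a finite symmetric measure on $S^{d-1}$ that is not concentrated on any $(d-1)$-dimensional subspace of $\mathbb{R}^d$, and let $\mathbb{M}_\lambda$ be the $\mathbb{R}^d$-valued exponentially tempered stable independently scattered random measure on $\mathbb{R}^n$ (with Lebesgue measure) associated with $\alpha,\lambda,\sigma$. Let $E\in Q(\mathbb{R}^n)$ and denote its trace by $q$. Assume that $\varphi:\mathbb{R}^n\to[0,\infty)$ is an $E$-homogeneous, $(\beta,E)$-admissible function for some $\beta>0$. Let $D\in Q(\mathbb{R}^d)$ be such that the maximum $H$ of the real parts of the eigenvalues of $D$ fulfills $$H<\beta+q\left(\frac1\alpha-\frac12\right).$$ Then the random field $\mathbb{X}=\{X(t):t\in\mathbb{R}^n\}$ defined by $$X(t)=\int_{\mathbb{R}^n}\left[\varphi(t-s)^{D-\frac q\alpha I}-\varphi(-s)^{D-\frac q\alpha I}\right]\mathbb{M}_\lambda(ds)$$ exists (i.e. for every $t$ the integrand belongs to $\mathcal{I}(\mathbb{M}_\lambda)$). Furthermore: (a) $\mathbb{X}$ is a $T\alpha S$ random field, i.e. all its finite-dimensional distributions are tempered $\alpha$-stable. (b) $\mathbb{X}$ is stochastically continuous. (c) $\mathbb{X}$ has stationary increments: for any $h\in\mathbb{R}^n$, $\{X(t+h)-X(h):t\in\mathbb{R}^n\}$ and $\{X(t):t\in\mathbb{R}^n\}$ have the same finite-dimensional distributions. (d) If $\frac q\alpha$ is not an eigenvalue of $D$, then $X(t)$ is full for every $t\ne0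$.
   Context: Notation: $L(\mathbb{R}^m)$ is the space of real $m\times m$ matrices, $I=I_d$ the identity on $\mathbb{R}^d$, $\|\cdot\|$ the Euclidean norm (and operator norm), $D^*$ the adjoint (transpose) of $D$. $Q(\mathbb{R}^m)$ is the set of $E\in L(\mathbb{R}^m)$ all of whose eigenvalues have strictly positive real part. For $c>0$ and a matrix $E$, $c^E:=\exp((\log c)E)$ (matrix exponential). A random vector is full if its law is not concentrated on any hyperplane. Generalized polar coordinates: for $E\in Q(\mathbb{R}^n)$ there is a norm $\|\cdot\|_E$ on $\mathbb{R}^n$ such that, with $S_E^{n-1}=\{x:\|x\|_E=1\}$, the map $(0,\infty)\times S_E^{n-1}\to\mathbb{R}^n\setminus\{0\}$, $(c,\theta)\mapsto c^E\theta$, is a homeomorphism; fix such a norm and write $x=\tau(x)^El(x)$ with $\tau(x)>0$, $l(x)\in S_E^{n-1}$ for $x\neq0$; put $\tau(0)=0$. A function $\varphi$ on $\mathbb{R}^n$ is $E$-homogeneous if $\varphi(c^Ex)=c\,\varphi(x)$ for all $c>0$, $x\ne0$. A function $\varphi:\mathbb{R}^n\to[0,\infty)$ is $(\beta,E)$-admissible ($\beta>0$) if (i) $\varphi(x)>0$ for all $x\ne0$, and (ii) $\varphi$ is continuous and for any $0<A<B$ there is a constant $C>0$ such that for all $y$ with $A\le\|y\|\le B$: $\tau(x)\le1\Rightarrow|\varphi(x+y)-\varphi(y)|\le C\tau(x)^\beta$. Infinitely divisible laws without Gaussian part are described by a shift and a Lévy measure $\phi$. A tempered $\alpha$-stable ($T\alpha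 S$) distribution on $\mathbb{R}^m$ is an infinitely divisible law without Gaussian part whose Lévy measure in polar coordinates is $\phi(dr,d\theta)=r^{-\alpha-1}q_0(r,\theta)\,dr\,\sigma_0(d\theta)$, with $\sigma_0$ a finite measure on $S^{m-1}$ and $q_0:(0,\infty)\times S^{m-1}\to(0,\infty)$ Borel such that for every $\theta$: $(-1)^k\frac{\partial^k}{\partial r^k}q_0(r,\theta)>0$ for all $r>0$, $k\in\mathbb{N}$, and $\lim_{r\to\infty}q_0(r,\theta)=0$. Random measure $\mathbb{M}_\lambda$: let $\phi_\lambda(A)=\int_{S^{d-1}}\int_0^\infty\mathbf{1}_A(r\theta)r^{-\alpha-1}e^{-\lambda r}\,dr\,\sigma(d\theta)$ and let $\mu_\lambda$ be the symmetric infinitely divisible law with log-characteristic function $\psi_\lambda(u)=\int_{\mathbb{R}^d}(\cos\langle u,x\rangle-1)\phi_\lambda(dx)$. $\mathbb{M}_\lambda$ is a family of $\mathbb{R}^d$-valued random vectors $\mathbb{M}_\lambda(A)$, indexed by Borel sets $A\subset\mathbb{R}^n$ of finite Lebesgue measure $|A|$, which is independent over disjoint sets, a.s. $\sigma$-additive over disjoint sequences whose union has finite measure, and such that $\mathbb{M}_\lambda(A)$ has log-characteristic function $|A|\psi_\lambda$. Stochastic integral: for simple $f=\sum_jD_j\mathbf{1}_{A_j}$ put $I(f)=\int f\,d\mathbb{M}_\lambda=\sum_jD_j\mathbb{M}_\lambda(A_j)$. A measurable $f:\mathbb{R}^n\to L(\mathbb{R}^d)$ belongs to $\mathcal{I}(\mathbb{M}_\lambda)$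 if there are simple $f_k\to f$ a.e. such that $I(f_k\mathbf{1}_A)$ converges in probability for every Borel $A$; then $I(f)=\int f\,d\mathbb{M}_\lambda=\lim I(f_k)$. Known facts: $f\in\mathcal{I}(\mathbb{M}_\lambda)$ iff $\int_{\mathbb{R}^n}\int_{\mathbb{R}^d}(1\wedge\|f(s)x\|^2)\phi_\lambda(dx)ds<\infty$ (this may be taken as the definition); $I$ is linear; and for $f_1,\dots,f_k\in\mathcal{I}(\mathbb{M}_\lambda)$ the vector $(I(f_1),\dots,I(f_k))^t$ has log-characteristic function $(u_1,\dots,u_k)^t\mapsto\int_{\mathbb{R}^n}\psi_\lambda\big(\sum_jf_j(s)^*u_j\big)ds$. Integrands need only be defined for Lebesgue-almost every $s$. *)

theory Defs
  imports "HOL-Probability.Probability"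
begin

section \<open>Matrices\<close>

definition complex_eigenvalues :: "real^'n^'n \<Rightarrow> complex set" where
  "complex_eigenvalues A =
     {z. \<exists>v::complex^'n. v \<noteq> 0 \<and> map_matrix complex_of_real A *v v = z *s v}"

definition pos_spectrum :: "(real^'n^'n) set" where
  "pos_spectrum = {A. \<forall>z\<in>complex_eigenvalues A. 0 < Re z}"

text \<open>The type \<^typ>\<open>real^'n^'n\<close> carries the componentwise product, so neither the library's
  \<^term>\<open>(^)\<close> nor its \<^term>\<open>exp\<close> is the matrix power or the matrix exponential.\<close>

definition mat_power :: "real^'n^'n \<Rightarrow> nat \<Rightarrow> real^'n^'n" where
  "mat_power A k = ((**) A ^^ k) (mat 1)"

definition mat_exp :: "real^'n^'n \<Rightarrow> real^'n^'n" where
  "mat_exp A = (\<Sum>k. (1 / fact k) *\<^sub>R mat_power A k)"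

text \<open>\<open>c\<^sup>A\<close> for \<open>c > 0\<close>; the value at \<open>c = 0\<close> has no meaning (it is the identity, as
  \<^term>\<open>ln 0 = (0::real)\<close>).\<close>

definition scalar_mpow :: "real \<Rightarrow> real^'n^'n \<Rightarrow> real^'n^'n" where
  "scalar_mpow c A = mat_exp (ln c *\<^sub>R A)"


section \<open>Generalized polar coordinates and admissible functions\<close>

definition is_norm :: "('a::real_vector \<Rightarrow> real) \<Rightarrow> bool" where
  "is_norm N \<longleftrightarrow>
     (\<forall>x. 0 \<le> N x) \<and> (\<forall>x. N x = 0 \<longleftrightarrow> x = 0) \<and>
     (\<forall>a x. N (a *\<^sub>R x) = \<bar>a\<bar> * N x) \<and> (\<forall>x y. N (x + y) \<le> N x + N y)"

definition polar_norm :: "real^'n^'n \<Rightarrow> (real^'n \<Rightarrow> real) \<Rightarrow> bool" where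
  "polar_norm E N \<longleftrightarrow> is_norm N \<and>
     (\<exists>g. homeomorphism ({0<..} \<times> {\<theta>. N \<theta> = 1}) (UNIV - {0})
            (\<lambda>(c, \<theta>). scalar_mpow c E *v \<theta>) g)"

definition polar_radius :: "real^'n^'n \<Rightarrow> (real^'n \<Rightarrow> real) \<Rightarrow> real^'n \<Rightarrow> real" where
  "polar_radius E N x =
     (if x = 0 then 0
      else THE c. 0 < c \<and> (\<exists>\<theta>. N \<theta> = 1 \<and> x = scalar_mpow c E *v \<theta>))"

definition homogeneous_fun :: "real^'n^'n \<Rightarrow> (real^'n \<Rightarrow> real) \<Rightarrow> bool" where
  "homogeneous_fun E \<phi> \<longleftrightarrow>
     (\<forall>c>0. \<forall>x. x \<noteq> 0 \<longrightarrow> \<phi> (scalar_mpow c E *v x) = c * \<phi> x)"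

definition admissible_fun ::
    "real \<Rightarrow> real^'n^'n \<Rightarrow> (real^'n \<Rightarrow> real) \<Rightarrow> (real^'n \<Rightarrow> real) \<Rightarrow> bool" where
  "admissible_fun \<beta> E N \<phi> \<longleftrightarrow>
     (\<forall>x. x \<noteq> 0 \<longrightarrow> 0 < \<phi> x) \<and>
     continuous_on UNIV \<phi> \<and>
     (\<forall>A B. 0 < A \<and> A < B \<longrightarrow>
        (\<exists>C>0. \<forall>x y. A \<le> norm y \<and> norm y \<le> B \<and> polar_radius E N x \<le> 1 \<longrightarrow>
           \<bar>\<phi> (x + y) - \<phi> y\<bar> \<le> C * polar_radius E N x powr \<beta>))"


section \<open>Infinitely divisible and tempered stable laws\<close>

definition char_fun :: "'a::euclidean_space measure \<Rightarrow> 'a \<Rightarrow> complex" where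
  "char_fun \<mu> u = (\<integral>x. iexp (u \<bullet> x) \<partial>\<mu>)"

text \<open>\<open>\<mu>\<close> is, for every \<open>m \<ge> 1\<close>, the law of a sum of \<open>m\<close> i.i.d. random vectors.\<close>

definition infinitely_divisible :: "'a::euclidean_space measure \<Rightarrow> bool" where
  "infinitely_divisible \<mu> \<longleftrightarrow> prob_space \<mu> \<and> sets \<mu> = sets borel \<and>
     (\<forall>m\<ge>(1::nat). \<exists>\<nu>. prob_space \<nu> \<and> sets \<nu> = sets borel \<and>
        \<mu> = distr (\<Pi>\<^sub>M i\<in>{..<m}. \<nu>) borel (\<lambda>x. \<Sum>i<m. x i))"

definition levy_measure :: "'a::euclidean_space measure \<Rightarrow> bool" where
  "levy_measure \<phi> \<longleftrightarrow> sets \<phi> = sets borel \<and> emeasure \<phi> {0} = 0 \<and>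
     (\<integral>\<^sup>+x. ennreal (min 1 ((norm x)\<^sup>2)) \<partial>\<phi>) < \<infinity>"

text \<open>Infinitely divisible with Levy-Khintchine triplet consisting of the shift \<open>b\<close>, no Gaussian
  part and the Levy measure \<open>\<phi>\<close>.  The shift, but not \<open>\<phi>\<close>, depends on the choice of the
  truncation function.\<close>

definition inf_div_no_gauss :: "'a::euclidean_space measure \<Rightarrow> 'a \<Rightarrow> 'a measure \<Rightarrow> bool" where
  "inf_div_no_gauss \<mu> b \<phi> \<longleftrightarrow> infinitely_divisible \<mu> \<and> levy_measure \<phi> \<and>
     (\<forall>u. char_fun \<mu> u =
        exp (\<i> * complex_of_real (u \<bullet> b) +
             (\<integral>x. (iexp (u \<bullet> x) - 1
                   - \<i> * complex_of_real ((u \<bullet> x) * indicat_real (cball 0 1) x)) \<partial>\<phi>)))"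

text \<open>The measure \<open>r\<^sup>-\<^sup>\<alpha>\<^sup>-\<^sup>1 q(r, \<theta>) dr \<sigma>(d\<theta>)\<close> in polar coordinates, where \<open>\<sigma>\<close> is a measure on the
  Borel sets of the unit sphere.\<close>

definition polar_measure ::
    "real \<Rightarrow> (real \<Rightarrow> 'a::euclidean_space \<Rightarrow> real) \<Rightarrow> 'a measure \<Rightarrow> 'a measure" where
  "polar_measure \<alpha> q \<sigma> =
     distr (density (restrict_space lborel {0<..} \<Otimes>\<^sub>M \<sigma>)
                    (\<lambda>(r, \<theta>). ennreal (r powr (- \<alpha> - 1) * q r \<theta>)))
           borel (\<lambda>(r, \<theta>). r *\<^sub>R \<theta>)"

definition sphere_measure :: "'a::euclidean_space measure \<Rightarrow> bool" where
  "sphere_measure \<sigma> \<longleftrightarrow> finite_measure \<sigma> \<and> sets \<sigma> = sets (restrict_space borel (sphere 0 1))"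

lemma emeasure_polar_measure:
  fixes \<sigma> :: "'a::euclidean_space measure"
  assumes \<sigma>: "sphere_measure \<sigma>"
    and q: "(\<lambda>(r, \<theta>). q r \<theta>) \<in>
              borel_measurable (restrict_space borel {0<..} \<Otimes>\<^sub>M restrict_space borel (sphere 0 1))"
    and A: "A \<in> sets borel"
  shows "emeasure (polar_measure \<alpha> q \<sigma>) A =
    (\<integral>\<^sup>+\<theta>. (\<integral>\<^sup>+r. ennreal (r powr (- \<alpha> - 1) * q r \<theta>) * indicator A (r *\<^sub>R \<theta>)
       * indicator {0<..} r \<partial>lborel) \<partial>\<sigma>)"
proof -
  let ?L = "restrict_space lborel {0<..} :: real measure"
  interpret S: finite_measure \<sigma> using \<sigma> by (simp add: sphere_measure_def)
  interpret L: sigma_finite_measure ?L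
    by (intro sigma_finite_measure_restrict_space sigma_finite_lborel) simp
  interpret P: pair_sigma_finite ?L \<sigma> ..
  have sets_\<sigma>: "sets \<sigma> = sets (restrict_space borel (sphere 0 1))"
    using \<sigma> by (simp add: sphere_measure_def)
  have sets_L: "sets ?L = sets (restrict_space borel {0<..})"
    by (simp add: sets_restrict_space)
  have [measurable_cong]:
    "sets (?L \<Otimes>\<^sub>M \<sigma>) = sets (restrict_space borel {0<..} \<Otimes>\<^sub>M restrict_space borel (sphere 0 1))"
    by (intro sets_pair_measure_cong sets_\<sigma> sets_L)
  have q': "(\<lambda>(r, \<theta>). q r \<theta>) \<in> borel_measurable (?L \<Otimes>\<^sub>M \<sigma>)"
    using q measurable_cong_sets[OF _ refl] by measurable
  have f1: "fst \<in> borel_measurable (?L \<Otimes>\<^sub>M \<sigma>)"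
    by (rule measurable_compose[OF measurable_fst])
       (simp add: measurable_restrict_space1)
  have f2': "(\<lambda>x. x) \<in> borel_measurable \<sigma>"
    using measurable_cong_sets[OF sets_\<sigma> refl, of borel] measurable_restrict_space1[of "\<lambda>x. x" borel borel]
    by auto
  have f2: "snd \<in> borel_measurable (?L \<Otimes>\<^sub>M \<sigma>)"
    by (rule measurable_compose[OF measurable_snd f2'])
  have m: "(\<lambda>(r, \<theta>). r *\<^sub>R \<theta>) \<in> borel_measurable (?L \<Otimes>\<^sub>M \<sigma>)"
    using f1 f2 by (simp add: split_beta')
  have d: "(\<lambda>(r, \<theta>). ennreal (r powr (- \<alpha> - 1) * q r \<theta>)) \<in> borel_measurable (?L \<Otimes>\<^sub>M \<sigma>)"
    using f1 q' by (simp add: split_beta')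
  have i: "(\<lambda>x. indicator A (fst x *\<^sub>R snd x) :: ennreal) \<in> borel_measurable (?L \<Otimes>\<^sub>M \<sigma>)"
    by (rule measurable_compose[OF m[unfolded split_beta'], of "indicator A"])
       (use A in simp)
  have "emeasure (polar_measure \<alpha> q \<sigma>) A =
      (\<integral>\<^sup>+x. indicator A x \<partial>polar_measure \<alpha> q \<sigma>)"
    using A by (simp add: polar_measure_def)
  also have "\<dots> = (\<integral>\<^sup>+x. ennreal (fst x powr (- \<alpha> - 1) * q (fst x) (snd x)) *
      indicator A (fst x *\<^sub>R snd x) \<partial>(?L \<Otimes>\<^sub>M \<sigma>))"
    unfolding polar_measure_def using A m d i
    by (subst nn_integral_distr) (auto simp: nn_integral_density split_beta')
  also have "\<dots> = (\<integral>\<^sup>+\<theta>. \<integral>\<^sup>+r. ennreal (r powr (- \<alpha> - 1) * q r \<theta>) *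
      indicator A (r *\<^sub>R \<theta>) \<partial>?L \<partial>\<sigma>)"
    using d i by (subst P.nn_integral_snd[symmetric]) (auto simp: split_beta')
  also have "\<dots> = (\<integral>\<^sup>+\<theta>. (\<integral>\<^sup>+r. ennreal (r powr (- \<alpha> - 1) * q r \<theta>) * indicator A (r *\<^sub>R \<theta>)
       * indicator {0<..} r \<partial>lborel) \<partial>\<sigma>)"
    by (simp add: nn_integral_restrict_space)
  finally show ?thesis .
qed

definition tempered_stable :: "real \<Rightarrow> 'a::euclidean_space measure \<Rightarrow> bool" where
  "tempered_stable \<alpha> \<mu> \<longleftrightarrow>
     (\<exists>b q \<sigma>. sphere_measure \<sigma> \<and>
        (\<lambda>(r, \<theta>). q r \<theta>) \<in>
          borel_measurable (restrict_space borel {0<..} \<Otimes>\<^sub>M restrict_space borel (sphere 0 1)) \<and>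
        (\<forall>\<theta>\<in>sphere 0 1.
           (\<forall>k. \<forall>r>0. (deriv ^^ k) (\<lambda>r. q r \<theta>) differentiable (at r) \<and>
                      0 < (- 1) ^ k * (deriv ^^ k) (\<lambda>r. q r \<theta>) r) \<and>
           ((\<lambda>r. q r \<theta>) \<longlongrightarrow> 0) at_top) \<and>
        inf_div_no_gauss \<mu> b (polar_measure \<alpha> q \<sigma>))"

definition full_law :: "'a::euclidean_space measure \<Rightarrow> bool" where
  "full_law \<mu> \<longleftrightarrow> (\<forall>a b. a \<noteq> 0 \<longrightarrow> \<not> (AE x in \<mu>. a \<bullet> x = b))"


section \<open>The random measure and its stochastic integral\<close>

definition phi_exp :: "real \<Rightarrow> real \<Rightarrow> 'a::euclidean_space measure \<Rightarrow> 'a measure" where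
  "phi_exp \<alpha> lam \<sigma> = polar_measure \<alpha> (\<lambda>r \<theta>. exp (- lam * r)) \<sigma>"

definition psi_exp :: "real \<Rightarrow> real \<Rightarrow> 'a::euclidean_space measure \<Rightarrow> 'a \<Rightarrow> real" where
  "psi_exp \<alpha> lam \<sigma> u = (\<integral>x. (cos (u \<bullet> x) - 1) \<partial>phi_exp \<alpha> lam \<sigma>)"

text \<open>Only the values \<open>M A\<close> at Borel sets \<open>A\<close> of finite Lebesgue measure matter.\<close>

definition exp_tempered_random_measure ::
    "'w measure \<Rightarrow> real \<Rightarrow> real \<Rightarrow> (real^'d) measure \<Rightarrow>
     ((real^'n) set \<Rightarrow> 'w \<Rightarrow> real^'d) \<Rightarrow> bool" where
  "exp_tempered_random_measure P \<alpha> lam \<sigma> M \<longleftrightarrow>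
     (\<forall>A\<in>sets borel. emeasure lborel A < \<infinity> \<longrightarrow>
        M A \<in> borel_measurable P \<and>
        (\<forall>u. char_fun (distr P borel (M A)) u =
               complex_of_real (exp (measure lborel A * psi_exp \<alpha> lam \<sigma> u)))) \<and>
     (\<forall>A::nat \<Rightarrow> (real^'n) set.
        range A \<subseteq> sets borel \<and> disjoint_family A \<and> (\<forall>i. emeasure lborel (A i) < \<infinity>) \<longrightarrow>
          prob_space.indep_vars P (\<lambda>_. borel) (\<lambda>i. M (A i)) UNIV) \<and>
     (\<forall>A::nat \<Rightarrow> (real^'n) set.
        range A \<subseteq> sets borel \<and> disjoint_family A \<and> emeasure lborel (\<Union>i. A i) < \<infinity> \<longrightarrow>
          (AE \<omega> in P. (\<lambda>i. M (A i) \<omega>) sums M (\<Union>i. A i) \<omega>))"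

definition tendsto_in_prob ::
    "'w measure \<Rightarrow> ('i \<Rightarrow> 'w \<Rightarrow> 'b::metric_space) \<Rightarrow> ('w \<Rightarrow> 'b) \<Rightarrow> 'i filter \<Rightarrow> bool" where
  "tendsto_in_prob P Y Z F \<longleftrightarrow>
     (\<forall>\<epsilon>>0. ((\<lambda>i. measure P {\<omega> \<in> space P. \<epsilon> < dist (Y i \<omega>) (Z \<omega>)}) \<longlongrightarrow> 0) F)"

text \<open>For a simple function, written in canonical form as the sum of \<open>D 1\<^bsub>{f = D}\<^esub>\<close> over its
  nonzero values \<open>D\<close>.\<close>

definition simple_stoch_integral ::
    "((real^'n) set \<Rightarrow> 'w \<Rightarrow> real^'d) \<Rightarrow> (real^'n \<Rightarrow> real^'d^'d) \<Rightarrow> 'w \<Rightarrow> real^'d" where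
  "simple_stoch_integral M f \<omega> = (\<Sum>D\<in>range f - {0}. D *v M (f -` {D}) \<omega>)"

text \<open>\<^const>\<open>Bochner_Integration.simple_bochner_integrable\<close> for \<^const>\<open>lborel\<close> is exactly: finitely many values, Borel level sets,
  and a support of finite Lebesgue measure.\<close>

definition stoch_approx ::
    "'w measure \<Rightarrow> ((real^'n) set \<Rightarrow> 'w \<Rightarrow> real^'d) \<Rightarrow> (real^'n \<Rightarrow> real^'d^'d) \<Rightarrow>
     (nat \<Rightarrow> real^'n \<Rightarrow> real^'d^'d) \<Rightarrow> bool" where
  "stoch_approx P M f fs \<longleftrightarrow>
     (\<forall>k. Bochner_Integration.simple_bochner_integrable lborel (fs k)) \<and>
     (AE s in lborel. (\<lambda>k. fs k s) \<longlonglongrightarrow> f s) \<and>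
     (\<forall>A\<in>sets borel. \<exists>Z\<in>borel_measurable P.
        tendsto_in_prob P
          (\<lambda>k. simple_stoch_integral M (\<lambda>s. indicat_real A s *\<^sub>R fs k s)) Z sequentially)"

definition stoch_integrable ::
    "'w measure \<Rightarrow> ((real^'n) set \<Rightarrow> 'w \<Rightarrow> real^'d) \<Rightarrow> (real^'n \<Rightarrow> real^'d^'d) set" where
  "stoch_integrable P M =
     {f. f \<in> borel_measurable borel \<and> (\<exists>fs. stoch_approx P M f fs)}"

text \<open>The stochastic integral is determined only up to almost sure equality, hence a relation:
  \<open>Y\<close> is one version of the integral of \<open>f\<close>.\<close>

definition has_stoch_integral ::
    "'w measure \<Rightarrow> ((real^'n) set \<Rightarrow> 'w \<Rightarrow> real^'d) \<Rightarrow> (real^'n \<Rightarrow> real^'d^'d) \<Rightarrow>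
     ('w \<Rightarrow> real^'d) \<Rightarrow> bool" where
  "has_stoch_integral P M f Y \<longleftrightarrow>
     f \<in> borel_measurable borel \<and> Y \<in> borel_measurable P \<and>
     (\<exists>fs. stoch_approx P M f fs \<and>
        tendsto_in_prob P (\<lambda>k. simple_stoch_integral M (fs k)) Y sequentially)"

text \<open>The matrix power is evaluated at \<open>0\<close> only for \<open>s \<in> {0, t}\<close>, a Lebesgue null set.\<close>

definition ma_kernel ::
    "(real^'n \<Rightarrow> real) \<Rightarrow> real^'d^'d \<Rightarrow> real^'n \<Rightarrow> real^'n \<Rightarrow> real^'d^'d" where
  "ma_kernel \<phi> B t s = scalar_mpow (\<phi> (t - s)) B - scalar_mpow (\<phi> (- s)) B"

definition fin_dim_dist ::
    "'w measure \<Rightarrow> ('t \<Rightarrow> 'w \<Rightarrow> real^'d) \<Rightarrow> ('k::finite \<Rightarrow> 't) \<Rightarrow> ((real^'d)^'k) measure" where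
  "fin_dim_dist P X t = distr P borel (\<lambda>\<omega>. \<chi> j. X (t j) \<omega>)"

end

theory Submission
  imports Defs "HOL-Computational_Algebra.Polynomial" "HOL-Computational_Algebra.Fundamental_Theorem_Algebra"
    "HOL-Real_Asymp.Real_Asymp"
begin

text \<open>The integral of \<open>min 1 (a\<^sup>2 |x|\<^sup>2)\<close> against the tempered Levy measure is at most a multiple of
  \<open>W a = min (a\<^sup>2) (a powr \<alpha>)\<close>, so \<open>f\<close> is integrable as soon as \<open>W (norm (f s))\<close> is.  For the moving
  average kernel this follows by cutting space into shells on which the polar radius \<open>\<tau>\<close> is
  comparable to a power of a fixed number: near \<open>0\<close> and \<open>t\<close> the kernel is bounded by a power of \<open>\<tau>\<close>
  and \<open>a powr \<alpha>\<close> is used, far away admissibility gives an extra factor \<open>\<tau> powr -\<beta>\<close> and \<open>a\<^sup>2\<close> is used.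

  The Levy measure of a vector of integrals is the image of \<open>ds \<phi>(dx)\<close> under \<open>(s, x) \<mapsto> F s x\<close>
  with \<open>F s\<close> linear.  A ray with direction \<open>\<theta>\<close> and tempering rate \<open>lam\<close> is mapped to the ray with
  direction \<open>F s \<theta> / |F s \<theta>|\<close> and rate \<open>lam / |F s \<theta>|\<close>; disintegrating over the direction, the radial
  density becomes \<open>r powr (-\<alpha> - 1)\<close> times a Laplace transform, which is completely monotone.

  If \<open>u \<bullet> X t\<close> is almost surely constant, then the transposed kernel annihilates \<open>u\<close>.  With
  \<open>R c\<close> the transpose of \<open>c\<^sup>B\<close> applied to \<open>u\<close>, this says \<open>R (\<phi> (t - s)) = R (\<phi> (-s))\<close>, so \<open>R (\<phi> x)\<close> has
  a limit \<open>w\<close> for \<open>x \<longlongrightarrow> 0\<close>; homogeneity makes \<open>w\<close> a fixed vector of all transposed powers \<open>c\<^sup>B\<close>,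
  hence \<open>w\<close> is in the kernel of the transpose of \<open>B\<close>, which is trivial unless \<open>0\<close> is an eigenvalue.\<close>

section \<open>Matrix exponentials\<close>

text \<open>The definition of the integral shapes the middle part. A version of the integral may
  come from any simple sequence whose integrals over all Borel sets converge, with no domination, so
  its law is not visibly determined by the integrand. A gliding hump argument shows that all such
  sequences lead to the same characteristic function, which dominated sequences then compute. The
  image Levy measure has another obstacle: in general only \<open>wgt \<alpha> (norm (f s))\<close>
  is integrable, not the \<alpha>-th power of the norm. The measure of directions and rates is
  therefore weighted by \<open>wgt\<close>, which keeps it finite; the missing factor
  \<open>max ((\<kappa> / lam) powr (2 - \<alpha>)) 1\<close> depends on the rate \<kappa> alone and
  moves into the Laplace transform. Infinite divisibility comes from dilating the parameter space so
  that volumes grow by m, which divides the exponent by m. The bound on H says exactly 2 (H -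
  q/\<alpha> - \<beta>) + q < 0, the convergence condition far away; positive real parts of the
  eigenvalues of D give the condition near the singularities.\<close>

lemma norm_transpose: "norm (transpose A) = norm (A :: real^'n^'m)"
  unfolding norm_vec_def L2_set_def transpose_def by (simp add: sum_nonneg) (subst sum.swap, rule refl)

text \<open>Matrices carry the Euclidean norm of their entries (the Frobenius norm), so this is
  Cauchy-Schwarz in each row.\<close>

lemma norm_matrix_vector_mult_le: "norm (A *v x) \<le> norm A * norm x" for A :: "real^'n^'m"
proof -
  have "norm (A *v x) = L2_set (\<lambda>i. \<bar>A $ i \<bullet> x\<bar>) UNIV"
    by (simp add: norm_vec_def matrix_vector_mul_component)
  also have "\<dots> \<le> L2_set (\<lambda>i. norm x * norm (A $ i)) UNIV"
    by (rule L2_set_mono) (auto simp: mult.commute[of "norm x"] Cauchy_Schwarz_ineq2)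
  also have "\<dots> = norm x * L2_set (\<lambda>i. norm (A $ i)) UNIV"
    by (rule L2_set_right_distrib[symmetric]) simp
  finally show ?thesis by (simp add: norm_vec_def mult.commute)
qed

lemma norm_matrix_mult_le: "norm (A ** B) \<le> norm A * norm B" for A :: "real^'n^'m" and B :: "real^'k^'n"
proof -
  have "(A ** B) $ i = transpose B *v (A $ i)" for i
    by (simp add: matrix_matrix_mult_def matrix_vector_mult_def transpose_def vec_eq_iff mult.commute)
  then have "norm (A ** B) = L2_set (\<lambda>i. norm (transpose B *v (A $ i))) UNIV"
    by (simp add: norm_vec_def)
  also have "\<dots> \<le> L2_set (\<lambda>i. norm B * norm (A $ i)) UNIV"
    by (rule L2_set_mono) (use norm_matrix_vector_mult_le[of "transpose B"] in \<open>auto simp: norm_transpose\<close>)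
  also have "\<dots> = norm B * L2_set (\<lambda>i. norm (A $ i)) UNIV"
    by (rule L2_set_right_distrib[symmetric]) simp
  finally show ?thesis by (simp add: norm_vec_def mult.commute)
qed

lemma bounded_bilinear_matrix_vector_mult: "bounded_bilinear (\<lambda>(A::real^'n^'m) x. A *v x)"
proof
  show "\<exists>K. \<forall>(A::real^'n^'m) x. norm (A *v x) \<le> norm A * norm x * K"
    by (rule exI[of _ 1]) (simp add: norm_matrix_vector_mult_le)
qed (simp_all add: matrix_vector_mult_add_rdistrib matrix_vector_right_distrib
    matrix_vector_mult_scaleR scaleR_matrix_vector_assoc)

lemma bounded_bilinear_matrix_mult: "bounded_bilinear (\<lambda>(A::real^'n^'m) (B::real^'k^'n). A ** B)"
proof
  show "\<exists>K. \<forall>(A::real^'n^'m) (B::real^'k^'n). norm (A ** B) \<le> norm A * norm B * K"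
    by (rule exI[of _ 1]) (simp add: norm_matrix_mult_le)
qed (simp_all add: matrix_matrix_mult_def vec_eq_iff sum.distrib algebra_simps sum_distrib_left)

lemma bounded_linear_transpose: "bounded_linear (transpose :: real^'n^'m \<Rightarrow> _)"
proof
  show "\<exists>K. \<forall>x::real^'n^'m. norm (transpose x) \<le> norm x * K"
    by (rule exI[of _ 1]) (simp add: norm_transpose)
qed (auto simp: transpose_def vec_eq_iff)

lemma mat_power_0 [simp]: "mat_power A 0 = mat 1"
  and mat_power_Suc [simp]: "mat_power A (Suc k) = A ** mat_power A k"
  by (simp_all add: mat_power_def)

text \<open>The Frobenius norm of the identity is the square root of the dimension, which is why
  \<open>norm (mat 1)\<close> stays as a factor.\<close>

lemma norm_mat_power_le: "norm (mat_power A k) \<le> norm (mat 1 :: real^'n^'n) * norm A ^ k"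
  for A :: "real^'n^'n"
proof (induction k)
  case (Suc k)
  have "norm (mat_power A (Suc k)) \<le> norm A * norm (mat_power A k)"
    by (simp add: norm_matrix_mult_le)
  also have "\<dots> \<le> norm A * (norm (mat 1 :: real^'n^'n) * norm A ^ k)"
    by (intro mult_left_mono Suc) simp
  finally show ?case by (simp add: algebra_simps)
qed simp

lemma mat_power_scaleR: "mat_power (t *\<^sub>R A) k = t ^ k *\<^sub>R mat_power A k" for A :: "real^'n^'n"
  by (induction k) (simp_all add:
      bounded_bilinear.scaleR_left[OF bounded_bilinear_matrix_mult]
      bounded_bilinear.scaleR_right[OF bounded_bilinear_matrix_mult])

lemma summable_mat_exp: "summable (\<lambda>k. (1 / fact k) *\<^sub>R mat_power A k)" for A :: "real^'n^'n"
proof (rule summable_comparison_test')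
  have "summable (\<lambda>k. norm (mat 1 :: real^'n^'n) * (norm A ^ k /\<^sub>R fact k))"
    by (intro summable_mult summable_exp_generic)
  then show "summable (\<lambda>k. norm (mat 1 :: real^'n^'n) * norm A ^ k / fact k)"
    by (simp add: field_simps)
  show "norm ((1 / fact k) *\<^sub>R mat_power A k) \<le> norm (mat 1 :: real^'n^'n) * norm A ^ k / fact k" for k
    using norm_mat_power_le[of A k] by (simp add: divide_right_mono)
qed

text \<open>Read entry by entry, the exponential is a scalar power series in t, and termwise
  differentiation of real power series applies.\<close>

lemma mat_exp_nth: "mat_exp (t *\<^sub>R A) $ i $ j = (\<Sum>k. (mat_power A k $ i $ j / fact k) * t ^ k)"
  and summable_mat_exp_nth: "summable (\<lambda>k. (mat_power A k $ i $ j / fact k) * t ^ k)"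
proof -
  have "(\<lambda>k. (1 / fact k) *\<^sub>R mat_power (t *\<^sub>R A) k) sums mat_exp (t *\<^sub>R A)"
    unfolding mat_exp_def by (rule summable_sums[OF summable_mat_exp])
  from sums_vec_nth[OF sums_vec_nth[OF this, of i], of j]
  have *: "(\<lambda>k. (mat_power A k $ i $ j / fact k) * t ^ k) sums (mat_exp (t *\<^sub>R A) $ i $ j)"
    by (simp add: mat_power_scaleR mult.commute)
  then show "mat_exp (t *\<^sub>R A) $ i $ j = (\<Sum>k. (mat_power A k $ i $ j / fact k) * t ^ k)"
    and "summable (\<lambda>k. (mat_power A k $ i $ j / fact k) * t ^ k)"
    by (simp_all add: sums_iff)
qed

lemma has_vector_derivative_matrix_componentI:
  fixes f :: "real \<Rightarrow> real^'n^'m"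
  assumes "\<And>i j. ((\<lambda>t. f t $ i $ j) has_real_derivative f' $ i $ j) (at t)"
  shows "(f has_vector_derivative f') (at t)"
proof -
  have *: "Basis = (\<Union>i j. {axis i (axis j 1)} :: (real^'n^'m) set)"
    by (auto simp: Basis_vec_def)
  have "((\<lambda>t. f t \<bullet> b) has_vector_derivative f' \<bullet> b) (at t)" if "b \<in> Basis" for b
    using assms that unfolding *
    by (auto simp: inner_axis has_real_derivative_iff_has_vector_derivative)
  then show ?thesis
    by (subst has_vector_derivative_def, subst has_derivative_componentwise_within)
       (auto simp: has_vector_derivative_def)
qed

lemma mat_exp_has_vector_derivative:
  fixes A :: "real^'n^'n"
  shows "((\<lambda>t. mat_exp (t *\<^sub>R A)) has_vector_derivative A ** mat_exp (t *\<^sub>R A)) (at t)"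
proof (rule has_vector_derivative_matrix_componentI)
  fix i j
  let ?c = "\<lambda>k. mat_power A k $ i $ j / fact k"
  have "((\<lambda>t. \<Sum>k. ?c k * t ^ k) has_real_derivative (\<Sum>k. diffs ?c k * t ^ k)) (at t)"
    by (rule termdiffs_strong_converges_everywhere) (rule summable_mat_exp_nth)
  moreover have "(\<Sum>k. diffs ?c k * t ^ k) = (A ** mat_exp (t *\<^sub>R A)) $ i $ j"
  proof -
    have "diffs ?c k * t ^ k = (\<Sum>l\<in>UNIV. A $ i $ l * ((mat_power A k $ l $ j / fact k) * t ^ k))" for k
      by (simp add: diffs_def field_simps matrix_matrix_mult_def sum_distrib_left sum_divide_distrib sum_distrib_right del: of_nat_Suc)
    then have "(\<Sum>k. diffs ?c k * t ^ k) = (\<Sum>l\<in>UNIV. A $ i $ l * (\<Sum>k. (mat_power A k $ l $ j / fact k) * t ^ k))"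
      by (simp only: suminf_sum summable_mult summable_mat_exp_nth suminf_mult)
    also have "\<dots> = (A ** mat_exp (t *\<^sub>R A)) $ i $ j"
      by (simp add: matrix_matrix_mult_def mat_exp_nth)
    finally show ?thesis .
  qed
  ultimately show "((\<lambda>t. mat_exp (t *\<^sub>R A) $ i $ j) has_real_derivative (A ** mat_exp (t *\<^sub>R A)) $ i $ j) (at t)"
    by (simp add: mat_exp_nth)
qed

lemma mat_exp_0 [simp]: "mat_exp 0 = (mat 1 :: real^'n^'n)"
proof -
  have "(\<lambda>k. (1 / fact k) *\<^sub>R mat_power (0 :: real^'n^'n) k) = (\<lambda>k. if k = 0 then mat 1 else 0)"
    by (rule ext, case_tac k) auto
  moreover have "(\<lambda>k. if k = 0 then mat 1 else 0) sums (mat 1 :: real^'n^'n)"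
    by (rule sums_single)
  ultimately show ?thesis by (simp only: mat_exp_def sums_unique[symmetric])
qed

lemma mat_power_commute: "mat_power A k ** A = A ** mat_power A k" for A :: "real^'n^'n"
  by (induction k) (simp_all flip: matrix_mul_assoc)

lemma mat_exp_commute: "mat_exp (t *\<^sub>R A) ** A = A ** mat_exp (t *\<^sub>R A)" for A :: "real^'n^'n"
proof -
  note s = summable_sums[OF summable_mat_exp[of "t *\<^sub>R A"], folded mat_exp_def]
  have "(\<lambda>k. ((1 / fact k) *\<^sub>R mat_power (t *\<^sub>R A) k) ** A) sums (mat_exp (t *\<^sub>R A) ** A)"
    by (rule bounded_linear.sums[OF bounded_bilinear.bounded_linear_left[OF bounded_bilinear_matrix_mult] s])
  moreover have "(\<lambda>k. A ** ((1 / fact k) *\<^sub>R mat_power (t *\<^sub>R A) k)) sums (A ** mat_exp (t *\<^sub>R A))"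
    by (rule bounded_linear.sums[OF bounded_bilinear.bounded_linear_right[OF bounded_bilinear_matrix_mult] s])
  moreover have "A ** ((1 / fact k) *\<^sub>R mat_power (t *\<^sub>R A) k) = ((1 / fact k) *\<^sub>R mat_power (t *\<^sub>R A) k) ** A" for k
    by (simp add: mat_power_scaleR mat_power_commute bounded_bilinear.scaleR_left[OF bounded_bilinear_matrix_mult]
      bounded_bilinear.scaleR_right[OF bounded_bilinear_matrix_mult])
  ultimately show ?thesis by (simp add: sums_iff)
qed

lemma vector_derivative_zero_imp_const:
  fixes f :: "real \<Rightarrow> 'a::real_normed_vector"
  assumes "\<And>t. (f has_vector_derivative 0) (at t)"
  shows "f x = f y"
proof -
  have "(f has_derivative (\<lambda>h. 0)) (at t within UNIV)" for t
    using assms[of t] by (simp add: has_vector_derivative_def)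
  from has_derivative_zero_constant[OF convex_UNIV this] show ?thesis by auto
qed

text \<open>The derivative of the left side in t vanishes because the exponential commutes with A,
  so the left side keeps its value at t = 0. The group law is the instance with -t for t and t + s
  for s.\<close>

lemma mat_exp_minus_add:
  fixes A :: "real^'n^'n"
  shows "mat_exp (- t *\<^sub>R A) ** mat_exp ((t + s) *\<^sub>R A) = mat_exp (s *\<^sub>R A)"
proof -
  let ?f = "\<lambda>t. mat_exp (- t *\<^sub>R A) ** mat_exp ((t + s) *\<^sub>R A)"
  have "(?f has_vector_derivative 0) (at t)" for t
  proof -
    have 1: "((\<lambda>t. mat_exp (- t *\<^sub>R A)) has_vector_derivative - (A ** mat_exp (- t *\<^sub>R A))) (at t)"
    proof -
      have "((\<lambda>t. - t) has_vector_derivative - 1) (at t)"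
        unfolding has_real_derivative_iff_has_vector_derivative[symmetric] by (auto intro!: derivative_eq_intros)
      from vector_diff_chain_at[OF this, where g = "\<lambda>t. mat_exp (t *\<^sub>R A)", OF mat_exp_has_vector_derivative]
      show ?thesis by (simp add: o_def)
    qed
    have 2: "((\<lambda>t. mat_exp ((t + s) *\<^sub>R A)) has_vector_derivative (A ** mat_exp ((t + s) *\<^sub>R A))) (at t)"
    proof -
      have "((\<lambda>t. t + s) has_vector_derivative 1) (at t)"
        unfolding has_real_derivative_iff_has_vector_derivative[symmetric] by (auto intro!: derivative_eq_intros)
      from vector_diff_chain_at[OF this, where g = "\<lambda>t. mat_exp (t *\<^sub>R A)", OF mat_exp_has_vector_derivative]
      show ?thesis by (simp add: o_def)
    qed
    have 3: "mat_exp (- t *\<^sub>R A) ** (A ** mat_exp ((t + s) *\<^sub>R A))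
        + - (A ** mat_exp (- t *\<^sub>R A)) ** mat_exp ((t + s) *\<^sub>R A) = 0"
      unfolding matrix_mul_assoc mat_exp_commute bounded_bilinear.minus_left[OF bounded_bilinear_matrix_mult]
      by simp
    from bounded_bilinear.has_vector_derivative[OF bounded_bilinear_matrix_mult 1 2]
    show ?thesis unfolding 3 .
  qed
  from vector_derivative_zero_imp_const[of ?f t 0, OF this] show ?thesis by simp
qed

lemma mat_exp_add: "mat_exp ((t + s) *\<^sub>R A) = mat_exp (t *\<^sub>R A) ** mat_exp (s *\<^sub>R A)" for A :: "real^'n^'n"
  using mat_exp_minus_add[of "- t" A "t + s"] by simp

lemma continuous_on_mat_exp: "continuous_on S (\<lambda>t. mat_exp (t *\<^sub>R A))" for A :: "real^'n^'n"
  by (intro continuous_at_imp_continuous_on ballI has_vector_derivative_continuous[OF mat_exp_has_vector_derivative])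

section \<open>Powers of positive reals with matrix exponents\<close>

lemma scalar_mpow_mult: "0 < a \<Longrightarrow> 0 < b \<Longrightarrow> scalar_mpow (a * b) A = scalar_mpow a A ** scalar_mpow b A"
  by (simp add: scalar_mpow_def ln_mult mat_exp_add)

lemma scalar_mpow_1 [simp]: "scalar_mpow 1 A = mat 1"
  by (simp add: scalar_mpow_def)

lemma scalar_mpow_inverse_left: "0 < a \<Longrightarrow> scalar_mpow (1 / a) A ** scalar_mpow a A = mat 1"
  using scalar_mpow_mult[of "1 / a" a A] by simp

lemma scalar_mpow_inverse_right: "0 < a \<Longrightarrow> scalar_mpow a A ** scalar_mpow (1 / a) A = mat 1"
  using scalar_mpow_mult[of a "1 / a" A] by simp

lemma continuous_on_scalar_mpow: "continuous_on {0<..} (\<lambda>c. scalar_mpow c A)"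
  unfolding scalar_mpow_def
  by (rule continuous_on_compose2[OF continuous_on_mat_exp[of UNIV A]]) (auto intro!: continuous_intros)

lemma borel_measurable_scalar_mpow [measurable]: "(\<lambda>c. scalar_mpow c A) \<in> borel_measurable borel"
proof -
  have [measurable]: "(\<lambda>t. mat_exp (t *\<^sub>R A)) \<in> borel_measurable borel"
    by (rule borel_measurable_continuous_onI[OF continuous_on_mat_exp])
  show ?thesis unfolding scalar_mpow_def by measurable
qed

section \<open>Growth of matrix powers\<close>

text \<open>Variation of constants: the integrating factor exp (-l t) removes the homogeneous part,
  and what remains has a derivative of size at most C exp ((a - Re l) t). Since
  \<open>Re l < a\<close> is strict, its integral has the same rate, so no polynomial factor
  appears.\<close>

lemma ode_growth:
  fixes y g :: "real \<Rightarrow> complex"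
  assumes y: "\<And>t. (y has_vector_derivative l * y t + g t) (at t)"
    and g: "\<And>t. 0 \<le> t \<Longrightarrow> norm (g t) \<le> C * exp (a * t)"
    and l: "Re l < a"
  shows "\<exists>K. \<forall>t\<ge>0. norm (y t) \<le> K * exp (a * t)"
proof -
  define u where "u t = exp (- l * of_real t) * y t" for t
  define b where "b = a - Re l"
  have b: "0 < b" using l by (simp add: b_def)
  have C: "0 \<le> C" using g[of 0] norm_ge_zero[of "g 0"] by (simp del: norm_ge_zero)
  have du: "(u has_vector_derivative exp (- l * of_real t) * g t) (at t)" for t
  proof -
    have "((\<lambda>t. exp (- l * of_real t)) has_vector_derivative (- l * exp (- l * of_real t))) (at t)"
    proof -
      have "((\<lambda>z. exp (- l * z)) has_field_derivative (- l * exp (- l * of_real t))) (at (of_real t))"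
        by (auto intro!: derivative_eq_intros)
      from has_vector_derivative_real_field[OF this] show ?thesis by simp
    qed
    from has_vector_derivative_mult[OF this y] show ?thesis
      unfolding u_def by (simp add: algebra_simps)
  qed
  have "norm (u t) \<le> norm (u 0) + C / b * exp (b * t)" if t: "0 < t" for t
  proof -
    have "norm (u t - u 0) \<le> C / b * exp (b * t) - C / b * exp (b * 0)"
    proof (rule differentiable_bound_general[OF t, where f' = "\<lambda>t. exp (- l * of_real t) * g t" and \<phi>' = "\<lambda>t. C * exp (b * t)"])
      show "continuous_on {0..t} u"
        by (intro continuous_at_imp_continuous_on ballI has_vector_derivative_continuous[OF du])
      show "continuous_on {0..t} (\<lambda>t. C / b * exp (b * t))" by (intro continuous_intros)
      show "(u has_vector_derivative exp (- l * of_real x) * g x) (at x)" for x by (rule du)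
      show "((\<lambda>t. C / b * exp (b * t)) has_vector_derivative C * exp (b * x)) (at x)" for x
        unfolding has_real_derivative_iff_has_vector_derivative[symmetric] using b
        by (auto intro!: derivative_eq_intros)
      show "norm (exp (- l * of_real x) * g x) \<le> C * exp (b * x)" if "0 < x" for x
      proof -
        have "exp (b * x) = exp (- (Re l * x)) * exp (a * x)"
          by (simp add: b_def left_diff_distrib flip: exp_add)
        with g[of x] that show ?thesis
          by (simp add: norm_mult norm_exp_eq_Re mult.left_commute[of C] mult_left_mono)
      qed
    qed
    moreover have "norm (u t) \<le> norm (u t - u 0) + norm (u 0)"
      by norm
    moreover have "0 \<le> C / b" using C b by simp
    ultimately show ?thesis by simp
  qed
  moreover have "0 \<le> C / b" using C b by simp
  ultimately have ub: "norm (u t) \<le> norm (u 0) + C / b * exp (b * t)" if "0 \<le> t" for t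
    using that by (cases "t = 0") auto
  have "norm (y t) \<le> (norm (u 0) + C / b) * exp (a * t)" if t: "0 \<le> t" for t
  proof -
    have "norm (y t) = exp (Re l * t) * norm (u t)"
      by (simp add: u_def norm_mult norm_exp_eq_Re flip: exp_add)
    also have "\<dots> \<le> exp (Re l * t) * (norm (u 0) * exp (b * t) + C / b * exp (b * t))"
    proof (intro mult_left_mono)
      have "norm (u 0) * 1 \<le> norm (u 0) * exp (b * t)" using b t by (intro mult_left_mono) auto
      with ub[OF t] show "norm (u t) \<le> norm (u 0) * exp (b * t) + C / b * exp (b * t)" by simp
    qed simp
    also have "\<dots> = (norm (u 0) + C / b) * exp (a * t)"
      by (simp add: b_def algebra_simps flip: exp_add)
    finally show ?thesis .
  qed
  then show ?thesis by blast
qed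

section \<open>Annihilating products of shifted matrices and the spectrum\<close>

definition shift_mult :: "complex^'n^'n \<Rightarrow> complex \<Rightarrow> complex^'n \<Rightarrow> complex^'n" where
  "shift_mult C l v = C *v v - l *s v"

text \<open>This is p(C) v as soon as \<open>N\<close> bounds the degree of p. The bound is a
  separate argument so that the induction that splits off linear factors can run over it.\<close>

definition poly_act :: "complex^'n^'n \<Rightarrow> nat \<Rightarrow> complex poly \<Rightarrow> complex^'n \<Rightarrow> complex^'n" where
  "poly_act C N p v = (\<Sum>k\<le>N. coeff p k *s ((*v) C ^^ k) v)"

lemma funpow_mult_vec_diff: "((*v) C ^^ k) (v - w) = ((*v) C ^^ k) v - ((*v) C ^^ k) w"
  for C :: "complex^'n^'n"
  by (induction k) (simp_all add: matrix_vector_mult_diff_distrib)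

lemma funpow_mult_vec_scale: "((*v) C ^^ k) (l *s v) = l *s ((*v) C ^^ k) v"
  for C :: "complex^'n^'n"
  by (induction k) (simp_all add: vector_scalar_commute)

text \<open>The coefficients of (X - l) q are those of q shifted by one, minus l times those of q;
  the coefficient of q in degree \<open>Suc N\<close> vanishes, so both sums can be cut at
  \<open>N\<close>.\<close>

lemma poly_act_linear_factor:
  assumes "degree q \<le> N"
  shows "poly_act C (Suc N) ([:- l, 1:] * q) v = poly_act C N q (shift_mult C l v)"
proof -
  have c: "coeff ([:- l, 1:] * q) k = (case k of 0 \<Rightarrow> 0 | Suc j \<Rightarrow> coeff q j) - l * coeff q k" for k
    by (simp add: coeff_pCons)
  have "coeff q (Suc N) = 0" using assms by (intro coeff_eq_0) simp
  then have "poly_act C (Suc N) ([:- l, 1:] * q) v =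
    (\<Sum>k\<le>N. coeff q k *s ((*v) C ^^ Suc k) v) - (\<Sum>k\<le>N. (l * coeff q k) *s ((*v) C ^^ k) v)"
    unfolding poly_act_def c
    by (simp only: vector_sub_rdistrib sum_subtractf sum.atMost_Suc_shift[of "\<lambda>k. (case k of 0 \<Rightarrow> 0 | Suc j \<Rightarrow> coeff q j) *s _ k"]) simp
  also have "\<dots> = poly_act C N q (shift_mult C l v)"
    by (simp add: poly_act_def shift_mult_def funpow_mult_vec_diff funpow_mult_vec_scale sum_subtractf
        vector_ssub_ldistrib vector_smult_assoc funpow_swap1 mult.commute)
  finally show ?thesis .
qed

lemma shift_mult_commute: "shift_mult C l (shift_mult C m v) = shift_mult C m (shift_mult C l v)"
  by (simp add: shift_mult_def matrix_vector_mult_diff_distrib vector_scalar_commute vector_ssub_ldistrib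
      vector_smult_assoc mult.commute)

lemma fold_shift_mult_commute: "fold (shift_mult C) L (shift_mult C m v) = shift_mult C m (fold (shift_mult C) L v)"
  by (induction L arbitrary: v) (simp, metis fold_simps(2) shift_mult_commute)

text \<open>The fundamental theorem of algebra splits p into linear factors. If l is not an
  eigenvalue, then C - l is injective and commutes with the other factors, so it can be cancelled;
  only eigenvalues stay in the list.\<close>

lemma poly_act_zero_imp_fold:
  assumes "p \<noteq> 0" "degree p \<le> N" "poly_act C N p v = 0"
  shows "\<exists>L. (\<forall>l\<in>set L. \<exists>w. w \<noteq> 0 \<and> C *v w = l *s w) \<and> fold (shift_mult C) L v = 0"
  using assms
proof (induction N arbitrary: p v)
  case 0
  then obtain c where "p = [:c:]" "c \<noteq> 0" by (metis degree_eq_zeroE le_zero_eq pCons_0_0)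
  with 0 have "v = 0" by (auto simp: poly_act_def)
  then show ?case by (intro exI[of _ "[]"]) simp
next
  case (Suc N)
  show ?case
  proof (cases "degree p = 0")
    case True
    then obtain c where c: "p = [:c:]" "c \<noteq> 0" using Suc by (metis degree_eq_zeroE pCons_0_0)
    have "(\<Sum>k\<le>Suc N. coeff [:c:] k *s ((*v) C ^^ k) v) = (\<Sum>k\<in>{0}. coeff [:c:] k *s ((*v) C ^^ k) v)"
      by (rule sum.mono_neutral_right) (auto simp: coeff_pCons split: nat.splits)
    with Suc c have "v = 0" by (simp add: poly_act_def)
    then show ?thesis by (intro exI[of _ "[]"]) simp
  next
    case False
    then have "\<not> constant (poly p)" by (simp add: constant_degree)
    then obtain l where "poly p l = 0" using fundamental_theorem_of_algebra by blast
    then obtain q where q: "p = [:- l, 1:] * q" using poly_eq_0_iff_dvd by (metis dvdE)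
    with Suc(2) have q0: "q \<noteq> 0" by auto
    have deg: "degree q \<le> N" using Suc(3) q0 unfolding q by (subst (asm) degree_mult_eq) auto
    have "poly_act C N q (shift_mult C l v) = 0"
      using Suc(4) unfolding q poly_act_linear_factor[OF deg] .
    from Suc(1)[OF q0 deg this] obtain L where
      L: "\<forall>l\<in>set L. \<exists>w. w \<noteq> 0 \<and> C *v w = l *s w" "fold (shift_mult C) L (shift_mult C l v) = 0"
      by blast
    show ?thesis
    proof (cases "\<exists>w. w \<noteq> 0 \<and> C *v w = l *s w")
      case True
      with L show ?thesis by (intro exI[of _ "l # L"]) auto
    next
      case False
      from L(2) have "shift_mult C l (fold (shift_mult C) L v) = 0" by (simp add: fold_shift_mult_commute)
      with False have "fold (shift_mult C) L v = 0" by (auto simp: shift_mult_def)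
      with L show ?thesis by blast
    qed
  qed
qed

text \<open>The n + 1 vectors v, C v, ..., C^n v of an n-dimensional space are dependent. Dependence
  is a property of the set of these vectors, so a repetition among them is treated apart: it gives
  the polynomial X^i - X^j.\<close>

lemma ex_annihilating_poly:
  fixes C :: "complex^'n^'n"
  shows "\<exists>p N. p \<noteq> 0 \<and> degree p \<le> N \<and> poly_act C N p v = 0"
proof -
  let ?N = "CARD('n)" and ?w = "\<lambda>k. ((*v) C ^^ k) v"
  show ?thesis
  proof (cases "inj_on ?w {..?N}")
    case False
    then obtain i j where ij: "i \<le> ?N" "j \<le> ?N" "i < j" "?w i = ?w j"
      unfolding inj_on_def by (metis atMost_iff linorder_neqE_nat)
    let ?p = "monom 1 i - monom 1 j :: complex poly"
    have "coeff ?p i = 1" using ij by simp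
    then have "?p \<noteq> 0" by (metis coeff_0 zero_neq_one)
    moreover have "degree ?p \<le> ?N" using ij degree_monom_le[of "1::complex" i] degree_monom_le[of "1::complex" j]
      by (intro degree_diff_le) auto
    moreover have "poly_act C ?N ?p v = ?w i - ?w j"
      using ij unfolding poly_act_def
      by (simp add: vector_sub_rdistrib sum_subtractf if_distrib[of "\<lambda>c. c *s _"] cong: if_cong)
    ultimately have "?p \<noteq> 0 \<and> degree ?p \<le> ?N \<and> poly_act C ?N ?p v = 0" using ij by simp
    then show ?thesis by blast
  next
    case True
    let ?S = "?w ` {..?N}"
    have card: "card ?S = Suc ?N" using card_image[OF True] by simp
    have "vec.dim ?S \<le> ?N" using vec.dim_subset_UNIV[of ?S] by (simp add: vec.dimension_def card_cart_basis)
    then have "vec.dependent ?S" using card by (intro vec.dependent_biggerset_general) simp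
    then obtain u where u: "\<exists>x\<in>?S. u x \<noteq> 0" "(\<Sum>x\<in>?S. u x *s x) = 0"
      by (subst (asm) vec.dependent_finite) auto
    from u(2) have s: "(\<Sum>k\<le>?N. u (?w k) *s ?w k) = 0"
      by (simp add: sum.reindex[OF True])
    let ?p = "\<Sum>k\<le>?N. monom (u (?w k)) k"
    have c: "coeff ?p k = (if k \<le> ?N then u (?w k) else 0)" for k
      by (simp add: coeff_sum)
    from u(1) obtain k where "k \<le> ?N" "u (?w k) \<noteq> 0" by auto
    with c[of k] have "?p \<noteq> 0" by auto
    moreover have "degree ?p \<le> ?N"
      by (intro degree_sum_le) (auto intro: order_trans[OF degree_monom_le])
    moreover have "poly_act C ?N ?p v = 0"
      using s unfolding poly_act_def c by simp
    ultimately show ?thesis by blast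
  qed
qed

lemma ex_eigenvalue_list:
  fixes C :: "complex^'n^'n"
  shows "\<exists>L. (\<forall>l\<in>set L. \<exists>w. w \<noteq> 0 \<and> C *v w = l *s w) \<and> fold (shift_mult C) L v = 0"
  using ex_annihilating_poly[of C v] poly_act_zero_imp_fold by blast

lemma fold_shift_mult_eigenvector:
  assumes "C *v v = z *s v"
  shows "fold (shift_mult C) L v = prod_list (map (\<lambda>l. z - l) L) *s v"
proof -
  have *: "fold (shift_mult C) L (c *s v) = (c * prod_list (map (\<lambda>l. z - l) L)) *s v" for c
    by (induction L arbitrary: c)
       (simp_all add: shift_mult_def vector_scalar_commute assms vector_smult_assoc mult_ac
          flip: vector_sub_rdistrib, simp add: algebra_simps)
  from *[of 1] show ?thesis by simp
qed

lemma fold_shift_mult_0 [simp]: "fold (shift_mult C) L 0 = 0"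
  by (induction L) (simp_all add: shift_mult_def)

lemma fold_shift_mult_add: "fold (shift_mult C) L (v + w) = fold (shift_mult C) L v + fold (shift_mult C) L w"
proof (induction L arbitrary: v w)
  case (Cons l L)
  have "shift_mult C l (v + w) = shift_mult C l v + shift_mult C l w"
    by (simp add: shift_mult_def matrix_vector_right_distrib vector_add_ldistrib)
  then show ?case by (simp add: Cons)
qed simp

lemma fold_shift_mult_scale: "fold (shift_mult C) L (c *s v) = c *s fold (shift_mult C) L v"
proof (induction L arbitrary: v)
  case (Cons l L)
  have "shift_mult C l (c *s v) = c *s shift_mult C l v"
    by (simp add: shift_mult_def vector_scalar_commute vector_ssub_ldistrib vector_smult_assoc mult.commute)
  then show ?case by (simp add: Cons)
qed simp

lemma fold_shift_mult_sum: "fold (shift_mult C) L (\<Sum>i\<in>I. f i) = (\<Sum>i\<in>I. fold (shift_mult C) L (f i))"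
  by (induction I rule: infinite_finite_induct) (simp_all add: fold_shift_mult_add)

text \<open>The concatenation of annihilating lists of all basis vectors kills the whole space. On
  an eigenvector for z it acts as the product of the numbers z - l, so z must be one of the l.
  Finiteness gives meaning to the maximum H of the real parts.\<close>

lemma finite_complex_eigenvalues: "finite (complex_eigenvalues (A :: real^'n^'n))"
proof -
  let ?C = "map_matrix complex_of_real A"
  obtain L where L: "\<And>i. fold (shift_mult ?C) (L i) (axis i 1) = 0"
  proof -
    have "\<forall>i. \<exists>L. fold (shift_mult ?C) L (axis i 1) = 0" using ex_eigenvalue_list[of ?C] by blast
    from choice[OF this] that show ?thesis by blast
  qed
  have "z \<in> (\<Union>i. set (L i))" if z: "z \<in> complex_eigenvalues A" for z
  proof (rule ccontr)
    assume nz: "z \<notin> (\<Union>i. set (L i))"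
    obtain v where v: "v \<noteq> 0" "?C *v v = z *s v" using z by (auto simp: complex_eigenvalues_def)
    obtain idx :: "'n list" where idx: "set idx = UNIV" using finite_list[of "UNIV :: 'n set"] by auto
    let ?K = "concat (map L idx)"
    have commute: "fold (shift_mult ?C) L1 (fold (shift_mult ?C) L2 w) = fold (shift_mult ?C) L2 (fold (shift_mult ?C) L1 w)" for L1 L2 w
      by (induction L1 arbitrary: w) (simp_all add: fold_shift_mult_commute)
    have "fold (shift_mult ?C) (concat (map L js)) (axis i 1) = 0" if "i \<in> set js" for i js
      using that
    proof (induction js)
      case (Cons j js)
      then show ?case
        by (cases "i = j") (auto simp: L commute[of _ "L j"])
    qed simp
    then have ax: "fold (shift_mult ?C) ?K (axis i 1) = 0" for i using idx by blast
    have "v = (\<Sum>i\<in>UNIV. v $ i *s axis i 1)" by (simp add: basis_expansion)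
    then have "fold (shift_mult ?C) ?K v = (\<Sum>i\<in>UNIV. v $ i *s fold (shift_mult ?C) ?K (axis i 1))"
      by (subst (asm) eq_commute, subst fold_shift_mult_scale[symmetric], subst fold_shift_mult_sum[symmetric]) simp
    then have "fold (shift_mult ?C) ?K v = 0" by (simp add: ax)
    moreover have "fold (shift_mult ?C) ?K v = prod_list (map (\<lambda>l. z - l) ?K) *s v"
      by (rule fold_shift_mult_eigenvector[OF v(2)])
    moreover have "prod_list (map (\<lambda>l. z - l) ?K) \<noteq> 0"
      using nz by (auto simp: prod_list_zero_iff)
    ultimately show False using v(1) by simp
  qed
  then show ?thesis by (rule finite_subset[OF subsetI]) auto
qed

section \<open>Growth of the matrix exponential\<close>

lemma map_matrix_of_real_mult: "map_matrix complex_of_real (A ** B) = map_matrix complex_of_real A ** map_matrix complex_of_real B"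
  by (simp add: vec_eq_iff matrix_matrix_mult_def)

lemma complex_mat_exp_has_vector_derivative:
  fixes A :: "real^'n^'n"
  defines "C \<equiv> map_matrix complex_of_real A"
  shows "((\<lambda>t. (map_matrix complex_of_real (mat_exp (t *\<^sub>R A)) *v v) $ i) has_vector_derivative
    (C *v (map_matrix complex_of_real (mat_exp (t *\<^sub>R A)) *v v)) $ i) (at t)"
proof -
  have *: "complex_of_real r * complex_of_real x * y = r *\<^sub>R (complex_of_real x * y)" for r x y
    by (simp add: scaleR_conv_of_real)
  have "linear (\<lambda>M::real^'n^'n. (map_matrix complex_of_real M *v v) $ i)"
    by (rule linearI) (simp_all add: matrix_vector_mult_def distrib_right sum.distrib scaleR_sum_right *)
  then have "bounded_linear (\<lambda>M::real^'n^'n. (map_matrix complex_of_real M *v v) $ i)"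
    by (simp add: linear_conv_bounded_linear)
  from bounded_linear.has_vector_derivative[OF this mat_exp_has_vector_derivative[of A t]]
  show ?thesis by (simp add: C_def map_matrix_of_real_mult matrix_vector_mul_assoc)
qed

text \<open>Induction along the annihilating list: y(t) = exp (t A) v solves y' = l y + exp (t A) (C
  - l) v, and the inhomogeneous term has the growth given by the induction hypothesis for the vector
  (C - l) v. Each component is then an instance of \<open>ode_growth\<close>.\<close>

lemma mat_exp_growth_vec:
  fixes A :: "real^'n^'n"
  defines "C \<equiv> map_matrix complex_of_real A"
  assumes "\<forall>l\<in>set L. Re l < a" "fold (shift_mult C) L v = 0"
  shows "\<exists>K. \<forall>t\<ge>0. \<forall>i. norm ((map_matrix complex_of_real (mat_exp (t *\<^sub>R A)) *v v) $ i) \<le> K * exp (a * t)"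
  using assms(2,3)
proof (induction L arbitrary: v)
  case Nil
  then show ?case by (intro exI[of _ 0]) simp
next
  case (Cons l L)
  let ?w = "shift_mult C l v" and ?E = "\<lambda>t. map_matrix complex_of_real (mat_exp (t *\<^sub>R A))"
  have "\<exists>K. \<forall>t\<ge>0. \<forall>i. norm ((?E t *v ?w) $ i) \<le> K * exp (a * t)"
    using Cons.prems by (intro Cons.IH) auto
  then obtain K where K: "\<forall>t\<ge>0. \<forall>i. norm ((?E t *v ?w) $ i) \<le> K * exp (a * t)"
    by blast
  have "\<exists>K. \<forall>t\<ge>0. norm ((?E t *v v) $ i) \<le> K * exp (a * t)" for i
  proof (rule ode_growth)
    show "norm ((?E t *v ?w) $ i) \<le> K * exp (a * t)" if "0 \<le> t" for t using K that by blast
    show "Re l < a" using Cons by simp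
    have "C *v (?E t *v v) = l *s (?E t *v v) + ?E t *v ?w" for t
      by (simp add: shift_mult_def matrix_vector_mult_diff_distrib vector_scalar_commute C_def
        matrix_vector_mul_assoc mat_exp_commute flip: map_matrix_of_real_mult)
    with complex_mat_exp_has_vector_derivative[of A v i]
    show "((\<lambda>t. (?E t *v v) $ i) has_vector_derivative l * (?E t *v v) $ i + (?E t *v ?w) $ i) (at t)" for t
      by (simp add: C_def)
  qed
  then obtain K where K: "\<And>i t. 0 \<le> t \<Longrightarrow> norm ((?E t *v v) $ i) \<le> K i * exp (a * t)" by metis
  have "norm ((?E t *v v) $ i) \<le> Max (range K) * exp (a * t)" if "0 \<le> t" for t i
    by (rule order_trans[OF K[OF that]]) (auto intro!: mult_right_mono)
  then show ?case by blast
qed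

text \<open>Every column is an orbit of a basis vector, and each basis vector has its own
  annihilating list of eigenvalues. The strict inequality absorbs the polynomial factors that
  nontrivial Jordan blocks would produce.\<close>

theorem mat_exp_growth:
  fixes A :: "real^'n^'n"
  assumes "\<And>z. z \<in> complex_eigenvalues A \<Longrightarrow> Re z < a"
  shows "\<exists>K>0. \<forall>t\<ge>0. norm (mat_exp (t *\<^sub>R A)) \<le> K * exp (a * t)"
proof -
  let ?C = "map_matrix complex_of_real A" and ?E = "\<lambda>t. map_matrix complex_of_real (mat_exp (t *\<^sub>R A))"
  have "\<exists>K. \<forall>t\<ge>0. \<forall>i. norm ((?E t *v axis j 1) $ i) \<le> K * exp (a * t)" for j
  proof -
    obtain L where L: "\<forall>l\<in>set L. \<exists>w. w \<noteq> 0 \<and> ?C *v w = l *s w" "fold (shift_mult ?C) L (axis j 1) = 0"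
      using ex_eigenvalue_list by blast
    then have "\<forall>l\<in>set L. Re l < a" using assms by (auto simp: complex_eigenvalues_def)
    from mat_exp_growth_vec[OF this L(2)] show ?thesis .
  qed
  then obtain K where K: "\<And>i j t. 0 \<le> t \<Longrightarrow> norm ((?E t *v axis j 1) $ i) \<le> K j * exp (a * t)" by metis
  have K': "\<bar>mat_exp (t *\<^sub>R A) $ i $ j\<bar> \<le> K j * exp (a * t)" if "0 \<le> t" for i j t
  proof -
    have "(?E t *v axis j 1) $ i = of_real (mat_exp (t *\<^sub>R A) $ i $ j)"
      by (simp add: matrix_vector_mult_def axis_def if_distrib cong: if_cong)
    with K[OF that, of j i] show ?thesis by simp
  qed
  have "norm (mat_exp (t *\<^sub>R A)) \<le> (\<Sum>i\<in>(UNIV::'n set). \<Sum>j\<in>UNIV. \<bar>K j\<bar>) * exp (a * t)" if t: "0 \<le> t" for t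
  proof -
    have "norm (mat_exp (t *\<^sub>R A)) \<le> (\<Sum>i\<in>UNIV. norm (mat_exp (t *\<^sub>R A) $ i))"
      unfolding norm_vec_def by (rule L2_set_le_sum) simp
    also have "\<dots> \<le> (\<Sum>i\<in>UNIV. \<Sum>j\<in>UNIV. \<bar>mat_exp (t *\<^sub>R A) $ i $ j\<bar>)"
      by (intro sum_mono norm_le_l1_cart)
    also have "\<dots> \<le> (\<Sum>i\<in>(UNIV::'n set). \<Sum>j\<in>UNIV. \<bar>K j\<bar> * exp (a * t))"
      by (intro sum_mono order_trans[OF K'[OF t]] mult_right_mono) auto
    finally show ?thesis by (simp only: sum_distrib_right)
  qed
  moreover have "(\<Sum>i\<in>(UNIV::'n set). \<Sum>j\<in>UNIV. \<bar>K j\<bar>) * exp (a * t) \<le> ((\<Sum>i\<in>(UNIV::'n set). \<Sum>j\<in>UNIV. \<bar>K j\<bar>) + 1) * exp (a * t)" for t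
    by (intro mult_right_mono) auto
  moreover have "0 < (\<Sum>i\<in>(UNIV::'n set). \<Sum>j\<in>UNIV. \<bar>K j\<bar>) + 1"
    by (intro add_nonneg_pos sum_nonneg) auto
  ultimately show ?thesis by (meson order_trans)
qed

section \<open>The determinant along the exponential flow\<close>

text \<open>In the Leibniz formula only the identity permutation contributes: any other permutation
  moves at least two indices, so after one factor is differentiated an off-diagonal entry of the
  identity matrix, a zero, is still present.\<close>

lemma det_has_derivative_at_mat_1:
  fixes f :: "real \<Rightarrow> real^'n^'n"
  assumes f: "(f has_vector_derivative f') (at t)" and f1: "f t = mat 1"
  shows "((\<lambda>t. det (f t)) has_real_derivative trace f') (at t)"
proof -
  have fij: "((\<lambda>t. f t $ i $ j) has_real_derivative f' $ i $ j) (at t)" for i j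
    unfolding has_real_derivative_iff_has_vector_derivative
    by (intro bounded_linear.has_vector_derivative[OF bounded_linear_vec_nth]
       bounded_linear.has_vector_derivative[OF bounded_linear_vec_nth] f)
  let ?P = "{p. p permutes (UNIV::'n set)}"
  let ?D = "\<lambda>p. of_int (sign p) * (\<Sum>i\<in>UNIV. f' $ i $ p i * (\<Prod>j\<in>UNIV - {i}. f t $ j $ p j))"
  have "((\<lambda>t. det (f t)) has_real_derivative (\<Sum>p\<in>?P. ?D p)) (at t)"
    unfolding det_def by (intro DERIV_sum DERIV_cmult has_field_derivative_prod fij)
  also have "(\<Sum>p\<in>?P. ?D p) = (\<Sum>p\<in>{id}. ?D p)"
  proof (rule sum.mono_neutral_right)
    show "finite ?P" by (rule finite_permutations) simp
    show "{id} \<subseteq> ?P" by (simp add: permutes_id)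
    show "\<forall>p\<in>?P - {id}. ?D p = 0"
    proof
      fix p assume p: "p \<in> ?P - {id}"
      then obtain k where k: "p k \<noteq> k" by (metis DiffD2 eq_id_iff singletonI)
      have inj: "inj p" using p permutes_inj by blast
      have "(\<Prod>j\<in>UNIV - {i}. f t $ j $ p j) = 0" for i
      proof -
        have "p (p k) \<noteq> p k" using inj k by (metis injD)
        with k obtain j where "j \<noteq> i" "p j \<noteq> j" by metis
        then show ?thesis by (intro prod_zero bexI[of _ j]) (auto simp: f1 mat_def)
      qed
      then show "?D p = 0" by (simp only: mult_zero_right sum.neutral_const)
    qed
  qed
  also have "\<dots> = trace f'" by (simp add: trace_def f1 mat_def)
  finally show ?thesis .
qed

text \<open>The group law carries the derivative at 0 to every t, so the determinant g solves g' =
  (trace f') g; multiplying by exp (-t trace f') gives a constant.\<close>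

lemma det_flow_eq_exp_trace:
  fixes f :: "real \<Rightarrow> real^'n^'n"
  assumes f: "(f has_vector_derivative f') (at 0)" and f0: "f 0 = mat 1"
    and add: "\<And>s t. f (s + t) = f s ** f t"
  shows "det (f t) = exp (t * trace f')"
proof -
  let ?g = "\<lambda>t. det (f t)" and ?q = "trace f'"
  have "(?g has_real_derivative ?g t * ?q) (at t)" for t
  proof -
    have "((\<lambda>s. ?g t * ?g s) has_real_derivative ?g t * ?q) (at 0)"
      by (intro DERIV_cmult det_has_derivative_at_mat_1 f f0)
    then have "((\<lambda>s. ?g (s + t)) has_real_derivative ?g t * ?q) (at 0)"
      by (simp add: add.commute[of _ t] add det_mul)
    then show ?thesis using DERIV_shift[of ?g "?g t * ?q" 0 t] by simp
  qed
  then have "((\<lambda>t. exp (- t * ?q) * ?g t) has_real_derivative 0) (at t)" for t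
    by (auto intro!: derivative_eq_intros simp: algebra_simps)
  then have "exp (- t * ?q) * ?g t = exp (- 0 * ?q) * ?g 0"
    by (intro DERIV_isconst_all) auto
  then show ?thesis by (simp add: f0 exp_minus field_simps)
qed

lemma complex_eigenvalues_uminus: "complex_eigenvalues (- A) = uminus ` complex_eigenvalues A"
proof -
  have "map_matrix complex_of_real (- A) *v v = - (map_matrix complex_of_real A *v v)" for v
    by (simp add: vec_eq_iff matrix_vector_mult_def sum_negf)
  then have *: "z \<in> complex_eigenvalues (- A) \<longleftrightarrow> - z \<in> complex_eigenvalues A" for z
    by (simp add: complex_eigenvalues_def vector_smult_lneg) (metis minus_minus)
  show ?thesis by (force simp: * image_iff)
qed

lemma complex_eigenvalues_diff_mat: "complex_eigenvalues (A - c *\<^sub>R mat 1) = (\<lambda>z. z - of_real c) ` complex_eigenvalues A"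
proof -
  have "map_matrix complex_of_real (A - c *\<^sub>R mat 1) *v v = map_matrix complex_of_real A *v v - of_real c *s v" for v
  proof -
    have "complex_of_real ((A - c *\<^sub>R mat 1) $ i $ j) * v $ j = of_real (A $ i $ j) * v $ j - (if i = j then of_real c * v $ j else 0)" for i j
      by (simp add: mat_def left_diff_distrib)
    then show ?thesis
      by (simp only: vec_eq_iff matrix_vector_mult_def nth_map_matrix vec_lambda_beta vector_minus_component
          vector_smult_component sum_subtractf) simp
  qed
  then have *: "z \<in> complex_eigenvalues (A - c *\<^sub>R mat 1) \<longleftrightarrow> z + of_real c \<in> complex_eigenvalues A" for z
    by (simp add: complex_eigenvalues_def vector_sadd_rdistrib diff_eq_eq add.commute)
  show ?thesis by (force simp: * image_iff)
qed

lemma scalar_mpow_growth_at_top: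
  fixes A :: "real^'n^'n"
  assumes "\<And>z. z \<in> complex_eigenvalues A \<Longrightarrow> Re z < a"
  shows "\<exists>K>0. \<forall>c\<ge>1. norm (scalar_mpow c A) \<le> K * c powr a"
proof -
  obtain K where K: "K > 0" "\<forall>t\<ge>0. norm (mat_exp (t *\<^sub>R A)) \<le> K * exp (a * t)"
    using mat_exp_growth[OF assms] by blast
  then have "\<forall>c\<ge>1. norm (scalar_mpow c A) \<le> K * c powr a"
    by (auto simp: scalar_mpow_def powr_def)
  with K show ?thesis by blast
qed

text \<open>For c \<le> 1 the power c^A is the exponential of (- ln c) (-A) with - ln c \<ge> 0, so
  the forward growth bound is applied to -A, whose eigenvalues are the negatives.\<close>

lemma scalar_mpow_growth_at_0:
  fixes A :: "real^'n^'n"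
  assumes "\<And>z. z \<in> complex_eigenvalues A \<Longrightarrow> a < Re z"
  shows "\<exists>K>0. \<forall>c. 0 < c \<and> c \<le> 1 \<longrightarrow> norm (scalar_mpow c A) \<le> K * c powr a"
proof -
  have "\<And>z. z \<in> complex_eigenvalues (- A) \<Longrightarrow> Re z < - a"
    using assms by (auto simp: complex_eigenvalues_uminus)
  from mat_exp_growth[OF this]
  obtain K where K: "K > 0" "\<forall>t\<ge>0. norm (mat_exp (t *\<^sub>R - A)) \<le> K * exp (- a * t)" by blast
  have "norm (scalar_mpow c A) \<le> K * c powr a" if "0 < c" "c \<le> 1" for c
    using K(2)[rule_format, of "- ln c"] that by (simp add: scalar_mpow_def powr_def)
  with K show ?thesis by blast
qed

lemma scalar_mpow_bounded_Icc:
  fixes A :: "real^'n^'n"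
  assumes "0 < l"
  shows "\<exists>K>0. \<forall>c. l \<le> c \<and> c \<le> u \<longrightarrow> norm (scalar_mpow c A) \<le> K"
proof -
  have "compact ((\<lambda>c. scalar_mpow c A) ` {l..u})"
    by (intro compact_continuous_image continuous_on_subset[OF continuous_on_scalar_mpow]) (use assms in auto)
  then show ?thesis by (force dest!: compact_imp_bounded simp: bounded_pos)
qed

section \<open>Linear changes of variables\<close>

text \<open>The linear change of variables formula as a predicate of the matrix, so that induction
  over elementary matrices applies to it. Singular matrices satisfy it vacuously, which settles the
  case of a zero row.\<close>

definition volume_factor_det :: "real^'n^'n \<Rightarrow> bool" where
  "volume_factor_det A \<longleftrightarrow> (det A \<noteq> 0 \<longrightarrow> (\<forall>f\<in>borel_measurable borel.
     (\<integral>\<^sup>+x. f x \<partial>lborel) = ennreal \<bar>det A\<bar> * (\<integral>\<^sup>+x. f (A *v x) \<partial>lborel)))"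

lemma borel_measurable_matrix_vector_mult [measurable]:
  "(\<lambda>x. A *v x) \<in> borel_measurable borel" for A :: "real^'n^'m"
  by (intro borel_measurable_continuous_onI linear_continuous_on matrix_vector_mul_bounded_linear)

lemma nn_integral_lborel_linear_diag:
  fixes A :: "real^'n^'n"
  assumes diag: "\<And>i j. i \<noteq> j \<Longrightarrow> A $ i $ j = 0"
  shows "volume_factor_det A"
  unfolding volume_factor_det_def
proof (intro impI ballI)
  fix f :: "real^'n \<Rightarrow> ennreal" assume [measurable]: "f \<in> borel_measurable borel"
  assume "det A \<noteq> 0"
  have det: "det A = (\<Prod>i\<in>UNIV. A $ i $ i)" by (rule det_diagonal) (rule diag)
  with \<open>det A \<noteq> 0\<close> have nz: "A $ i $ i \<noteq> 0" for i by auto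
  \<comment> \<open>The affine image formula wants scaling factors indexed by basis vectors;
    \<open>c (axis i 1)\<close> is the i-th diagonal entry.\<close>
  define c where "c b = (\<Sum>i\<in>UNIV. A $ i $ i * b $ i)" for b :: "real^'n"
  have ca: "c (axis i 1) = A $ i $ i" for i
    by (simp add: c_def axis_def if_distrib cong: if_cong)
  have B: "Basis = range (\<lambda>i. axis i 1 :: real^'n)" by (auto simp: Basis_vec_def)
  have inj: "inj (\<lambda>i. axis i 1 :: real^'n)" by (auto simp: inj_on_def axis_eq_axis)
  have T: "A *v x = 0 + (\<Sum>j\<in>Basis. (c j * (x \<bullet> j)) *\<^sub>R j)" for x
  proof -
    have "(A *v x) $ i = (0 + (\<Sum>j\<in>Basis. (c j * (x \<bullet> j)) *\<^sub>R j)) $ i" for i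
    proof -
      have "(A *v x) $ i = (\<Sum>j\<in>{i}. A $ i $ j * x $ j)"
        unfolding matrix_vector_mult_def vec_lambda_beta by (rule sum.mono_neutral_right) (auto simp: diag)
      also have "\<dots> = (\<Sum>j\<in>UNIV. A $ j $ j * x $ j * (if i = j then 1 else 0))"
        by (simp add: if_distrib cong: if_cong)
      also have "\<dots> = (0 + (\<Sum>j\<in>Basis. (c j * (x \<bullet> j)) *\<^sub>R j)) $ i"
      proof -
        have "(0 + (\<Sum>j\<in>Basis. (c j * (x \<bullet> j)) *\<^sub>R j)) $ i = (\<Sum>j\<in>UNIV. c (axis j 1) * (x \<bullet> axis j 1) * axis j 1 $ i)"
          unfolding B sum.reindex[OF inj] by (simp add: o_def)
        then show ?thesis by (simp add: ca inner_axis) (simp add: axis_def)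
      qed
      finally show ?thesis .
    qed
    then show ?thesis by (simp add: vec_eq_iff)
  qed
  have "lborel = density (distr lborel borel (\<lambda>x. A *v x)) (\<lambda>_. (\<Prod>j\<in>Basis. \<bar>c j\<bar>))"
    unfolding T by (rule lborel_affine_euclidean) (auto simp: B ca nz)
  moreover have "(\<Prod>j\<in>Basis. \<bar>c j\<bar>) = \<bar>det A\<bar>"
    by (simp add: B prod.reindex[OF inj] ca det abs_prod)
  ultimately have "lborel = density (distr lborel borel (\<lambda>x. A *v x)) (\<lambda>_. ennreal \<bar>det A\<bar>)" by simp
  then have "(\<integral>\<^sup>+x. f x \<partial>lborel) = (\<integral>\<^sup>+x. f x \<partial>density (distr lborel borel (\<lambda>x. A *v x)) (\<lambda>_. ennreal \<bar>det A\<bar>))"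
    by metis
  also have "\<dots> = ennreal \<bar>det A\<bar> * (\<integral>\<^sup>+x. f (A *v x) \<partial>lborel)"
    by (simp add: nn_integral_density nn_integral_distr nn_integral_cmult)
  finally show "(\<integral>\<^sup>+x. f x \<partial>lborel) = ennreal \<bar>det A\<bar> * (\<integral>\<^sup>+x. f (A *v x) \<partial>lborel)" .
qed

text \<open>Exchanging two coordinates only permutes the side lengths of a box, and boxes determine
  Lebesgue measure; the determinant is -1.\<close>

lemma nn_integral_lborel_linear_swap:
  fixes m n :: "'n::finite"
  assumes "m \<noteq> n"
  shows "volume_factor_det (\<chi> i j. mat 1 $ i $ Transposition.transpose m n j :: real^'n^'n)"
proof -
  let ?t = "Transposition.transpose m n"
  let ?A = "\<chi> i j. mat 1 $ i $ ?t j :: real^'n^'n"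
  have A: "?A *v x = (\<chi> i. x $ ?t i)" for x
  proof -
    have "(\<Sum>j\<in>UNIV. (if i = ?t j then 1 else 0) * x $ j) = (\<Sum>j\<in>UNIV. if j = ?t i then x $ j else 0)" for i
      by (intro sum.cong) (auto simp: transpose_eq_iff)
    then show ?thesis by (simp add: matrix_vector_mult_def mat_def vec_eq_iff)
  qed
  have B: "Basis = range (\<lambda>i. axis i 1 :: real^'n)" by (auto simp: Basis_vec_def)
  have inj: "inj (\<lambda>i. axis i 1 :: real^'n)" by (auto simp: inj_on_def axis_eq_axis)
  have "det ?A = of_int (sign ?t) * det (mat 1 :: real^'n^'n)"
    by (rule det_permute_columns) (simp add: permutes_swap_id)
  then have d: "\<bar>det ?A\<bar> = 1" using assms by (simp add: sign_swap_id)
  have "lborel = distr lborel borel (\<lambda>x. ?A *v x)"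
  proof (rule lborel_eqI)
    fix l u :: "real^'n" assume lu: "\<And>b. b \<in> Basis \<Longrightarrow> l \<bullet> b \<le> u \<bullet> b"
    have lu': "l $ i \<le> u $ i" for i using lu[of "axis i 1"] by (simp add: inner_axis)
    have "(\<lambda>x. ?A *v x) -` box l u = box (\<chi> i. l $ ?t i) (\<chi> i. u $ ?t i)"
      unfolding A by (auto simp: mem_box_cart) (metis transpose_involutory)+
    then have "emeasure (distr lborel borel (\<lambda>x. ?A *v x)) (box l u) = emeasure lborel (box (\<chi> i. l $ ?t i) (\<chi> i. u $ ?t i) :: (real^'n) set)"
      by (subst emeasure_distr) auto
    also have "\<dots> = ennreal (\<Prod>b\<in>Basis. ((\<chi> i. u $ ?t i) - (\<chi> i. l $ ?t i)) \<bullet> (b :: real^'n))"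
      by (subst emeasure_lborel_box_eq) (auto simp: B inner_axis lu')
    also have "(\<Prod>b\<in>Basis. ((\<chi> i. u $ ?t i) - (\<chi> i. l $ ?t i)) \<bullet> (b :: real^'n)) = (\<Prod>i\<in>UNIV. u $ ?t i - l $ ?t i)"
      by (simp add: B prod.reindex[OF inj] inner_axis)
    also have "\<dots> = (\<Prod>i\<in>UNIV. u $ i - l $ i)"
      by (rule prod.reindex_bij_betw[of ?t UNIV UNIV "\<lambda>i. u $ i - l $ i"]) simp
    also have "\<dots> = (\<Prod>b\<in>Basis. (u - l) \<bullet> b)"
      by (simp add: B prod.reindex[OF inj] inner_axis)
    finally show "emeasure (distr lborel borel (\<lambda>x. ?A *v x)) (box l u) = ennreal (\<Prod>b\<in>Basis. (u - l) \<bullet> b)" .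
  qed simp
  note eq = this
  have "(\<integral>\<^sup>+x. f x \<partial>lborel) = (\<integral>\<^sup>+x. f (?A *v x) \<partial>lborel)" if [measurable]: "f \<in> borel_measurable borel" for f
    by (subst eq) (simp add: nn_integral_distr)
  then show ?thesis
    unfolding volume_factor_det_def d ennreal_1 mult_1_left by (intro impI ballI)
qed

text \<open>Integrating in the direction of \<open>axis m 1\<close> before all other coordinates,
  the shear is a translation by \<open>c * x $ n\<close>, constant in that variable because m and n
  differ.\<close>

lemma nn_integral_lborel_shear:
  fixes m n :: "'n::finite" and f :: "real^'n \<Rightarrow> ennreal"
  assumes mn: "m \<noteq> n" and [measurable]: "f \<in> borel_measurable borel"
  shows "(\<integral>\<^sup>+x. f (x + (c * x $ n) *\<^sub>R axis m 1) \<partial>lborel) = (\<integral>\<^sup>+x. f x \<partial>lborel)"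
proof -
  let ?m = "axis m 1 :: real^'n" and ?n = "axis n 1 :: real^'n"
  let ?B = "Basis - {?m}"
  have Bm: "Basis = insert ?m ?B" by (auto simp: Basis_vec_def)
  have fin: "finite ?B" "?m \<notin> ?B" by auto
  have nB: "?n \<in> ?B" using mn by (auto simp: Basis_vec_def axis_eq_axis)
  interpret product_sigma_finite "\<lambda>_::real^'n. lborel :: real measure" ..
  let ?T = "\<lambda>x :: real^'n \<Rightarrow> real. \<Sum>b\<in>Basis. x b *\<^sub>R b"
  have T: "?T x = x ?m *\<^sub>R ?m + (\<Sum>b\<in>?B. x b *\<^sub>R b)" for x
    by (subst Bm, subst sum.insert) auto
  have eqT: "?T (x(?m := y)) = y *\<^sub>R ?m + (\<Sum>b\<in>?B. x b *\<^sub>R b)" for x y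
    unfolding T by (simp cong: sum.cong) (rule sum.cong, auto)
  have Tn: "?T x $ n = x ?n" for x
    by (simp add: Basis_vec_def sum.UNION_disjoint axis_eq_axis) (simp add: axis_def if_distrib cong: if_cong)
  have [measurable]: "(\<lambda>x. x $ n) \<in> borel_measurable borel"
    by (intro borel_measurable_continuous_onI continuous_intros)
  have meas: "?T \<in> borel_measurable (Pi\<^sub>M (insert ?m ?B) (\<lambda>b. lborel))"
    by (rule borel_measurable_sum) (use Bm in \<open>auto intro!: borel_measurable_scaleR measurable_component_singleton\<close>)
  have "(\<integral>\<^sup>+x. g x \<partial>lborel) = (\<integral>\<^sup>+x. \<integral>\<^sup>+y. g (y *\<^sub>R ?m + (\<Sum>b\<in>?B. x b *\<^sub>R b)) \<partial>lborel \<partial>Pi\<^sub>M ?B (\<lambda>b. lborel))"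
    if [measurable]: "g \<in> borel_measurable borel" for g :: "real^'n \<Rightarrow> ennreal"
  proof -
    have "(\<integral>\<^sup>+x. g x \<partial>lborel) = (\<integral>\<^sup>+x. g (?T x) \<partial>Pi\<^sub>M (insert ?m ?B) (\<lambda>b. lborel))"
      using meas Bm by (subst lborel_eq, subst nn_integral_distr) auto
    also have "\<dots> = (\<integral>\<^sup>+x. \<integral>\<^sup>+y. g (?T (x(?m := y))) \<partial>lborel \<partial>Pi\<^sub>M ?B (\<lambda>b. lborel))"
      by (rule product_nn_integral_insert[OF fin]) (rule measurable_compose[OF meas], simp)
    finally show ?thesis unfolding eqT .
  qed
  note split = this
  have "(\<integral>\<^sup>+x. f (x + (c * x $ n) *\<^sub>R ?m) \<partial>lborel) =
    (\<integral>\<^sup>+x. \<integral>\<^sup>+y. f ((y + c * x ?n) *\<^sub>R ?m + (\<Sum>b\<in>?B. x b *\<^sub>R b)) \<partial>lborel \<partial>Pi\<^sub>M ?B (\<lambda>b. lborel))"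
  proof (subst split, simp, intro nn_integral_cong)
    fix x y
    have "(y *\<^sub>R ?m + (\<Sum>b\<in>?B. x b *\<^sub>R b)) $ n = x ?n"
    proof -
      have "?n \<noteq> ?m" using nB by blast
      then show ?thesis using Tn[of "x(?m := y)"] unfolding eqT by (simp only: fun_upd_apply if_False)
    qed
    then show "f (y *\<^sub>R ?m + (\<Sum>b\<in>?B. x b *\<^sub>R b) + (c * (y *\<^sub>R ?m + (\<Sum>b\<in>?B. x b *\<^sub>R b)) $ n) *\<^sub>R ?m) =
      f ((y + c * x ?n) *\<^sub>R ?m + (\<Sum>b\<in>?B. x b *\<^sub>R b))"
      by (simp add: scaleR_add_left add_ac)
  qed
  also have "\<dots> = (\<integral>\<^sup>+x. \<integral>\<^sup>+y. f (y *\<^sub>R ?m + (\<Sum>b\<in>?B. x b *\<^sub>R b)) \<partial>lborel \<partial>Pi\<^sub>M ?B (\<lambda>b. lborel))"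
  proof (rule nn_integral_cong)
    fix x
    show "(\<integral>\<^sup>+y. f ((y + c * x ?n) *\<^sub>R ?m + (\<Sum>b\<in>?B. x b *\<^sub>R b)) \<partial>lborel) = (\<integral>\<^sup>+y. f (y *\<^sub>R ?m + (\<Sum>b\<in>?B. x b *\<^sub>R b)) \<partial>lborel)"
      by (subst nn_integral_real_affine[of _ 1 "c * x ?n"]) (simp_all add: add.commute)
  qed
  also have "\<dots> = (\<integral>\<^sup>+x. f x \<partial>lborel)" by (rule split[symmetric]) simp
  finally show ?thesis .
qed

theorem nn_integral_lborel_linear:
  fixes A :: "real^'n^'n" and f :: "real^'n \<Rightarrow> ennreal"
  assumes "det A \<noteq> 0" and "f \<in> borel_measurable borel"
  shows "(\<integral>\<^sup>+x. f x \<partial>lborel) = ennreal \<bar>det A\<bar> * (\<integral>\<^sup>+x. f (A *v x) \<partial>lborel)"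
proof -
  have "volume_factor_det A"
  proof (induction A rule: induct_matrix_elementary)
    case (1 A B)
    show ?case unfolding volume_factor_det_def
    proof (intro impI ballI)
      fix f :: "real^'n \<Rightarrow> ennreal" assume f[measurable]: "f \<in> borel_measurable borel"
      assume "det (A ** B) \<noteq> 0"
      then have AB: "det A \<noteq> 0" "det B \<noteq> 0" by (auto simp: det_mul)
      have "(\<integral>\<^sup>+x. f x \<partial>lborel) = ennreal \<bar>det A\<bar> * (\<integral>\<^sup>+x. f (A *v x) \<partial>lborel)"
        using 1(1) AB f unfolding volume_factor_det_def by blast
      also have "(\<integral>\<^sup>+x. f (A *v x) \<partial>lborel) = ennreal \<bar>det B\<bar> * (\<integral>\<^sup>+x. f (A *v (B *v x)) \<partial>lborel)"
        by (rule bspec[OF mp[OF 1(2)[unfolded volume_factor_det_def] AB(2)]]) measurable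
      finally show "(\<integral>\<^sup>+x. f x \<partial>lborel) = ennreal \<bar>det (A ** B)\<bar> * (\<integral>\<^sup>+x. f ((A ** B) *v x) \<partial>lborel)"
        by (simp add: det_mul abs_mult ennreal_mult mult.assoc matrix_vector_mul_assoc)
    qed
  next
    case (2 A i)
    then show ?case by (simp add: volume_factor_det_def det_zero_row)
  next
    case (3 A)
    then show ?case by (rule nn_integral_lborel_linear_diag)
  next
    case (4 m n)
    then show ?case by (rule nn_integral_lborel_linear_swap)
  next
    case (5 m n c)
    note idplus = this
    let ?A = "\<chi> i j. if i = m \<and> j = n then c else of_bool (i = j) :: real^'n^'n"
    have "?A = (\<chi> k. if k = m then row m (mat 1) + c *s row n (mat 1) else row k (mat 1))"
      using idplus by (auto simp: vec_eq_iff row_def mat_def)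
    then have "det ?A = 1" using det_row_operation[OF idplus, of "mat 1" c] by simp
    moreover have "?A *v x = x + (c * x $ n) *\<^sub>R axis m 1" for x
    proof -
      have "(\<Sum>j\<in>UNIV. (if i = m \<and> j = n then c else of_bool (i = j)) * x $ j) = x $ i + c * x $ n * axis m 1 $ i" for i
      proof -
        have "(if i = m \<and> j = n then c else of_bool (i = j)) * x $ j = (if j = i then x $ j else 0) + (if j = n then (if i = m then c * x $ j else 0) else 0)" for j
          using idplus by auto
        then show ?thesis by (simp add: sum.distrib axis_def)
      qed
      then show ?thesis by (simp add: vec_eq_iff matrix_vector_mult_def)
    qed
    ultimately show ?case
      using nn_integral_lborel_shear[OF idplus] by (simp add: volume_factor_det_def)
  qed
  with assms show ?thesis unfolding volume_factor_det_def by blast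
qed

lemma det_mat_exp: "det (mat_exp (t *\<^sub>R A)) = exp (t * trace A)" for A :: "real^'n^'n"
  using mat_exp_has_vector_derivative[of A 0]
  by (intro det_flow_eq_exp_trace) (simp_all add: mat_exp_add)

lemma det_scalar_mpow: "0 < c \<Longrightarrow> det (scalar_mpow c A) = c powr trace A"
  by (simp add: scalar_mpow_def det_mat_exp powr_def mult.commute)

section \<open>Uniqueness of characteristic functions\<close>

text \<open>The transform at t = 0 shows that the total masses agree. Zero mass is trivial, and
  otherwise dividing by the mass reduces the claim to Levy's uniqueness theorem for probability
  laws.\<close>

lemma finite_measure_eqI_char:
  fixes m1 m2 :: "real measure"
  assumes fin: "finite_measure m1" "finite_measure m2" and sets: "sets m1 = sets borel" "sets m2 = sets borel"
    and char: "\<And>t. (\<integral>x. iexp (t * x) \<partial>m1) = (\<integral>x. iexp (t * x) \<partial>m2)"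
  shows "m1 = m2"
proof -
  interpret m1: finite_measure m1 by fact
  interpret m2: finite_measure m2 by fact
  have [measurable_cong]: "sets m1 = sets borel" "sets m2 = sets borel" by fact+
  have sp: "space m1 = UNIV" "space m2 = UNIV"
    using sets_eq_imp_space_eq[OF sets(1)] sets_eq_imp_space_eq[OF sets(2)] by simp_all
  define c where "c = measure m1 UNIV"
  have c2: "c = measure m2 UNIV" using char[of 0] by (simp add: c_def sp)
  show ?thesis
  proof (cases "c = 0")
    case True
    then have z: "emeasure m1 UNIV = 0" "emeasure m2 UNIV = 0"
      using c2 by (simp_all add: c_def m1.emeasure_eq_measure m2.emeasure_eq_measure)
    have "emeasure m1 A = 0" "emeasure m2 A = 0" for A
      using emeasure_space[of m1 A] emeasure_space[of m2 A] z by (simp_all add: sp)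
    then show ?thesis using sets by (intro measure_eqI) auto
  next
    case False
    then have c: "0 < c" by (simp add: c_def zero_less_measure_iff)
    let ?d = "\<lambda>m. density m (\<lambda>x. ennreal (1 / c))"
    have "real_distribution (?d m)" if "finite_measure m" "sets m = sets borel" "measure m UNIV = c" for m :: "real measure"
    proof -
      interpret m: finite_measure m by fact
      have spm: "space m = UNIV" using sets_eq_imp_space_eq[OF that(2)] by simp
      have "emeasure (?d m) UNIV = 1"
        using c that spm by (subst emeasure_density) (auto simp: m.emeasure_eq_measure sets.top[of m] ennreal_mult[symmetric] nn_integral_cmult simp flip: ennreal_1)
      then have "prob_space (?d m)" by (intro prob_spaceI) (simp add: spm)
      then show ?thesis by (simp add: real_distribution_def real_distribution_axioms_def that)
    qed
    then have rd: "real_distribution (?d m1)" "real_distribution (?d m2)"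
      using fin sets c2 by (simp_all add: c_def)
    have "char (?d m1) = char (?d m2)"
      unfolding char_def using c char by (intro ext) (subst integral_density integral_density; simp)+
    with rd have eq: "?d m1 = ?d m2" by (rule Levy_uniqueness)
    have "emeasure m A = ennreal c * emeasure (?d m) A" if "A \<in> sets borel" "sets m = sets borel" for A m
    proof -
      have "emeasure (?d m) A = ennreal (1 / c) * emeasure m A"
        using that by (subst emeasure_density) (auto simp: nn_integral_cmult)
      then show ?thesis using c by (simp add: mult.assoc[symmetric] ennreal_mult[symmetric])
    qed
    note * = this
    show ?thesis
    proof (rule measure_eqI)
      fix A assume "A \<in> sets m1"
      then show "emeasure m1 A = emeasure m2 A" using sets eq *[of A m1] *[of A m2] by simp
    qed (simp add: sets)
  qed
qed

text \<open>One coordinate at a time: as soon as the complex measures with densities \<open>exp (i u \<bullet> x)\<close> times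
  an indicator agree, so do the positive ones with densities \<open>1 + cos (u \<bullet> x)\<close> and
  \<open>1 + sin (u \<bullet> x)\<close>, whose marginals on the next coordinate the one-dimensional theorem determines.\<close>

lemma char_fun_step:
  fixes \<mu> \<nu> :: "'a::euclidean_space measure"
  assumes prob: "prob_space \<mu>" "prob_space \<nu>" and sets: "sets \<mu> = sets borel" "sets \<nu> = sets borel"
    and S: "S \<in> sets borel" and B: "B \<in> sets borel"
    and eq: "\<And>u. (\<integral>x. indicator S x * iexp (u \<bullet> x) \<partial>\<mu>) = (\<integral>x. indicator S x * iexp (u \<bullet> x) \<partial>\<nu>)"
  shows "(\<integral>x. indicator (S \<inter> {x. x \<bullet> b \<in> B}) x * iexp (u \<bullet> x) \<partial>\<mu>) =
    (\<integral>x. indicator (S \<inter> {x. x \<bullet> b \<in> B}) x * iexp (u \<bullet> x) \<partial>\<nu>)"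
proof -
  interpret \<mu>: prob_space \<mu> by fact
  interpret \<nu>: prob_space \<nu> by fact
  have [measurable_cong]: "sets \<mu> = sets borel" "sets \<nu> = sets borel" by fact+
  have [measurable]: "S \<in> sets borel" "B \<in> sets borel" by fact+
  have key: "(\<integral>x. g x * indicator (S \<inter> {x. x \<bullet> b \<in> B}) x \<partial>\<mu>) = (\<integral>x. g x * indicator (S \<inter> {x. x \<bullet> b \<in> B}) x \<partial>\<nu>)"
    if g[measurable]: "g \<in> borel_measurable borel" and g0: "\<And>x. 0 \<le> g x" and g2: "\<And>x. g x \<le> 2"
      and geq: "\<And>t. (\<integral>x. complex_of_real (g x) * (indicator S x * iexp (t * (x \<bullet> b))) \<partial>\<mu>) =
        (\<integral>x. complex_of_real (g x) * (indicator S x * iexp (t * (x \<bullet> b))) \<partial>\<nu>)"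
    for g :: "'a \<Rightarrow> real"
  proof -
    let ?m = "\<lambda>\<mu>. distr (density \<mu> (\<lambda>x. ennreal (g x * indicator S x))) borel (\<lambda>x. x \<bullet> b)"
    have gS: "0 \<le> g x * indicator S x" "g x * indicator S x \<le> 2" for x
      using g0[of x] g2[of x] by (auto simp: indicator_def)
    have int: "integrable \<rho> (\<lambda>x. g x * indicator S x)" if "prob_space \<rho>" "sets \<rho> = sets borel" for \<rho> :: "'a measure"
    proof -
      interpret \<rho>: prob_space \<rho> by fact
      have [measurable_cong]: "sets \<rho> = sets borel" by fact
      show ?thesis by (rule \<rho>.integrable_const_bound[where B = 2]) (use gS in auto)
    qed
    have fin: "finite_measure (?m \<rho>)" if "prob_space \<rho>" "sets \<rho> = sets borel" for \<rho> :: "'a measure"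
    proof -
      have [measurable_cong]: "sets \<rho> = sets borel" by fact
      have "emeasure (density \<rho> (\<lambda>x. ennreal (g x * indicator S x))) (space \<rho>) = (\<integral>\<^sup>+x. ennreal (g x * indicator S x) \<partial>\<rho>)"
        by (subst emeasure_density) (auto intro!: nn_integral_cong)
      also have "\<dots> < \<infinity>" using int[OF that] gS by (subst nn_integral_eq_integral) auto
      finally have "finite_measure (density \<rho> (\<lambda>x. ennreal (g x * indicator S x)))"
        by (intro finite_measureI) auto
      then show ?thesis by (rule finite_measure.finite_measure_distr) simp
    qed
    have "?m \<mu> = ?m \<nu>"
    proof (rule finite_measure_eqI_char[OF fin fin])
      fix t :: real
      have "(\<integral>x. iexp (t * x) \<partial>?m \<rho>) = (\<integral>x. complex_of_real (g x) * (indicator S x * iexp (t * (x \<bullet> b))) \<partial>\<rho>)"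
        if "sets \<rho> = sets borel" for \<rho> :: "'a measure"
      proof -
        have [measurable_cong]: "sets \<rho> = sets borel" by fact
        show ?thesis
          by (subst integral_distr, simp, simp, subst integral_density)
            (use gS in \<open>auto intro!: Bochner_Integration.integral_cong simp: scaleR_conv_of_real indicator_def\<close>)
      qed
      then show "(\<integral>x. iexp (t * x) \<partial>?m \<mu>) = (\<integral>x. iexp (t * x) \<partial>?m \<nu>)"
        using sets geq by simp
    qed (use prob sets in simp_all)
    then have "measure (?m \<mu>) B = measure (?m \<nu>) B" by simp
    moreover have "measure (?m \<rho>) B = (\<integral>x. g x * indicator (S \<inter> {x. x \<bullet> b \<in> B}) x \<partial>\<rho>)"
      if "sets \<rho> = sets borel" for \<rho> :: "'a measure"
    proof -
      have [measurable_cong]: "sets \<rho> = sets borel" by fact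
      have sp: "space \<rho> = UNIV" using sets_eq_imp_space_eq[OF that] by simp
      have "measure (?m \<rho>) B = (\<integral>x. indicator B x \<partial>?m \<rho>)" by simp
      also have "\<dots> = (\<integral>x. g x * indicator S x * indicator B (x \<bullet> b) \<partial>\<rho>)"
        by (subst integral_distr, simp, simp, subst integral_density) (use gS in auto)
      also have "\<dots> = (\<integral>x. g x * indicator (S \<inter> {x. x \<bullet> b \<in> B}) x \<partial>\<rho>)"
        by (intro Bochner_Integration.integral_cong) (auto simp: indicator_def)
      finally show ?thesis .
    qed
    ultimately show ?thesis using sets by simp
  qed
  have I: "integrable \<rho> (\<lambda>x. indicator S x * iexp (v \<bullet> x))" if "prob_space \<rho>" "sets \<rho> = sets borel" for v and \<rho> :: "'a measure"
  proof -
    interpret \<rho>: prob_space \<rho> by fact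
    have [measurable_cong]: "sets \<rho> = sets borel" by fact
    show ?thesis by (rule \<rho>.integrable_const_bound[where B = 1]) (auto simp: norm_mult indicator_def)
  qed
  have e1: "(\<integral>x. indicator S x * iexp (t * (x \<bullet> b)) \<partial>\<mu>) = (\<integral>x. indicator S x * iexp (t * (x \<bullet> b)) \<partial>\<nu>)" for t
    using eq[of "t *\<^sub>R b"] by (simp add: inner_commute)
  \<comment> \<open>By Euler's formula, multiplication by the cosine shifts the frequency by u and
    by -u; \<open>eq\<close> is assumed at all frequencies, so the weighted transforms agree as
    well.\<close>
  have c1: "complex_of_real (1 + cos (u \<bullet> x)) * (indicator S x * iexp (t * (x \<bullet> b))) =
    indicator S x * iexp ((t *\<^sub>R b) \<bullet> x) + (indicator S x * iexp ((t *\<^sub>R b + u) \<bullet> x) + indicator S x * iexp ((t *\<^sub>R b - u) \<bullet> x)) / 2" for t x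
  proof -
    have "2 * cos (complex_of_real (u \<bullet> x)) = iexp (u \<bullet> x) + iexp (- (u \<bullet> x))"
      by (simp add: cos_exp_eq)
    then have a: "complex_of_real (cos (u \<bullet> x)) = (iexp (u \<bullet> x) + iexp (- (u \<bullet> x))) / 2"
      by (simp add: cos_of_real eq_divide_eq mult.commute)
    have b: "iexp ((t *\<^sub>R b + u) \<bullet> x) = iexp (t * (x \<bullet> b)) * iexp (u \<bullet> x)"
      "iexp ((t *\<^sub>R b - u) \<bullet> x) = iexp (t * (x \<bullet> b)) * iexp (- (u \<bullet> x))"
      "iexp ((t *\<^sub>R b) \<bullet> x) = iexp (t * (x \<bullet> b))"
      by (simp_all add: inner_add_left inner_diff_left inner_commute algebra_simps flip: exp_add)
    show ?thesis unfolding of_real_add of_real_1 a b by (simp add: algebra_simps add_divide_distrib diff_divide_distrib)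
  qed
  have c2: "complex_of_real (1 + sin (u \<bullet> x)) * (indicator S x * iexp (t * (x \<bullet> b))) =
    indicator S x * iexp ((t *\<^sub>R b) \<bullet> x) + (indicator S x * iexp ((t *\<^sub>R b + u) \<bullet> x) - indicator S x * iexp ((t *\<^sub>R b - u) \<bullet> x)) / (2 * \<i>)" for t x
  proof -
    have "2 * \<i> * sin (complex_of_real (u \<bullet> x)) = iexp (u \<bullet> x) - iexp (- (u \<bullet> x))"
      by (simp add: sin_exp_eq)
    then have a: "complex_of_real (sin (u \<bullet> x)) = (iexp (u \<bullet> x) - iexp (- (u \<bullet> x))) / (2 * \<i>)"
      by (simp add: sin_of_real eq_divide_eq mult.commute)
    have b: "iexp ((t *\<^sub>R b + u) \<bullet> x) = iexp (t * (x \<bullet> b)) * iexp (u \<bullet> x)"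
      "iexp ((t *\<^sub>R b - u) \<bullet> x) = iexp (t * (x \<bullet> b)) * iexp (- (u \<bullet> x))"
      "iexp ((t *\<^sub>R b) \<bullet> x) = iexp (t * (x \<bullet> b))"
      by (simp_all add: inner_add_left inner_diff_left inner_commute algebra_simps flip: exp_add)
    show ?thesis unfolding of_real_add of_real_1 a b by (simp add: algebra_simps add_divide_distrib diff_divide_distrib)
  qed
  note int = I[OF prob(1) sets(1)] I[OF prob(2) sets(2)]
  let ?T = "S \<inter> {x. x \<bullet> b \<in> B}"
  have k0: "(\<integral>x. (1::real) * indicator ?T x \<partial>\<mu>) = (\<integral>x. 1 * indicator ?T x \<partial>\<nu>)" (is "?a\<mu> = ?a\<nu>")
    by (rule key[of "\<lambda>_. 1"]) (use e1 in simp_all)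
  have k1: "(\<integral>x. (1 + cos (u \<bullet> x)) * indicator ?T x \<partial>\<mu>) = (\<integral>x. (1 + cos (u \<bullet> x)) * indicator ?T x \<partial>\<nu>)"
  proof (rule key)
    show "0 \<le> 1 + cos (u \<bullet> x)" "1 + cos (u \<bullet> x) \<le> 2" for x
      using cos_ge_minus_one[of "u \<bullet> x"] cos_le_one[of "u \<bullet> x"] by linarith+
    fix t
    show "(\<integral>x. complex_of_real (1 + cos (u \<bullet> x)) * (indicator S x * iexp (t * (x \<bullet> b))) \<partial>\<mu>) =
        (\<integral>x. complex_of_real (1 + cos (u \<bullet> x)) * (indicator S x * iexp (t * (x \<bullet> b))) \<partial>\<nu>)"
      unfolding c1 using int by (simp add: eq del: of_real_mult inner_scaleR_left)
  qed simp
  have k2: "(\<integral>x. (1 + sin (u \<bullet> x)) * indicator ?T x \<partial>\<mu>) = (\<integral>x. (1 + sin (u \<bullet> x)) * indicator ?T x \<partial>\<nu>)"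
  proof (rule key)
    show "0 \<le> 1 + sin (u \<bullet> x)" "1 + sin (u \<bullet> x) \<le> 2" for x
      using sin_ge_minus_one[of "u \<bullet> x"] sin_le_one[of "u \<bullet> x"] by linarith+
    fix t
    show "(\<integral>x. complex_of_real (1 + sin (u \<bullet> x)) * (indicator S x * iexp (t * (x \<bullet> b))) \<partial>\<mu>) =
        (\<integral>x. complex_of_real (1 + sin (u \<bullet> x)) * (indicator S x * iexp (t * (x \<bullet> b))) \<partial>\<nu>)"
      unfolding c2 using int by (simp add: eq del: of_real_mult inner_scaleR_left)
  qed simp
  \<comment> \<open>The constants 1 made the weights nonnegative. Subtracting the integral of the
    bare indicator leaves cosine and sine, that is, the transform itself.\<close>
  have J: "(\<integral>x. indicator ?T x * iexp (u \<bullet> x) \<partial>\<rho>) =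
    complex_of_real ((\<integral>x. (1 + cos (u \<bullet> x)) * indicator ?T x \<partial>\<rho>) - (\<integral>x. 1 * indicator ?T x \<partial>\<rho>))
    + \<i> * complex_of_real ((\<integral>x. (1 + sin (u \<bullet> x)) * indicator ?T x \<partial>\<rho>) - (\<integral>x. 1 * indicator ?T x \<partial>\<rho>))"
    if "prob_space \<rho>" "sets \<rho> = sets borel" for \<rho> :: "'a measure"
  proof -
    interpret \<rho>: prob_space \<rho> by fact
    have [measurable_cong]: "sets \<rho> = sets borel" by fact
    have i: "integrable \<rho> (\<lambda>x. (1 + cos (u \<bullet> x)) * indicator ?T x)" "integrable \<rho> (\<lambda>x. (1 + sin (u \<bullet> x)) * indicator ?T x)"
       "integrable \<rho> (\<lambda>x. 1 * indicator ?T x :: real)"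
    proof -
      have b: "norm ((1 + cos (u \<bullet> x)) * indicator ?T x) \<le> 2" "norm ((1 + sin (u \<bullet> x)) * indicator ?T x) \<le> 2"
        "norm (1 * indicator ?T x :: real) \<le> 2" for x
        by (auto simp: indicator_def intro!: order_trans[OF abs_triangle_ineq])
      show "integrable \<rho> (\<lambda>x. (1 + cos (u \<bullet> x)) * indicator ?T x)" "integrable \<rho> (\<lambda>x. (1 + sin (u \<bullet> x)) * indicator ?T x)"
       "integrable \<rho> (\<lambda>x. 1 * indicator ?T x :: real)"
        by (rule \<rho>.integrable_const_bound[where B = 2]; use b in auto)+
    qed
    have "indicator ?T x * iexp (u \<bullet> x) = complex_of_real ((1 + cos (u \<bullet> x)) * indicator ?T x - 1 * indicator ?T x)
       + \<i> * complex_of_real ((1 + sin (u \<bullet> x)) * indicator ?T x - 1 * indicator ?T x)" for x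
      by (auto simp: indicator_def cis_conv_exp[symmetric] complex_eq_iff)
    then have "(\<integral>x. indicator ?T x * iexp (u \<bullet> x) \<partial>\<rho>) = (\<integral>x. complex_of_real ((1 + cos (u \<bullet> x)) * indicator ?T x - 1 * indicator ?T x)
       + \<i> * complex_of_real ((1 + sin (u \<bullet> x)) * indicator ?T x - 1 * indicator ?T x) \<partial>\<rho>)" by simp
    also have "\<dots> = complex_of_real (\<integral>x. (1 + cos (u \<bullet> x)) * indicator ?T x - 1 * indicator ?T x \<partial>\<rho>)
       + \<i> * complex_of_real (\<integral>x. (1 + sin (u \<bullet> x)) * indicator ?T x - 1 * indicator ?T x \<partial>\<rho>)"
      using i by (subst Bochner_Integration.integral_add)
        (auto intro!: integrable_mult_right integrable_of_real Bochner_Integration.integrable_diff simp del: of_real_diff of_real_mult)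
    also have "\<dots> = complex_of_real ((\<integral>x. (1 + cos (u \<bullet> x)) * indicator ?T x \<partial>\<rho>) - (\<integral>x. 1 * indicator ?T x \<partial>\<rho>))
    + \<i> * complex_of_real ((\<integral>x. (1 + sin (u \<bullet> x)) * indicator ?T x \<partial>\<rho>) - (\<integral>x. 1 * indicator ?T x \<partial>\<rho>))"
      using i by (subst (1 2) Bochner_Integration.integral_diff) auto
    finally show ?thesis .
  qed
  show ?thesis unfolding J[OF prob(1) sets(1)] J[OF prob(2) sets(2)] k0 k1 k2 ..
qed

text \<open>Coordinates are added to the box one at a time while the frequency v stays arbitrary, as
  the next step needs it. At v = 0 the masses of all open boxes agree, and these form an
  intersection-stable generator.\<close>

theorem char_fun_unique:
  fixes \<mu> \<nu> :: "'a::euclidean_space measure"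
  assumes prob: "prob_space \<mu>" "prob_space \<nu>" and sets: "sets \<mu> = sets borel" "sets \<nu> = sets borel"
    and eq: "\<And>u. char_fun \<mu> u = char_fun \<nu> u"
  shows "\<mu> = \<nu>"
proof -
  interpret \<mu>: prob_space \<mu> by fact
  interpret \<nu>: prob_space \<nu> by fact
  have boxes: "(\<integral>x. indicator {x. \<forall>b\<in>J. l \<bullet> b < x \<bullet> b \<and> x \<bullet> b < u \<bullet> b} x * iexp (v \<bullet> x) \<partial>\<mu>) =
     (\<integral>x. indicator {x. \<forall>b\<in>J. l \<bullet> b < x \<bullet> b \<and> x \<bullet> b < u \<bullet> b} x * iexp (v \<bullet> x) \<partial>\<nu>)"
    if "finite J" for J l u v
    using that
  proof (induction J arbitrary: v)
    case empty
    then show ?case using eq[of v] by (simp add: char_fun_def)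
  next
    case (insert b J)
    have *: "{x. \<forall>b\<in>insert b J. l \<bullet> b < x \<bullet> b \<and> x \<bullet> b < u \<bullet> b} =
      {x. \<forall>b\<in>J. l \<bullet> b < x \<bullet> b \<and> x \<bullet> b < u \<bullet> b} \<inter> {x. x \<bullet> b \<in> {l \<bullet> b <..< u \<bullet> b}}" by auto
    have "{x. \<forall>b\<in>J. l \<bullet> b < x \<bullet> b \<and> x \<bullet> b < u \<bullet> b} \<in> sets borel"
    proof -
      have "{x. \<forall>b\<in>J. l \<bullet> b < x \<bullet> b \<and> x \<bullet> b < u \<bullet> b} = (\<Inter>b\<in>J. {x. l \<bullet> b < x \<bullet> b \<and> x \<bullet> b < u \<bullet> b})" by auto
      also have "\<dots> \<in> sets borel"
        using insert(1) by (intro borel_open open_INT ballI open_Collect_conj open_Collect_less continuous_intros)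
      finally show ?thesis .
    qed
    then show ?case unfolding * by (intro char_fun_step prob sets insert) (simp_all add: open_greaterThanLessThan)
  qed
  have box: "emeasure \<mu> (box l u) = emeasure \<nu> (box l u)" for l u
  proof -
    have b: "box l u = {x. \<forall>b\<in>Basis. l \<bullet> b < x \<bullet> b \<and> x \<bullet> b < u \<bullet> b}" by (auto simp: box_def)
    have "(\<lambda>x. indicator (box l u) x * iexp (0 \<bullet> x)) = (\<lambda>x. complex_of_real (indicator (box l u) x))"
      by (auto simp: indicator_def)
    with boxes[OF finite_Basis, of l u 0]
    have "(\<integral>x. complex_of_real (indicator (box l u) x) \<partial>\<mu>) = (\<integral>x. complex_of_real (indicator (box l u) x) \<partial>\<nu>)"
      unfolding b[symmetric] by (simp only:)
    moreover have "space \<mu> = UNIV" "space \<nu> = UNIV"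
      using sets_eq_imp_space_eq[OF sets(1)] sets_eq_imp_space_eq[OF sets(2)] by simp_all
    ultimately have "measure \<mu> (box l u) = measure \<nu> (box l u)"
      using sets by (simp add: integral_complex_of_real del: of_real_indicator)
    then show ?thesis by (simp add: \<mu>.emeasure_eq_measure \<nu>.emeasure_eq_measure)
  qed
  show ?thesis
  proof (rule measure_eqI_generator_eq)
    let ?E = "range (\<lambda>(a, b). box a b::'a set)"
    show "Int_stable ?E" by (auto simp: Int_stable_def box_Int_box)
    show "?E \<subseteq> Pow UNIV" "sets \<mu> = sigma_sets UNIV ?E" "sets \<nu> = sigma_sets UNIV ?E"
      by (simp_all add: borel_eq_box sets)
    let ?A = "\<lambda>n::nat. box (- (real n *\<^sub>R One)) (real n *\<^sub>R One) :: 'a set"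
    show "range ?A \<subseteq> ?E" "(\<Union>i. ?A i) = UNIV" unfolding UN_box_eq_UNIV by auto
    show "emeasure \<mu> (?A i) \<noteq> \<infinity>" for i by simp
    show "emeasure \<mu> X = emeasure \<nu> X" if "X \<in> ?E" for X using that box by auto
  qed
qed

section \<open>Generalized polar coordinates\<close>

lemma scalar_mpow_powr_bounded_Icc:
  fixes A :: "real^'n^'n"
  assumes "0 < l"
  shows "\<exists>K>0. \<forall>c. l \<le> c \<and> c \<le> u \<longrightarrow> norm (scalar_mpow c A) \<le> K * c powr a"
proof -
  have "continuous_on {l..u} (\<lambda>c. scalar_mpow c A /\<^sub>R c powr a)"
    using assms by (intro continuous_intros continuous_on_subset[OF continuous_on_scalar_mpow]) auto
  then have "compact ((\<lambda>c. scalar_mpow c A /\<^sub>R c powr a) ` {l..u})"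
    by (intro compact_continuous_image) auto
  then obtain K where K: "K > 0" "\<And>c. c \<in> {l..u} \<Longrightarrow> norm (scalar_mpow c A /\<^sub>R c powr a) \<le> K"
    by (force dest!: compact_imp_bounded simp: bounded_pos)
  then have "\<forall>c. l \<le> c \<and> c \<le> u \<longrightarrow> norm (scalar_mpow c A) \<le> K * c powr a"
    using assms by (force simp: field_simps)
  with K(1) show ?thesis by blast
qed

lemma scalar_mpow_growth_Ioc:
  fixes A :: "real^'n^'n"
  assumes "\<And>z. z \<in> complex_eigenvalues A \<Longrightarrow> a < Re z"
  shows "\<exists>K>0. \<forall>c. 0 < c \<and> c \<le> R \<longrightarrow> norm (scalar_mpow c A) \<le> K * c powr a"
proof -
  obtain K1 where K1: "K1 > 0" "\<And>c. 0 < c \<Longrightarrow> c \<le> 1 \<Longrightarrow> norm (scalar_mpow c A) \<le> K1 * c powr a"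
    using scalar_mpow_growth_at_0[OF assms] by blast
  obtain K2 where K2: "K2 > 0" "\<And>c. 1 \<le> c \<Longrightarrow> c \<le> R \<Longrightarrow> norm (scalar_mpow c A) \<le> K2 * c powr a"
    using scalar_mpow_powr_bounded_Icc[of 1 R A a] by auto
  have "norm (scalar_mpow c A) \<le> max K1 K2 * c powr a" if "0 < c" "c \<le> R" for c
  proof (cases "c \<le> 1")
    case True
    show ?thesis by (rule order_trans[OF K1(2)]) (use True that in \<open>auto intro: mult_right_mono\<close>)
  next
    case False
    show ?thesis by (rule order_trans[OF K2(2)]) (use False that in \<open>auto intro: mult_right_mono\<close>)
  qed
  then show ?thesis using K1(1) by (intro exI[of _ "max K1 K2"]) auto
qed

lemma scalar_mpow_growth_Ici:
  fixes A :: "real^'n^'n"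
  assumes "\<And>z. z \<in> complex_eigenvalues A \<Longrightarrow> Re z < a" and R: "0 < R"
  shows "\<exists>K>0. \<forall>c\<ge>R. norm (scalar_mpow c A) \<le> K * c powr a"
proof -
  obtain K1 where K1: "K1 > 0" "\<And>c. 1 \<le> c \<Longrightarrow> norm (scalar_mpow c A) \<le> K1 * c powr a"
    using scalar_mpow_growth_at_top[OF assms(1)] by blast
  obtain K2 where K2: "K2 > 0" "\<And>c. R \<le> c \<Longrightarrow> c \<le> 1 \<Longrightarrow> norm (scalar_mpow c A) \<le> K2 * c powr a"
    using scalar_mpow_powr_bounded_Icc[OF R, of 1 A a] by auto
  have "norm (scalar_mpow c A) \<le> max K1 K2 * c powr a" if "R \<le> c" for c
  proof (cases "1 \<le> c")
    case True
    show ?thesis by (rule order_trans[OF K1(2)]) (use True that in \<open>auto intro: mult_right_mono\<close>)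
  next
    case False
    show ?thesis by (rule order_trans[OF K2(2)]) (use False that in \<open>auto intro: mult_right_mono\<close>)
  qed
  then show ?thesis using K1(1) by (intro exI[of _ "max K1 K2"]) auto
qed

text \<open>Finitely many positive real parts have a positive minimum; halving it makes the bound
  strict.\<close>

lemma pos_spectrum_lower_bound:
  fixes A :: "real^'n^'n"
  assumes "A \<in> pos_spectrum"
  shows "\<exists>a>0. \<forall>z\<in>complex_eigenvalues A. a < Re z"
proof (cases "complex_eigenvalues A = {}")
  case False
  let ?m = "Min (Re ` complex_eigenvalues A)"
  have fin: "finite (Re ` complex_eigenvalues A)" using finite_complex_eigenvalues by blast
  then have "?m \<in> Re ` complex_eigenvalues A" using False by (intro Min_in) auto
  then have "0 < ?m" using assms by (auto simp: pos_spectrum_def)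
  moreover have "?m \<le> Re z" if "z \<in> complex_eigenvalues A" for z using fin that by (intro Min_le) auto
  ultimately show ?thesis by (intro exI[of _ "?m / 2"]) force
qed (auto intro: exI[of _ 1])

locale polar_coordinates =
  fixes E :: "real^'n^'n" and N :: "real^'n \<Rightarrow> real"
  assumes E: "E \<in> pos_spectrum" and N: "polar_norm E N"
begin

abbreviation pw :: "real \<Rightarrow> real^'n^'n" where "pw c \<equiv> scalar_mpow c E"
abbreviation \<tau> :: "real^'n \<Rightarrow> real" where "\<tau> \<equiv> polar_radius E N"

lemma N_ge_0: "0 \<le> N x" and N_eq_0: "N x = 0 \<longleftrightarrow> x = 0" and N_scale: "N (a *\<^sub>R x) = \<bar>a\<bar> * N x"
  and N_add: "N (x + y) \<le> N x + N y"
  using N by (auto simp: polar_norm_def is_norm_def)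

lemma N_0 [simp]: "N 0 = 0" using N_eq_0 by blast

lemma homeo: "\<exists>g. homeomorphism ({0<..} \<times> {\<theta>. N \<theta> = 1}) (UNIV - {0}) (\<lambda>(c, \<theta>). pw c *v \<theta>) g"
  using N by (auto simp: polar_norm_def)

lemma polar_inj:
  assumes "0 < c" "0 < d" "N \<theta> = 1" "N \<eta> = 1" "pw c *v \<theta> = pw d *v \<eta>"
  shows "c = d" "\<theta> = \<eta>"
proof -
  obtain g where g: "homeomorphism ({0<..} \<times> {\<theta>. N \<theta> = 1}) (UNIV - {0}) (\<lambda>(c, \<theta>). pw c *v \<theta>) g"
    using homeo by blast
  have "g (pw c *v \<theta>) = (c, \<theta>)" "g (pw d *v \<eta>) = (d, \<eta>)"
    using assms(1-4) homeomorphism_apply1[OF g, of "(c, \<theta>)"] homeomorphism_apply1[OF g, of "(d, \<eta>)"] by simp_all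
  then have "(c, \<theta>) = (d, \<eta>)" unfolding assms(5) by (rule trans[OF sym])
  then show "c = d" "\<theta> = \<eta>" by simp_all
qed

lemma polar_ex: "x \<noteq> 0 \<Longrightarrow> \<exists>c \<theta>. 0 < c \<and> N \<theta> = 1 \<and> x = pw c *v \<theta>"
proof -
  assume x: "x \<noteq> 0"
  obtain g where g: "homeomorphism ({0<..} \<times> {\<theta>. N \<theta> = 1}) (UNIV - {0}) (\<lambda>(c, \<theta>). pw c *v \<theta>) g"
    using homeo by blast
  have "x \<in> (\<lambda>(c, \<theta>). pw c *v \<theta>) ` ({0<..} \<times> {\<theta>. N \<theta> = 1})"
    using homeomorphism_image1[OF g] x by simp
  then show ?thesis by auto
qed

lemma \<tau>_0 [simp]: "\<tau> 0 = 0" by (simp add: polar_radius_def)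

lemma polar_nonzero: assumes "0 < c" "N \<theta> = 1" shows "pw c *v \<theta> \<noteq> 0"
proof
  assume "pw c *v \<theta> = 0"
  then have "pw (1 / c) *v (pw c *v \<theta>) = 0" by simp
  then have "\<theta> = 0" using assms by (simp add: matrix_vector_mul_assoc scalar_mpow_inverse_left)
  with assms N_eq_0 show False by auto
qed

lemma \<tau>_eq: assumes "0 < c" "N \<theta> = 1" shows "\<tau> (pw c *v \<theta>) = c"
proof -
  have "(THE c'. 0 < c' \<and> (\<exists>\<eta>. N \<eta> = 1 \<and> pw c *v \<theta> = pw c' *v \<eta>)) = c"
    using assms polar_inj(1) by (intro the_equality) blast+
  then show ?thesis using polar_nonzero[OF assms] by (simp add: polar_radius_def)
qed

lemma \<tau>_pos: "x \<noteq> 0 \<Longrightarrow> 0 < \<tau> x"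
  using polar_ex \<tau>_eq by metis

lemma \<tau>_ge_0: "0 \<le> \<tau> x"
  using \<tau>_pos[of x] by (cases "x = 0") auto

lemma \<tau>_decomp: assumes "x \<noteq> 0" obtains \<theta> where "N \<theta> = 1" "x = pw (\<tau> x) *v \<theta>" "\<theta> = pw (1 / \<tau> x) *v x"
proof -
  obtain c \<theta> where c: "0 < c" "N \<theta> = 1" and x: "x = pw c *v \<theta>" using polar_ex[OF assms] by blast
  have "\<tau> x = c" unfolding x using c by (rule \<tau>_eq)
  moreover have "\<theta> = pw (1 / c) *v x"
    unfolding x matrix_vector_mul_assoc scalar_mpow_inverse_left[OF c(1)] by simp
  ultimately show ?thesis using that[of \<theta>] c(2) x by metis
qed

lemma \<tau>_scale: assumes "0 < c" shows "\<tau> (pw c *v x) = c * \<tau> x"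
proof (cases "x = 0")
  case False
  then obtain \<theta> where \<theta>: "N \<theta> = 1" "x = pw (\<tau> x) *v \<theta>" using \<tau>_decomp by blast
  have "pw c *v x = pw (c * \<tau> x) *v \<theta>"
    using \<tau>_pos[OF False] assms
    by (subst \<theta>(2)) (simp only: scalar_mpow_mult matrix_vector_mul_assoc)
  then show ?thesis using \<tau>_eq[of "c * \<tau> x" \<theta>] \<theta>(1) \<tau>_pos[OF False] assms by simp
qed simp

lemma continuous_on_\<tau>: "continuous_on (UNIV - {0}) \<tau>"
proof -
  obtain g where g: "homeomorphism ({0<..} \<times> {\<theta>. N \<theta> = 1}) (UNIV - {0}) (\<lambda>(c, \<theta>). pw c *v \<theta>) g"
    using homeo by blast
  have "continuous_on (UNIV - {0}) (\<lambda>x. fst (g x))"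
    using g by (intro continuous_on_fst) (simp add: homeomorphism_def)
  moreover have "fst (g x) = \<tau> x" if "x \<noteq> 0" for x
  proof -
    obtain c \<theta> where c: "0 < c" "N \<theta> = 1" "x = pw c *v \<theta>" using polar_ex[OF \<open>x \<noteq> 0\<close>] by blast
    then have "g x = (c, \<theta>)" using homeomorphism_apply1[OF g, of "(c, \<theta>)"] by auto
    then show ?thesis using c \<tau>_eq by simp
  qed
  ultimately show ?thesis by (rule continuous_on_eq) simp
qed

lemma borel_measurable_\<tau> [measurable]: "\<tau> \<in> borel_measurable borel"
proof -
  have "(\<lambda>x. if x \<in> UNIV - {0} then \<tau> x else 0) \<in> borel_measurable borel"
    by (rule borel_measurable_continuous_on_if) (auto intro: continuous_on_\<tau>)
  also have "(\<lambda>x. if x \<in> UNIV - {0} then \<tau> x else 0) = \<tau>" by auto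
  finally show ?thesis .
qed

lemma N_bound: "\<exists>K>0. \<forall>x. N x \<le> K * norm x"
proof -
  have sum: "N (sum f I) \<le> (\<Sum>i\<in>I. N (f i))" if "finite I" for f and I :: "'n set"
    using that by (induction I) (auto simp: N_eq_0 intro: order_trans[OF N_add])
  have "N x \<le> ((\<Sum>i\<in>UNIV. N (axis i 1)) + 1) * norm x" for x
  proof -
    have "N x = N (\<Sum>i\<in>UNIV. x $ i *\<^sub>R axis i 1)" by (simp add: basis_expansion scalar_mult_eq_scaleR[symmetric])
    also have "\<dots> \<le> (\<Sum>i\<in>UNIV. N (x $ i *\<^sub>R axis i 1))" by (rule sum) simp
    also have "\<dots> \<le> (\<Sum>i\<in>UNIV. norm x * N (axis i 1))"
      by (intro sum_mono) (auto simp: N_scale N_ge_0 component_le_norm_cart intro!: mult_right_mono)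
    also have "\<dots> = (\<Sum>i\<in>UNIV. N (axis i 1)) * norm x" by (simp add: sum_distrib_left mult.commute)
    also have "\<dots> \<le> ((\<Sum>i\<in>UNIV. N (axis i 1)) + 1) * norm x" by (intro mult_right_mono) auto
    finally show ?thesis .
  qed
  moreover have "0 < (\<Sum>i\<in>UNIV. N (axis i 1)) + 1" by (intro add_nonneg_pos sum_nonneg N_ge_0) simp
  ultimately show ?thesis by blast
qed

lemma continuous_on_N: "continuous_on A N"
proof -
  obtain K where K: "K > 0" "\<And>x. N x \<le> K * norm x" using N_bound by blast
  have "\<bar>N x - N y\<bar> \<le> K * norm (x - y)" for x y
    using N_add[of "x - y" y] N_add[of "y - x" x] K(2)[of "x - y"] K(2)[of "y - x"]
    by (simp add: norm_minus_commute)
  then have "K-lipschitz_on A N" using K(1) by (intro lipschitz_onI) (auto simp: dist_real_def dist_norm)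
  then show ?thesis by (rule lipschitz_on_continuous_on)
qed

text \<open>Equivalence of norms: N is Lipschitz by expansion in the standard basis, hence attains a
  minimum on the Euclidean unit sphere, and this minimum is positive.\<close>

lemma unit_bounds: "\<exists>m>0. \<exists>M>0. \<forall>\<theta>. N \<theta> = 1 \<longrightarrow> m \<le> norm \<theta> \<and> norm \<theta> \<le> M"
proof -
  obtain K where K: "K > 0" "\<And>x. N x \<le> K * norm x" using N_bound by blast
  have "sphere 0 1 \<noteq> ({} :: (real^'n) set)" by simp
  from continuous_attains_inf[OF compact_sphere this continuous_on_N]
  obtain x0 :: "real^'n" where x0: "norm x0 = 1" "\<And>x. norm x = 1 \<Longrightarrow> N x0 \<le> N x" by auto
  have pos: "0 < N x0" using N_ge_0[of x0] N_eq_0[of x0] x0(1) by (auto simp: less_le)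
  have "N x0 * norm x \<le> N x" for x
  proof (cases "x = 0")
    case False
    have "N x0 \<le> N ((1 / norm x) *\<^sub>R x)" using False by (intro x0(2)) simp
    with False show ?thesis by (simp add: N_scale field_simps)
  qed (simp add: N_eq_0)
  then have "norm \<theta> \<le> 1 / N x0" if "N \<theta> = 1" for \<theta> using pos that by (metis mult.commute pos_le_divide_eq)
  moreover have "1 / K \<le> norm \<theta>" if "N \<theta> = 1" for \<theta> using K that by (metis divide_le_eq mult.commute)
  ultimately show ?thesis using K(1) pos by (intro exI[of _ "1 / K"] exI[of _ "1 / N x0"] conjI) auto
qed

lemma compact_unit: "compact {\<theta>. N \<theta> = 1}" and unit_nonempty: "{\<theta>. N \<theta> = 1} \<noteq> {}"
proof -
  obtain M where "\<And>\<theta>. N \<theta> = 1 \<Longrightarrow> norm \<theta> \<le> M" using unit_bounds by blast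
  then have "bounded {\<theta>. N \<theta> = 1}" by (auto simp: bounded_iff)
  moreover have "closed {\<theta>. N \<theta> = 1}"
    by (intro closed_Collect_eq continuous_on_N continuous_on_const)
  ultimately show "compact {\<theta>. N \<theta> = 1}" by (simp add: compact_eq_bounded_closed)
  have "axis undefined 1 \<noteq> (0 :: real^'n)" by (simp add: axis_eq_0_iff)
  then show "{\<theta>. N \<theta> = 1} \<noteq> {}" using polar_ex by blast
qed

lemma pw_bound: "\<exists>a>0. \<forall>R. \<exists>K>0. \<forall>c. 0 < c \<and> c \<le> R \<longrightarrow> norm (pw c) \<le> K * c powr a"
  using pos_spectrum_lower_bound[OF E] scalar_mpow_growth_Ioc[of E] by metis

text \<open>Polar decomposition with a unit vector of bounded length and the bound on the powers of
  E. The exponent comes before the radius R in the quantifiers, since only the constant K depends on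
  R.\<close>

lemma norm_le_\<tau>: "\<exists>a>0. \<forall>R. \<exists>K>0. \<forall>x. \<tau> x \<le> R \<longrightarrow> norm x \<le> K * \<tau> x powr a"
proof -
  obtain a where a: "a > 0" "\<And>R. \<exists>K>0. \<forall>c. 0 < c \<and> c \<le> R \<longrightarrow> norm (pw c) \<le> K * c powr a"
    using pw_bound by blast
  obtain M where M: "M > 0" "\<And>\<theta>. N \<theta> = 1 \<Longrightarrow> norm \<theta> \<le> M" using unit_bounds by blast
  have "\<exists>K>0. \<forall>x. \<tau> x \<le> R \<longrightarrow> norm x \<le> K * \<tau> x powr a" for R
  proof -
    obtain K where K: "K > 0" "\<And>c. 0 < c \<Longrightarrow> c \<le> R \<Longrightarrow> norm (pw c) \<le> K * c powr a" using a(2)[of R] by blast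
    have "norm x \<le> (K * M) * \<tau> x powr a" if "\<tau> x \<le> R" for x
    proof (cases "x = 0")
      case False
      then obtain \<theta> where \<theta>: "N \<theta> = 1" "x = pw (\<tau> x) *v \<theta>" using \<tau>_decomp by blast
      have "norm x \<le> norm (pw (\<tau> x)) * norm \<theta>" by (subst \<theta>(2)) (rule norm_matrix_vector_mult_le)
      also have "\<dots> \<le> (K * \<tau> x powr a) * M"
        using K \<tau>_pos[OF False] that M \<theta>(1) by (intro mult_mono) auto
      finally show ?thesis by (simp add: mult_ac)
    qed simp
    then show ?thesis using K M by (intro exI[of _ "K * M"]) auto
  qed
  with a(1) show ?thesis by blast
qed

lemma bounded_\<tau>_le: "\<exists>K. \<forall>x. \<tau> x \<le> R \<longrightarrow> norm x \<le> K"
proof -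
  obtain a K where a: "a > 0" and K: "K > 0" "\<And>x. \<tau> x \<le> R \<Longrightarrow> norm x \<le> K * \<tau> x powr a" using norm_le_\<tau> by blast
  have "norm x \<le> K * R powr a" if "\<tau> x \<le> R" for x
    by (rule order_trans[OF K(2)[OF that]]) (use K that a in \<open>auto intro!: mult_left_mono powr_mono2 \<tau>_ge_0\<close>)
  then show ?thesis by blast
qed

text \<open>The unit vector belonging to x is the power 1/\<tau> x of E applied to x, and 1/\<tau> x
  stays below 1/\<epsilon>; a small x would thus give a unit vector that is too short.\<close>

lemma \<tau>_ge_imp_norm_ge: assumes "0 < \<epsilon>" shows "\<exists>\<delta>>0. \<forall>x. \<epsilon> \<le> \<tau> x \<longrightarrow> \<delta> \<le> norm x"
proof -
  obtain a K where a: "a > 0" and K: "K > 0" "\<And>c. 0 < c \<Longrightarrow> c \<le> 1 / \<epsilon> \<Longrightarrow> norm (pw c) \<le> K * c powr a" using pw_bound by blast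
  obtain m where m: "m > 0" "\<And>\<theta>. N \<theta> = 1 \<Longrightarrow> m \<le> norm \<theta>" using unit_bounds by blast
  let ?K = "K * (1 / \<epsilon>) powr a"
  have "m / ?K \<le> norm x" if x: "\<epsilon> \<le> \<tau> x" for x
  proof -
    have "x \<noteq> 0" using x assms by auto
    then obtain \<theta> where \<theta>: "N \<theta> = 1" "\<theta> = pw (1 / \<tau> x) *v x" using \<tau>_decomp by blast
    have "m \<le> norm \<theta>" using m \<theta> by blast
    also have "\<dots> \<le> norm (pw (1 / \<tau> x)) * norm x" by (subst \<theta>(2)) (rule norm_matrix_vector_mult_le)
    also have "\<dots> \<le> ?K * norm x"
    proof (rule mult_right_mono)
      have "norm (pw (1 / \<tau> x)) \<le> K * (1 / \<tau> x) powr a"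
        using x assms by (intro K(2)) (auto simp: field_simps)
      also have "\<dots> \<le> ?K" using x assms K a by (intro mult_left_mono powr_mono2) (auto simp: field_simps)
      finally show "norm (pw (1 / \<tau> x)) \<le> ?K" .
    qed simp
    finally show ?thesis using K assms by (simp add: field_simps)
  qed
  moreover have "0 < m / ?K" using m K assms by simp
  ultimately show ?thesis by blast
qed

lemma \<tau>_small: "0 < \<epsilon> \<Longrightarrow> \<exists>\<delta>>0. \<forall>x. norm x < \<delta> \<longrightarrow> \<tau> x < \<epsilon>"
  using \<tau>_ge_imp_norm_ge by (metis not_less)

lemma norm_ge_imp_\<tau>_ge: assumes "0 < \<delta>" shows "\<exists>c>0. \<forall>x. \<delta> \<le> norm x \<longrightarrow> c \<le> \<tau> x"
proof -
  obtain a K where a: "a > 0" and K: "K > 0" "\<And>x. \<tau> x \<le> 1 \<Longrightarrow> norm x \<le> K * \<tau> x powr a" using norm_le_\<tau> by blast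
  \<comment> \<open>The second entry solves K c^a = \<delta>/2; the first keeps \<tau> in the range
    where the bound with constant K is available.\<close>
  let ?c = "min 1 ((\<delta> / (2 * K)) powr (1 / a))"
  have "?c \<le> \<tau> x" if x: "\<delta> \<le> norm x" for x
  proof (rule ccontr)
    assume "\<not> ?c \<le> \<tau> x"
    then have "\<tau> x \<le> 1" "\<tau> x < (\<delta> / (2 * K)) powr (1 / a)" by auto
    then have "\<tau> x powr a \<le> ((\<delta> / (2 * K)) powr (1 / a)) powr a"
      using a by (intro powr_mono2 \<tau>_ge_0) auto
    also have "\<dots> = \<delta> / (2 * K)" using a assms K by (simp add: powr_powr)
    finally have "K * \<tau> x powr a \<le> \<delta> / 2" using K by (simp add: field_simps)
    with K(2)[OF \<open>\<tau> x \<le> 1\<close>] x assms show False by simp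
  qed
  moreover have "0 < ?c" using assms K by simp
  ultimately show ?thesis by blast
qed

text \<open>Continuity of \<tau> is available away from 0 only, so compactness serves on an annulus
  and smallness of \<tau> inside it.\<close>

lemma \<tau>_bounded: "\<exists>r>0. \<forall>x. norm x \<le> R \<longrightarrow> \<tau> x \<le> r"
proof -
  obtain \<delta> where \<delta>: "\<delta> > 0" "\<And>x. norm x < \<delta> \<Longrightarrow> \<tau> x < 1" using \<tau>_small[of 1] by auto
  have "compact (\<tau> ` {x. \<delta> \<le> norm x \<and> norm x \<le> R})"
  proof (rule compact_continuous_image)
    show "continuous_on {x. \<delta> \<le> norm x \<and> norm x \<le> R} \<tau>"
      by (rule continuous_on_subset[OF continuous_on_\<tau>]) (use \<delta> in auto)
    have "closed ({x. \<delta> \<le> norm x} \<inter> cball (0::real^'n) R)"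
      by (intro closed_Int closed_Collect_le continuous_intros closed_cball)
    then have "compact ({x. \<delta> \<le> norm x} \<inter> cball (0::real^'n) R)"
      by (simp add: compact_eq_bounded_closed bounded_Int)
    also have "{x. \<delta> \<le> norm x} \<inter> cball (0::real^'n) R = {x. \<delta> \<le> norm x \<and> norm x \<le> R}" by auto
    finally show "compact {x::real^'n. \<delta> \<le> norm x \<and> norm x \<le> R}" .
  qed
  then obtain r where r: "r > 0" "\<And>x. \<delta> \<le> norm x \<Longrightarrow> norm x \<le> R \<Longrightarrow> \<tau> x \<le> r"
    by (force dest!: compact_imp_bounded simp: bounded_pos)
  have "\<tau> x \<le> max r 1" if "norm x \<le> R" for x
    using r(2)[of x] \<delta>(2)[of x] that by (cases "norm x < \<delta>") auto
  then show ?thesis by (intro exI[of _ "max r 1"]) auto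
qed

text \<open>The power c of E maps the unit shell onto the shell at c, because \<tau> is multiplied
  by c, and its determinant is c to the power \<open>trace E\<close>.\<close>

lemma emeasure_shell:
  assumes "0 < c"
  shows "emeasure lborel {x. c \<le> \<tau> x \<and> \<tau> x < 2 * c} = ennreal (c powr trace E) * emeasure lborel {x. 1 \<le> \<tau> x \<and> \<tau> x < 2}"
proof -
  have "det (pw c) \<noteq> 0" using assms by (simp add: det_scalar_mpow)
  have *: "c \<le> \<tau> (pw c *v x) \<and> \<tau> (pw c *v x) < 2 * c \<longleftrightarrow> 1 \<le> \<tau> x \<and> \<tau> x < 2" for x
    using assms by (auto simp: \<tau>_scale)
  have "emeasure lborel {x. c \<le> \<tau> x \<and> \<tau> x < 2 * c} = (\<integral>\<^sup>+x. indicator {x. c \<le> \<tau> x \<and> \<tau> x < 2 * c} x \<partial>lborel)" by simp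
  also have "\<dots> = ennreal \<bar>det (pw c)\<bar> * (\<integral>\<^sup>+x. indicator {x. c \<le> \<tau> x \<and> \<tau> x < 2 * c} (pw c *v x) \<partial>lborel)"
    by (rule nn_integral_lborel_linear) (fact, measurable)
  also have "(\<integral>\<^sup>+x. indicator {x. c \<le> \<tau> x \<and> \<tau> x < 2 * c} (pw c *v x) \<partial>lborel) = (\<integral>\<^sup>+x. indicator {x. 1 \<le> \<tau> x \<and> \<tau> x < 2} x \<partial>lborel)"
    by (intro nn_integral_cong) (auto simp: indicator_def *)
  finally show ?thesis using assms by (simp add: det_scalar_mpow)
qed

lemma emeasure_unit_shell: "emeasure lborel {x. 1 \<le> \<tau> x \<and> \<tau> x < 2} < \<infinity>"
proof -
  obtain K where "\<And>x. \<tau> x \<le> 2 \<Longrightarrow> norm x \<le> K" using bounded_\<tau>_le by blast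
  then have "bounded {x. 1 \<le> \<tau> x \<and> \<tau> x < 2}" by (auto simp: bounded_iff intro!: exI[of _ K])
  then show ?thesis by (rule emeasure_bounded_finite)
qed

text \<open>On the shell at R b^k the integrand is comparable to (R b^k)^p and the volume to (R
  b^k)^(trace E), so a geometric series with ratio b^(p + trace E) bounds the integral. The shells
  only have to cover X; b = 1/2 serves near the origin and b = 2 far away.\<close>

lemma nn_integral_shells:
  assumes b: "0 < b" "b powr (p + trace E) < 1" and R: "0 < R"
    and X: "\<And>x. x \<in> X \<Longrightarrow> \<exists>k::nat. R * b ^ k \<le> \<tau> x \<and> \<tau> x < 2 * (R * b ^ k)"
  shows "(\<integral>\<^sup>+x. ennreal (\<tau> x powr p) * indicator X x \<partial>lborel) < \<infinity>"
proof -
  let ?S = "\<lambda>k::nat. {x. R * b ^ k \<le> \<tau> x \<and> \<tau> x < 2 * (R * b ^ k)}"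
  \<comment> \<open>Within a shell \<tau> varies by a factor of at most 2, and
    \<open>2 powr \<bar>p\<bar>\<close> pays for this variation for either sign of p.\<close>
  let ?C = "\<lambda>k::nat. 2 powr \<bar>p\<bar> * (R * b ^ k) powr p"
  have Rb: "0 < R * b ^ k" for k using b R by simp
  have "(\<integral>\<^sup>+x. ennreal (\<tau> x powr p) * indicator X x \<partial>lborel) \<le> (\<integral>\<^sup>+x. (\<Sum>k. ennreal (?C k) * indicator (?S k) x) \<partial>lborel)"
  proof (rule nn_integral_mono)
    fix x :: "real^'n"
    show "ennreal (\<tau> x powr p) * indicator X x \<le> (\<Sum>k. ennreal (?C k) * indicator (?S k) x)"
    proof (cases "x \<in> X")
      case True
      then obtain k where k: "R * b ^ k \<le> \<tau> x" "\<tau> x < 2 * (R * b ^ k)" using X by blast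
      have "\<tau> x powr p \<le> ?C k"
      proof (cases "0 \<le> p")
        case True
        have "\<tau> x powr p \<le> (2 * (R * b ^ k)) powr p" using k True by (intro powr_mono2 \<tau>_ge_0) auto
        also have "\<dots> = ?C k" using True Rb[of k] by (simp add: powr_mult)
        finally show ?thesis .
      next
        case False
        have "\<tau> x powr p \<le> (R * b ^ k) powr p" using k False Rb[of k] by (intro powr_mono2') auto
        also have "\<dots> \<le> ?C k" using mult_right_mono[of 1 "2 powr \<bar>p\<bar>" "(R * b ^ k) powr p"] ge_one_powr_ge_zero[of 2 "\<bar>p\<bar>"] by simp
        finally show ?thesis .
      qed
      then have "ennreal (\<tau> x powr p) * indicator X x \<le> ennreal (?C k) * indicator (?S k) x"
        using k True by (simp add: ennreal_leI)
      also have "f k \<le> suminf f" for f :: "nat \<Rightarrow> ennreal" using sum_le_suminf[of f "{k}"] by simp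
      then have "ennreal (?C k) * indicator (?S k) x \<le> (\<Sum>k. ennreal (?C k) * indicator (?S k) x)" .
      finally show ?thesis .
    qed simp
  qed
  also have "\<dots> = (\<Sum>k. ennreal (?C k) * emeasure lborel (?S k))"
    by (simp add: nn_integral_suminf nn_integral_cmult_indicator)
  also have "\<dots> = (\<Sum>k. ennreal (2 powr \<bar>p\<bar> * R powr (p + trace E) * (b powr (p + trace E)) ^ k) * emeasure lborel {x. 1 \<le> \<tau> x \<and> \<tau> x < 2})"
  proof (intro suminf_cong)
    fix k
    have "?C k * (R * b ^ k) powr trace E = 2 powr \<bar>p\<bar> * (R * b ^ k) powr (p + trace E)"
      by (simp add: powr_add)
    also have "(R * b ^ k) powr (p + trace E) = R powr (p + trace E) * (b powr (p + trace E)) ^ k"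
      using b R by (simp add: powr_mult powr_power powr_powr mult.commute flip: powr_realpow)
    finally show "ennreal (?C k) * emeasure lborel (?S k) = ennreal (2 powr \<bar>p\<bar> * R powr (p + trace E) * (b powr (p + trace E)) ^ k) * emeasure lborel {x. 1 \<le> \<tau> x \<and> \<tau> x < 2}"
      by (simp add: emeasure_shell[OF Rb] mult.assoc ennreal_mult'[symmetric] flip: mult.assoc[of "ennreal _"])
  qed
  also have "\<dots> = (\<Sum>k. ennreal (2 powr \<bar>p\<bar> * R powr (p + trace E) * (b powr (p + trace E)) ^ k)) * emeasure lborel {x. 1 \<le> \<tau> x \<and> \<tau> x < 2}"
    by (rule ennreal_suminf_multc)
  also have "\<dots> < \<infinity>"
  proof -
    have "summable (\<lambda>k. 2 powr \<bar>p\<bar> * R powr (p + trace E) * (b powr (p + trace E)) ^ k)"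
      using b by (intro summable_mult summable_geometric) simp
    then have "(\<Sum>k. ennreal (2 powr \<bar>p\<bar> * R powr (p + trace E) * (b powr (p + trace E)) ^ k)) < \<infinity>"
      by (subst suminf_ennreal2) auto
    then show ?thesis using emeasure_unit_shell by (simp add: ennreal_mult_less_top)
  qed
  finally show ?thesis .
qed

lemma nn_integral_\<tau>_near:
  assumes "0 < p + trace E" "0 < R"
  shows "(\<integral>\<^sup>+x. ennreal (\<tau> x powr p) * indicator {x. 0 < \<tau> x \<and> \<tau> x < R} x \<partial>lborel) < \<infinity>"
\<comment> \<open>Starting at R/2 makes the outermost shell end exactly at R.\<close>
proof (rule nn_integral_shells[where b = "1 / 2" and R = "R / 2"])
  have "(1 / 2 :: real) powr (p + trace E) = 2 powr (- (p + trace E))"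
    by (simp add: powr_divide powr_minus_divide del: minus_add_distrib)
  also have "\<dots> < 1" using assms by (intro powr_less_one) auto
  finally show "(1 / 2) powr (p + trace E) < 1" .
  fix x assume "x \<in> {x. 0 < \<tau> x \<and> \<tau> x < R}"
  then have x: "0 < \<tau> x" "\<tau> x < R" by auto
  let ?P = "\<lambda>k::nat. R / 2 * (1 / 2) ^ k \<le> \<tau> x"
  obtain k0 where "(1 / 2 :: real) ^ k0 < \<tau> x / R" using real_arch_pow_inv[of "\<tau> x / R" "1 / 2"] x by auto
  then have "R * (1 / 2) ^ k0 \<le> \<tau> x" using assms(2) by (simp add: field_simps)
  moreover have "R / 2 * (1 / 2) ^ k0 \<le> R * (1 / 2) ^ k0" using assms(2) by (intro mult_right_mono) auto
  ultimately have ex: "?P k0" by simp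
  define k where "k = (LEAST k. ?P k)"
  have "?P k" unfolding k_def by (rule LeastI[of ?P, OF ex])
  moreover have "\<tau> x < 2 * (R / 2 * (1 / 2) ^ k)"
  proof (cases k)
    case (Suc j)
    then have "\<not> ?P j" unfolding k_def by (metis lessI not_less_Least)
    then show ?thesis using Suc by simp
  qed (use x in simp)
  ultimately show "\<exists>k::nat. R / 2 * (1 / 2) ^ k \<le> \<tau> x \<and> \<tau> x < 2 * (R / 2 * (1 / 2) ^ k)" by blast
qed (use assms in auto)

lemma nn_integral_\<tau>_far:
  assumes "p + trace E < 0" "0 < R"
  shows "(\<integral>\<^sup>+x. ennreal (\<tau> x powr p) * indicator {x. R \<le> \<tau> x} x \<partial>lborel) < \<infinity>"
proof (rule nn_integral_shells[where b = 2 and R = R])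
  show "2 powr (p + trace E) < 1" using assms by (intro powr_less_one) auto
  fix x assume "x \<in> {x. R \<le> \<tau> x}"
  then have x: "R \<le> \<tau> x" by auto
  let ?P = "\<lambda>k::nat. \<tau> x < 2 * (R * 2 ^ k)"
  obtain k0 where "\<tau> x / R < 2 ^ k0" using real_arch_pow[of 2 "\<tau> x / R"] by auto
  then have "\<tau> x < R * 2 ^ k0" using assms(2) by (simp add: field_simps)
  then have ex: "?P k0" using assms(2) by (smt (verit) zero_less_mult_iff zero_less_power)
  define k where "k = (LEAST k. ?P k)"
  have "?P k" unfolding k_def by (rule LeastI[of ?P, OF ex])
  moreover have "R * 2 ^ k \<le> \<tau> x"
  proof (cases k)
    case (Suc j)
    then have "\<not> ?P j" unfolding k_def by (metis lessI not_less_Least)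
    then show ?thesis using Suc by simp
  qed (use x in simp)
  ultimately show "\<exists>k::nat. R * 2 ^ k \<le> \<tau> x \<and> \<tau> x < 2 * (R * 2 ^ k)" by blast
qed (use assms in auto)

end

section \<open>The moving average kernel\<close>

text \<open>The growth in \<open>a\<close> of the truncated second moment of the tempered Levy measure dilated by \<open>a\<close>.\<close>

definition wgt :: "real \<Rightarrow> real \<Rightarrow> real" where
  "wgt \<alpha> a = min (a\<^sup>2) (a powr \<alpha>)"

lemma wgt_nonneg [simp]: "0 \<le> wgt \<alpha> a" by (simp add: wgt_def)
lemma wgt_0 [simp]: "wgt \<alpha> 0 = 0" by (simp add: wgt_def)
lemma wgt_le_square: "wgt \<alpha> a \<le> a\<^sup>2" and wgt_le_powr: "wgt \<alpha> a \<le> a powr \<alpha>" by (simp_all add: wgt_def)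
lemma borel_measurable_wgt [measurable]: "wgt \<alpha> \<in> borel_measurable borel"
  unfolding wgt_def by measurable

lemma wgt_mono: "0 \<le> \<alpha> \<Longrightarrow> 0 \<le> a \<Longrightarrow> a \<le> b \<Longrightarrow> wgt \<alpha> a \<le> wgt \<alpha> b"
  unfolding wgt_def by (intro min.mono power_mono powr_mono2) auto

lemma powr_le_max_square:
  fixes b :: real assumes "0 \<le> \<alpha>" "\<alpha> \<le> 2" "0 \<le> b" shows "b powr \<alpha> \<le> max 1 (b\<^sup>2)"
proof (cases "b \<le> 1")
  case True then show ?thesis using powr_mono2[of \<alpha> b 1] assms by simp
next
  case False
  then have "b powr \<alpha> \<le> b powr 2" using assms by (intro powr_mono) auto
  then show ?thesis using False by simp
qed

text \<open>A substitute for homogeneity: the square scales by b^2 and the other branch by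
  b^\<alpha>, and both factors are at most \<open>max 1 (b\<^sup>2)\<close>.\<close>

lemma wgt_mult_le:
  assumes "0 \<le> \<alpha>" "\<alpha> \<le> 2" "0 \<le> a" "0 \<le> b"
  shows "wgt \<alpha> (b * a) \<le> max 1 (b\<^sup>2) * wgt \<alpha> a"
proof -
  have "(b * a)\<^sup>2 \<le> max 1 (b\<^sup>2) * a\<^sup>2" by (simp add: power_mult_distrib mult_right_mono)
  moreover have "(b * a) powr \<alpha> \<le> max 1 (b\<^sup>2) * a powr \<alpha>"
    using assms powr_le_max_square by (simp add: powr_mult mult_right_mono)
  ultimately show ?thesis unfolding wgt_def by (simp add: min_def)
qed

text \<open>Since a + b is at most twice the maximum, the constant 4 is the scaling factor 2^2. It
  makes \<open>wgt\<close> a substitute for a norm in all later triangle inequalities.\<close>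

lemma wgt_add_le:
  assumes "0 \<le> \<alpha>" "\<alpha> \<le> 2" "0 \<le> a" "0 \<le> b"
  shows "wgt \<alpha> (a + b) \<le> 4 * (wgt \<alpha> a + wgt \<alpha> b)"
proof -
  let ?c = "max a b"
  have "wgt \<alpha> (a + b) \<le> wgt \<alpha> (2 * ?c)" using assms by (intro wgt_mono) auto
  also have "\<dots> \<le> max 1 (2\<^sup>2) * wgt \<alpha> ?c" using assms by (intro wgt_mult_le) auto
  also have "wgt \<alpha> ?c \<le> wgt \<alpha> a + wgt \<alpha> b" by (simp add: max_def)
  finally show ?thesis by simp
qed

lemma wgt_norm_diff_le:
  assumes "0 \<le> \<alpha>" "\<alpha> \<le> 2"
  shows "wgt \<alpha> (norm (x - y)) \<le> 4 * (wgt \<alpha> (norm x) + wgt \<alpha> (norm y))"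
  by (rule order_trans[OF wgt_mono[OF assms(1) _ norm_triangle_ineq4] wgt_add_le[OF assms]]) auto

lemma nn_integral_lborel_reflect:
  fixes f :: "'a::euclidean_space \<Rightarrow> ennreal"
  assumes [measurable]: "f \<in> borel_measurable borel"
  shows "(\<integral>\<^sup>+x. f (t - x) \<partial>lborel) = (\<integral>\<^sup>+x. f x \<partial>lborel)"
proof -
  have "lborel = density (distr lborel borel (\<lambda>x::'a. t + (-1) *\<^sub>R x)) (\<lambda>_. ennreal (\<bar>-1\<bar> ^ DIM('a)))"
    by (rule lborel_affine) simp
  then have "(\<integral>\<^sup>+x. f x \<partial>lborel) = (\<integral>\<^sup>+x. f x \<partial>density (distr lborel borel (\<lambda>x::'a. t + (-1) *\<^sub>R x)) (\<lambda>_. ennreal (\<bar>-1\<bar> ^ DIM('a))))"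
    by metis
  then show ?thesis by (simp add: nn_integral_density nn_integral_distr)
qed

text \<open>The derivative of c^A is (1/c) A c^A, which is bounded on a compact interval away from
  0; the mean value inequality does the rest.\<close>

lemma scalar_mpow_lipschitz_Icc:
  fixes A :: "real^'n^'n"
  assumes "0 < l"
  shows "\<exists>L>0. \<forall>u v. l \<le> u \<and> u \<le> r \<and> l \<le> v \<and> v \<le> r \<longrightarrow> norm (scalar_mpow u A - scalar_mpow v A) \<le> L * \<bar>u - v\<bar>"
proof -
  obtain K where K: "K > 0" "\<And>c. l \<le> c \<Longrightarrow> c \<le> r \<Longrightarrow> norm (scalar_mpow c A) \<le> K"
    using scalar_mpow_bounded_Icc[OF assms] by blast
  have d: "((\<lambda>c. scalar_mpow c A) has_vector_derivative (1 / c) *\<^sub>R (A ** scalar_mpow c A)) (at c within {l..r})" if "c \<in> {l..r}" for c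
  proof -
    have "(ln has_vector_derivative 1 / c) (at c)"
      unfolding has_real_derivative_iff_has_vector_derivative[symmetric]
      using that assms by (auto intro!: derivative_eq_intros)
    from vector_diff_chain_at[OF this, where g = "\<lambda>t. mat_exp (t *\<^sub>R A)", OF mat_exp_has_vector_derivative]
    have "((\<lambda>c. scalar_mpow c A) has_vector_derivative (1 / c) *\<^sub>R (A ** scalar_mpow c A)) (at c)"
      by (simp add: o_def scalar_mpow_def[abs_def])
    then show ?thesis by (rule has_vector_derivative_at_within)
  qed
  let ?L = "1 / l * (norm A * K)"
  have "norm (scalar_mpow u A - scalar_mpow v A) \<le> ?L * norm (u - v)" if "u \<in> {l..r}" "v \<in> {l..r}" for u v
  proof (rule differentiable_bound[OF convex_real_interval(5) d[unfolded has_vector_derivative_def] _ that])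
    fix c assume c: "c \<in> {l..r}"
    have "norm (A ** scalar_mpow c A) \<le> norm A * K"
      by (rule order_trans[OF norm_matrix_mult_le mult_left_mono]) (use K(2) c in auto)
    then have "norm ((1 / c) *\<^sub>R (A ** scalar_mpow c A)) \<le> ?L"
      using c assms K(1) unfolding norm_scaleR by (intro mult_mono) (auto simp: field_simps)
    from mult_left_mono[OF this abs_ge_zero]
    show "onorm (\<lambda>x. x *\<^sub>R (1 / c) *\<^sub>R (A ** scalar_mpow c A)) \<le> ?L"
      by (intro onorm_le) (simp only: norm_scaleR[of _ "_ *\<^sub>R _"] real_norm_def mult.commute[of ?L])
  qed auto
  note bd = this
  show ?thesis
  proof (intro exI[of _ "?L + 1"] conjI allI impI)
    show "0 < ?L + 1" using assms K(1) by (intro add_nonneg_pos) auto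
    fix u v assume "l \<le> u \<and> u \<le> r \<and> l \<le> v \<and> v \<le> r"
    then have "norm (scalar_mpow u A - scalar_mpow v A) \<le> ?L * \<bar>u - v\<bar>" using bd[of u v] by simp
    also have "\<dots> \<le> (?L + 1) * \<bar>u - v\<bar>" by (intro mult_right_mono) auto
    finally show "norm (scalar_mpow u A - scalar_mpow v A) \<le> (?L + 1) * \<bar>u - v\<bar>" .
  qed
qed

text \<open>The numbers b and a enclose the real parts of the eigenvalues of B strictly. With the
  shell estimates, \<open>0 < b * \<alpha> + trace E\<close> is integrability of \<tau>^(b \<alpha>)
  near 0, and \<open>2 * (a - \<beta>) + trace E < 0\<close> is integrability of \<tau>^(2 (a -
  \<beta>)) far away.\<close>

locale admissible_kernel = polar_coordinates E N
  for E :: "real^'n^'n" and N +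
  fixes \<phi> :: "real^'n \<Rightarrow> real" and B :: "real^'d^'d" and \<alpha> \<beta> a b :: real
  assumes \<phi>_nonneg: "\<And>x. 0 \<le> \<phi> x" and hom: "homogeneous_fun E \<phi>" and adm: "admissible_fun \<beta> E N \<phi>"
    and \<alpha>: "0 < \<alpha>" "\<alpha> < 2" and \<beta>: "0 < \<beta>"
    and eig_lower: "\<And>z. z \<in> complex_eigenvalues B \<Longrightarrow> b < Re z" and b: "0 < b * \<alpha> + trace E"
    and eig_upper: "\<And>z. z \<in> complex_eigenvalues B \<Longrightarrow> Re z < a" and a: "2 * (a - \<beta>) + trace E < 0"
begin

lemma \<phi>_pos: "x \<noteq> 0 \<Longrightarrow> 0 < \<phi> x" and continuous_\<phi>: "continuous_on A \<phi>"
  using adm continuous_on_subset[of UNIV \<phi> A] by (auto simp: admissible_fun_def)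

lemma borel_measurable_\<phi> [measurable]: "\<phi> \<in> borel_measurable borel"
  by (rule borel_measurable_continuous_onI[OF continuous_\<phi>])

lemma \<phi>_scale: "0 < c \<Longrightarrow> x \<noteq> 0 \<Longrightarrow> \<phi> (pw c *v x) = c * \<phi> x"
  using hom by (simp add: homogeneous_fun_def)

lemma unit_nz: "N \<theta> = 1 \<Longrightarrow> \<theta> \<noteq> 0" by auto

lemma \<phi>_unit_bounds: "\<exists>m>0. \<exists>M>0. \<forall>\<theta>. N \<theta> = 1 \<longrightarrow> m \<le> \<phi> \<theta> \<and> \<phi> \<theta> \<le> M"
proof -
  obtain x0 where x0: "N x0 = 1" "\<And>\<theta>. N \<theta> = 1 \<Longrightarrow> \<phi> x0 \<le> \<phi> \<theta>"
    using continuous_attains_inf[OF compact_unit unit_nonempty continuous_\<phi>] by auto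
  obtain x1 where x1: "N x1 = 1" "\<And>\<theta>. N \<theta> = 1 \<Longrightarrow> \<phi> \<theta> \<le> \<phi> x1"
    using continuous_attains_sup[OF compact_unit unit_nonempty continuous_\<phi>] by auto
  show ?thesis using x0 x1 \<phi>_pos[OF unit_nz] by metis
qed

lemma \<phi>_\<tau>_bounds: "\<exists>m>0. \<exists>M>0. \<forall>x. x \<noteq> 0 \<longrightarrow> m * \<tau> x \<le> \<phi> x \<and> \<phi> x \<le> M * \<tau> x"
proof -
  obtain m M where mM: "m > 0" "M > 0" "\<And>\<theta>. N \<theta> = 1 \<Longrightarrow> m \<le> \<phi> \<theta> \<and> \<phi> \<theta> \<le> M" using \<phi>_unit_bounds by metis
  have "m * \<tau> x \<le> \<phi> x \<and> \<phi> x \<le> M * \<tau> x" if x: "x \<noteq> 0" for x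
  proof -
    obtain \<theta> where \<theta>: "N \<theta> = 1" "x = pw (\<tau> x) *v \<theta>" using \<tau>_decomp[OF x] by blast
    have "\<phi> x = \<tau> x * \<phi> \<theta>" by (subst \<theta>(2)) (rule \<phi>_scale[OF \<tau>_pos[OF x] unit_nz[OF \<theta>(1)]])
    then show ?thesis using mM(3)[OF \<theta>(1)] \<tau>_pos[OF x] by (simp add: mult.commute)
  qed
  with mM show ?thesis by blast
qed

text \<open>Homogeneity says nothing about the origin. The value follows from continuity together
  with \<phi> \<le> M \<tau> off the origin, where \<tau> tends to 0.\<close>

lemma \<phi>_0 [simp]: "\<phi> 0 = 0"
proof (rule ccontr)
  assume "\<phi> 0 \<noteq> 0"
  then have pos: "0 < \<phi> 0" using \<phi>_nonneg[of 0] by simp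
  obtain M where M: "M > 0" "\<And>x. x \<noteq> 0 \<Longrightarrow> \<phi> x \<le> M * \<tau> x" using \<phi>_\<tau>_bounds by blast
  have "isCont \<phi> 0" using continuous_\<phi>[of UNIV] by (simp add: continuous_on_eq_continuous_at)
  then obtain d where d: "d > 0" "\<And>x. norm x < d \<Longrightarrow> \<bar>\<phi> x - \<phi> 0\<bar> < \<phi> 0 / 2"
    using pos unfolding continuous_at_eps_delta by (metis dist_norm dist_real_def diff_zero half_gt_zero)
  obtain e where e: "e > 0" "\<And>x. norm x < e \<Longrightarrow> \<tau> x < \<phi> 0 / (2 * M)" using \<tau>_small[of "\<phi> 0 / (2 * M)"] pos M by auto
  have "0 \<le> min d e / 2" using d(1) e(1) by simp
  then obtain x :: "real^'n" where n: "norm x = min d e / 2" using vector_choose_size by blast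
  have "x \<noteq> 0" "norm x < d" "norm x < e" using d(1) e(1) n by auto
  then have "\<phi> x \<le> M * \<tau> x" "\<tau> x < \<phi> 0 / (2 * M)" "\<bar>\<phi> x - \<phi> 0\<bar> < \<phi> 0 / 2" using M d e by blast+
  moreover from this(2) have "M * \<tau> x < \<phi> 0 / 2" using M(1) by (simp add: field_simps)
  ultimately show False by linarith
qed

lemma N_minus: "N (- x) = N x" using N_scale[of "-1" x] by simp

lemma \<tau>_minus: "\<tau> (- x) = \<tau> x"
proof (cases "x = 0")
  case False
  obtain \<theta> where \<theta>: "N \<theta> = 1" "x = pw (\<tau> x) *v \<theta>" using \<tau>_decomp[OF False] by blast
  have "- x = pw (\<tau> x) *v (- \<theta>)"
    by (subst \<theta>(2)) (simp add: linear_neg[OF matrix_vector_mul_linear])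
  then show ?thesis using \<tau>_eq[OF \<tau>_pos[OF False], of "- \<theta>"] \<theta>(1) by (simp add: N_minus)
qed simp

definition kpow :: "real^'n \<Rightarrow> real^'d^'d" where "kpow s = scalar_mpow (\<phi> s) B"

lemma borel_measurable_kpow [measurable]: "kpow \<in> borel_measurable borel"
  unfolding kpow_def[abs_def] by measurable

lemma ma_kernel_eq: "ma_kernel \<phi> B t s = kpow (t - s) - kpow (- s)"
  by (simp add: ma_kernel_def kpow_def)

lemma borel_measurable_ma_kernel [measurable]: "ma_kernel \<phi> B t \<in> borel_measurable borel"
  unfolding ma_kernel_eq[abs_def] by measurable

lemma kpow_near: "\<exists>K>0. \<forall>s. s \<noteq> 0 \<and> \<tau> s \<le> R \<longrightarrow> norm (kpow s) \<le> K * \<tau> s powr b"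
proof -
  obtain m M where mM: "m > 0" "M > 0" "\<And>x. x \<noteq> 0 \<Longrightarrow> m * \<tau> x \<le> \<phi> x \<and> \<phi> x \<le> M * \<tau> x" using \<phi>_\<tau>_bounds by metis
  obtain K where K: "K > 0" "\<And>c. 0 < c \<Longrightarrow> c \<le> M * R \<Longrightarrow> norm (scalar_mpow c B) \<le> K * c powr b"
    using scalar_mpow_growth_Ioc[OF eig_lower] by blast
  have "norm (kpow s) \<le> (K * (m powr b + M powr b)) * \<tau> s powr b" if "s \<noteq> 0" "\<tau> s \<le> R" for s
  proof -
    have \<phi>s: "m * \<tau> s \<le> \<phi> s" "\<phi> s \<le> M * \<tau> s" "0 < \<tau> s" "0 < \<phi> s" using mM that \<tau>_pos \<phi>_pos by auto
    have "M * \<tau> s \<le> M * R" using that mM by (intro mult_left_mono) auto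
    then have "norm (kpow s) \<le> K * \<phi> s powr b"
      unfolding kpow_def using \<phi>s by (intro K(2)) auto
    \<comment> \<open>The exponent b may have either sign, so either the upper or the lower
      comparison of \<phi> with \<tau> is used; the sum of the two constants covers both
      cases.\<close>
    also have "\<phi> s powr b \<le> (m powr b + M powr b) * \<tau> s powr b"
    proof (cases "0 \<le> b")
      case True
      then have "\<phi> s powr b \<le> (M * \<tau> s) powr b" using \<phi>s by (intro powr_mono2) auto
      then show ?thesis using \<phi>s mM by (simp add: powr_mult distrib_right add_increasing)
    next
      case False
      then have "\<phi> s powr b \<le> (m * \<tau> s) powr b" using \<phi>s mM by (intro powr_mono2') auto
      then show ?thesis using \<phi>s mM by (simp add: powr_mult distrib_right add_increasing2)
    qed
    finally show ?thesis using K by (simp add: mult.assoc)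
  qed
  moreover have "0 < K * (m powr b + M powr b)" using K mM by (simp add: add_pos_pos)
  ultimately show ?thesis by blast
qed

text \<open>Near the singularity the power branch of \<open>wgt\<close> is the useful one: it gives
  \<tau>^(b \<alpha>), which is integrable by the choice of b.\<close>

lemma kpow_integral_finite: "(\<integral>\<^sup>+s. ennreal (wgt \<alpha> (norm (kpow s))) * indicator (cball 0 R) s \<partial>lborel) < \<infinity>"
proof -
  obtain r where r: "r > 0" "\<And>x. norm x \<le> R \<Longrightarrow> \<tau> x \<le> r" using \<tau>_bounded by blast
  obtain K where K: "K > 0" "\<And>s. s \<noteq> 0 \<Longrightarrow> \<tau> s \<le> r \<Longrightarrow> norm (kpow s) \<le> K * \<tau> s powr b" using kpow_near by blast
  have "(\<integral>\<^sup>+s. ennreal (wgt \<alpha> (norm (kpow s))) * indicator (cball 0 R) s \<partial>lborel)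
    \<le> (\<integral>\<^sup>+s. ennreal (K powr \<alpha>) * (ennreal (\<tau> s powr (b * \<alpha>)) * indicator {x. 0 < \<tau> x \<and> \<tau> x < 2 * r} s) \<partial>lborel)"
  proof (rule nn_integral_mono_AE, rule AE_mp[OF AE_lborel_singleton[of 0]], rule AE_I2, rule impI)
    fix s :: "real^'n" assume s: "s \<noteq> 0"
    show "ennreal (wgt \<alpha> (norm (kpow s))) * indicator (cball 0 R) s \<le>
      ennreal (K powr \<alpha>) * (ennreal (\<tau> s powr (b * \<alpha>)) * indicator {x. 0 < \<tau> x \<and> \<tau> x < 2 * r} s)"
    proof (cases "norm s \<le> R")
      case True
      then have t: "0 < \<tau> s" "\<tau> s \<le> r" using r s \<tau>_pos by auto
      have "wgt \<alpha> (norm (kpow s)) \<le> (norm (kpow s)) powr \<alpha>" by (rule wgt_le_powr)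
      also have "\<dots> \<le> (K * \<tau> s powr b) powr \<alpha>" using K(2)[OF s t(2)] \<alpha> by (intro powr_mono2) auto
      also have "\<dots> = K powr \<alpha> * \<tau> s powr (b * \<alpha>)" using K t by (simp add: powr_mult powr_powr)
      finally have "wgt \<alpha> (norm (kpow s)) \<le> K powr \<alpha> * \<tau> s powr (b * \<alpha>)" .
      moreover have "\<tau> s < 2 * r" using t r by linarith
      ultimately show ?thesis using True t(1) by (simp add: ennreal_leI flip: ennreal_mult)
    qed simp
  qed
  also have "\<dots> = ennreal (K powr \<alpha>) * (\<integral>\<^sup>+s. ennreal (\<tau> s powr (b * \<alpha>)) * indicator {x. 0 < \<tau> x \<and> \<tau> x < 2 * r} s \<partial>lborel)"
    by (rule nn_integral_cmult) measurable
  also have "\<dots> < \<infinity>" using nn_integral_\<tau>_near[OF b, of "2 * r"] r by (simp add: ennreal_mult_less_top)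
  finally show ?thesis .
qed

text \<open>With c = \<tau> s, write -s and h as the power c of E applied to a unit vector y and to
  some x. Homogeneity takes c^B out of both terms, leaving \<phi>(x + y)^B - \<phi>(y)^B with y in a
  compact set. There the Lipschitz bound and admissibility apply, and \<tau> x = \<tau> h / \<tau>
  s.\<close>

lemma ma_kernel_tail:
  "\<exists>\<eta>>0. \<forall>c0>0. \<exists>K>0. \<forall>h s. c0 \<le> \<tau> s \<and> \<tau> h \<le> \<eta> * \<tau> s \<longrightarrow>
     norm (ma_kernel \<phi> B h s) \<le> K * \<tau> s powr a * (\<tau> h / \<tau> s) powr \<beta>"
proof -
  obtain n1 n2 where n: "0 < n1" "0 < n2" "\<And>\<theta>. N \<theta> = 1 \<Longrightarrow> n1 \<le> norm \<theta> \<and> norm \<theta> \<le> n2" using unit_bounds by metis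
  obtain m M where mM: "m > 0" "M > 0" "\<And>\<theta>. N \<theta> = 1 \<Longrightarrow> m \<le> \<phi> \<theta> \<and> \<phi> \<theta> \<le> M" using \<phi>_unit_bounds by metis
  \<comment> \<open>Admissibility requires strictly ordered radii, so n1 + n2 replaces n2 as the
    outer one.\<close>
  obtain C where C: "C > 0" "\<And>x y. n1 \<le> norm y \<Longrightarrow> norm y \<le> n1 + n2 \<Longrightarrow> \<tau> x \<le> 1 \<Longrightarrow> \<bar>\<phi> (x + y) - \<phi> y\<bar> \<le> C * \<tau> x powr \<beta>"
    using adm n(1,2) unfolding admissible_fun_def by (metis less_add_same_cancel1)
  obtain L where L: "L > 0" "\<And>u v. m / 2 \<le> u \<Longrightarrow> u \<le> M + m / 2 \<Longrightarrow> m / 2 \<le> v \<Longrightarrow> v \<le> M + m / 2 \<Longrightarrow> norm (scalar_mpow u B - scalar_mpow v B) \<le> L * \<bar>u - v\<bar>"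
    using scalar_mpow_lipschitz_Icc[of "m / 2" "M + m / 2" B] mM by auto
  \<comment> \<open>Chosen so that C \<eta>^\<beta> \<le> m/2: then \<phi>(x + y) stays in
    [m/2, M + m/2], away from 0. The bound by 1 keeps x in the range of the admissibility
    estimate.\<close>
  define \<eta> where "\<eta> = min 1 ((m / (2 * C)) powr (1 / \<beta>))"
  have \<eta>: "0 < \<eta>" "\<eta> \<le> 1" using mM C by (auto simp: \<eta>_def)
  have \<eta>\<beta>: "C * \<eta> powr \<beta> \<le> m / 2"
  proof -
    have "\<eta> powr \<beta> \<le> ((m / (2 * C)) powr (1 / \<beta>)) powr \<beta>" using \<eta> \<beta> by (intro powr_mono2) (auto simp: \<eta>_def)
    also have "\<dots> = m / (2 * C)" using \<beta> mM C by (simp add: powr_powr)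
    finally show ?thesis using C by (simp add: field_simps)
  qed
  have "\<exists>K>0. \<forall>h s. c0 \<le> \<tau> s \<and> \<tau> h \<le> \<eta> * \<tau> s \<longrightarrow>
     norm (ma_kernel \<phi> B h s) \<le> K * \<tau> s powr a * (\<tau> h / \<tau> s) powr \<beta>" if c0: "0 < c0" for c0
  proof -
    obtain K where K: "K > 0" "\<And>c. c0 \<le> c \<Longrightarrow> norm (scalar_mpow c B) \<le> K * c powr a"
      using scalar_mpow_growth_Ici[OF eig_upper c0] by blast
    have "norm (ma_kernel \<phi> B h s) \<le> (K * L * C) * \<tau> s powr a * (\<tau> h / \<tau> s) powr \<beta>"
      if c: "c0 \<le> \<tau> s" and h: "\<tau> h \<le> \<eta> * \<tau> s" for h s
    proof -
      define c where "c = \<tau> s"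
      have c0: "0 < c" "c0 \<le> c" using c c0 by (auto simp: c_def)
      have "- s \<noteq> 0" using c0 by (auto simp: c_def)
      then obtain y where y: "N y = 1" "- s = pw (\<tau> (- s)) *v y" using \<tau>_decomp by blast
      have s: "- s = pw c *v y" using y(2) by (simp add: \<tau>_minus c_def)
      define x where "x = pw (1 / c) *v h"
      have hx: "h = pw c *v x"
        unfolding x_def matrix_vector_mul_assoc scalar_mpow_inverse_right[OF c0(1)] by simp
      have \<tau>x: "\<tau> x = \<tau> h / c" unfolding x_def using c0 by (simp add: \<tau>_scale)
      have \<tau>x\<eta>: "\<tau> x \<le> \<eta>" using h c0 by (simp add: \<tau>x c_def[symmetric] field_simps)
      have d: "\<bar>\<phi> (x + y) - \<phi> y\<bar> \<le> C * \<tau> x powr \<beta>"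
        using n(3)[OF y(1)] n(1) \<tau>x\<eta> \<eta> by (intro C(2)) auto
      also have "\<dots> \<le> C * \<eta> powr \<beta>" using C \<beta> \<tau>x\<eta> by (intro mult_left_mono powr_mono2 \<tau>_ge_0) auto
      also note \<eta>\<beta>
      finally have d2: "\<bar>\<phi> (x + y) - \<phi> y\<bar> \<le> m / 2" .
      have \<phi>y: "m \<le> \<phi> y" "\<phi> y \<le> M" using mM(3)[OF y(1)] by auto
      have xy: "m / 2 \<le> \<phi> (x + y)" "\<phi> (x + y) \<le> M + m / 2" using d2 \<phi>y by linarith+
      then have xy0: "x + y \<noteq> 0" using mM(1) by auto
      have k1: "kpow (h - s) = scalar_mpow c B ** scalar_mpow (\<phi> (x + y)) B"
      proof -
        have "h - s = pw c *v (x + y)" using s hx by (simp add: matrix_vector_right_distrib)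
        then show ?thesis
          using \<phi>_scale[OF c0(1) xy0] \<phi>_pos[OF xy0] c0 by (simp add: kpow_def scalar_mpow_mult)
      qed
      have k2: "kpow (- s) = scalar_mpow c B ** scalar_mpow (\<phi> y) B"
        using \<phi>_scale[OF c0(1) unit_nz[OF y(1)]] \<phi>_pos[OF unit_nz[OF y(1)]] c0
        by (simp add: kpow_def s scalar_mpow_mult)
      have "ma_kernel \<phi> B h s = scalar_mpow c B ** (scalar_mpow (\<phi> (x + y)) B - scalar_mpow (\<phi> y) B)"
        by (simp add: ma_kernel_eq k1 k2 bounded_bilinear.diff_right[OF bounded_bilinear_matrix_mult])
      then have "norm (ma_kernel \<phi> B h s) \<le> norm (scalar_mpow c B) * norm (scalar_mpow (\<phi> (x + y)) B - scalar_mpow (\<phi> y) B)"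
        by (simp add: norm_matrix_mult_le)
      also have "\<dots> \<le> (K * c powr a) * (L * (C * \<tau> x powr \<beta>))"
      proof (rule mult_mono)
        show "norm (scalar_mpow c B) \<le> K * c powr a" using K c0 by blast
        have "norm (scalar_mpow (\<phi> (x + y)) B - scalar_mpow (\<phi> y) B) \<le> L * \<bar>\<phi> (x + y) - \<phi> y\<bar>"
          using xy \<phi>y mM by (intro L(2)) auto
        also have "\<dots> \<le> L * (C * \<tau> x powr \<beta>)" using d L by (intro mult_left_mono) auto
        finally show "norm (scalar_mpow (\<phi> (x + y)) B - scalar_mpow (\<phi> y) B) \<le> L * (C * \<tau> x powr \<beta>)" .
      qed (use K in auto)
      finally show ?thesis by (simp add: \<tau>x c_def mult_ac)
    qed
    then show ?thesis using K L C by (intro exI[of _ "K * L * C"]) auto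
  qed
  with \<eta>(1) show ?thesis by blast
qed

text \<open>Here the square branch of \<open>wgt\<close> is used; squaring the tail bound leaves
  \<tau> s to the power 2 (a - \<beta>). The factor in \<tau> h is kept explicit because it forces
  the integral to 0 when h does.\<close>

lemma ma_kernel_far_integral:
  assumes c0: "0 < c0" and \<eta>: "0 < \<eta>"
    and K: "0 < K" "\<And>h s. c0 \<le> \<tau> s \<Longrightarrow> \<tau> h \<le> \<eta> * \<tau> s \<Longrightarrow>
     norm (ma_kernel \<phi> B h s) \<le> K * \<tau> s powr a * (\<tau> h / \<tau> s) powr \<beta>"
  shows "\<exists>I<\<infinity>. \<forall>h. \<tau> h \<le> \<eta> * c0 \<longrightarrow>
    (\<integral>\<^sup>+s. ennreal (wgt \<alpha> (norm (ma_kernel \<phi> B h s))) * indicator {s. c0 \<le> \<tau> s} s \<partial>lborel) \<le> ennreal (\<tau> h powr (2 * \<beta>)) * I"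
    (is "\<exists>I<\<infinity>. \<forall>h. _ \<longrightarrow> ?J h \<le> _ * I")
proof -
  let ?I0 = "\<integral>\<^sup>+s. ennreal (\<tau> s powr (2 * (a - \<beta>))) * indicator {s. c0 \<le> \<tau> s} s \<partial>lborel"
  have "?J h \<le> ennreal (\<tau> h powr (2 * \<beta>)) * (ennreal (K\<^sup>2) * ?I0)" if h: "\<tau> h \<le> \<eta> * c0" for h
  proof -
    have "?J h \<le> (\<integral>\<^sup>+s. ennreal (\<tau> h powr (2 * \<beta>) * K\<^sup>2) * (ennreal (\<tau> s powr (2 * (a - \<beta>))) * indicator {s. c0 \<le> \<tau> s} s) \<partial>lborel)"
    proof (rule nn_integral_mono)
      fix s
      show "ennreal (wgt \<alpha> (norm (ma_kernel \<phi> B h s))) * indicator {s. c0 \<le> \<tau> s} s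
        \<le> ennreal (\<tau> h powr (2 * \<beta>) * K\<^sup>2) * (ennreal (\<tau> s powr (2 * (a - \<beta>))) * indicator {s. c0 \<le> \<tau> s} s)"
      proof (cases "c0 \<le> \<tau> s")
        case True
        then have \<tau>s: "0 < \<tau> s" using c0 by simp
        have "\<tau> h \<le> \<eta> * \<tau> s" using h True \<eta> by (meson mult_left_mono order_trans less_imp_le)
        have "wgt \<alpha> (norm (ma_kernel \<phi> B h s)) \<le> (norm (ma_kernel \<phi> B h s))\<^sup>2" by (rule wgt_le_square)
        also have "\<dots> \<le> (K * \<tau> s powr a * (\<tau> h / \<tau> s) powr \<beta>)\<^sup>2"
          by (rule power_mono[OF K(2)[OF True \<open>\<tau> h \<le> \<eta> * \<tau> s\<close>]]) simp
        also have "\<dots> = \<tau> h powr (2 * \<beta>) * K\<^sup>2 * \<tau> s powr (2 * (a - \<beta>))"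
        proof -
          have sq: "(x powr y)\<^sup>2 = x powr (2 * y)" for x y :: real
            by (simp add: power2_eq_square flip: powr_add)
          have "(\<tau> h / \<tau> s) powr (2 * \<beta>) = \<tau> h powr (2 * \<beta>) / \<tau> s powr (2 * \<beta>)"
            using \<tau>s by (simp add: powr_divide \<tau>_ge_0)
          then show ?thesis by (simp add: power_mult_distrib sq right_diff_distrib powr_diff)
        qed
        finally show ?thesis using True by (simp add: ennreal_leI flip: ennreal_mult)
      qed simp
    qed
    also have "\<dots> = ennreal (\<tau> h powr (2 * \<beta>) * K\<^sup>2) * ?I0" by (rule nn_integral_cmult) measurable
    finally show ?thesis by (simp add: ennreal_mult mult.assoc)
  qed
  moreover have "ennreal (K\<^sup>2) * ?I0 < \<infinity>"
    using nn_integral_\<tau>_far[OF a c0] by (simp add: ennreal_mult_less_top)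
  ultimately show ?thesis by blast
qed

text \<open>The order of quantifiers matters: \<eta> is independent of c0. A large c0 then handles a
  fixed shift, and a small c0 handles small shifts.\<close>

lemma ma_kernel_far:
  "\<exists>\<eta>>0. \<forall>c0>0. \<exists>I<\<infinity>. \<forall>h. \<tau> h \<le> \<eta> * c0 \<longrightarrow>
    (\<integral>\<^sup>+s. ennreal (wgt \<alpha> (norm (ma_kernel \<phi> B h s))) * indicator {s. c0 \<le> \<tau> s} s \<partial>lborel) \<le> ennreal (\<tau> h powr (2 * \<beta>)) * I"
proof -
  obtain \<eta> where \<eta>: "0 < \<eta>" and tail: "\<And>c0. 0 < c0 \<Longrightarrow> \<exists>K>0. \<forall>h s. c0 \<le> \<tau> s \<and> \<tau> h \<le> \<eta> * \<tau> s \<longrightarrow>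
     norm (ma_kernel \<phi> B h s) \<le> K * \<tau> s powr a * (\<tau> h / \<tau> s) powr \<beta>"
    using ma_kernel_tail by blast
  show ?thesis
  proof (intro exI[of _ \<eta>] conjI allI impI \<eta>)
    fix c0 :: real assume c0: "0 < c0"
    then obtain K where "0 < K" "\<And>h s. c0 \<le> \<tau> s \<Longrightarrow> \<tau> h \<le> \<eta> * \<tau> s \<Longrightarrow>
       norm (ma_kernel \<phi> B h s) \<le> K * \<tau> s powr a * (\<tau> h / \<tau> s) powr \<beta>" using tail by blast
    from ma_kernel_far_integral[OF c0 \<eta> this]
    show "\<exists>I<\<infinity>. \<forall>h. \<tau> h \<le> \<eta> * c0 \<longrightarrow>
      (\<integral>\<^sup>+s. ennreal (wgt \<alpha> (norm (ma_kernel \<phi> B h s))) * indicator {s. c0 \<le> \<tau> s} s \<partial>lborel) \<le> ennreal (\<tau> h powr (2 * \<beta>)) * I" .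
  qed
qed

text \<open>The quasi-triangle inequality costs a factor 4 and leaves two reflected translates of
  \<open>kpow\<close>; on X both arguments lie in the ball of radius R + norm h, so each contributes
  the same integral.\<close>

lemma ma_kernel_near:
  assumes [measurable]: "X \<in> sets borel" and X: "X \<subseteq> cball 0 R"
  shows "(\<integral>\<^sup>+s. ennreal (wgt \<alpha> (norm (ma_kernel \<phi> B h s))) * indicator X s \<partial>lborel)
    \<le> 8 * (\<integral>\<^sup>+s. ennreal (wgt \<alpha> (norm (kpow s))) * indicator (cball 0 (R + norm h)) s \<partial>lborel)"
proof -
  let ?G = "\<lambda>s. ennreal (wgt \<alpha> (norm (kpow s))) * indicator (cball 0 (R + norm h)) s"
  have "cball (0::real^'n) (R + norm h) \<in> sets borel" by simp
  note [measurable] = this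
  have G: "?G \<in> borel_measurable borel" by measurable
  have Gc: "(\<lambda>s. ?G (c - s)) \<in> borel_measurable lborel" for c
    by (rule measurable_compose[OF _ G]) measurable
  have "(\<integral>\<^sup>+s. ennreal (wgt \<alpha> (norm (ma_kernel \<phi> B h s))) * indicator X s \<partial>lborel)
    \<le> (\<integral>\<^sup>+s. 4 * (?G (h - s) + ?G (0 - s)) \<partial>lborel)"
  proof (rule nn_integral_mono)
    fix s
    show "ennreal (wgt \<alpha> (norm (ma_kernel \<phi> B h s))) * indicator X s \<le> 4 * (?G (h - s) + ?G (0 - s))"
    proof (cases "s \<in> X")
      case True
      then have "norm s \<le> R" using X by auto
      then have "norm (h - s) \<le> R + norm h" "norm (0 - s) \<le> R + norm h"
        using norm_triangle_ineq4[of h s] by (auto intro: order_trans)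
      moreover have "wgt \<alpha> (norm (ma_kernel \<phi> B h s)) \<le> 4 * (wgt \<alpha> (norm (kpow (h - s))) + wgt \<alpha> (norm (kpow (0 - s))))"
        using wgt_norm_diff_le[of \<alpha> "kpow (h - s)" "kpow (0 - s)"] \<alpha> by (simp add: ma_kernel_eq)
      then have "ennreal (wgt \<alpha> (norm (ma_kernel \<phi> B h s))) \<le> ennreal (4 * (wgt \<alpha> (norm (kpow (h - s))) + wgt \<alpha> (norm (kpow (0 - s)))))"
        by (rule ennreal_leI)
      ultimately show ?thesis using True by (simp add: ennreal_mult ennreal_plus)
    qed simp
  qed
  also have "\<dots> = 4 * ((\<integral>\<^sup>+s. ?G (h - s) \<partial>lborel) + (\<integral>\<^sup>+s. ?G (0 - s) \<partial>lborel))"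
    by (subst nn_integral_cmult[OF borel_measurable_add[OF Gc Gc]], subst nn_integral_add[OF Gc Gc]) (rule refl)
  also have "\<dots> = 8 * (\<integral>\<^sup>+s. ?G s \<partial>lborel)"
    by (subst (1 2) nn_integral_lborel_reflect[OF G]) (simp add: mult_2[symmetric] mult.assoc[symmetric])
  finally show ?thesis .
qed

lemma nn_integral_indicator_split:
  assumes [measurable]: "f \<in> borel_measurable M" "{x\<in>space M. P x} \<in> sets M"
  shows "(\<integral>\<^sup>+x. f x \<partial>M) = (\<integral>\<^sup>+x. f x * indicator {x. P x} x \<partial>M) + (\<integral>\<^sup>+x. f x * indicator {x. \<not> P x} x \<partial>M)"
proof -
  have "(\<integral>\<^sup>+x. f x \<partial>M) = (\<integral>\<^sup>+x. f x * indicator {x\<in>space M. P x} x + f x * indicator (space M - {x\<in>space M. P x}) x \<partial>M)"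
    by (intro nn_integral_cong) (auto simp: indicator_def)
  also have "\<dots> = (\<integral>\<^sup>+x. f x * indicator {x\<in>space M. P x} x \<partial>M) + (\<integral>\<^sup>+x. f x * indicator (space M - {x\<in>space M. P x}) x \<partial>M)"
    by (rule nn_integral_add) measurable
  also have "\<dots> = (\<integral>\<^sup>+x. f x * indicator {x. P x} x \<partial>M) + (\<integral>\<^sup>+x. f x * indicator {x. \<not> P x} x \<partial>M)"
    by (intro arg_cong2[where f = "(+)"] nn_integral_cong) (auto simp: indicator_def)
  finally show ?thesis .
qed

theorem ma_kernel_integrable: "(\<integral>\<^sup>+s. ennreal (wgt \<alpha> (norm (ma_kernel \<phi> B t s))) \<partial>lborel) < \<infinity>"
proof -
  obtain \<eta> where \<eta>: "\<eta> > 0" "\<And>c0. 0 < c0 \<Longrightarrow> \<exists>I<\<infinity>. \<forall>h. \<tau> h \<le> \<eta> * c0 \<longrightarrow>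
    (\<integral>\<^sup>+s. ennreal (wgt \<alpha> (norm (ma_kernel \<phi> B h s))) * indicator {s. c0 \<le> \<tau> s} s \<partial>lborel) \<le> ennreal (\<tau> h powr (2 * \<beta>)) * I"
    using ma_kernel_far by blast
  \<comment> \<open>The smallest convenient value with \<tau> t \<le> \<eta> c0; the summand 1 keeps
    it positive for t = 0.\<close>
  define c0 where "c0 = \<tau> t / \<eta> + 1"
  have c0: "0 < c0" using \<eta> \<tau>_ge_0[of t] by (simp add: c0_def add_nonneg_pos)
  have "\<tau> t \<le> \<eta> * c0" using \<eta> by (simp add: c0_def distrib_left)
  then have "(\<integral>\<^sup>+s. ennreal (wgt \<alpha> (norm (ma_kernel \<phi> B t s))) * indicator {s. c0 \<le> \<tau> s} s \<partial>lborel) < \<infinity>"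
    using \<eta>(2)[OF c0] by (auto simp: ennreal_mult_less_top less_top intro: le_less_trans)
  moreover have "(\<integral>\<^sup>+s. ennreal (wgt \<alpha> (norm (ma_kernel \<phi> B t s))) * indicator {s. \<not> c0 \<le> \<tau> s} s \<partial>lborel) < \<infinity>"
  proof -
    obtain R where "\<And>x. \<tau> x \<le> c0 \<Longrightarrow> norm x \<le> R" using bounded_\<tau>_le by blast
    then have X: "{s. \<not> c0 \<le> \<tau> s} \<subseteq> cball 0 R" by auto
    have "{s. \<not> c0 \<le> \<tau> s} \<in> sets borel" by measurable
    from ma_kernel_near[OF this X, of t] show ?thesis
      by (rule le_less_trans) (use kpow_integral_finite[of "R + norm t"] in \<open>simp add: ennreal_mult_less_top\<close>)
  qed
  ultimately show ?thesis by (subst nn_integral_indicator_split[where P = "\<lambda>s. c0 \<le> \<tau> s"]) auto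
qed

text \<open>The two regions are handled in a fixed order. A small ball is chosen so that the near
  part is small, by continuity from above of the measure with density
  \<open>wgt \<alpha> (norm (kpow s))\<close>. With the ball fixed, the far part vanishes through
  its factor in \<tau> h.\<close>

theorem ma_kernel_integral_small:
  assumes "0 < \<epsilon>"
  shows "\<exists>\<delta>>0. \<forall>h. norm h < \<delta> \<longrightarrow> (\<integral>\<^sup>+s. ennreal (wgt \<alpha> (norm (ma_kernel \<phi> B h s))) \<partial>lborel) < ennreal \<epsilon>"
proof -
  let ?D = "density lborel (\<lambda>s. ennreal (wgt \<alpha> (norm (kpow s))))"
  let ?F = "\<lambda>R. \<integral>\<^sup>+s. ennreal (wgt \<alpha> (norm (kpow s))) * indicator (cball 0 R) s \<partial>lborel"
  have F: "emeasure ?D (cball 0 R) = ?F R" for R by (rule emeasure_density) auto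
  have "(\<lambda>n. emeasure ?D (cball 0 (1 / Suc n))) \<longlonglongrightarrow> emeasure ?D (\<Inter>n. cball 0 (1 / Suc n))"
  proof (rule Lim_emeasure_decseq)
    show "decseq (\<lambda>n. cball (0::real^'n) (1 / Suc n))"
      by (intro decseq_SucI subset_cball) (simp add: frac_le)
    show "emeasure ?D (cball 0 (1 / Suc n)) \<noteq> \<infinity>" for n using kpow_integral_finite[of "1 / Suc n"] by (simp add: F less_top)
  qed auto
  also have "(\<Inter>n. cball (0::real^'n) (1 / Suc n)) = {0}"
  proof -
    have "x = 0" if x: "\<And>n. norm x \<le> 1 / Suc n" for x :: "real^'n"
    proof (rule ccontr)
      assume "x \<noteq> 0"
      then obtain n where "inverse (Suc n) < norm x" using reals_Archimedean[of "norm x"] by auto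
      with x[of n] show False by (simp add: inverse_eq_divide)
    qed
    then show ?thesis by auto
  qed
  also have "emeasure ?D {0} = 0"
    by (subst emeasure_density) (auto simp: nn_integral_null_set[of "{0}"] null_sets_def)
  finally have "(\<lambda>n. ?F (1 / Suc n)) \<longlonglongrightarrow> 0" unfolding F .
  \<comment> \<open>The factor 8 of the near estimate turns \<epsilon>/32 into \<epsilon>/4.\<close>
  moreover have "0 < ennreal (\<epsilon> / 32)" using assms by simp
  ultimately have "eventually (\<lambda>n. ?F (1 / Suc n) < ennreal (\<epsilon> / 32)) sequentially" by (rule order_tendstoD(2))
  then obtain n where n: "?F (1 / Suc n) < ennreal (\<epsilon> / 32)" by (auto simp: eventually_sequentially)
  \<comment> \<open>Half of the radius just found: a shift by h with norm below \<rho> stays within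
    the ball of radius 2 \<rho>.\<close>
  define \<rho> where "\<rho> = 1 / Suc n / 2"
  have \<rho>: "0 < \<rho>" "?F (2 * \<rho>) < ennreal (\<epsilon> / 32)" proof -
    have "2 * (x / 2) = x" for x :: real by simp
    then have "2 * \<rho> = 1 / Suc n" unfolding \<rho>_def .
    with n show "?F (2 * \<rho>) < ennreal (\<epsilon> / 32)" by (simp only:)
  qed (simp add: \<rho>_def)
  obtain c0 where c0: "0 < c0" "\<And>x. \<rho> \<le> norm x \<Longrightarrow> c0 \<le> \<tau> x" using norm_ge_imp_\<tau>_ge[OF \<rho>(1)] by blast
  obtain \<eta> I where \<eta>: "\<eta> > 0" and I: "I < \<infinity>" "\<And>h. \<tau> h \<le> \<eta> * c0 \<Longrightarrow>
    (\<integral>\<^sup>+s. ennreal (wgt \<alpha> (norm (ma_kernel \<phi> B h s))) * indicator {s. c0 \<le> \<tau> s} s \<partial>lborel) \<le> ennreal (\<tau> h powr (2 * \<beta>)) * I"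
    using ma_kernel_far c0(1) by blast
  define i where "i = enn2real I"
  have i: "I = ennreal i" "0 \<le> i" using I(1) by (simp_all add: i_def)
  \<comment> \<open>The first entry keeps h in the range of the far estimate; the second makes
    \<tau> h to the power 2 \<beta>, times i, at most \<epsilon>/4. Adding 1 to i avoids division by
    0.\<close>
  define e where "e = min (\<eta> * c0) ((\<epsilon> / (4 * (i + 1))) powr (1 / (2 * \<beta>)))"
  have e: "0 < e" using \<eta> c0 assms i by (simp add: e_def)
  obtain d where d: "d > 0" "\<And>h. norm h < d \<Longrightarrow> \<tau> h < e" using \<tau>_small[OF e] by blast
  have "(\<integral>\<^sup>+s. ennreal (wgt \<alpha> (norm (ma_kernel \<phi> B h s))) \<partial>lborel) < ennreal \<epsilon>" if h: "norm h < min d \<rho>" for h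
  proof -
    let ?k = "\<lambda>s. ennreal (wgt \<alpha> (norm (ma_kernel \<phi> B h s)))"
    have \<tau>h: "\<tau> h < e" using d(2)[of h] h by simp
    have "\<tau> h powr (2 * \<beta>) \<le> ((\<epsilon> / (4 * (i + 1))) powr (1 / (2 * \<beta>))) powr (2 * \<beta>)"
      using \<tau>h \<beta> by (intro powr_mono2 \<tau>_ge_0) (auto simp: e_def)
    also have "\<dots> = \<epsilon> / (4 * (i + 1))" using \<beta> assms i by (simp add: powr_powr)
    finally have p: "\<tau> h powr (2 * \<beta>) * i \<le> \<epsilon> / 4"
      using i assms by (simp add: field_simps) (smt (verit) mult_left_mono mult_nonneg_nonneg powr_ge_zero)
    have "(\<integral>\<^sup>+s. ?k s * indicator {s. c0 \<le> \<tau> s} s \<partial>lborel) \<le> ennreal (\<tau> h powr (2 * \<beta>)) * I"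
      using \<tau>h by (intro I(2)) (simp add: e_def)
    also have "\<dots> \<le> ennreal (\<epsilon> / 4)" using p i by (simp add: ennreal_leI flip: ennreal_mult)
    finally have far: "(\<integral>\<^sup>+s. ?k s * indicator {s. c0 \<le> \<tau> s} s \<partial>lborel) \<le> ennreal (\<epsilon> / 4)" .
    have "(\<integral>\<^sup>+s. ?k s * indicator {s. \<not> c0 \<le> \<tau> s} s \<partial>lborel) \<le> 8 * ?F (\<rho> + norm h)"
    proof (rule ma_kernel_near)
      show "{s. \<not> c0 \<le> \<tau> s} \<subseteq> cball 0 \<rho>" using c0(2) by (auto simp: not_le[symmetric] intro: less_imp_le ccontr)
      show "{s. \<not> c0 \<le> \<tau> s} \<in> sets borel" by measurable
    qed
    also have "8 * ?F (\<rho> + norm h) \<le> 8 * ?F (2 * \<rho>)"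
      using h by (intro mult_left_mono nn_integral_mono) (auto simp: indicator_def)
    also have "8 * ?F (2 * \<rho>) \<le> 8 * ennreal (\<epsilon> / 32)" using \<rho> by (intro mult_left_mono) auto
    also have "\<dots> = ennreal (\<epsilon> / 4)" using assms by (subst ennreal_numeral[symmetric], subst ennreal_mult[symmetric]) auto
    finally have near: "(\<integral>\<^sup>+s. ?k s * indicator {s. \<not> c0 \<le> \<tau> s} s \<partial>lborel) \<le> ennreal (\<epsilon> / 4)" .
    have "(\<integral>\<^sup>+s. ?k s \<partial>lborel) \<le> ennreal (\<epsilon> / 4) + ennreal (\<epsilon> / 4)"
      by (subst nn_integral_indicator_split[where P = "\<lambda>s. c0 \<le> \<tau> s"]) (auto intro!: add_mono far near)
    also have "\<dots> = ennreal (\<epsilon> / 2)" using assms by (simp flip: ennreal_plus)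
    also have "\<dots> < ennreal \<epsilon>" using assms by (simp add: ennreal_lessI)
    finally show ?thesis .
  qed
  moreover have "0 < min d \<rho>" using d \<rho> by simp
  ultimately show ?thesis by blast
qed

end

section \<open>The exponentially tempered Levy measure\<close>

lemma sphere_measure_space: "sphere_measure \<sigma> \<Longrightarrow> space \<sigma> = sphere 0 1"
  using sets_eq_imp_space_eq[of \<sigma> "restrict_space borel (sphere 0 1)"]
  by (simp add: sphere_measure_def space_restrict_space)

lemma nn_integral_polar_measure:
  fixes \<sigma> :: "'a::euclidean_space measure"
  assumes \<sigma>: "sphere_measure \<sigma>"
    and q: "(\<lambda>(r, \<theta>). q r \<theta>) \<in>
              borel_measurable (restrict_space borel {0<..} \<Otimes>\<^sub>M restrict_space borel (sphere 0 1))"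
    and f[measurable]: "f \<in> borel_measurable borel"
  shows "(\<integral>\<^sup>+x. f x \<partial>polar_measure \<alpha> q \<sigma>) =
    (\<integral>\<^sup>+\<theta>. (\<integral>\<^sup>+r. ennreal (r powr (- \<alpha> - 1) * q r \<theta>) * f (r *\<^sub>R \<theta>)
       * indicator {0<..} r \<partial>lborel) \<partial>\<sigma>)"
proof -
  let ?L = "restrict_space lborel {0<..} :: real measure"
  interpret S: finite_measure \<sigma> using \<sigma> by (simp add: sphere_measure_def)
  interpret L: sigma_finite_measure ?L
    by (intro sigma_finite_measure_restrict_space sigma_finite_lborel) simp
  interpret P: pair_sigma_finite ?L \<sigma> ..
  have sets_\<sigma>: "sets \<sigma> = sets (restrict_space borel (sphere 0 1))"
    using \<sigma> by (simp add: sphere_measure_def)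
  have sets_L: "sets ?L = sets (restrict_space borel {0<..})"
    by (simp add: sets_restrict_space)
  have [measurable_cong]:
    "sets (?L \<Otimes>\<^sub>M \<sigma>) = sets (restrict_space borel {0<..} \<Otimes>\<^sub>M restrict_space borel (sphere 0 1))"
    by (intro sets_pair_measure_cong sets_\<sigma> sets_L)
  have q': "(\<lambda>(r, \<theta>). q r \<theta>) \<in> borel_measurable (?L \<Otimes>\<^sub>M \<sigma>)"
    using q measurable_cong_sets[OF _ refl] by measurable
  have f1: "fst \<in> borel_measurable (?L \<Otimes>\<^sub>M \<sigma>)"
    by (rule measurable_compose[OF measurable_fst]) (simp add: measurable_restrict_space1)
  have f2': "(\<lambda>x. x) \<in> borel_measurable \<sigma>"
    using measurable_cong_sets[OF sets_\<sigma> refl, of borel] measurable_restrict_space1[of "\<lambda>x. x" borel borel]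
    by auto
  have f2: "snd \<in> borel_measurable (?L \<Otimes>\<^sub>M \<sigma>)"
    by (rule measurable_compose[OF measurable_snd f2'])
  have m: "(\<lambda>(r, \<theta>). r *\<^sub>R \<theta>) \<in> borel_measurable (?L \<Otimes>\<^sub>M \<sigma>)"
    using f1 f2 by (simp add: split_beta')
  have d: "(\<lambda>(r, \<theta>). ennreal (r powr (- \<alpha> - 1) * q r \<theta>)) \<in> borel_measurable (?L \<Otimes>\<^sub>M \<sigma>)"
    using f1 q' by (simp add: split_beta')
  have i: "(\<lambda>x. f (fst x *\<^sub>R snd x)) \<in> borel_measurable (?L \<Otimes>\<^sub>M \<sigma>)"
    by (rule measurable_compose[OF m[unfolded split_beta'] f])
  have "(\<integral>\<^sup>+x. f x \<partial>polar_measure \<alpha> q \<sigma>) = (\<integral>\<^sup>+x. ennreal (fst x powr (- \<alpha> - 1) * q (fst x) (snd x)) *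
      f (fst x *\<^sub>R snd x) \<partial>(?L \<Otimes>\<^sub>M \<sigma>))"
    unfolding polar_measure_def using m d i
    by (subst nn_integral_distr) (auto simp: nn_integral_density split_beta')
  also have "\<dots> = (\<integral>\<^sup>+\<theta>. \<integral>\<^sup>+r. ennreal (r powr (- \<alpha> - 1) * q r \<theta>) * f (r *\<^sub>R \<theta>) \<partial>?L \<partial>\<sigma>)"
    using d i by (subst P.nn_integral_snd[symmetric]) (auto simp: split_beta')
  also have "\<dots> = (\<integral>\<^sup>+\<theta>. (\<integral>\<^sup>+r. ennreal (r powr (- \<alpha> - 1) * q r \<theta>) * f (r *\<^sub>R \<theta>)
       * indicator {0<..} r \<partial>lborel) \<partial>\<sigma>)"
    by (simp add: nn_integral_restrict_space)
  finally show ?thesis .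
qed

text \<open>Near 0 the integrand is r^(1 - \<alpha>), integrable as \<alpha> < 2; beyond 1 it is
  r^(-\<alpha> - 1), integrable as \<alpha> > 0.\<close>

lemma radial_integral_finite:
  assumes "0 < \<alpha>" "\<alpha> < 2"
  shows "(\<integral>\<^sup>+r. ennreal (r powr (- \<alpha> - 1) * min 1 (r\<^sup>2)) * indicator {0<..} r \<partial>lborel) < \<infinity>"
proof -
  have 1: "(\<integral>\<^sup>+r. ennreal (r powr (1 - \<alpha>)) * indicator {0..1} r \<partial>lborel) < \<infinity>"
  proof -
    have "((\<lambda>r. r powr (1 - \<alpha>)) has_integral (1 powr (1 - \<alpha> + 1) / (1 - \<alpha> + 1))) {0..1}"
      using assms by (intro has_integral_powr_from_0) auto
    from nn_integral_has_integral_lebesgue'[OF _ this] show ?thesis by simp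
  qed
  have 2: "(\<integral>\<^sup>+r. ennreal (r powr (- \<alpha> - 1)) * indicator {1..} r \<partial>lborel) < \<infinity>"
  proof -
    have "((\<lambda>r. r powr (- \<alpha> - 1)) has_integral (- (1 powr (- \<alpha> - 1 + 1)) / (- \<alpha> - 1 + 1))) {1..}"
      using assms by (intro has_integral_powr_to_inf) auto
    from nn_integral_has_integral_lebesgue'[OF _ this] show ?thesis by simp
  qed
  have "(\<integral>\<^sup>+r. ennreal (r powr (- \<alpha> - 1) * min 1 (r\<^sup>2)) * indicator {0<..} r \<partial>lborel)
    \<le> (\<integral>\<^sup>+r. ennreal (r powr (1 - \<alpha>)) * indicator {0..1} r + ennreal (r powr (- \<alpha> - 1)) * indicator {1..} r \<partial>lborel)"
  proof (rule nn_integral_mono)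
    fix r :: real
    show "ennreal (r powr (- \<alpha> - 1) * min 1 (r\<^sup>2)) * indicator {0<..} r \<le>
      ennreal (r powr (1 - \<alpha>)) * indicator {0..1} r + ennreal (r powr (- \<alpha> - 1)) * indicator {1..} r"
    proof (cases "0 < r")
      case r: True
      show ?thesis
      proof (cases "r \<le> 1")
        case True
        have "r powr (1 - \<alpha>) = r powr (- \<alpha> - 1) * r powr 2" by (simp flip: powr_add)
        then have "r powr (- \<alpha> - 1) * min 1 (r\<^sup>2) \<le> r powr (1 - \<alpha>)"
          using r True by (simp add: mult_left_mono)
        then show ?thesis using r True by (simp add: ennreal_leI add_increasing2)
      next
        case False
        then have "r powr (- \<alpha> - 1) * min 1 (r\<^sup>2) \<le> r powr (- \<alpha> - 1)"
          by (simp add: mult_left_le)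
        then show ?thesis using r False by (simp add: ennreal_leI add_increasing)
      qed
    qed simp
  qed
  also have "\<dots> < \<infinity>" using 1 2 by (subst nn_integral_add) auto
  finally show ?thesis .
qed

locale tempered_levy =
  fixes \<alpha> lam :: real and \<sigma> :: "(real^'d) measure"
  assumes \<alpha>: "0 < \<alpha>" "\<alpha> < 2" and lam: "0 < lam" and \<sigma>: "sphere_measure \<sigma>"
    and sym: "distr \<sigma> \<sigma> uminus = \<sigma>"
    and nondeg: "\<And>V. subspace V \<Longrightarrow> dim V = CARD('d) - 1 \<Longrightarrow> 0 < emeasure \<sigma> (sphere 0 1 - V)"
begin

sublocale S: finite_measure \<sigma> using \<sigma> by (simp add: sphere_measure_def)

lemma sets_\<sigma>: "sets \<sigma> = sets (restrict_space borel (sphere 0 1))" and space_\<sigma>: "space \<sigma> = sphere 0 1"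
  using \<sigma> sphere_measure_space by (auto simp: sphere_measure_def)

abbreviation "\<Phi> \<equiv> phi_exp \<alpha> lam \<sigma>"
abbreviation "\<psi> \<equiv> psi_exp \<alpha> lam \<sigma>"

lemma sets_\<Phi> [measurable_cong, simp]: "sets \<Phi> = sets borel" and space_\<Phi> [simp]: "space \<Phi> = UNIV"
  by (simp_all add: phi_exp_def polar_measure_def)

lemma nn_integral_\<Phi>:
  assumes "f \<in> borel_measurable borel"
  shows "(\<integral>\<^sup>+x. f x \<partial>\<Phi>) = (\<integral>\<^sup>+\<theta>. (\<integral>\<^sup>+r. ennreal (r powr (- \<alpha> - 1) * exp (- lam * r)) * f (r *\<^sub>R \<theta>) * indicator {0<..} r \<partial>lborel) \<partial>\<sigma>)"
  unfolding phi_exp_def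
proof (rule nn_integral_polar_measure[OF \<sigma> _ assms])
  have [measurable]: "(\<lambda>r. r) \<in> borel_measurable (restrict_space borel {0<..})" by (rule measurable_restrict_space1) simp
  show "(\<lambda>(r, \<theta>). exp (- lam * r)) \<in> borel_measurable (restrict_space borel {0<..} \<Otimes>\<^sub>M restrict_space borel (sphere 0 1))"
    by measurable
qed

lemma emeasure_\<Phi>_0: "emeasure \<Phi> {0} = 0"
proof -
  have "emeasure \<Phi> {0} = (\<integral>\<^sup>+x. indicator {0} x \<partial>\<Phi>)" by simp
  also have "\<dots> = (\<integral>\<^sup>+\<theta>. (\<integral>\<^sup>+r. ennreal (r powr (- \<alpha> - 1) * exp (- lam * r)) * indicator {0} (r *\<^sub>R \<theta>) * indicator {0<..} r \<partial>lborel) \<partial>\<sigma>)"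
    by (rule nn_integral_\<Phi>) simp
  also have "\<dots> = (\<integral>\<^sup>+\<theta>. (\<integral>\<^sup>+r. 0 \<partial>(lborel :: real measure)) \<partial>\<sigma>)"
  proof (intro nn_integral_cong)
    fix \<theta> and r :: real assume "\<theta> \<in> space \<sigma>" and "r \<in> space lborel"
    then have "\<theta> \<noteq> 0" by (auto simp: space_\<sigma>)
    then show "ennreal (r powr (- \<alpha> - 1) * exp (- lam * r)) * indicator {0} (r *\<^sub>R \<theta>) * indicator {0<..} r = 0"
      by (simp add: indicator_def)
  qed
  finally show ?thesis by simp
qed

text \<open>Two estimates of one integral. Dropping the exponential and substituting a r gives a
  multiple of a^\<alpha>; bounding the minimum by a^2 r^2 and using the exponential to tame large r
  gives a multiple of a^2. Together they give \<open>wgt\<close>.\<close>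

lemma radial_bound: "\<exists>C\<ge>0. \<forall>a\<ge>0. (\<integral>\<^sup>+r. ennreal (r powr (- \<alpha> - 1) * exp (- lam * r)) * ennreal (min 1 (a\<^sup>2 * r\<^sup>2)) * indicator {0<..} r \<partial>lborel)
   \<le> ennreal (C * wgt \<alpha> a)"
proof -
  let ?g = "\<lambda>r. ennreal (r powr (- \<alpha> - 1) * min 1 (r\<^sup>2)) * indicator {0<..} r"
  define c where "c = enn2real (\<integral>\<^sup>+r. ?g r \<partial>lborel)"
  have c: "(\<integral>\<^sup>+r. ?g r \<partial>lborel) = ennreal c" "0 \<le> c" using radial_integral_finite[OF \<alpha>] by (simp_all add: c_def)
  let ?J = "\<lambda>a. \<integral>\<^sup>+r. ennreal (r powr (- \<alpha> - 1) * exp (- lam * r)) * ennreal (min 1 (a\<^sup>2 * r\<^sup>2)) * indicator {0<..} r \<partial>lborel"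
  \<comment> \<open>From exp x \<ge> x^2 / 2 with x = lam r one gets exp (-lam r) r^2 \<le> 2 /
    lam^2; the 1 serves for r \<le> 1.\<close>
  define e where "e = max 1 (2 / lam\<^sup>2)"
  have e: "1 \<le> e" by (simp add: e_def)
  have J1: "?J a \<le> ennreal (a powr \<alpha> * c)" if a: "0 < a" for a
  proof -
    have "?J a \<le> (\<integral>\<^sup>+r. ennreal (a powr (\<alpha> + 1)) * ?g (0 + a * r) \<partial>lborel)"
    proof (rule nn_integral_mono)
      fix r :: real
      show "ennreal (r powr (- \<alpha> - 1) * exp (- lam * r)) * ennreal (min 1 (a\<^sup>2 * r\<^sup>2)) * indicator {0<..} r \<le> ennreal (a powr (\<alpha> + 1)) * ?g (0 + a * r)"
      proof (cases "0 < r")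
        case True
        have "r powr (- \<alpha> - 1) * exp (- lam * r) * min 1 (a\<^sup>2 * r\<^sup>2) \<le> r powr (- \<alpha> - 1) * 1 * min 1 (a\<^sup>2 * r\<^sup>2)"
          using lam True by (intro mult_right_mono mult_left_mono) auto
        also have "\<dots> = a powr (\<alpha> + 1) * ((a * r) powr (- \<alpha> - 1) * min 1 ((a * r)\<^sup>2))"
        proof -
          have "a powr (\<alpha> + 1) * a powr (- \<alpha> - 1) = 1" using a by (simp flip: powr_add)
          then show ?thesis using a True by (simp add: powr_mult power_mult_distrib mult.assoc[symmetric])
        qed
        finally show ?thesis using True a by (simp add: ennreal_leI flip: ennreal_mult')
      qed simp
    qed
    also have "\<dots> = ennreal (a powr (\<alpha> + 1)) * (\<integral>\<^sup>+r. ?g (0 + a * r) \<partial>lborel)"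
      by (rule nn_integral_cmult) measurable
    also have "(\<integral>\<^sup>+r. ?g (0 + a * r) \<partial>lborel) = ennreal (c / a)"
    proof -
      have "ennreal c = ennreal a * (\<integral>\<^sup>+r. ?g (0 + a * r) \<partial>lborel)"
        using nn_integral_real_affine[of ?g a 0] a c by simp
      then have "ennreal (1 / a) * ennreal c = (\<integral>\<^sup>+r. ?g (0 + a * r) \<partial>lborel)"
        using a by (simp add: mult.assoc[symmetric] ennreal_mult'[symmetric])
      then show ?thesis using a c by (simp add: ennreal_mult'[symmetric])
    qed
    also have "ennreal (a powr (\<alpha> + 1)) * ennreal (c / a) = ennreal (a powr \<alpha> * c)"
      using a by (simp add: ennreal_mult'[symmetric] powr_add)
    finally show ?thesis .
  qed
  have J2: "?J a \<le> ennreal (a\<^sup>2 * (e * c))" if a: "0 \<le> a" for a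
  proof -
    have "?J a \<le> (\<integral>\<^sup>+r. ennreal (a\<^sup>2 * e) * ?g r \<partial>lborel)"
    proof (rule nn_integral_mono)
      fix r :: real
      show "ennreal (r powr (- \<alpha> - 1) * exp (- lam * r)) * ennreal (min 1 (a\<^sup>2 * r\<^sup>2)) * indicator {0<..} r \<le> ennreal (a\<^sup>2 * e) * ?g r"
      proof (cases "0 < r")
        case True
        have "exp (- lam * r) * r\<^sup>2 \<le> e * min 1 (r\<^sup>2)"
        proof (cases "r \<le> 1")
          case True
          with \<open>0 < r\<close> have "r\<^sup>2 \<le> 1" by (simp add: power_le_one)
          moreover have "exp (- lam * r) * r\<^sup>2 \<le> 1 * r\<^sup>2" using lam \<open>0 < r\<close> by (intro mult_right_mono) auto
          moreover have "1 * r\<^sup>2 \<le> e * r\<^sup>2" using e by (intro mult_right_mono) auto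
          ultimately show ?thesis by (simp add: min_def)
        next
          case False
          have "0 \<le> lam * r" using lam True by simp
          then have "(lam * r)\<^sup>2 / 2 \<le> exp (lam * r)" using exp_lower_Taylor_quadratic[of "lam * r"] by linarith
          then have "exp (- lam * r) * ((lam * r)\<^sup>2 / 2) \<le> 1" by (simp add: exp_minus field_simps)
          then have "exp (- lam * r) * r\<^sup>2 \<le> 2 / lam\<^sup>2" using lam by (simp add: field_simps)
          then have "exp (- lam * r) * r\<^sup>2 \<le> e" by (simp add: e_def)
          moreover have "1 \<le> r\<^sup>2" using False by simp
          ultimately show ?thesis by (simp add: min_def)
        qed
        then have "r powr (- \<alpha> - 1) * a\<^sup>2 * (exp (- lam * r) * r\<^sup>2) \<le> r powr (- \<alpha> - 1) * a\<^sup>2 * (e * min 1 (r\<^sup>2))"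
          by (intro mult_left_mono) auto
        moreover have "r powr (- \<alpha> - 1) * exp (- lam * r) * min 1 (a\<^sup>2 * r\<^sup>2) \<le> r powr (- \<alpha> - 1) * exp (- lam * r) * (a\<^sup>2 * r\<^sup>2)"
          by (intro mult_left_mono) auto
        moreover have "r powr (- \<alpha> - 1) * exp (- lam * r) * (a\<^sup>2 * r\<^sup>2) = r powr (- \<alpha> - 1) * a\<^sup>2 * (exp (- lam * r) * r\<^sup>2)"
          "r powr (- \<alpha> - 1) * a\<^sup>2 * (e * min 1 (r\<^sup>2)) = a\<^sup>2 * e * (r powr (- \<alpha> - 1) * min 1 (r\<^sup>2))"
          by (simp_all only: mult_ac)
        ultimately have "r powr (- \<alpha> - 1) * exp (- lam * r) * min 1 (a\<^sup>2 * r\<^sup>2) \<le> a\<^sup>2 * e * (r powr (- \<alpha> - 1) * min 1 (r\<^sup>2))"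
          by linarith
        then show ?thesis using True e by (simp add: ennreal_leI flip: ennreal_mult')
      qed simp
    qed
    also have "\<dots> = ennreal (a\<^sup>2 * e) * ennreal c"
      by (subst nn_integral_cmult) (use c in auto)
    finally show ?thesis using e by (simp add: ennreal_mult'[symmetric] mult.assoc)
  qed
  have "?J a \<le> ennreal (e * c * wgt \<alpha> a)" if "0 \<le> a" for a
  proof (cases "a = 0")
    case False
    then have a: "0 < a" using that by simp
    show ?thesis
    proof (cases "a\<^sup>2 \<le> a powr \<alpha>")
      case True
      then show ?thesis using J2[of a] a by (simp add: wgt_def mult_ac)
    next
      case False
      have "a powr \<alpha> * c \<le> a powr \<alpha> * (e * c)" using c e by (intro mult_left_mono) (auto simp: mult_right_mono[of 1 e c, simplified])
      with False J1[OF a] show ?thesis by (simp add: wgt_def mult_ac) (meson ennreal_leI order_trans)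
    qed
  qed simp
  then show ?thesis using e c by (intro exI[of _ "e * c"]) auto
qed

lemma \<Phi>_bound: "\<exists>C\<ge>0. \<forall>a\<ge>0. (\<integral>\<^sup>+x. ennreal (min 1 (a\<^sup>2 * (norm x)\<^sup>2)) \<partial>\<Phi>) \<le> ennreal (C * wgt \<alpha> a)"
proof -
  obtain C where C: "C \<ge> 0" "\<And>a. 0 \<le> a \<Longrightarrow> (\<integral>\<^sup>+r. ennreal (r powr (- \<alpha> - 1) * exp (- lam * r)) * ennreal (min 1 (a\<^sup>2 * r\<^sup>2)) * indicator {0<..} r \<partial>lborel)
   \<le> ennreal (C * wgt \<alpha> a)" using radial_bound by blast
  have "(\<integral>\<^sup>+x. ennreal (min 1 (a\<^sup>2 * (norm x)\<^sup>2)) \<partial>\<Phi>) \<le> ennreal (measure \<sigma> (sphere 0 1) * C * wgt \<alpha> a)" if a: "0 \<le> a" for a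
  proof -
    have "(\<integral>\<^sup>+x. ennreal (min 1 (a\<^sup>2 * (norm x)\<^sup>2)) \<partial>\<Phi>) =
       (\<integral>\<^sup>+\<theta>. (\<integral>\<^sup>+r. ennreal (r powr (- \<alpha> - 1) * exp (- lam * r)) * ennreal (min 1 (a\<^sup>2 * (norm (r *\<^sub>R \<theta>))\<^sup>2)) * indicator {0<..} r \<partial>lborel) \<partial>\<sigma>)"
      by (rule nn_integral_\<Phi>) measurable
    also have "\<dots> \<le> (\<integral>\<^sup>+\<theta>. ennreal (C * wgt \<alpha> a) \<partial>\<sigma>)"
    proof (rule nn_integral_mono)
      fix \<theta> assume "\<theta> \<in> space \<sigma>"
      then have "norm \<theta> = 1" by (simp add: space_\<sigma>)
      then show "(\<integral>\<^sup>+r. ennreal (r powr (- \<alpha> - 1) * exp (- lam * r)) * ennreal (min 1 (a\<^sup>2 * (norm (r *\<^sub>R \<theta>))\<^sup>2)) * indicator {0<..} r \<partial>lborel) \<le> ennreal (C * wgt \<alpha> a)"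
        using C(2)[OF a] by simp
    qed
    also have "\<dots> = ennreal (measure \<sigma> (sphere 0 1) * C * wgt \<alpha> a)"
      using C(1) by (simp add: space_\<sigma>[symmetric] S.emeasure_eq_measure ennreal_mult'[symmetric] mult_ac)
    finally show ?thesis .
  qed
  then show ?thesis using C(1) by (intro exI[of _ "measure \<sigma> (sphere 0 1) * C"]) auto
qed

text \<open>Fixing one constant by choice lets all later bounds, including the tail constant, refer
  to the same number.\<close>

definition C\<Phi> :: real where
  "C\<Phi> = (SOME C. C \<ge> 0 \<and> (\<forall>a\<ge>0. (\<integral>\<^sup>+x. ennreal (min 1 (a\<^sup>2 * (norm x)\<^sup>2)) \<partial>\<Phi>) \<le> ennreal (C * wgt \<alpha> a)))"

lemma C\<Phi>: "0 \<le> C\<Phi>" "0 \<le> a \<Longrightarrow> (\<integral>\<^sup>+x. ennreal (min 1 (a\<^sup>2 * (norm x)\<^sup>2)) \<partial>\<Phi>) \<le> ennreal (C\<Phi> * wgt \<alpha> a)"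
  using someI_ex[OF \<Phi>_bound] unfolding C\<Phi>_def[symmetric] by blast+

text \<open>The origin is a null set and the complements of balls around it have finite mass by the
  bound for the truncated second moment. This provides measurability of \<psi>, which is an integral
  with a parameter.\<close>

sublocale \<Phi>: sigma_finite_measure \<Phi>
proof
  let ?A = "insert {0} (range (\<lambda>n. {x::real^'d. 1 / Suc n \<le> norm x}))"
  have m: "{x::real^'d. 1 / Suc n \<le> norm x} \<in> sets borel" for n by measurable
  have fin: "emeasure \<Phi> {x. 1 / Suc n \<le> norm x} < \<infinity>" for n
  proof -
    have "emeasure \<Phi> {x. 1 / Suc n \<le> norm x} = (\<integral>\<^sup>+x. indicator {x. 1 / Suc n \<le> norm x} x \<partial>\<Phi>)" using m by simp
    also have "\<dots> \<le> (\<integral>\<^sup>+x. ennreal (min 1 ((real (Suc n))\<^sup>2 * (norm x)\<^sup>2)) \<partial>\<Phi>)"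
    proof (rule nn_integral_mono)
      fix x :: "real^'d"
      show "indicator {x. 1 / Suc n \<le> norm x} x \<le> ennreal (min 1 ((real (Suc n))\<^sup>2 * (norm x)\<^sup>2))"
      proof (cases "1 / Suc n \<le> norm x")
        case True
        then have "1 \<le> real (Suc n) * norm x" by (simp add: field_simps)
        then have "1 \<le> (real (Suc n) * norm x)\<^sup>2" by (rule one_le_power)
        then show ?thesis using True by (simp add: power_mult_distrib)
      qed simp
    qed
    also have "\<dots> \<le> ennreal (C\<Phi> * wgt \<alpha> (Suc n))" by (rule C\<Phi>) simp
    finally show ?thesis by (simp add: le_less_trans)
  qed
  have "x \<in> \<Union> ?A" for x
  proof (cases "x = 0")
    case False
    then obtain n where "inverse (Suc n) < norm x" using reals_Archimedean[of "norm x"] by auto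
    then show ?thesis by (auto simp: inverse_eq_divide intro!: exI[of _ n])
  qed auto
  then have "\<Union> ?A = space \<Phi>" by auto
  moreover have "emeasure \<Phi> a \<noteq> \<infinity>" if "a \<in> ?A" for a
  proof -
    from that consider "a = {0}" | n where "a = {x. 1 / Suc n \<le> norm x}" by blast
    then show ?thesis using fin by cases (simp_all only: emeasure_\<Phi>_0 less_top infinity_ennreal_def, simp)
  qed
  moreover have "?A \<subseteq> sets \<Phi>" using m by auto
  ultimately show "\<exists>A. countable A \<and> A \<subseteq> sets \<Phi> \<and> \<Union>A = space \<Phi> \<and> (\<forall>a\<in>A. emeasure \<Phi> a \<noteq> \<infinity>)"
    by (intro exI[of _ ?A]) blast
qed

section \<open>The characteristic exponent\<close>

lemma one_minus_cos_le: "1 - cos y \<le> 2 * min 1 (y\<^sup>2)" for y :: real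
proof -
  have "1 - cos y = 2 * (sin (y / 2))\<^sup>2" using cos_double_sin[of "y / 2"] by simp
  also have "\<dots> \<le> 2 * (y / 2)\<^sup>2"
    using abs_sin_x_le_abs_x[of "y / 2"] by (intro mult_left_mono) (simp_all only: abs_le_square_iff)
  finally have "1 - cos y \<le> y\<^sup>2 / 2" by (simp add: power_divide)
  moreover have "1 - cos y \<le> 2" using cos_ge_minus_one[of y] by linarith
  moreover have "0 \<le> y\<^sup>2" by simp
  ultimately show ?thesis by (simp only: min_def split: if_split) linarith
qed

lemma one_minus_cos_inner_le: "1 - cos (v \<bullet> x) \<le> 2 * min 1 ((norm v)\<^sup>2 * (norm x)\<^sup>2)" for v x :: "'a::real_inner"
proof -
  have "(v \<bullet> x)\<^sup>2 \<le> (norm v)\<^sup>2 * (norm x)\<^sup>2"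
    using power_mono[OF Cauchy_Schwarz_ineq2[of v x], of 2] by (simp add: power_mult_distrib)
  then show ?thesis using one_minus_cos_le[of "v \<bullet> x"] by (auto simp: min_def split: if_splits)
qed

lemma nn_integral_one_minus_cos_le: "(\<integral>\<^sup>+x. ennreal (1 - cos (v \<bullet> x)) \<partial>\<Phi>) \<le> ennreal (2 * C\<Phi> * wgt \<alpha> (norm v))"
proof -
  have "(\<integral>\<^sup>+x. ennreal (1 - cos (v \<bullet> x)) \<partial>\<Phi>) \<le> (\<integral>\<^sup>+x. ennreal 2 * ennreal (min 1 ((norm v)\<^sup>2 * (norm x)\<^sup>2)) \<partial>\<Phi>)"
    by (intro nn_integral_mono, subst ennreal_mult'[symmetric]) (auto intro!: ennreal_leI one_minus_cos_inner_le)
  also have "\<dots> = ennreal 2 * (\<integral>\<^sup>+x. ennreal (min 1 ((norm v)\<^sup>2 * (norm x)\<^sup>2)) \<partial>\<Phi>)"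
    by (rule nn_integral_cmult) measurable
  also have "\<dots> \<le> ennreal 2 * ennreal (C\<Phi> * wgt \<alpha> (norm v))" by (intro mult_left_mono C\<Phi>) auto
  also have "\<dots> = ennreal (2 * C\<Phi> * wgt \<alpha> (norm v))" by (subst ennreal_mult'[symmetric]) (auto simp: mult.assoc)
  finally show ?thesis .
qed

lemma integrable_cos: "integrable \<Phi> (\<lambda>x. cos (v \<bullet> x) - 1)"
proof (rule integrableI_bounded)
  have "norm (cos (v \<bullet> x) - 1) = 1 - cos (v \<bullet> x)" for x using cos_le_one[of "v \<bullet> x"] by simp
  then show "(\<integral>\<^sup>+x. ennreal (norm (cos (v \<bullet> x) - 1)) \<partial>\<Phi>) < \<infinity>"
    using nn_integral_one_minus_cos_le[of v] by (simp add: le_less_trans)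
qed measurable

lemma minus_\<psi>: "- \<psi> v = (\<integral>x. 1 - cos (v \<bullet> x) \<partial>\<Phi>)"
  unfolding psi_exp_def by (subst Bochner_Integration.integral_minus[symmetric]) simp

lemma integrable_one_minus_cos: "integrable \<Phi> (\<lambda>x. 1 - cos (v \<bullet> x))"
  using integrable_minus[OF integrable_cos[of v]] by simp

lemma ennreal_minus_\<psi>: "ennreal (- \<psi> v) = (\<integral>\<^sup>+x. ennreal (1 - cos (v \<bullet> x)) \<partial>\<Phi>)"
  unfolding minus_\<psi> by (rule nn_integral_eq_integral[symmetric, OF integrable_one_minus_cos]) simp

lemma \<psi>_nonpos: "\<psi> v \<le> 0"
proof -
  have "0 \<le> (\<integral>x. 1 - cos (v \<bullet> x) \<partial>\<Phi>)" by (rule Bochner_Integration.integral_nonneg) simp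
  then show ?thesis using minus_\<psi>[of v] by linarith
qed

lemma \<psi>_bound: "- \<psi> v \<le> 2 * C\<Phi> * wgt \<alpha> (norm v)"
  using nn_integral_one_minus_cos_le[of v] C\<Phi>(1) unfolding ennreal_minus_\<psi>[symmetric]
  by (subst (asm) ennreal_le_iff) auto

lemma \<psi>_0 [simp]: "\<psi> 0 = 0" by (simp add: psi_exp_def)

lemma borel_measurable_\<psi> [measurable]: "\<psi> \<in> borel_measurable borel"
proof -
  have "(\<lambda>v. \<integral>\<^sup>+x. ennreal (1 - cos (v \<bullet> x)) \<partial>\<Phi>) \<in> borel_measurable borel"
    by (rule \<Phi>.borel_measurable_nn_integral) measurable
  then have "(\<lambda>v. - enn2real (ennreal (- \<psi> v))) \<in> borel_measurable borel"
    unfolding ennreal_minus_\<psi> by measurable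
  then show ?thesis using \<psi>_nonpos by simp
qed

lemma continuous_\<psi>: assumes "v \<longlonglongrightarrow> w" shows "(\<lambda>k. \<psi> (v k)) \<longlonglongrightarrow> \<psi> w"
proof -
  obtain R where R: "\<And>k. norm (v k) \<le> R" and R0: "0 \<le> R"
    using convergent_imp_Bseq[OF convergentI[OF assms]] by (auto simp: Bseq_def intro: less_imp_le)
  show ?thesis unfolding psi_exp_def
  proof (rule integral_dominated_convergence[where w = "\<lambda>x. 2 * min 1 (R\<^sup>2 * (norm x)\<^sup>2)"])
    show "integrable \<Phi> (\<lambda>x. 2 * min 1 (R\<^sup>2 * (norm x)\<^sup>2))"
    proof (rule integrable_mult_right, rule integrableI_bounded)
      show "(\<integral>\<^sup>+x. ennreal (norm (min 1 (R\<^sup>2 * (norm x)\<^sup>2))) \<partial>\<Phi>) < \<infinity>"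
        using C\<Phi>(2)[OF R0] by (simp add: le_less_trans)
    qed measurable
    show "AE x in \<Phi>. (\<lambda>k. cos (v k \<bullet> x) - 1) \<longlonglongrightarrow> cos (w \<bullet> x) - 1"
      by (intro AE_I2 tendsto_intros assms)
    show "AE x in \<Phi>. norm (cos (v k \<bullet> x) - 1) \<le> 2 * min 1 (R\<^sup>2 * (norm x)\<^sup>2)" for k
    proof (rule AE_I2)
      fix x
      have "norm (cos (v k \<bullet> x) - 1) = 1 - cos (v k \<bullet> x)" using cos_le_one[of "v k \<bullet> x"] by simp
      also have "\<dots> \<le> 2 * min 1 ((norm (v k))\<^sup>2 * (norm x)\<^sup>2)" by (rule one_minus_cos_inner_le)
      also have "\<dots> \<le> 2 * min 1 (R\<^sup>2 * (norm x)\<^sup>2)"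
        by (intro mult_left_mono min.mono mult_right_mono power_mono R) auto
      finally show "norm (cos (v k \<bullet> x) - 1) \<le> 2 * min 1 (R\<^sup>2 * (norm x)\<^sup>2)" .
    qed
  qed measurable
qed

text \<open>If v were nonzero, \<sigma> would charge the directions off the hyperplane orthogonal to
  v. Along such a direction \<theta> the integrand is positive for 0 < r < \<pi> / |v \<bullet>
  \<theta>|, an interval of positive length, so the integral could not vanish.\<close>

lemma \<psi>_eq_0_imp: assumes "\<psi> v = 0" shows "v = 0"
proof (rule ccontr)
  assume v: "v \<noteq> 0"
  let ?V = "{x. v \<bullet> x = 0}"
  have V: "0 < emeasure \<sigma> (sphere 0 1 - ?V)"
    using v by (intro nondeg subspace_hyperplane) (simp add: dim_hyperplane)
  have "(\<integral>\<^sup>+x. ennreal (1 - cos (v \<bullet> x)) \<partial>\<Phi>) = 0"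
    using ennreal_minus_\<psi>[of v] assms by simp
  then have z: "(\<integral>\<^sup>+\<theta>. (\<integral>\<^sup>+r. ennreal (r powr (- \<alpha> - 1) * exp (- lam * r)) * ennreal (1 - cos (v \<bullet> (r *\<^sub>R \<theta>))) * indicator {0<..} r \<partial>lborel) \<partial>\<sigma>) = 0"
    by (subst (asm) nn_integral_\<Phi>) auto
  have [measurable]: "(\<lambda>x. x) \<in> borel_measurable \<sigma>"
    using measurable_cong_sets[OF sets_\<sigma> refl, of borel] measurable_restrict_space1[of "\<lambda>x. x" borel borel] by auto
  have ae\<theta>: "AE \<theta> in \<sigma>. (\<integral>\<^sup>+r. ennreal (r powr (- \<alpha> - 1) * exp (- lam * r)) * ennreal (1 - cos (v \<bullet> (r *\<^sub>R \<theta>))) * indicator {0<..} r \<partial>lborel) = 0"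
    using z by (subst (asm) nn_integral_0_iff_AE) measurable
  have nz: "(\<integral>\<^sup>+r. ennreal (r powr (- \<alpha> - 1) * exp (- lam * r)) * ennreal (1 - cos (v \<bullet> (r *\<^sub>R \<theta>))) * indicator {0<..} r \<partial>lborel) \<noteq> 0"
    if "v \<bullet> \<theta> \<noteq> 0" for \<theta>
  proof
    assume "(\<integral>\<^sup>+r. ennreal (r powr (- \<alpha> - 1) * exp (- lam * r)) * ennreal (1 - cos (v \<bullet> (r *\<^sub>R \<theta>))) * indicator {0<..} r \<partial>lborel) = 0"
    then have ae: "AE r in lborel. ennreal (r powr (- \<alpha> - 1) * exp (- lam * r)) * ennreal (1 - cos (v \<bullet> (r *\<^sub>R \<theta>))) * indicator {0<..} r = 0"
      by (subst (asm) nn_integral_0_iff_AE) measurable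
    let ?\<delta> = "pi / \<bar>v \<bullet> \<theta>\<bar>"
    have \<delta>: "0 < ?\<delta>" using that by simp
    have "AE r in lborel. r \<notin> {0<..<?\<delta>}"
      using ae
    proof (rule AE_mp, intro AE_I2 impI notI)
      fix r assume e: "ennreal (r powr (- \<alpha> - 1) * exp (- lam * r)) * ennreal (1 - cos (v \<bullet> (r *\<^sub>R \<theta>))) * indicator {0<..} r = 0"
        and r: "r \<in> {0<..<?\<delta>}"
      have "cos \<bar>r * (v \<bullet> \<theta>)\<bar> < cos 0"
      proof (rule cos_monotone_0_pi)
        show "\<bar>r * (v \<bullet> \<theta>)\<bar> \<le> pi" using r that by (simp add: abs_mult field_simps)
        show "0 < \<bar>r * (v \<bullet> \<theta>)\<bar>" using r that by simp
      qed simp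
      then have "0 < 1 - cos (v \<bullet> (r *\<^sub>R \<theta>))" by simp
      moreover have "0 < r powr (- \<alpha> - 1) * exp (- lam * r)" using r by simp
      ultimately show False using e r by (simp add: ennreal_eq_0_iff)
    qed
    then have "emeasure lborel {0<..<?\<delta>} = 0"
      by (subst (asm) AE_iff_measurable[where N = "{0<..<?\<delta>}"]) auto
    then show False using \<delta> by (simp only: emeasure_lborel_Ioo less_imp_le) simp
  qed
  have "AE \<theta> in \<sigma>. \<theta> \<in> ?V"
    by (rule AE_mp[OF ae\<theta>]) (intro AE_I2 impI, unfold mem_Collect_eq, rule ccontr, erule notE[OF nz])
  then have "emeasure \<sigma> {\<theta>\<in>space \<sigma>. \<not> \<theta> \<in> ?V} = 0"
    by (subst (asm) AE_iff_measurable[OF _ refl]) measurable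
  also have "{\<theta>\<in>space \<sigma>. \<not> \<theta> \<in> ?V} = sphere 0 1 - ?V" by (auto simp: space_\<sigma>)
  finally show False using V by simp
qed

end

section \<open>Convergence in probability\<close>

lemma norm_integral_le:
  fixes f :: "'a \<Rightarrow> 'b::{banach, second_countable_topology}"
  assumes "integrable M f" "integrable M g" "\<And>x. x \<in> space M \<Longrightarrow> norm (f x) \<le> g x"
  shows "norm (integral\<^sup>L M f) \<le> (\<integral>x. g x \<partial>M)"
  using assms by (intro order_trans[OF integral_norm_bound integral_mono]) auto

lemma norm_iexp_diff_le: "norm (iexp a - iexp b) \<le> \<bar>a - b\<bar>"
proof -
  have "iexp a - iexp b = iexp b * (iexp (a - b) - 1)"
    by (simp add: algebra_simps flip: exp_add)
  then have "norm (iexp a - iexp b) = norm (iexp (a - b) - 1)" by (simp add: norm_mult)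
  also have "\<dots> \<le> \<bar>a - b\<bar>" using iexp_approx1[of "a - b" 0] by simp
  finally show ?thesis .
qed

lemma char_fun_distr: "Y \<in> borel_measurable P \<Longrightarrow> char_fun (distr P borel Y) u = (\<integral>\<omega>. iexp (u \<bullet> Y \<omega>) \<partial>P)"
  unfolding char_fun_def by (rule integral_distr) auto

context prob_space
begin

lemma integrable_iexp:
  fixes Y :: "'a \<Rightarrow> 'b::euclidean_space"
  assumes [measurable]: "Y \<in> borel_measurable M"
  shows "integrable M (\<lambda>\<omega>. iexp (u \<bullet> Y \<omega>))"
  by (rule integrable_const_bound[where B = 1]) auto

lemma norm_expectation_iexp_diff_le:
  fixes Y Z :: "'a \<Rightarrow> 'b::euclidean_space"
  assumes [measurable]: "Y \<in> borel_measurable M" "Z \<in> borel_measurable M" and \<epsilon>: "0 \<le> \<epsilon>"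
  shows "norm ((\<integral>\<omega>. iexp (u \<bullet> Y \<omega>) \<partial>M) - (\<integral>\<omega>. iexp (u \<bullet> Z \<omega>) \<partial>M)) \<le> norm u * \<epsilon> + 2 * prob {\<omega>\<in>space M. \<epsilon> < dist (Y \<omega>) (Z \<omega>)}"
proof -
  let ?A = "{\<omega>\<in>space M. \<epsilon> < dist (Y \<omega>) (Z \<omega>)}"
  have iA: "integrable M (indicator ?A :: 'a \<Rightarrow> real)"
    by (rule integrable_real_indicator) (auto simp: emeasure_eq_measure)
  have "norm ((\<integral>\<omega>. iexp (u \<bullet> Y \<omega>) \<partial>M) - (\<integral>\<omega>. iexp (u \<bullet> Z \<omega>) \<partial>M)) = norm (\<integral>\<omega>. iexp (u \<bullet> Y \<omega>) - iexp (u \<bullet> Z \<omega>) \<partial>M)"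
    by (subst Bochner_Integration.integral_diff) (auto intro!: integrable_iexp)
  also have "\<dots> \<le> (\<integral>\<omega>. norm u * \<epsilon> + 2 * indicator ?A \<omega> \<partial>M)"
  proof (rule norm_integral_le)
    show "integrable M (\<lambda>\<omega>. iexp (u \<bullet> Y \<omega>) - iexp (u \<bullet> Z \<omega>))"
      by (intro Bochner_Integration.integrable_diff integrable_iexp) auto
    show "integrable M (\<lambda>\<omega>. norm u * \<epsilon> + 2 * indicator ?A \<omega>)"
      by (intro Bochner_Integration.integrable_add integrable_mult_right integrable_const iA)
    fix \<omega> assume \<omega>: "\<omega> \<in> space M"
    show "norm (iexp (u \<bullet> Y \<omega>) - iexp (u \<bullet> Z \<omega>)) \<le> norm u * \<epsilon> + 2 * indicator ?A \<omega>"
    proof (cases "\<omega> \<in> ?A")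
      case True
      have "norm (iexp (u \<bullet> Y \<omega>) - iexp (u \<bullet> Z \<omega>)) \<le> norm (iexp (u \<bullet> Y \<omega>)) + norm (iexp (u \<bullet> Z \<omega>))"
        by (rule norm_triangle_ineq4)
      then have "norm (iexp (u \<bullet> Y \<omega>) - iexp (u \<bullet> Z \<omega>)) \<le> 2" by (simp only: norm_exp_i_times)
      moreover have "0 \<le> norm u * \<epsilon>" using \<epsilon> by simp
      ultimately show ?thesis using True by simp
    next
      case False
      have "norm (iexp (u \<bullet> Y \<omega>) - iexp (u \<bullet> Z \<omega>)) \<le> \<bar>u \<bullet> Y \<omega> - u \<bullet> Z \<omega>\<bar>" by (rule norm_iexp_diff_le)
      also have "\<dots> = \<bar>u \<bullet> (Y \<omega> - Z \<omega>)\<bar>" by (simp add: inner_diff_right)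
      also have "\<dots> \<le> norm u * norm (Y \<omega> - Z \<omega>)" by (rule Cauchy_Schwarz_ineq2)
      also have "\<dots> \<le> norm u * \<epsilon>" using False \<omega> by (intro mult_left_mono) (auto simp: dist_norm)
      finally show ?thesis using False by simp
    qed
  qed
  also have "\<dots> = norm u * \<epsilon> + 2 * prob ?A"
    using iA by (subst Bochner_Integration.integral_add) (auto simp: prob_space)
  finally show ?thesis .
qed

lemma tendsto_in_prob_imp_cf:
  fixes Y :: "'i \<Rightarrow> 'a \<Rightarrow> 'b::euclidean_space"
  assumes meas: "\<And>i. Y i \<in> borel_measurable M" "Z \<in> borel_measurable M" and lim: "tendsto_in_prob M Y Z F"
  shows "((\<lambda>i. \<integral>\<omega>. iexp (u \<bullet> Y i \<omega>) \<partial>M) \<longlongrightarrow> (\<integral>\<omega>. iexp (u \<bullet> Z \<omega>) \<partial>M)) F"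
proof (rule tendstoI)
  fix e :: real assume e: "0 < e"
  define \<epsilon> where "\<epsilon> = e / (2 * (norm u + 1))"
  have n: "0 < norm u + 1" by (simp add: add_nonneg_pos)
  then have \<epsilon>: "0 < \<epsilon>" using e by (simp add: \<epsilon>_def)
  have "norm u * \<epsilon> \<le> (norm u + 1) * \<epsilon>" using \<epsilon> by simp
  also have "\<dots> = e / 2"
  proof -
    have "c * (e / (2 * c)) = e / 2" if "0 < c" for c :: real using that by simp
    from this[OF n] show ?thesis by (simp only: \<epsilon>_def)
  qed
  finally have u\<epsilon>: "norm u * \<epsilon> \<le> e / 2" .
  have "((\<lambda>i. prob {\<omega>\<in>space M. \<epsilon> < dist (Y i \<omega>) (Z \<omega>)}) \<longlongrightarrow> 0) F"
    using lim \<epsilon> by (simp add: tendsto_in_prob_def)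
  moreover have "0 < e / 4" using e by simp
  ultimately have "eventually (\<lambda>i. prob {\<omega>\<in>space M. \<epsilon> < dist (Y i \<omega>) (Z \<omega>)} < e / 4) F"
    by (rule order_tendstoD(2))
  then show "eventually (\<lambda>i. dist (\<integral>\<omega>. iexp (u \<bullet> Y i \<omega>) \<partial>M) (\<integral>\<omega>. iexp (u \<bullet> Z \<omega>) \<partial>M) < e) F"
  proof eventually_elim
    case (elim i)
    have "norm ((\<integral>\<omega>. iexp (u \<bullet> Y i \<omega>) \<partial>M) - (\<integral>\<omega>. iexp (u \<bullet> Z \<omega>) \<partial>M)) \<le> norm u * \<epsilon> + 2 * prob {\<omega>\<in>space M. \<epsilon> < dist (Y i \<omega>) (Z \<omega>)}"
      using \<epsilon> by (intro norm_expectation_iexp_diff_le meas) simp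
    with elim u\<epsilon> show ?case unfolding dist_norm by linarith
  qed
qed

text \<open>The difference x of the two exponentials satisfies |x|^2 = 2 (1 - cos), and |x| \<le>
  \<delta> + |x|^2 / \<delta>. Two characteristic functions are thus compared using only the
  characteristic function of the difference at the same frequency.\<close>

lemma norm_expectation_iexp_diff_le_cos:
  fixes Y Z :: "'a \<Rightarrow> 'b::euclidean_space"
  assumes [measurable]: "Y \<in> borel_measurable M" "Z \<in> borel_measurable M" and \<delta>: "0 < \<delta>"
  shows "norm ((\<integral>\<omega>. iexp (u \<bullet> Y \<omega>) \<partial>M) - (\<integral>\<omega>. iexp (u \<bullet> Z \<omega>) \<partial>M)) \<le>
    \<delta> + 2 / \<delta> * (1 - Re (\<integral>\<omega>. iexp (u \<bullet> (Y \<omega> - Z \<omega>)) \<partial>M))"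
proof -
  let ?W = "\<lambda>\<omega>. u \<bullet> (Y \<omega> - Z \<omega>)"
  have Re: "Re (\<integral>\<omega>. iexp (?W \<omega>) \<partial>M) = (\<integral>\<omega>. cos (?W \<omega>) \<partial>M)"
    using integrable_iexp[of "\<lambda>\<omega>. Y \<omega> - Z \<omega>" u] by (subst integral_Re[symmetric]) (auto simp: Re_exp)
  have icos: "integrable M (\<lambda>\<omega>. cos (?W \<omega>))" by (rule integrable_const_bound[where B = 1]) auto
  have "norm ((\<integral>\<omega>. iexp (u \<bullet> Y \<omega>) \<partial>M) - (\<integral>\<omega>. iexp (u \<bullet> Z \<omega>) \<partial>M)) = norm (\<integral>\<omega>. iexp (u \<bullet> Y \<omega>) - iexp (u \<bullet> Z \<omega>) \<partial>M)"
    by (subst Bochner_Integration.integral_diff) (auto intro!: integrable_iexp)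
  also have "\<dots> \<le> (\<integral>\<omega>. \<delta> + 2 / \<delta> * (1 - cos (?W \<omega>)) \<partial>M)"
  proof (rule norm_integral_le)
    show "integrable M (\<lambda>\<omega>. iexp (u \<bullet> Y \<omega>) - iexp (u \<bullet> Z \<omega>))"
      by (intro Bochner_Integration.integrable_diff integrable_iexp) auto
    show "integrable M (\<lambda>\<omega>. \<delta> + 2 / \<delta> * (1 - cos (?W \<omega>)))"
      using icos by (intro Bochner_Integration.integrable_add integrable_mult_right integrable_const Bochner_Integration.integrable_diff)
    fix \<omega>
    let ?x = "norm (iexp (u \<bullet> Y \<omega>) - iexp (u \<bullet> Z \<omega>))"
    have "iexp (u \<bullet> Y \<omega>) - iexp (u \<bullet> Z \<omega>) = iexp (u \<bullet> Z \<omega>) * (iexp (?W \<omega>) - 1)"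
      by (simp add: algebra_simps inner_diff_right flip: exp_add)
    then have "?x = norm (iexp (?W \<omega>) - 1)" by (simp add: norm_mult)
    then have "?x\<^sup>2 = (cos (?W \<omega>) - 1)\<^sup>2 + (sin (?W \<omega>))\<^sup>2" by (simp add: cmod_power2 Re_exp Im_exp)
    also have "\<dots> = 2 * (1 - cos (?W \<omega>))"
      using sin_cos_squared_add[of "?W \<omega>"] by (simp add: power2_diff algebra_simps)
    finally have sq: "?x\<^sup>2 = 2 * (1 - cos (?W \<omega>))" .
    have "?x \<le> \<delta> + ?x\<^sup>2 / \<delta>"
    proof (cases "?x \<le> \<delta>")
      case True then show ?thesis using \<delta> by (simp add: add_increasing2)
    next
      case False
      then have "?x * \<delta> \<le> ?x * ?x" by (intro mult_left_mono) auto
      then have "?x \<le> ?x\<^sup>2 / \<delta>" using \<delta> by (simp add: field_simps power2_eq_square)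
      with \<delta> show ?thesis by simp
    qed
    then show "?x \<le> \<delta> + 2 / \<delta> * (1 - cos (?W \<omega>))" unfolding sq by simp
  qed
  also have "\<dots> = \<delta> + 2 / \<delta> * (1 - Re (\<integral>\<omega>. iexp (?W \<omega>) \<partial>M))"
    using icos by (simp add: Re prob_space)
  finally show ?thesis .
qed

text \<open>A Laplace transform with an explicit antiderivative. It represents y^2 / (1 + y^2), a
  smooth substitute for the indicator of large |y|, by cosines, and so turns bounds on
  characteristic functions into tail bounds.\<close>

lemma nn_integral_exp_one_minus_cos:
  "(\<integral>\<^sup>+t. ennreal (exp (- t) * (1 - cos (t * y))) * indicator {0..} t \<partial>lborel) = ennreal (y\<^sup>2 / (1 + y\<^sup>2))"
proof -
  let ?F = "\<lambda>t. - exp (- t) + exp (- t) * (cos (t * y) - y * sin (t * y)) / (1 + y\<^sup>2)"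
  have p: "0 < 1 + y\<^sup>2" by (simp add: add_pos_nonneg)
  have "(\<integral>\<^sup>+t. ennreal (exp (- t) * (1 - cos (t * y))) * indicator {0..} t \<partial>lborel) = ennreal (0 - ?F 0)"
  proof (rule nn_integral_FTC_atLeast)
    fix t :: real
    have "exp (- t) + (- exp (- t) * (cos (t * y) - y * sin (t * y)) + exp (- t) * (- sin (t * y) * y - y * (cos (t * y) * y))) / (1 + y\<^sup>2)
      = exp (- t) - exp (- t) * cos (t * y) * (1 + y\<^sup>2) / (1 + y\<^sup>2)"
      by (simp add: algebra_simps power2_eq_square flip: add_divide_distrib)
    also have "\<dots> = exp (- t) - exp (- t) * cos (t * y)"
      by (simp only: nonzero_mult_div_cancel_right[OF less_imp_neq[OF p, symmetric]])
    also have "\<dots> = exp (- t) * (1 - cos (t * y))" by (simp add: algebra_simps)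
    finally have e: "exp (- t) + (- exp (- t) * (cos (t * y) - y * sin (t * y)) + exp (- t) * (- sin (t * y) * y - y * (cos (t * y) * y))) / (1 + y\<^sup>2) = exp (- t) * (1 - cos (t * y))" .
    have p': "1 + y\<^sup>2 \<noteq> 0" using p by linarith
    have "(?F has_real_derivative exp (- t) + (- exp (- t) * (cos (t * y) - y * sin (t * y)) + exp (- t) * (- sin (t * y) * y - y * (cos (t * y) * y))) / (1 + y\<^sup>2)) (at t)"
      using p' by (auto intro!: derivative_eq_intros)
    then show "(?F has_real_derivative exp (- t) * (1 - cos (t * y))) (at t)" unfolding e .
    show "0 \<le> exp (- t) * (1 - cos (t * y))" by simp
  next
    have 1: "((\<lambda>t::real. exp (- t)) \<longlongrightarrow> 0) at_top" by real_asymp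
    have "((\<lambda>t. exp (- t) * ((cos (t * y) - y * sin (t * y)) / (1 + y\<^sup>2))) \<longlongrightarrow> 0) at_top"
    proof (rule Lim_null_comparison)
      show "((\<lambda>t::real. exp (- t) * (1 + \<bar>y\<bar>)) \<longlongrightarrow> 0) at_top" by (rule tendsto_mult_left_zero[OF 1])
      show "eventually (\<lambda>t. norm (exp (- t) * ((cos (t * y) - y * sin (t * y)) / (1 + y\<^sup>2))) \<le> exp (- t) * (1 + \<bar>y\<bar>)) at_top"
      proof (intro always_eventually allI)
        fix t :: real
        have "\<bar>cos (t * y) - y * sin (t * y)\<bar> \<le> \<bar>cos (t * y)\<bar> + \<bar>y\<bar> * \<bar>sin (t * y)\<bar>"
          by (metis abs_mult abs_triangle_ineq4)
        also have "\<dots> \<le> 1 + \<bar>y\<bar> * 1" by (intro add_mono mult_left_mono) auto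
        finally have "\<bar>cos (t * y) - y * sin (t * y)\<bar> / (1 + y\<^sup>2) \<le> (1 + \<bar>y\<bar>) / 1"
          by (intro frac_le) auto
        from mult_left_mono[OF this, of "exp (- t)"]
        show "norm (exp (- t) * ((cos (t * y) - y * sin (t * y)) / (1 + y\<^sup>2))) \<le> exp (- t) * (1 + \<bar>y\<bar>)"
          using p by (simp add: abs_mult)
      qed
    qed
    from tendsto_add[OF tendsto_minus[OF 1] this] show "(?F \<longlongrightarrow> 0) at_top" by simp
  qed measurable
  also have "0 - ?F 0 = y\<^sup>2 / (1 + y\<^sup>2)"
  proof -
    have "1 + y\<^sup>2 \<noteq> 0" using p by linarith
    then show ?thesis by (simp add: field_simps)
  qed
  finally show ?thesis .
qed

lemma nn_integral_exp_quadratic: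
  "(\<integral>\<^sup>+t. ennreal (exp (- t) * (t\<^sup>2 + 1)) * indicator {0..} t \<partial>lborel) = ennreal 3"
proof -
  let ?F = "\<lambda>t::real. - exp (- t) * (t\<^sup>2 + 2 * t + 3)"
  have "(\<integral>\<^sup>+t. ennreal (exp (- t) * (t\<^sup>2 + 1)) * indicator {0..} t \<partial>lborel) = ennreal (0 - ?F 0)"
  proof (rule nn_integral_FTC_atLeast)
    show "(?F has_real_derivative exp (- t) * (t\<^sup>2 + 1)) (at t)" for t
      by (auto intro!: derivative_eq_intros simp: algebra_simps)
    show "(?F \<longlongrightarrow> 0) at_top" by real_asymp
  qed auto
  then show ?thesis by simp
qed

text \<open>On the event, Y^2 / (1 + Y^2) is at least \<epsilon>^2 / (1 + \<epsilon>^2). Its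
  expectation is an average of the cosine bounds with weight exp (-t), and 3 is the integral of exp
  (-t) (t^2 + 1).\<close>

lemma prob_tail_le:
  fixes Y :: "'a \<Rightarrow> real"
  assumes [measurable]: "Y \<in> borel_measurable M" and X: "0 \<le> X"
    and cos: "\<And>t. 1 - (\<integral>\<omega>. cos (t * Y \<omega>) \<partial>M) \<le> X * (t\<^sup>2 + 1)" and \<epsilon>: "0 < \<epsilon>"
  shows "prob {\<omega>\<in>space M. \<epsilon> < \<bar>Y \<omega>\<bar>} \<le> 3 * (1 + \<epsilon>\<^sup>2) / \<epsilon>\<^sup>2 * X"
proof -
  interpret PL: pair_sigma_finite M lborel ..
  let ?A = "{\<omega>\<in>space M. \<epsilon> < \<bar>Y \<omega>\<bar>}"
  let ?c = "\<epsilon>\<^sup>2 / (1 + \<epsilon>\<^sup>2)"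
  have c: "0 < ?c" using \<epsilon> by (simp add: add_pos_pos)
  have icos: "integrable M (\<lambda>\<omega>. cos (t * Y \<omega>))" for t by (rule integrable_const_bound[where B = 1]) auto
  have "ennreal (?c * prob ?A) = (\<integral>\<^sup>+\<omega>. ennreal ?c * indicator ?A \<omega> \<partial>M)"
    using c by (simp add: nn_integral_cmult_indicator emeasure_eq_measure ennreal_mult del: times_divide_eq_left)
  also have "\<dots> \<le> (\<integral>\<^sup>+\<omega>. ennreal ((Y \<omega>)\<^sup>2 / (1 + (Y \<omega>)\<^sup>2)) \<partial>M)"
  proof (rule nn_integral_mono)
    fix \<omega> assume "\<omega> \<in> space M"
    show "ennreal ?c * indicator ?A \<omega> \<le> ennreal ((Y \<omega>)\<^sup>2 / (1 + (Y \<omega>)\<^sup>2))"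
    proof (cases "\<omega> \<in> ?A")
      case True
      then have "\<epsilon>\<^sup>2 \<le> (Y \<omega>)\<^sup>2" using \<epsilon> by (simp add: abs_le_square_iff[symmetric])
      moreover have "a / (1 + a) \<le> b / (1 + b)" if "0 \<le> a" "a \<le> b" for a b :: real
        using that by (simp add: field_simps)
      ultimately have "?c \<le> (Y \<omega>)\<^sup>2 / (1 + (Y \<omega>)\<^sup>2)" by simp
      then show ?thesis using True by (simp add: ennreal_leI)
    qed simp
  qed
  also have "\<dots> = (\<integral>\<^sup>+\<omega>. \<integral>\<^sup>+t. ennreal (exp (- t) * (1 - cos (t * Y \<omega>))) * indicator {0..} t \<partial>lborel \<partial>M)"
    by (simp only: nn_integral_exp_one_minus_cos)
  also have "\<dots> = (\<integral>\<^sup>+t. \<integral>\<^sup>+\<omega>. ennreal (exp (- t) * (1 - cos (t * Y \<omega>))) * indicator {0..} t \<partial>M \<partial>lborel)"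
    by (rule PL.Fubini'[symmetric]) measurable
  also have "\<dots> \<le> (\<integral>\<^sup>+t. ennreal X * (ennreal (exp (- t) * (t\<^sup>2 + 1)) * indicator {0..} t) \<partial>lborel)"
  proof (rule nn_integral_mono)
    fix t :: real
    have "(\<integral>\<^sup>+\<omega>. ennreal (exp (- t) * (1 - cos (t * Y \<omega>))) * indicator {0..} t \<partial>M) = ennreal (\<integral>\<omega>. exp (- t) * (1 - cos (t * Y \<omega>)) \<partial>M) * indicator {0..} t"
      by (subst nn_integral_multc, measurable) (subst nn_integral_eq_integral, auto intro!: integrable_mult_right Bochner_Integration.integrable_diff icos)
    also have "(\<integral>\<omega>. exp (- t) * (1 - cos (t * Y \<omega>)) \<partial>M) = exp (- t) * (1 - (\<integral>\<omega>. cos (t * Y \<omega>) \<partial>M))"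
      using icos by (simp add: prob_space)
    also have "ennreal \<dots> * indicator {0..} t \<le> ennreal (exp (- t) * (X * (t\<^sup>2 + 1))) * indicator {0..} t"
      by (intro mult_right_mono ennreal_leI mult_left_mono cos) auto
    also have "\<dots> = ennreal X * (ennreal (exp (- t) * (t\<^sup>2 + 1)) * indicator {0..} t)"
      using X by (cases "0 \<le> t") (simp_all add: ennreal_mult'[symmetric] mult_ac)
    finally show "(\<integral>\<^sup>+\<omega>. ennreal (exp (- t) * (1 - cos (t * Y \<omega>))) * indicator {0..} t \<partial>M) \<le> ennreal X * (ennreal (exp (- t) * (t\<^sup>2 + 1)) * indicator {0..} t)" .
  qed
  also have "\<dots> = ennreal (X * 3)"
    by (subst nn_integral_cmult, measurable) (simp only: nn_integral_exp_quadratic ennreal_mult'[OF X])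
  finally have "?c * prob ?A \<le> X * 3" using X by (subst (asm) ennreal_le_iff) auto
  then have "prob ?A \<le> X * 3 / ?c" by (simp only: pos_le_divide_eq[OF c] mult.commute)
  then show ?thesis using \<epsilon> by (simp add: mult_ac)
qed

lemma tendsto_in_prob_add:
  fixes Y Z :: "'i \<Rightarrow> 'a \<Rightarrow> 'b::euclidean_space"
  assumes [measurable]: "\<And>i. Y i \<in> borel_measurable M" "\<And>i. Z i \<in> borel_measurable M" "Y' \<in> borel_measurable M" "Z' \<in> borel_measurable M"
    and Y: "tendsto_in_prob M Y Y' F" and Z: "tendsto_in_prob M Z Z' F"
  shows "tendsto_in_prob M (\<lambda>i \<omega>. Y i \<omega> + Z i \<omega>) (\<lambda>\<omega>. Y' \<omega> + Z' \<omega>) F"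
  unfolding tendsto_in_prob_def
proof (intro allI impI)
  fix \<epsilon> :: real assume \<epsilon>: "0 < \<epsilon>"
  let ?p = "\<lambda>i. prob {\<omega>\<in>space M. \<epsilon> / 2 < dist (Y i \<omega>) (Y' \<omega>)} + prob {\<omega>\<in>space M. \<epsilon> / 2 < dist (Z i \<omega>) (Z' \<omega>)}"
  have "(?p \<longlongrightarrow> 0 + 0) F"
    using Y[unfolded tendsto_in_prob_def, rule_format, of "\<epsilon> / 2"] Z[unfolded tendsto_in_prob_def, rule_format, of "\<epsilon> / 2"] \<epsilon>
    by (intro tendsto_add) simp_all
  then have p: "(?p \<longlongrightarrow> 0) F" by simp
  have "prob {\<omega>\<in>space M. \<epsilon> < dist (Y i \<omega> + Z i \<omega>) (Y' \<omega> + Z' \<omega>)} \<le> ?p i" for i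
  proof -
    have "prob {\<omega>\<in>space M. \<epsilon> < dist (Y i \<omega> + Z i \<omega>) (Y' \<omega> + Z' \<omega>)} \<le>
      prob ({\<omega>\<in>space M. \<epsilon> / 2 < dist (Y i \<omega>) (Y' \<omega>)} \<union> {\<omega>\<in>space M. \<epsilon> / 2 < dist (Z i \<omega>) (Z' \<omega>)})"
    proof (rule finite_measure_mono)
      show "{\<omega>\<in>space M. \<epsilon> < dist (Y i \<omega> + Z i \<omega>) (Y' \<omega> + Z' \<omega>)} \<subseteq>
        {\<omega>\<in>space M. \<epsilon> / 2 < dist (Y i \<omega>) (Y' \<omega>)} \<union> {\<omega>\<in>space M. \<epsilon> / 2 < dist (Z i \<omega>) (Z' \<omega>)}"
      proof
        fix \<omega> assume \<omega>: "\<omega> \<in> {\<omega>\<in>space M. \<epsilon> < dist (Y i \<omega> + Z i \<omega>) (Y' \<omega> + Z' \<omega>)}"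
        have "dist (Y i \<omega> + Z i \<omega>) (Y' \<omega> + Z' \<omega>) \<le> dist (Y i \<omega>) (Y' \<omega>) + dist (Z i \<omega>) (Z' \<omega>)" by (rule dist_triangle_add)
        with \<omega> show "\<omega> \<in> {\<omega>\<in>space M. \<epsilon> / 2 < dist (Y i \<omega>) (Y' \<omega>)} \<union> {\<omega>\<in>space M. \<epsilon> / 2 < dist (Z i \<omega>) (Z' \<omega>)}" by auto
      qed
    qed measurable
    also have "\<dots> \<le> ?p i" by (rule measure_Un_le) measurable
    finally show ?thesis .
  qed
  then show "((\<lambda>i. prob {\<omega>\<in>space M. \<epsilon> < dist (Y i \<omega> + Z i \<omega>) (Y' \<omega> + Z' \<omega>)}) \<longlongrightarrow> 0) F"
    by (intro tendsto_sandwich[OF _ _ tendsto_const p] always_eventually) auto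
qed

lemma tendsto_in_prob_lipschitz:
  fixes Y :: "'i \<Rightarrow> 'a \<Rightarrow> 'b::euclidean_space" and g :: "'b \<Rightarrow> 'c::euclidean_space"
  assumes [measurable]: "\<And>i. Y i \<in> borel_measurable M" "Y' \<in> borel_measurable M"
    and g: "\<And>x y. dist (g x) (g y) \<le> L * dist x y" and L: "0 < L" and Y: "tendsto_in_prob M Y Y' F"
  shows "tendsto_in_prob M (\<lambda>i \<omega>. g (Y i \<omega>)) (\<lambda>\<omega>. g (Y' \<omega>)) F"
  unfolding tendsto_in_prob_def
proof (intro allI impI)
  fix \<epsilon> :: real assume \<epsilon>: "0 < \<epsilon>"
  have p: "((\<lambda>i. prob {\<omega>\<in>space M. \<epsilon> / L < dist (Y i \<omega>) (Y' \<omega>)}) \<longlongrightarrow> 0) F"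
    using Y \<epsilon> L unfolding tendsto_in_prob_def by auto
  have "prob {\<omega>\<in>space M. \<epsilon> < dist (g (Y i \<omega>)) (g (Y' \<omega>))} \<le> prob {\<omega>\<in>space M. \<epsilon> / L < dist (Y i \<omega>) (Y' \<omega>)}" for i
  proof (rule finite_measure_mono)
    show "{\<omega>\<in>space M. \<epsilon> < dist (g (Y i \<omega>)) (g (Y' \<omega>))} \<subseteq> {\<omega>\<in>space M. \<epsilon> / L < dist (Y i \<omega>) (Y' \<omega>)}"
    proof
      fix \<omega> assume \<omega>: "\<omega> \<in> {\<omega>\<in>space M. \<epsilon> < dist (g (Y i \<omega>)) (g (Y' \<omega>))}"
      then have "\<epsilon> < L * dist (Y i \<omega>) (Y' \<omega>)" using g[of "Y i \<omega>" "Y' \<omega>"] by simp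
      with \<omega> L show "\<omega> \<in> {\<omega>\<in>space M. \<epsilon> / L < dist (Y i \<omega>) (Y' \<omega>)}" by (simp add: field_simps)
    qed
  qed measurable
  then show "((\<lambda>i. prob {\<omega>\<in>space M. \<epsilon> < dist (g (Y i \<omega>)) (g (Y' \<omega>))}) \<longlongrightarrow> 0) F"
    by (intro tendsto_sandwich[OF _ _ tendsto_const p] always_eventually) auto
qed

lemma tendsto_in_prob_cong_AE:
  fixes Y Z :: "'i \<Rightarrow> 'a \<Rightarrow> 'b::euclidean_space"
  assumes [measurable]: "\<And>i. Y i \<in> borel_measurable M" "\<And>i. Z i \<in> borel_measurable M" "Y' \<in> borel_measurable M"
    and ae: "\<And>i. AE \<omega> in M. Y i \<omega> = Z i \<omega>" and Y: "tendsto_in_prob M Y Y' F"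
  shows "tendsto_in_prob M Z Y' F"
proof -
  have "prob {\<omega>\<in>space M. \<epsilon> < dist (Z i \<omega>) (Y' \<omega>)} = prob {\<omega>\<in>space M. \<epsilon> < dist (Y i \<omega>) (Y' \<omega>)}" for \<epsilon> i
    using ae[of i] by (intro finite_measure_eq_AE) auto
  with Y show ?thesis unfolding tendsto_in_prob_def by simp
qed

lemma AE_tendsto_imp_in_prob:
  fixes Y :: "nat \<Rightarrow> 'a \<Rightarrow> 'b::euclidean_space"
  assumes [measurable]: "\<And>i. Y i \<in> borel_measurable M" "Z \<in> borel_measurable M"
    and ae: "AE \<omega> in M. (\<lambda>i. Y i \<omega>) \<longlonglongrightarrow> Z \<omega>"
  shows "tendsto_in_prob M Y Z sequentially"
  unfolding tendsto_in_prob_def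
proof (intro allI impI)
  fix \<epsilon> :: real assume \<epsilon>: "0 < \<epsilon>"
  let ?A = "\<lambda>i. {\<omega>\<in>space M. \<epsilon> < dist (Y i \<omega>) (Z \<omega>)}"
  have "(\<lambda>i. \<integral>\<omega>. indicator (?A i) \<omega> \<partial>M) \<longlonglongrightarrow> (\<integral>\<omega>. 0 \<partial>M :: real)"
  proof (rule integral_dominated_convergence[where w = "\<lambda>_. 1"])
    show "AE \<omega> in M. (\<lambda>i. indicator (?A i) \<omega> :: real) \<longlonglongrightarrow> 0"
      using ae
    proof eventually_elim
      case (elim \<omega>)
      then have "eventually (\<lambda>i. dist (Y i \<omega>) (Z \<omega>) < \<epsilon>) sequentially" using \<epsilon> by (rule tendstoD)
      then have "eventually (\<lambda>i. indicator (?A i) \<omega> = (0::real)) sequentially" by eventually_elim (simp add: indicator_def)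
      then show ?case by (rule tendsto_eventually)
    qed
  qed (auto simp: indicator_def)
  then show "(\<lambda>i. prob (?A i)) \<longlonglongrightarrow> 0" by simp
qed

text \<open>A subsequence with summable increments converges almost surely by Borel-Cantelli, and
  the Cauchy property carries its limit over to the whole sequence.\<close>

lemma Cauchy_in_prob_imp_convergent:
  fixes Y :: "nat \<Rightarrow> 'a \<Rightarrow> 'b::euclidean_space"
  assumes [measurable]: "\<And>i. Y i \<in> borel_measurable M"
    and cauchy: "\<And>\<epsilon> \<eta>. 0 < \<epsilon> \<Longrightarrow> 0 < \<eta> \<Longrightarrow> \<exists>n0. \<forall>m\<ge>n0. \<forall>n\<ge>n0. prob {\<omega>\<in>space M. \<epsilon> < dist (Y m \<omega>) (Y n \<omega>)} \<le> \<eta>"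
  shows "\<exists>Z\<in>borel_measurable M. tendsto_in_prob M Y Z sequentially"
proof -
  have "\<forall>k::nat. \<exists>n0. \<forall>m\<ge>n0. \<forall>n\<ge>n0. prob {\<omega>\<in>space M. (1/2)^k < dist (Y m \<omega>) (Y n \<omega>)} \<le> (1/2)^k"
    using cauchy by simp
  then obtain n0 where n0: "\<And>k m n. n0 k \<le> m \<Longrightarrow> n0 k \<le> n \<Longrightarrow> prob {\<omega>\<in>space M. (1/2)^k < dist (Y m \<omega>) (Y n \<omega>)} \<le> (1/2)^k"
    by metis
  \<comment> \<open>The maximum makes both r k and r (k + 1) admissible at level k; the summand k
    makes the indices tend to infinity.\<close>
  define r where "r k = Max (n0 ` {..k}) + k" for k
  have rm: "n0 k \<le> r j" if "k \<le> j" for k j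
  proof -
    have "n0 k \<le> Max (n0 ` {..j})" using that by (intro Max_ge) auto
    then show ?thesis by (simp add: r_def)
  qed
  have r0: "n0 k \<le> r k" "n0 k \<le> r (Suc k)" "k \<le> r k" for k
    using rm[of k k] rm[of k "Suc k"] by (simp_all add: r_def)
  let ?A = "\<lambda>k. {\<omega>\<in>space M. (1/2)^k < dist (Y (r k) \<omega>) (Y (r (Suc k)) \<omega>)}"
  have "AE \<omega> in M. eventually (\<lambda>k. \<omega> \<in> space M - ?A k) sequentially"
  proof (rule borel_cantelli_AE1)
    show "summable (\<lambda>k. measure M (?A k))"
      by (rule summable_comparison_test'[where g = "\<lambda>k. (1/2)^k" and N = 0]) (use n0 r0 in auto)
  qed (auto simp: emeasure_eq_measure)
  then have conv: "AE \<omega> in M. convergent (\<lambda>k. Y (r k) \<omega>)"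
  proof eventually_elim
    case (elim \<omega>)
    then obtain N where N: "\<And>k. N \<le> k \<Longrightarrow> norm (Y (r (Suc k)) \<omega> - Y (r k) \<omega>) \<le> (1/2)^k"
      by (auto simp: eventually_sequentially dist_norm norm_minus_commute not_less)
    have "summable (\<lambda>k. Y (r (Suc k)) \<omega> - Y (r k) \<omega>)"
      by (rule summable_comparison_test'[where g = "\<lambda>k. (1/2)^k" and N = N]) (use N in auto)
    then have "convergent (\<lambda>n. \<Sum>k<n. Y (r (Suc k)) \<omega> - Y (r k) \<omega>)" by (simp add: summable_iff_convergent)
    then have "convergent (\<lambda>n. Y (r n) \<omega> - Y (r 0) \<omega>)" by (simp only: sum_lessThan_telescope[of "\<lambda>k. Y (r k) \<omega>"])
    from convergent_add[OF this convergent_const[of "Y (r 0) \<omega>"]] show ?case by simp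
  qed
  define Z where "Z \<omega> = lim (\<lambda>k. Y (r k) \<omega>)" for \<omega>
  have Z[measurable]: "Z \<in> borel_measurable M" unfolding Z_def[abs_def] by (rule borel_measurable_lim_metric) measurable
  have "AE \<omega> in M. (\<lambda>k. Y (r k) \<omega>) \<longlonglongrightarrow> Z \<omega>"
    using conv by eventually_elim (simp add: Z_def convergent_LIMSEQ_iff)
  then have sub: "tendsto_in_prob M (\<lambda>k. Y (r k)) Z sequentially" by (intro AE_tendsto_imp_in_prob) measurable
  have "tendsto_in_prob M Y Z sequentially"
    unfolding tendsto_in_prob_def
  proof (intro allI impI LIMSEQ_I)
    fix \<epsilon> e :: real assume \<epsilon>: "0 < \<epsilon>" and e: "0 < e"
    obtain N where N: "\<And>m n. N \<le> m \<Longrightarrow> N \<le> n \<Longrightarrow> prob {\<omega>\<in>space M. \<epsilon> / 2 < dist (Y m \<omega>) (Y n \<omega>)} \<le> e / 4"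
      using cauchy[of "\<epsilon> / 2" "e / 4"] \<epsilon> e by auto
    have "(\<lambda>k. prob {\<omega>\<in>space M. \<epsilon> / 2 < dist (Y (r k) \<omega>) (Z \<omega>)}) \<longlonglongrightarrow> 0"
      using sub[unfolded tendsto_in_prob_def, rule_format, of "\<epsilon> / 2"] \<epsilon> by simp
    moreover have "0 < e / 4" using e by simp
    ultimately have "eventually (\<lambda>k. prob {\<omega>\<in>space M. \<epsilon> / 2 < dist (Y (r k) \<omega>) (Z \<omega>)} < e / 4) sequentially"
      by (rule order_tendstoD(2))
    with eventually_ge_at_top[of N]
    have "eventually (\<lambda>k. N \<le> k \<and> prob {\<omega>\<in>space M. \<epsilon> / 2 < dist (Y (r k) \<omega>) (Z \<omega>)} < e / 4) sequentially"
      by (rule eventually_conj)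
    from eventually_happens'[OF sequentially_bot this]
    obtain k where k: "N \<le> k" "prob {\<omega>\<in>space M. \<epsilon> / 2 < dist (Y (r k) \<omega>) (Z \<omega>)} < e / 4" by blast
    have "norm (prob {\<omega>\<in>space M. \<epsilon> < dist (Y n \<omega>) (Z \<omega>)} - 0) < e" if n: "N \<le> n" for n
    proof -
      have "prob {\<omega>\<in>space M. \<epsilon> < dist (Y n \<omega>) (Z \<omega>)} \<le>
        prob ({\<omega>\<in>space M. \<epsilon> / 2 < dist (Y n \<omega>) (Y (r k) \<omega>)} \<union> {\<omega>\<in>space M. \<epsilon> / 2 < dist (Y (r k) \<omega>) (Z \<omega>)})"
      proof (rule finite_measure_mono)
        show "{\<omega>\<in>space M. \<epsilon> < dist (Y n \<omega>) (Z \<omega>)} \<subseteq>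
          {\<omega>\<in>space M. \<epsilon> / 2 < dist (Y n \<omega>) (Y (r k) \<omega>)} \<union> {\<omega>\<in>space M. \<epsilon> / 2 < dist (Y (r k) \<omega>) (Z \<omega>)}"
        proof
          fix \<omega> assume \<omega>: "\<omega> \<in> {\<omega>\<in>space M. \<epsilon> < dist (Y n \<omega>) (Z \<omega>)}"
          have "dist (Y n \<omega>) (Z \<omega>) \<le> dist (Y n \<omega>) (Y (r k) \<omega>) + dist (Y (r k) \<omega>) (Z \<omega>)" by (rule dist_triangle)
          with \<omega> show "\<omega> \<in> {\<omega>\<in>space M. \<epsilon> / 2 < dist (Y n \<omega>) (Y (r k) \<omega>)} \<union> {\<omega>\<in>space M. \<epsilon> / 2 < dist (Y (r k) \<omega>) (Z \<omega>)}" by auto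
        qed
      qed measurable
      also have "\<dots> \<le> prob {\<omega>\<in>space M. \<epsilon> / 2 < dist (Y n \<omega>) (Y (r k) \<omega>)} + prob {\<omega>\<in>space M. \<epsilon> / 2 < dist (Y (r k) \<omega>) (Z \<omega>)}"
        by (rule measure_Un_le) measurable
      also have "\<dots> < e"
        using N[OF n, of "r k"] k r0(3)[of k] e by linarith
      finally show ?thesis by simp
    qed
    then show "\<exists>no. \<forall>n\<ge>no. norm (prob {\<omega>\<in>space M. \<epsilon> < dist (Y n \<omega>) (Z \<omega>)} - 0) < e" by blast
  qed
  then show ?thesis using Z by blast
qed

text \<open>The norm is at most the sum of the absolute coordinates, so one of the d coordinates
  must exceed \<epsilon>/d; the tail bound at the frequencies t e_j handles each.\<close>

lemma prob_norm_tail_le: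
  fixes Y :: "'a \<Rightarrow> real^'d"
  assumes [measurable]: "Y \<in> borel_measurable M" and X: "0 \<le> X"
    and cf: "\<And>u. 1 - Re (\<integral>\<omega>. iexp (u \<bullet> Y \<omega>) \<partial>M) \<le> X * ((norm u)\<^sup>2 + 1)" and \<epsilon>: "0 < \<epsilon>"
  shows "prob {\<omega>\<in>space M. \<epsilon> < norm (Y \<omega>)} \<le> real CARD('d) * (3 * (1 + (\<epsilon> / CARD('d))\<^sup>2) / (\<epsilon> / CARD('d))\<^sup>2) * X"
proof -
  let ?\<epsilon> = "\<epsilon> / CARD('d)"
  have [measurable]: "(\<lambda>\<omega>. Y \<omega> $ j) \<in> borel_measurable M" for j
    by (rule measurable_compose[OF assms(1)]) (intro borel_measurable_continuous_onI continuous_intros)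
  have j: "prob {\<omega>\<in>space M. ?\<epsilon> < \<bar>Y \<omega> $ j\<bar>} \<le> 3 * (1 + ?\<epsilon>\<^sup>2) / ?\<epsilon>\<^sup>2 * X" for j
  proof (rule prob_tail_le)
    fix t :: real
    have "Re (\<integral>\<omega>. iexp ((t *\<^sub>R axis j 1) \<bullet> Y \<omega>) \<partial>M) = (\<integral>\<omega>. cos (t * Y \<omega> $ j) \<partial>M)"
      using integrable_iexp[of Y "t *\<^sub>R axis j 1"]
      by (subst integral_Re[symmetric]) (auto simp: Re_exp inner_axis')
    with cf[of "t *\<^sub>R axis j 1"] show "1 - (\<integral>\<omega>. cos (t * Y \<omega> $ j) \<partial>M) \<le> X * (t\<^sup>2 + 1)" by (simp add: norm_axis_1)
  qed (use X \<epsilon> in auto)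
  have "prob {\<omega>\<in>space M. \<epsilon> < norm (Y \<omega>)} \<le> prob (\<Union>j\<in>UNIV. {\<omega>\<in>space M. ?\<epsilon> < \<bar>Y \<omega> $ j\<bar>})"
  proof (rule finite_measure_mono)
    show "{\<omega>\<in>space M. \<epsilon> < norm (Y \<omega>)} \<subseteq> (\<Union>j\<in>UNIV. {\<omega>\<in>space M. ?\<epsilon> < \<bar>Y \<omega> $ j\<bar>})"
    proof
      fix \<omega> assume \<omega>: "\<omega> \<in> {\<omega>\<in>space M. \<epsilon> < norm (Y \<omega>)}"
      have "\<exists>j. ?\<epsilon> < \<bar>Y \<omega> $ j\<bar>"
      proof (rule ccontr)
        assume "\<not> (\<exists>j. ?\<epsilon> < \<bar>Y \<omega> $ j\<bar>)"
        then have "(\<Sum>j\<in>UNIV. \<bar>Y \<omega> $ j\<bar>) \<le> (\<Sum>j\<in>(UNIV::'d set). ?\<epsilon>)" by (intro sum_mono) (simp add: not_less)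
        with norm_le_l1_cart[of "Y \<omega>"] \<omega> show False by simp
      qed
      with \<omega> show "\<omega> \<in> (\<Union>j\<in>UNIV. {\<omega>\<in>space M. ?\<epsilon> < \<bar>Y \<omega> $ j\<bar>})" by auto
    qed
  qed measurable
  also have "\<dots> \<le> (\<Sum>j\<in>UNIV. prob {\<omega>\<in>space M. ?\<epsilon> < \<bar>Y \<omega> $ j\<bar>})"
    by (rule finite_measure_subadditive_finite) auto
  also have "\<dots> \<le> (\<Sum>j\<in>(UNIV::'d set). 3 * (1 + ?\<epsilon>\<^sup>2) / ?\<epsilon>\<^sup>2 * X)" by (intro sum_mono j)
  finally show ?thesis by (simp add: mult.assoc)
qed

end

section \<open>Integrals of simple functions\<close>

text \<open>If the masses do not tend to 0, infinitely many exceed a fixed e. As each B j loses its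
  mass in the limit while each measure lives on the union of the B j, one can select measures
  concentrated on disjoint humps C i. The union of the even humps then has large mass for every
  second selected measure and small mass for the others, so the exponentials cannot converge on it.
  The exponential form is what characteristic functions provide.\<close>

lemma gliding_hump:
  fixes \<nu> :: "nat \<Rightarrow> 'a measure"
  assumes fin: "\<And>k. finite_measure (\<nu> k)" and sets: "\<And>k. sets (\<nu> k) = sets M"
    and B: "\<And>j. B j \<in> sets M" "incseq B" and conull: "\<And>k. emeasure (\<nu> k) (space M - (\<Union>j. B j)) = 0"
    and B0: "\<And>j. (\<lambda>k. measure (\<nu> k) (B j)) \<longlonglongrightarrow> 0"
    and conv: "\<And>A. A \<in> sets M \<Longrightarrow> convergent (\<lambda>k. exp (- measure (\<nu> k) A))"
  shows "(\<lambda>k. measure (\<nu> k) (space M)) \<longlonglongrightarrow> 0"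
proof (rule ccontr)
  assume "\<not> ?thesis"
  then obtain e where e: "0 < e" and freq: "\<And>n. \<exists>k\<ge>n. e \<le> measure (\<nu> k) (space M)"
    unfolding LIMSEQ_def by (auto simp: dist_real_def not_less)
  \<comment> \<open>With e = 8 d each hump carries at least 6 d, more than the 4 d that is claimed,
    against at most 2 d at the odd indices.\<close>
  define d where "d = e / 8"
  have d: "0 < d" using e by (simp add: d_def)
  have sp: "space (\<nu> k) = space M" for k using sets_eq_imp_space_eq[OF sets] .
  have mB: "B j \<in> sets (\<nu> k)" for j k using B(1) sets by simp
  have meas_diff: "measure (\<nu> k) (space M - B j) = measure (\<nu> k) (space M) - measure (\<nu> k) (B j)" for j k
    using finite_measure.finite_measure_compl[OF fin mB] by (simp add: sp)
  have up: "(\<lambda>j. measure (\<nu> k) (space M - B j)) \<longlonglongrightarrow> 0" for k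
  proof -
    interpret F: finite_measure "\<nu> k" by (rule fin)
    have "(\<lambda>j. measure (\<nu> k) (B j)) \<longlonglongrightarrow> measure (\<nu> k) (\<Union>j. B j)"
      using mB B(2) by (intro F.finite_Lim_measure_incseq) auto
    moreover have "measure (\<nu> k) (\<Union>j. B j) = measure (\<nu> k) (space M)"
    proof -
      have "(\<Union>j. B j) \<in> sets (\<nu> k)" using mB by blast
      then have "measure (\<nu> k) (space M - (\<Union>j. B j)) = measure (\<nu> k) (space M) - measure (\<nu> k) (\<Union>j. B j)"
        using F.finite_measure_compl by (simp add: sp)
      moreover have "measure (\<nu> k) (space M - (\<Union>j. B j)) = 0" using conull by (simp add: measure_def)
      ultimately show ?thesis by simp
    qed
    ultimately have "(\<lambda>j. measure (\<nu> k) (B j)) \<longlonglongrightarrow> measure (\<nu> k) (space M)" by simp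
    from tendsto_diff[OF tendsto_const this, of "measure (\<nu> k) (space M)"] show ?thesis unfolding meas_diff by simp
  qed
  have step: "\<exists>k' j'. k < k' \<and> j < j' \<and> e \<le> measure (\<nu> k') (space M) \<and> measure (\<nu> k') (B j) < d \<and> measure (\<nu> k') (space M - B j') < d" for k j
  proof -
    have "eventually (\<lambda>k. measure (\<nu> k) (B j) < d) sequentially" using order_tendstoD(2)[OF B0 d] .
    then obtain n where n: "\<And>k. n \<le> k \<Longrightarrow> measure (\<nu> k) (B j) < d" by (auto simp: eventually_sequentially)
    obtain k' where k': "max n (Suc k) \<le> k'" "e \<le> measure (\<nu> k') (space M)" using freq by blast
    have "eventually (\<lambda>j. measure (\<nu> k') (space M - B j) < d) sequentially" using order_tendstoD(2)[OF up d] .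
    then obtain j0 where j0: "\<And>j. j0 \<le> j \<Longrightarrow> measure (\<nu> k') (space M - B j) < d" by (auto simp: eventually_sequentially)
    show ?thesis using k' n[of k'] j0[of "max j0 (Suc j)"] by (intro exI[of _ k'] exI[of _ "max j0 (Suc j)"]) auto
  qed
  \<comment> \<open>A state is a pair of an index of a measure and an index of an exhausting set;
    the next measure nearly misses the old set and is nearly carried by the new one.\<close>
  define nxt where "nxt p = (SOME q. fst p < fst q \<and> snd p < snd q \<and> e \<le> measure (\<nu> (fst q)) (space M)
     \<and> measure (\<nu> (fst q)) (B (snd p)) < d \<and> measure (\<nu> (fst q)) (space M - B (snd q)) < d)" for p :: "nat \<times> nat"
  have nxt: "fst p < fst (nxt p) \<and> snd p < snd (nxt p) \<and> e \<le> measure (\<nu> (fst (nxt p))) (space M)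
     \<and> measure (\<nu> (fst (nxt p))) (B (snd p)) < d \<and> measure (\<nu> (fst (nxt p))) (space M - B (snd (nxt p))) < d" for p
    unfolding nxt_def by (rule someI_ex) (use step[of "fst p" "snd p"] in auto)
  define s where "s i = (nxt ^^ i) (0, 0)" for i
  define k where "k i = fst (s i)" for i
  define j where "j i = snd (s i)" for i
  have s_Suc: "s (Suc i) = nxt (s i)" for i by (simp add: s_def)
  have kj: "k i < k (Suc i)" "j i < j (Suc i)" "e \<le> measure (\<nu> (k (Suc i))) (space M)"
    "measure (\<nu> (k (Suc i))) (B (j i)) < d" "measure (\<nu> (k (Suc i))) (space M - B (j (Suc i))) < d" for i
    using nxt[of "s i"] by (auto simp: k_def j_def s_Suc)
  have mono_k: "strict_mono k" and mono_j: "strict_mono j" using kj by (auto intro: strict_monoI_Suc)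
  define C where "C i = B (j (Suc i)) - B (j i)" for i
  have mC: "C i \<in> sets M" for i using B by (simp add: C_def)
  define A where "A = (\<Union>i. C (2 * i))"
  have mA: "A \<in> sets M" using mC by (auto simp: A_def)
  have rest: "measure (\<nu> (k (Suc i))) (space M - C i) \<le> 2 * d" for i
  proof -
    interpret F: finite_measure "\<nu> (k (Suc i))" by (rule fin)
    have "measure (\<nu> (k (Suc i))) (space M - C i) \<le> measure (\<nu> (k (Suc i))) ((space M - B (j (Suc i))) \<union> B (j i))"
      using B(1) sets by (intro F.finite_measure_mono) (auto simp: C_def)
    also have "\<dots> \<le> measure (\<nu> (k (Suc i))) (space M - B (j (Suc i))) + measure (\<nu> (k (Suc i))) (B (j i))"
      using B(1) sets by (intro measure_Un_le) auto
    finally show ?thesis using kj[of i] by simp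
  qed
  have even: "4 * d \<le> measure (\<nu> (k (Suc (2 * i)))) A" for i
  proof -
    interpret F: finite_measure "\<nu> (k (Suc (2 * i)))" by (rule fin)
    have "measure (\<nu> (k (Suc (2 * i)))) (C (2 * i)) = measure (\<nu> (k (Suc (2 * i)))) (space M) - measure (\<nu> (k (Suc (2 * i)))) (space M - C (2 * i))"
      using F.finite_measure_compl[of "C (2 * i)"] mC sets by (simp add: sp)
    moreover have "measure (\<nu> (k (Suc (2 * i)))) (C (2 * i)) \<le> measure (\<nu> (k (Suc (2 * i)))) A"
      using mA sets by (intro F.finite_measure_mono) (auto simp: A_def)
    ultimately show ?thesis using rest[of "2 * i"] kj(3)[of "2 * i"] e by (simp add: d_def)
  qed
  have disj: "C i \<inter> C i' = {}" if "i < i'" for i i'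
  proof -
    have "j (Suc i) \<le> j i'" using mono_j that by (simp add: strict_mono_less_eq Suc_le_eq)
    then have "B (j (Suc i)) \<subseteq> B (j i')" by (rule incseqD[OF B(2)])
    then show ?thesis by (auto simp: C_def)
  qed
  have odd: "measure (\<nu> (k (Suc (2 * i + 1)))) A \<le> 2 * d" for i
  proof -
    interpret F: finite_measure "\<nu> (k (Suc (2 * i + 1)))" by (rule fin)
    have "C (2 * i') \<inter> C (2 * i + 1) = {}" for i'
    proof (cases "2 * i' < 2 * i + 1")
      case False
      then have "2 * i + 1 < 2 * i'" by presburger
      from disj[OF this] show ?thesis by blast
    qed (rule disj)
    then have "A \<subseteq> space M - C (2 * i + 1)" using sets.sets_into_space[OF mA] by (auto simp: A_def)
    then have "measure (\<nu> (k (Suc (2 * i + 1)))) A \<le> measure (\<nu> (k (Suc (2 * i + 1)))) (space M - C (2 * i + 1))"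
      using mC sets by (intro F.finite_measure_mono) auto
    also have "\<dots> \<le> 2 * d" by (rule rest)
    finally show ?thesis .
  qed
  obtain L where L: "(\<lambda>k. exp (- measure (\<nu> k) A)) \<longlonglongrightarrow> L" using conv[OF mA] by (auto simp: convergent_def)
  have "strict_mono (\<lambda>i. k (Suc (2 * i)))" "strict_mono (\<lambda>i. k (Suc (2 * i + 1)))"
    using mono_k by (auto simp: strict_mono_def)
  from this[THEN LIMSEQ_subseq_LIMSEQ[OF L]]
  have L1: "(\<lambda>i. exp (- measure (\<nu> (k (Suc (2 * i)))) A)) \<longlonglongrightarrow> L" and L2: "(\<lambda>i. exp (- measure (\<nu> (k (Suc (2 * i + 1)))) A)) \<longlonglongrightarrow> L"
    by (simp_all add: o_def)
  have "L \<le> exp (- (4 * d))" by (rule LIMSEQ_le_const2[OF L1]) (use even in auto)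
  moreover have "exp (- (2 * d)) \<le> L" by (rule LIMSEQ_le_const[OF L2]) (use odd in auto)
  ultimately have "exp (- (2 * d)) \<le> exp (- (4 * d))" by linarith
  with d show False by simp
qed

locale tempered_random_measure = tempered_levy \<alpha> lam \<sigma> + prob_space P
  for \<alpha> lam and \<sigma> :: "(real^'d) measure" and P :: "'w measure" +
  fixes M :: "(real^'n) set \<Rightarrow> 'w \<Rightarrow> real^'d"
  assumes M: "exp_tempered_random_measure P \<alpha> lam \<sigma> M"
begin

lemma M_measurable: "A \<in> sets borel \<Longrightarrow> emeasure lborel A < \<infinity> \<Longrightarrow> M A \<in> borel_measurable P"
  using M by (simp add: exp_tempered_random_measure_def)

lemma M_cf: "A \<in> sets borel \<Longrightarrow> emeasure lborel A < \<infinity> \<Longrightarrow> (\<integral>\<omega>. iexp (u \<bullet> M A \<omega>) \<partial>P) = of_real (exp (measure lborel A * \<psi> u))"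
  using M char_fun_distr[OF M_measurable, of A u] by (simp add: exp_tempered_random_measure_def)

lemma M_indep: "range A \<subseteq> sets borel \<Longrightarrow> disjoint_family A \<Longrightarrow> (\<And>i::nat. emeasure lborel (A i) < \<infinity>) \<Longrightarrow> indep_vars (\<lambda>_. borel) (\<lambda>i. M (A i)) UNIV"
  using M by (simp add: exp_tempered_random_measure_def)

lemma M_sums: "range A \<subseteq> sets borel \<Longrightarrow> disjoint_family A \<Longrightarrow> emeasure lborel (\<Union>i::nat. A i) < \<infinity> \<Longrightarrow> AE \<omega> in P. (\<lambda>i. M (A i) \<omega>) sums M (\<Union>i. A i) \<omega>"
  using M by (simp add: exp_tempered_random_measure_def)

text \<open>Additivity along the constant sequence of empty sets gives a convergent series with
  constant terms.\<close>

lemma M_empty: "AE \<omega> in P. M {} \<omega> = 0"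
proof -
  have "AE \<omega> in P. (\<lambda>i::nat. M {} \<omega>) sums M (\<Union>i::nat. {}) \<omega>"
    by (rule M_sums) (auto simp: disjoint_family_on_def)
  then show ?thesis
  proof eventually_elim
    case (elim \<omega>)
    then have "summable (\<lambda>i::nat. M {} \<omega>)" by (rule sums_summable)
    then show ?case by (simp add: summable_const_iff)
  qed
qed

text \<open>Independence and additivity of M are given for sequences of sets only; a finite family
  is enumerated and continued by empty sets, on which M vanishes almost surely.\<close>

definition pad :: "'i set \<Rightarrow> ('i \<Rightarrow> (real^'n) set) \<Rightarrow> nat \<Rightarrow> (real^'n) set" where
  "pad I A n = (if n < card I then A (from_nat_into I n) else {})"

lemma pad_props:
  assumes I: "finite I" and A: "\<And>i. i \<in> I \<Longrightarrow> A i \<in> sets borel" "\<And>i. i \<in> I \<Longrightarrow> emeasure lborel (A i) < \<infinity>" "disjoint_family_on A I"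
  shows "range (pad I A) \<subseteq> sets borel" "disjoint_family (pad I A)" "emeasure lborel (pad I A n) < \<infinity>"
    "(\<Union>n. pad I A n) = (\<Union>i\<in>I. A i)" "bij_betw (from_nat_into I) {..<card I} I"
proof -
  show bij: "bij_betw (from_nat_into I) {..<card I} I" using bij_betw_from_nat_into_finite[OF I] by simp
  then have inI: "n < card I \<Longrightarrow> from_nat_into I n \<in> I" for n by (auto simp: bij_betw_def)
  show "range (pad I A) \<subseteq> sets borel" using A inI by (auto simp: pad_def)
  show "emeasure lborel (pad I A n) < \<infinity>" using A(2) inI by (auto simp: pad_def)
  show "disjoint_family (pad I A)"
    unfolding disjoint_family_on_def
  proof (intro ballI impI)
    fix m n :: nat assume "m \<noteq> n"
    then have "m < card I \<Longrightarrow> n < card I \<Longrightarrow> from_nat_into I m \<noteq> from_nat_into I n"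
      using bij by (auto simp: bij_betw_def inj_on_def)
    then show "pad I A m \<inter> pad I A n = {}"
      using A(3) inI unfolding pad_def disjoint_family_on_def by auto
  qed
  have "(\<Union>n. pad I A n) = (\<Union>n\<in>{..<card I}. A (from_nat_into I n))" by (auto simp: pad_def split: if_splits)
  also have "\<dots> = (\<Union>i\<in>from_nat_into I ` {..<card I}. A i)" by blast
  also have "from_nat_into I ` {..<card I} = I" using bij by (simp add: bij_betw_def)
  finally show "(\<Union>n. pad I A n) = (\<Union>i\<in>I. A i)" .
qed

lemma M_finite_additive:
  assumes I: "finite I" and A: "\<And>i. i \<in> I \<Longrightarrow> A i \<in> sets borel" "\<And>i. i \<in> I \<Longrightarrow> emeasure lborel (A i) < \<infinity>" "disjoint_family_on A I"
  shows "AE \<omega> in P. M (\<Union>i\<in>I. A i) \<omega> = (\<Sum>i\<in>I. M (A i) \<omega>)"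
proof -
  have p: "range (pad I A) \<subseteq> sets borel" "disjoint_family (pad I A)" "\<And>n. emeasure lborel (pad I A n) < \<infinity>"
    "(\<Union>n. pad I A n) = (\<Union>i\<in>I. A i)" "bij_betw (from_nat_into I) {..<card I} I"
    by (rule pad_props[OF I]; use A in blast)+
  have "emeasure lborel (\<Union>i\<in>I. A i) \<le> (\<Sum>i\<in>I. emeasure lborel (A i))"
    using A I by (intro emeasure_subadditive_finite) auto
  also have "\<dots> < \<infinity>" using A I by (simp add: less_top[symmetric])
  finally have "emeasure lborel (\<Union>n. pad I A n) < \<infinity>" by (simp add: p(4))
  from M_sums[OF p(1,2) this] M_empty show ?thesis
  proof eventually_elim
    case (elim \<omega>)
    have "(\<lambda>n. M (pad I A n) \<omega>) sums (\<Sum>n<card I. M (pad I A n) \<omega>)"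
      by (rule sums_finite) (use elim(2) in \<open>auto simp: pad_def\<close>)
    with elim(1) have "M (\<Union>i\<in>I. A i) \<omega> = (\<Sum>n<card I. M (pad I A n) \<omega>)" by (simp add: p(4) sums_iff)
    also have "\<dots> = (\<Sum>n<card I. M (A (from_nat_into I n)) \<omega>)" by (simp add: pad_def)
    also have "\<dots> = (\<Sum>i\<in>I. M (A i) \<omega>)" by (rule sum.reindex_bij_betw[OF p(5)])
    finally show ?case .
  qed
qed

lemma M_finite_cf:
  assumes I: "finite I" and A: "\<And>i. i \<in> I \<Longrightarrow> A i \<in> sets borel" "\<And>i. i \<in> I \<Longrightarrow> emeasure lborel (A i) < \<infinity>" "disjoint_family_on A I"
  shows "(\<integral>\<omega>. iexp (\<Sum>i\<in>I. v i \<bullet> M (A i) \<omega>) \<partial>P) = of_real (exp (\<Sum>i\<in>I. measure lborel (A i) * \<psi> (v i)))"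
proof -
  have p: "range (pad I A) \<subseteq> sets borel" "disjoint_family (pad I A)" "\<And>n. emeasure lborel (pad I A n) < \<infinity>"
    "(\<Union>n. pad I A n) = (\<Union>i\<in>I. A i)" "bij_betw (from_nat_into I) {..<card I} I"
    by (rule pad_props[OF I]; use A in blast)+
  let ?f = "from_nat_into I" and ?N = "{..<card I}"
  have "indep_vars (\<lambda>_. borel) (\<lambda>n. M (pad I A n)) ?N"
    by (rule indep_vars_subset[OF M_indep[OF p(1,2,3)] subset_UNIV])
  then have ind: "indep_vars (\<lambda>_. borel) (\<lambda>n \<omega>. iexp (v (?f n) \<bullet> M (pad I A n) \<omega>)) ?N"
    by (rule indep_vars_compose2) measurable
  have mp: "M (pad I A n) \<in> borel_measurable P" for n using p(1,3) by (intro M_measurable) auto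
  have "(\<integral>\<omega>. iexp (\<Sum>i\<in>I. v i \<bullet> M (A i) \<omega>) \<partial>P) = (\<integral>\<omega>. (\<Prod>n\<in>?N. iexp (v (?f n) \<bullet> M (pad I A n) \<omega>)) \<partial>P)"
  proof (intro Bochner_Integration.integral_cong refl)
    fix \<omega>
    have "(\<Sum>i\<in>I. v i \<bullet> M (A i) \<omega>) = (\<Sum>n\<in>?N. v (?f n) \<bullet> M (pad I A n) \<omega>)"
      by (subst sum.reindex_bij_betw[OF p(5), symmetric]) (simp add: pad_def)
    then show "iexp (\<Sum>i\<in>I. v i \<bullet> M (A i) \<omega>) = (\<Prod>n\<in>?N. iexp (v (?f n) \<bullet> M (pad I A n) \<omega>))"
      by (simp add: exp_sum sum_distrib_left)
  qed
  also have "\<dots> = (\<Prod>n\<in>?N. \<integral>\<omega>. iexp (v (?f n) \<bullet> M (pad I A n) \<omega>) \<partial>P)"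
    using ind by (rule indep_vars_lebesgue_integral[OF finite_lessThan]) (intro integrable_iexp mp)
  also have "\<dots> = (\<Prod>n\<in>?N. of_real (exp (measure lborel (pad I A n) * \<psi> (v (?f n)))))"
    using p(1,3) by (intro prod.cong refl M_cf) auto
  also have "\<dots> = of_real (exp (\<Sum>n\<in>?N. measure lborel (pad I A n) * \<psi> (v (?f n))))"
    by (simp add: exp_sum)
  also have "(\<Sum>n\<in>?N. measure lborel (pad I A n) * \<psi> (v (?f n))) = (\<Sum>i\<in>I. measure lborel (A i) * \<psi> (v i))"
    by (subst sum.reindex_bij_betw[OF p(5), symmetric]) (simp add: pad_def)
  finally show ?thesis .
qed

abbreviation sint :: "(real^'n \<Rightarrow> real^'d^'d) \<Rightarrow> 'w \<Rightarrow> real^'d" where "sint \<equiv> simple_stoch_integral M"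
abbreviation sb :: "(real^'n \<Rightarrow> 'b::real_vector) \<Rightarrow> bool" where "sb \<equiv> Bochner_Integration.simple_bochner_integrable lborel"

lemma sb_props:
  assumes "sb f"
  shows "finite (range f)" "f -` {y} \<in> sets borel" "y \<noteq> 0 \<Longrightarrow> emeasure lborel (f -` {y}) < \<infinity>"
proof -
  have s: "simple_function lborel f" and e: "emeasure lborel {x\<in>space lborel. f x \<noteq> 0} \<noteq> \<infinity>"
    using assms by (auto simp: Bochner_Integration.simple_bochner_integrable.simps)
  show "finite (range f)" using simple_functionD(1)[OF s] by simp
  show "f -` {y} \<in> sets borel" using simple_functionD(2)[OF s, of "{y}"] by simp
  assume "y \<noteq> 0"
  have "{x\<in>space lborel. f x \<noteq> 0} \<in> sets lborel"
    using simple_functionD(2)[OF s, of "- {0}"] by (simp add: vimage_def Collect_conj_eq Int_commute Compl_eq)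
  then have "emeasure lborel (f -` {y}) \<le> emeasure lborel {x\<in>space lborel. f x \<noteq> 0}"
    using \<open>y \<noteq> 0\<close> by (intro emeasure_mono) auto
  then show "emeasure lborel (f -` {y}) < \<infinity>" using e by (simp add: less_top le_less_trans)
qed

lemma sint_measurable: "sb f \<Longrightarrow> sint f \<in> borel_measurable P"
  unfolding simple_stoch_integral_def[abs_def]
  by (intro borel_measurable_sum measurable_compose[OF M_measurable borel_measurable_matrix_vector_mult])
     (auto dest: sb_props)

text \<open>The simple integral is defined through the canonical form, so sums need a common
  refinement: p labels the cells, F assigns a matrix to each label, and cells with the same matrix
  are merged by finite additivity. The label \<open>z0\<close> may have infinite measure and must
  carry the matrix 0. Pairs of functions as labels give additivity.\<close>

lemma sint_refine:
  fixes p :: "real^'n \<Rightarrow> 'z" and F :: "'z \<Rightarrow> real^'d^'d"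
  assumes fin: "finite (range p)" and F0: "F z0 = 0"
    and meas: "\<And>z. z \<in> range p - {z0} \<Longrightarrow> p -` {z} \<in> sets borel" "\<And>z. z \<in> range p - {z0} \<Longrightarrow> emeasure lborel (p -` {z}) < \<infinity>"
  shows "AE \<omega> in P. sint (\<lambda>s. F (p s)) \<omega> = (\<Sum>z\<in>range p - {z0}. F z *v M (p -` {z}) \<omega>)"
proof -
  let ?R = "range p - {z0}" and ?D = "range (\<lambda>s. F (p s)) - {0}"
  have finR: "finite ?R" using fin by simp
  have finD: "finite ?D" using fin by (simp add: image_image[symmetric, of F p])
  have un: "(\<lambda>s. F (p s)) -` {D} = (\<Union>z\<in>{z\<in>?R. F z = D}. p -` {z})" if "D \<in> ?D" for D
    using that F0 by auto
  have "AE \<omega> in P. M ((\<lambda>s. F (p s)) -` {D}) \<omega> = (\<Sum>z\<in>{z\<in>?R. F z = D}. M (p -` {z}) \<omega>)" if "D \<in> ?D" for D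
    unfolding un[OF that] by (rule M_finite_additive) (use meas finR in \<open>auto simp: disjoint_family_on_def\<close>)
  then have "AE \<omega> in P. \<forall>D\<in>?D. M ((\<lambda>s. F (p s)) -` {D}) \<omega> = (\<Sum>z\<in>{z\<in>?R. F z = D}. M (p -` {z}) \<omega>)"
    using finD by (intro AE_finite_allI) auto
  then show ?thesis
  proof eventually_elim
    case (elim \<omega>)
    have "sint (\<lambda>s. F (p s)) \<omega> = (\<Sum>D\<in>?D. \<Sum>z\<in>{z\<in>?R. F z = D}. F z *v M (p -` {z}) \<omega>)"
      unfolding simple_stoch_integral_def using elim
      by (intro sum.cong refl) (auto simp: linear_sum[OF matrix_vector_mul_linear])
    also have "\<dots> = (\<Sum>z\<in>{z\<in>?R. F z \<noteq> 0}. F z *v M (p -` {z}) \<omega>)"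
    proof -
      have "(\<Sum>D\<in>?D. \<Sum>z\<in>{z\<in>?R. F z = D}. F z *v M (p -` {z}) \<omega>) =
        (\<Sum>D\<in>?D. \<Sum>z\<in>{z\<in>{z\<in>?R. F z \<noteq> 0}. F z = D}. F z *v M (p -` {z}) \<omega>)"
        by (intro sum.cong refl) auto
      also have "\<dots> = (\<Sum>z\<in>{z\<in>?R. F z \<noteq> 0}. F z *v M (p -` {z}) \<omega>)"
        using finR finD by (intro sum.group) auto
      finally show ?thesis .
    qed
    also have "\<dots> = (\<Sum>z\<in>?R. F z *v M (p -` {z}) \<omega>)"
      using finR by (intro sum.mono_neutral_left) auto
    finally show ?case .
  qed
qed

lemma sint_cf:
  assumes f: "sb f"
  shows "(\<integral>\<omega>. iexp (u \<bullet> sint f \<omega>) \<partial>P) = of_real (exp (\<integral>s. \<psi> (transpose (f s) *v u) \<partial>lborel))"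
    and "integrable lborel (\<lambda>s. \<psi> (transpose (f s) *v u))"
proof -
  let ?R = "range f - {0}"
  note sb = sb_props[OF f]
  have finR: "finite ?R" using sb by simp
  have "u \<bullet> sint f \<omega> = (\<Sum>D\<in>?R. (transpose D *v u) \<bullet> M (f -` {D}) \<omega>)" for \<omega>
    by (simp add: simple_stoch_integral_def inner_sum_right dot_lmul_matrix transpose_matrix_vector)
  then have "(\<integral>\<omega>. iexp (u \<bullet> sint f \<omega>) \<partial>P) = (\<integral>\<omega>. iexp (\<Sum>D\<in>?R. (transpose D *v u) \<bullet> M (f -` {D}) \<omega>) \<partial>P)" by simp
  also have "\<dots> = of_real (exp (\<Sum>D\<in>?R. measure lborel (f -` {D}) * \<psi> (transpose D *v u)))"
    by (rule M_finite_cf) (use sb finR in \<open>auto simp: disjoint_family_on_def\<close>)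
  also have eq: "(\<lambda>s. \<psi> (transpose (f s) *v u)) = (\<lambda>s. \<Sum>D\<in>?R. indicator (f -` {D}) s * \<psi> (transpose D *v u))"
  proof
    fix s
    have "(\<Sum>D\<in>?R. indicator (f -` {D}) s * \<psi> (transpose D *v u)) = (\<Sum>D\<in>?R. if D = f s then \<psi> (transpose D *v u) else 0)"
      by (intro sum.cong refl) (auto simp: indicator_def)
    also have "\<dots> = \<psi> (transpose (f s) *v u)" using finR by (auto simp: transpose_def matrix_vector_mult_def zero_vec_def[symmetric])
    finally show "\<psi> (transpose (f s) *v u) = (\<Sum>D\<in>?R. indicator (f -` {D}) s * \<psi> (transpose D *v u))" by simp
  qed
  have i: "integrable lborel (\<lambda>s. indicator (f -` {D}) s * \<psi> (transpose D *v u))" if "D \<in> ?R" for D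
    using sb(2,3)[of D] that by (intro integrable_mult_left integrable_real_indicator) auto
  have "(\<Sum>D\<in>?R. measure lborel (f -` {D}) * \<psi> (transpose D *v u)) = (\<integral>s. \<psi> (transpose (f s) *v u) \<partial>lborel)"
    unfolding eq using i by (subst Bochner_Integration.integral_sum) auto
  finally show "(\<integral>\<omega>. iexp (u \<bullet> sint f \<omega>) \<partial>P) = of_real (exp (\<integral>s. \<psi> (transpose (f s) *v u) \<partial>lborel))" .
  show "integrable lborel (\<lambda>s. \<psi> (transpose (f s) *v u))"
    unfolding eq by (intro Bochner_Integration.integrable_sum i)
qed

lemma sb_pair:
  assumes "sb f" "sb g"
  shows "finite (range (\<lambda>s. (f s, g s)))" "z \<in> range (\<lambda>s. (f s, g s)) - {(0, 0)} \<Longrightarrow> (\<lambda>s. (f s, g s)) -` {z} \<in> sets borel"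
    "z \<in> range (\<lambda>s. (f s, g s)) - {(0, 0)} \<Longrightarrow> emeasure lborel ((\<lambda>s. (f s, g s)) -` {z}) < \<infinity>"
proof -
  note f = sb_props[OF assms(1)] and g = sb_props[OF assms(2)]
  show "finite (range (\<lambda>s. (f s, g s)))"
    by (rule finite_subset[of _ "range f \<times> range g"]) (use f g in auto)
  have eq: "(\<lambda>s. (f s, g s)) -` {z} = f -` {fst z} \<inter> g -` {snd z}" for z by (cases z) auto
  show "(\<lambda>s. (f s, g s)) -` {z} \<in> sets borel" unfolding eq using f g by auto
  assume "z \<in> range (\<lambda>s. (f s, g s)) - {(0, 0)}"
  then have "fst z \<noteq> 0 \<or> snd z \<noteq> 0" by (cases z) auto
  moreover have "emeasure lborel (f -` {fst z} \<inter> g -` {snd z}) \<le> emeasure lborel (f -` {fst z})"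
    "emeasure lborel (f -` {fst z} \<inter> g -` {snd z}) \<le> emeasure lborel (g -` {snd z})"
    using f g by (auto intro!: emeasure_mono)
  ultimately show "emeasure lborel ((\<lambda>s. (f s, g s)) -` {z}) < \<infinity>"
    unfolding eq using f(3)[of "fst z"] g(3)[of "snd z"] by (auto intro: le_less_trans)
qed

lemma sint_add:
  assumes "sb f" "sb g"
  shows "AE \<omega> in P. sint (\<lambda>s. f s + g s) \<omega> = sint f \<omega> + sint g \<omega>"
proof -
  note p = sb_pair[OF assms]
  have "AE \<omega> in P. sint (\<lambda>s. (\<lambda>z. fst z + snd z) (f s, g s)) \<omega> = (\<Sum>z\<in>range (\<lambda>s. (f s, g s)) - {(0,0)}. (fst z + snd z) *v M ((\<lambda>s. (f s, g s)) -` {z}) \<omega>)"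
    by (rule sint_refine) (use p in auto)
  moreover have "AE \<omega> in P. sint (\<lambda>s. fst (f s, g s)) \<omega> = (\<Sum>z\<in>range (\<lambda>s. (f s, g s)) - {(0,0)}. fst z *v M ((\<lambda>s. (f s, g s)) -` {z}) \<omega>)"
    by (rule sint_refine) (use p in auto)
  moreover have "AE \<omega> in P. sint (\<lambda>s. snd (f s, g s)) \<omega> = (\<Sum>z\<in>range (\<lambda>s. (f s, g s)) - {(0,0)}. snd z *v M ((\<lambda>s. (f s, g s)) -` {z}) \<omega>)"
    by (rule sint_refine) (use p in auto)
  ultimately show ?thesis
    by eventually_elim (simp add: sum.distrib matrix_vector_mult_add_rdistrib)
qed

lemma sint_matrix_mult:
  assumes "sb f"
  shows "AE \<omega> in P. sint (\<lambda>s. C ** f s) \<omega> = C *v sint f \<omega>"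
proof -
  note p = sb_props[OF assms]
  have "AE \<omega> in P. sint (\<lambda>s. C ** f s) \<omega> = (\<Sum>z\<in>range f - {0}. (C ** z) *v M (f -` {z}) \<omega>)"
    by (rule sint_refine[where F = "\<lambda>z. C ** z"]) (use p in auto)
  then show ?thesis
    by eventually_elim (simp add: simple_stoch_integral_def linear_sum[OF matrix_vector_mul_linear] matrix_vector_mul_assoc)
qed

lemma sb_add: "sb f \<Longrightarrow> sb g \<Longrightarrow> sb (\<lambda>s. f s + g s)"
  by (rule Bochner_Integration.simple_bochner_integrable_compose2) auto

lemma sb_matrix_mult:
  assumes f: "sb f" shows "sb (\<lambda>s. C ** f s)"
  using Bochner_Integration.simple_bochner_integrable_compose2[of "\<lambda>x y. C ** x", OF _ f f] by simp

lemma sb_indicator: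
  assumes f: "sb f" and A: "A \<in> sets borel" shows "sb (\<lambda>s. indicat_real A s *\<^sub>R f s)"
proof -
  have s: "simple_function lborel f" and e: "emeasure lborel {x\<in>space lborel. f x \<noteq> 0} \<noteq> \<infinity>"
    using f by (auto simp: Bochner_Integration.simple_bochner_integrable.simps)
  have s': "simple_function lborel (\<lambda>s. indicat_real A s *\<^sub>R f s)"
    by (rule simple_function_compose2[OF simple_function_indicator s]) (use A in simp)
  have m: "{x\<in>space lborel. f x \<noteq> 0} \<in> sets lborel"
    using simple_functionD(2)[OF s, of "- {0}"] by (simp add: vimage_def Collect_conj_eq Int_commute Compl_eq)
  have "emeasure lborel {x\<in>space lborel. indicat_real A x *\<^sub>R f x \<noteq> 0} \<le> emeasure lborel {x\<in>space lborel. f x \<noteq> 0}"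
    using m by (intro emeasure_mono) auto
  with e s' show ?thesis by (simp add: Bochner_Integration.simple_bochner_integrable.simps less_top le_less_trans)
qed

end

section \<open>Existence of stochastic integrals\<close>

lemma borel_measurable_transpose [measurable (raw)]:
  fixes f :: "'a \<Rightarrow> real^'n^'m"
  assumes "f \<in> borel_measurable M"
  shows "(\<lambda>x. transpose (f x)) \<in> borel_measurable M"
  by (rule measurable_compose[OF assms])
     (intro borel_measurable_continuous_onI linear_continuous_on bounded_linear_transpose)

lemma borel_measurable_matrix_vector_mult_raw [measurable (raw)]:
  fixes f :: "'a \<Rightarrow> real^'n^'m"
  assumes [measurable]: "f \<in> borel_measurable M" "g \<in> borel_measurable M"
  shows "(\<lambda>x. f x *v g x) \<in> borel_measurable M"
proof -
  have "continuous_on UNIV (\<lambda>x::(real^'n^'m) \<times> (real^'n). fst x *v snd x)"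
    by (intro bounded_bilinear.continuous_on[OF bounded_bilinear_matrix_vector_mult] continuous_intros)
  from measurable_compose[OF _ borel_measurable_continuous_onI[OF this], of "\<lambda>x. (f x, g x)" M]
  show ?thesis by simp
qed

lemma borel_measurable_matrix_mult_raw [measurable (raw)]:
  fixes f :: "'a \<Rightarrow> real^'n^'m" and g :: "'a \<Rightarrow> real^'k^'n"
  assumes [measurable]: "f \<in> borel_measurable M" "g \<in> borel_measurable M"
  shows "(\<lambda>x. f x ** g x) \<in> borel_measurable M"
proof -
  have "continuous_on UNIV (\<lambda>x::(real^'n^'m) \<times> (real^'k^'n). fst x ** snd x)"
    by (intro bounded_bilinear.continuous_on[OF bounded_bilinear_matrix_mult] continuous_intros)
  from measurable_compose[OF _ borel_measurable_continuous_onI[OF this], of "\<lambda>x. (f x, g x)" M]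
  show ?thesis by simp
qed

context tempered_levy
begin

text \<open>The modular that replaces a norm on integrands: it is quasi-subadditive, and its
  finiteness is the integrability criterion used below. The row type is free because nothing here
  needs square matrices.\<close>

definition wint :: "(real^'n \<Rightarrow> real^'d^'e) \<Rightarrow> ennreal" where
  "wint f = (\<integral>\<^sup>+s. ennreal (wgt \<alpha> (norm (f s))) \<partial>lborel)"

lemma \<alpha>': "0 \<le> \<alpha>" "\<alpha> \<le> 2" using \<alpha> by auto

lemma \<psi>_transpose_bound: "- \<psi> (transpose A *v u) \<le> 2 * C\<Phi> * (max 1 ((norm u)\<^sup>2) * wgt \<alpha> (norm A))" for A :: "real^'d^'e"
proof -
  have "norm (transpose A *v u) \<le> norm u * norm A"
    using norm_matrix_vector_mult_le[of "transpose A" u] by (simp add: norm_transpose mult.commute)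
  then have "wgt \<alpha> (norm (transpose A *v u)) \<le> wgt \<alpha> (norm u * norm A)" by (intro wgt_mono \<alpha>') auto
  also have "\<dots> \<le> max 1 ((norm u)\<^sup>2) * wgt \<alpha> (norm A)" by (intro wgt_mult_le \<alpha>') auto
  finally have "2 * C\<Phi> * wgt \<alpha> (norm (transpose A *v u)) \<le> 2 * C\<Phi> * (max 1 ((norm u)\<^sup>2) * wgt \<alpha> (norm A))"
    using C\<Phi>(1) by (intro mult_left_mono) auto
  with \<psi>_bound[of "transpose A *v u"] show ?thesis by linarith
qed

lemma integrable_wgt:
  assumes [measurable]: "f \<in> borel_measurable borel" and "wint f < \<infinity>"
  shows "integrable lborel (\<lambda>s. wgt \<alpha> (norm (f s)))"
  by (rule integrableI_bounded) (use assms(2) in \<open>auto simp: wint_def\<close>)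

lemma integrable_\<psi>_transpose:
  fixes f :: "real^'n \<Rightarrow> real^'d^'e"
  assumes [measurable]: "f \<in> borel_measurable borel" and w: "wint f < \<infinity>"
  shows "integrable lborel (\<lambda>s. \<psi> (transpose (f s) *v u))"
proof (rule Bochner_Integration.integrable_bound)
  show "integrable lborel (\<lambda>s. 2 * C\<Phi> * (max 1 ((norm u)\<^sup>2) * wgt \<alpha> (norm (f s))))"
    using integrable_wgt[OF assms] by simp
  show "AE s in lborel. norm (\<psi> (transpose (f s) *v u)) \<le> norm (2 * C\<Phi> * (max 1 ((norm u)\<^sup>2) * wgt \<alpha> (norm (f s))))"
  proof (rule AE_I2)
    fix s
    show "norm (\<psi> (transpose (f s) *v u)) \<le> norm (2 * C\<Phi> * (max 1 ((norm u)\<^sup>2) * wgt \<alpha> (norm (f s))))"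
      unfolding real_norm_def abs_of_nonpos[OF \<psi>_nonpos]
      by (rule order_trans[OF \<psi>_transpose_bound abs_ge_self])
  qed
qed measurable

lemma integral_\<psi>_transpose_bound:
  fixes f :: "real^'n \<Rightarrow> real^'d^'e"
  assumes [measurable]: "f \<in> borel_measurable borel" and w: "wint f < \<infinity>"
  shows "- (\<integral>s. \<psi> (transpose (f s) *v u) \<partial>lborel) \<le> 2 * C\<Phi> * enn2real (wint f) * ((norm u)\<^sup>2 + 1)"
proof -
  have "- (\<integral>s. \<psi> (transpose (f s) *v u) \<partial>lborel) = (\<integral>s. - \<psi> (transpose (f s) *v u) \<partial>lborel)" by simp
  also have "\<dots> \<le> (\<integral>s. 2 * C\<Phi> * (max 1 ((norm u)\<^sup>2) * wgt \<alpha> (norm (f s))) \<partial>lborel)"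
    using integrable_\<psi>_transpose[OF assms] integrable_wgt[OF assms] by (intro integral_mono \<psi>_transpose_bound) auto
  also have "\<dots> = 2 * C\<Phi> * (max 1 ((norm u)\<^sup>2) * (\<integral>s. wgt \<alpha> (norm (f s)) \<partial>lborel))" by simp
  also have "(\<integral>s. wgt \<alpha> (norm (f s)) \<partial>lborel) = enn2real (wint f)"
    unfolding wint_def by (rule integral_eq_nn_integral) auto
  also have "2 * C\<Phi> * (max 1 ((norm u)\<^sup>2) * enn2real (wint f)) \<le> 2 * C\<Phi> * (((norm u)\<^sup>2 + 1) * enn2real (wint f))"
    using C\<Phi>(1) by (intro mult_left_mono mult_right_mono) auto
  finally show ?thesis by (simp add: mult_ac)
qed

lemma wint_add_le:
  fixes f g :: "real^'n \<Rightarrow> real^'d^'e"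
  assumes [measurable]: "f \<in> borel_measurable borel" "g \<in> borel_measurable borel"
    and h: "\<And>s. norm (h s) \<le> norm (f s) + norm (g s)"
  shows "wint h \<le> 4 * (wint f + wint g)"
proof -
  have "wint h \<le> (\<integral>\<^sup>+s. 4 * (ennreal (wgt \<alpha> (norm (f s))) + ennreal (wgt \<alpha> (norm (g s)))) \<partial>lborel)"
    unfolding wint_def
  proof (rule nn_integral_mono)
    fix s
    have "wgt \<alpha> (norm (h s)) \<le> wgt \<alpha> (norm (f s) + norm (g s))" by (intro wgt_mono \<alpha>' h) auto
    also have "\<dots> \<le> 4 * (wgt \<alpha> (norm (f s)) + wgt \<alpha> (norm (g s)))" by (intro wgt_add_le \<alpha>') auto
    finally have "ennreal (wgt \<alpha> (norm (h s))) \<le> ennreal (4 * (wgt \<alpha> (norm (f s)) + wgt \<alpha> (norm (g s))))" by (rule ennreal_leI)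
    then show "ennreal (wgt \<alpha> (norm (h s))) \<le> 4 * (ennreal (wgt \<alpha> (norm (f s))) + ennreal (wgt \<alpha> (norm (g s))))"
      by (simp add: ennreal_mult ennreal_plus)
  qed
  also have "\<dots> = 4 * (wint f + wint g)"
    unfolding wint_def by (subst nn_integral_cmult, measurable) (subst nn_integral_add, auto)
  finally show ?thesis .
qed

lemma wint_matrix_mult:
  fixes f :: "real^'n \<Rightarrow> real^'d^'e" and C :: "real^'e^'k"
  assumes [measurable]: "f \<in> borel_measurable borel" and "wint f < \<infinity>"
  shows "wint (\<lambda>s. C ** f s) < \<infinity>"
proof -
  have "wint (\<lambda>s. C ** f s) \<le> (\<integral>\<^sup>+s. ennreal (max 1 ((norm C)\<^sup>2)) * ennreal (wgt \<alpha> (norm (f s))) \<partial>lborel)"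
    unfolding wint_def
  proof (rule nn_integral_mono)
    fix s
    have "wgt \<alpha> (norm (C ** f s)) \<le> wgt \<alpha> (norm C * norm (f s))" by (intro wgt_mono \<alpha>' norm_matrix_mult_le) auto
    also have "\<dots> \<le> max 1 ((norm C)\<^sup>2) * wgt \<alpha> (norm (f s))" by (intro wgt_mult_le \<alpha>') auto
    finally show "ennreal (wgt \<alpha> (norm (C ** f s))) \<le> ennreal (max 1 ((norm C)\<^sup>2)) * ennreal (wgt \<alpha> (norm (f s)))"
      by (subst ennreal_mult'[symmetric]) (auto intro: ennreal_leI)
  qed
  also have "\<dots> = ennreal (max 1 ((norm C)\<^sup>2)) * wint f" unfolding wint_def by (rule nn_integral_cmult) measurable
  also have "\<dots> < \<infinity>" using assms(2) by (simp add: ennreal_mult_less_top)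
  finally show ?thesis .
qed

text \<open>The pointwise bound by twice the norm of f allows dominated convergence; a sequence in
  \<open>stoch_approx\<close> need not satisfy it.\<close>

definition good_approx :: "(real^'n \<Rightarrow> real^'d^'e) \<Rightarrow> (nat \<Rightarrow> real^'n \<Rightarrow> real^'d^'e) \<Rightarrow> bool" where
  "good_approx f fs \<longleftrightarrow> (\<forall>k. Bochner_Integration.simple_bochner_integrable lborel (fs k)) \<and>
     (\<forall>s. (\<lambda>k. fs k s) \<longlonglongrightarrow> f s) \<and> (\<forall>k s. norm (fs k s) \<le> 2 * norm (f s))"

lemma ex_good_approx:
  fixes f :: "real^'n \<Rightarrow> real^'d^'e"
  assumes [measurable]: "f \<in> borel_measurable borel"
  shows "\<exists>fs. good_approx f fs"
proof -
  have "f \<in> borel_measurable lborel" by simp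
  from borel_measurable_implies_sequence_metric[OF this, of 0]
  obtain F where F: "\<And>i. simple_function lborel (F i)" "\<And>x. (\<lambda>i. F i x) \<longlonglongrightarrow> f x" "\<And>i x. norm (F i x) \<le> 2 * norm (f x)"
    by auto
  \<comment> \<open>Cutting off at a growing ball gives supports of finite measure; at each fixed
    point the cut has no effect from some index on.\<close>
  define fs where "fs k s = indicat_real (cball 0 (real k)) s *\<^sub>R F k s" for k s
  have "Bochner_Integration.simple_bochner_integrable lborel (fs k)" for k
  proof (rule Bochner_Integration.simple_bochner_integrable.intros)
    show s: "simple_function lborel (fs k)"
      unfolding fs_def by (rule simple_function_compose2[OF simple_function_indicator F(1)]) simp
    have "emeasure lborel {x\<in>space lborel. fs k x \<noteq> 0} \<le> emeasure lborel (cball 0 (real k) :: (real^'n) set)"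
      by (intro emeasure_mono) (auto simp: fs_def indicator_def split: if_splits)
    also have "\<dots> < \<infinity>" by (rule emeasure_bounded_finite) simp
    finally show "emeasure lborel {x\<in>space lborel. fs k x \<noteq> 0} \<noteq> \<infinity>" by simp
  qed
  moreover have "(\<lambda>k. fs k s) \<longlonglongrightarrow> f s" for s
  proof (rule Lim_transform_eventually[OF F(2)])
    obtain n where "norm s \<le> real n" using real_arch_simple by blast
    then have "\<And>k. n \<le> k \<Longrightarrow> F k s = fs k s" by (auto simp: fs_def indicator_def)
    then show "eventually (\<lambda>k. F k s = fs k s) sequentially" by (auto simp: eventually_sequentially)
  qed
  moreover have "norm (fs k s) \<le> 2 * norm (f s)" for k s using F(3)[of k s] by (simp add: fs_def indicator_def)
  ultimately have "good_approx f fs" by (simp add: good_approx_def)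
  then show ?thesis by blast
qed

lemma sb_measurable: "Bochner_Integration.simple_bochner_integrable lborel f \<Longrightarrow> f \<in> borel_measurable borel"
  using borel_measurable_simple_function[of lborel f] by (auto simp: Bochner_Integration.simple_bochner_integrable.simps)

lemma good_approx_wint_tendsto:
  fixes f :: "real^'n \<Rightarrow> real^'d^'e"
  assumes f[measurable]: "f \<in> borel_measurable borel" and w: "wint f < \<infinity>" and g: "good_approx f fs"
  shows "(\<lambda>k. wint (\<lambda>s. fs k s - f s)) \<longlonglongrightarrow> 0"
proof -
  have [measurable]: "fs k \<in> borel_measurable borel" for k using g by (intro sb_measurable) (simp add: good_approx_def)
  have "(\<lambda>k. \<integral>\<^sup>+s. ennreal (wgt \<alpha> (norm (fs k s - f s))) \<partial>lborel) \<longlonglongrightarrow> (\<integral>\<^sup>+s. 0 \<partial>(lborel :: (real^'n) measure))"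
  proof (rule nn_integral_dominated_convergence[where w = "\<lambda>s. ennreal (9 * wgt \<alpha> (norm (f s)))"])
    show "AE s in lborel. ennreal (wgt \<alpha> (norm (fs k s - f s))) \<le> ennreal (9 * wgt \<alpha> (norm (f s)))" for k
    proof (rule AE_I2, rule ennreal_leI)
      fix s
      have "norm (fs k s - f s) \<le> norm (fs k s) + norm (f s)" by (rule norm_triangle_ineq4)
      also have "\<dots> \<le> 3 * norm (f s)" using g by (auto simp: good_approx_def)
      finally have "wgt \<alpha> (norm (fs k s - f s)) \<le> wgt \<alpha> (3 * norm (f s))" by (intro wgt_mono \<alpha>') auto
      also have "\<dots> \<le> max 1 (3\<^sup>2) * wgt \<alpha> (norm (f s))" by (intro wgt_mult_le \<alpha>') auto
      finally show "wgt \<alpha> (norm (fs k s - f s)) \<le> 9 * wgt \<alpha> (norm (f s))" by simp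
    qed
    have "(\<integral>\<^sup>+s. ennreal (9 * wgt \<alpha> (norm (f s))) \<partial>lborel) = 9 * wint f"
      unfolding wint_def by (simp add: ennreal_mult' nn_integral_cmult)
    then show "(\<integral>\<^sup>+s. ennreal (9 * wgt \<alpha> (norm (f s))) \<partial>lborel) < \<infinity>" using w by (simp add: ennreal_mult_less_top)
    show "AE s in lborel. (\<lambda>k. ennreal (wgt \<alpha> (norm (fs k s - f s)))) \<longlonglongrightarrow> 0"
    proof (rule AE_I2)
      fix s
      have "(\<lambda>k. fs k s - f s) \<longlonglongrightarrow> f s - f s" using g by (intro tendsto_diff tendsto_const) (simp add: good_approx_def)
      then have "(\<lambda>k. (norm (fs k s - f s))\<^sup>2) \<longlonglongrightarrow> (norm (f s - f s))\<^sup>2" by (intro tendsto_power tendsto_norm)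
      then have sq: "(\<lambda>k. (norm (fs k s - f s))\<^sup>2) \<longlonglongrightarrow> 0" by simp
      have "(\<lambda>k. wgt \<alpha> (norm (fs k s - f s))) \<longlonglongrightarrow> 0"
        by (rule tendsto_sandwich[OF _ _ tendsto_const sq]) (auto intro!: always_eventually wgt_le_square)
      then show "(\<lambda>k. ennreal (wgt \<alpha> (norm (fs k s - f s)))) \<longlonglongrightarrow> 0"
        using tendsto_ennrealI by fastforce
    qed
  qed measurable
  then show ?thesis by (simp add: wint_def)
qed

lemma good_approx_\<psi>_tendsto:
  fixes f :: "real^'n \<Rightarrow> real^'d^'e"
  assumes f[measurable]: "f \<in> borel_measurable borel" and w: "wint f < \<infinity>" and g: "good_approx f fs"
  shows "(\<lambda>k. \<integral>s. \<psi> (transpose (fs k s) *v u) \<partial>lborel) \<longlonglongrightarrow> (\<integral>s. \<psi> (transpose (f s) *v u) \<partial>lborel)"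
proof -
  have [measurable]: "fs k \<in> borel_measurable borel" for k using g by (intro sb_measurable) (simp add: good_approx_def)
  show ?thesis
  proof (rule integral_dominated_convergence[where w = "\<lambda>s. 2 * C\<Phi> * (max 1 ((norm u)\<^sup>2) * (4 * wgt \<alpha> (norm (f s))))"])
    show "integrable lborel (\<lambda>s. 2 * C\<Phi> * (max 1 ((norm u)\<^sup>2) * (4 * wgt \<alpha> (norm (f s)))))"
      using integrable_wgt[OF f w] by simp
    show "AE s in lborel. norm (\<psi> (transpose (fs k s) *v u)) \<le> 2 * C\<Phi> * (max 1 ((norm u)\<^sup>2) * (4 * wgt \<alpha> (norm (f s))))" for k
    proof (rule AE_I2)
      fix s
      have "wgt \<alpha> (norm (fs k s)) \<le> wgt \<alpha> (2 * norm (f s))" using g by (intro wgt_mono \<alpha>') (auto simp: good_approx_def)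
      also have "\<dots> \<le> max 1 (2\<^sup>2) * wgt \<alpha> (norm (f s))" by (intro wgt_mult_le \<alpha>') auto
      finally have "wgt \<alpha> (norm (fs k s)) \<le> 4 * wgt \<alpha> (norm (f s))" by simp
      then have "2 * C\<Phi> * (max 1 ((norm u)\<^sup>2) * wgt \<alpha> (norm (fs k s))) \<le> 2 * C\<Phi> * (max 1 ((norm u)\<^sup>2) * (4 * wgt \<alpha> (norm (f s))))"
        using C\<Phi>(1) by (intro mult_left_mono) auto
      with \<psi>_transpose_bound[of "fs k s" u]
      show "norm (\<psi> (transpose (fs k s) *v u)) \<le> 2 * C\<Phi> * (max 1 ((norm u)\<^sup>2) * (4 * wgt \<alpha> (norm (f s))))"
        unfolding real_norm_def abs_of_nonpos[OF \<psi>_nonpos] by linarith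
    qed
    show "AE s in lborel. (\<lambda>k. \<psi> (transpose (fs k s) *v u)) \<longlonglongrightarrow> \<psi> (transpose (f s) *v u)"
      using g by (intro AE_I2 continuous_\<psi> bounded_bilinear.tendsto[OF bounded_bilinear_matrix_vector_mult]
         bounded_linear.tendsto[OF bounded_linear_transpose] tendsto_const) (simp add: good_approx_def)
  qed measurable
qed

end

context tempered_random_measure
begin

lemma sint_diff:
  assumes "sb f" "sb g"
  shows "AE \<omega> in P. sint (\<lambda>s. f s - g s) \<omega> = sint f \<omega> - sint g \<omega>"
proof -
  note p = sb_pair[OF assms]
  have "AE \<omega> in P. sint (\<lambda>s. (\<lambda>z. fst z - snd z) (f s, g s)) \<omega> = (\<Sum>z\<in>range (\<lambda>s. (f s, g s)) - {(0,0)}. (fst z - snd z) *v M ((\<lambda>s. (f s, g s)) -` {z}) \<omega>)"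
    by (rule sint_refine) (use p in auto)
  moreover have "AE \<omega> in P. sint (\<lambda>s. fst (f s, g s)) \<omega> = (\<Sum>z\<in>range (\<lambda>s. (f s, g s)) - {(0,0)}. fst z *v M ((\<lambda>s. (f s, g s)) -` {z}) \<omega>)"
    by (rule sint_refine) (use p in auto)
  moreover have "AE \<omega> in P. sint (\<lambda>s. snd (f s, g s)) \<omega> = (\<Sum>z\<in>range (\<lambda>s. (f s, g s)) - {(0,0)}. snd z *v M ((\<lambda>s. (f s, g s)) -` {z}) \<omega>)"
    by (rule sint_refine) (use p in auto)
  ultimately show ?thesis
    by eventually_elim (simp add: sum_subtractf matrix_vector_mult_diff_rdistrib)
qed

lemma sb_diff: "sb f \<Longrightarrow> sb g \<Longrightarrow> sb (\<lambda>s. f s - g s)"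
  by (rule Bochner_Integration.simple_bochner_integrable_compose2) auto

lemma sb_wint:
  fixes f :: "real^'n \<Rightarrow> real^'d^'d"
  assumes f: "sb f" shows "wint f < \<infinity>"
proof -
  have s: "simple_function lborel f" and e: "emeasure lborel {x\<in>space lborel. f x \<noteq> 0} \<noteq> \<infinity>"
    using f by (auto simp: Bochner_Integration.simple_bochner_integrable.simps)
  have [measurable]: "f \<in> borel_measurable borel" by (rule sb_measurable[OF f])
  have fin: "finite (range (\<lambda>s. wgt \<alpha> (norm (f s))))"
    using sb_props(1)[OF f] by (metis finite_imageI image_image)
  let ?m = "Max (range (\<lambda>s. wgt \<alpha> (norm (f s))))"
  have m0: "0 \<le> ?m" using Max_ge[OF fin, of "wgt \<alpha> (norm (f undefined))"] by (meson order_trans rangeI wgt_nonneg)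
  have "wint f \<le> (\<integral>\<^sup>+s. ennreal ?m * indicator {x\<in>space lborel. f x \<noteq> 0} s \<partial>lborel)"
    unfolding wint_def
  proof (rule nn_integral_mono)
    fix s
    show "ennreal (wgt \<alpha> (norm (f s))) \<le> ennreal ?m * indicator {x\<in>space lborel. f x \<noteq> 0} s"
      using Max_ge[OF fin, of "wgt \<alpha> (norm (f s))"] by (cases "f s = 0") (auto intro: ennreal_leI)
  qed
  also have "\<dots> = ennreal ?m * emeasure lborel {x\<in>space lborel. f x \<noteq> 0}"
    by (rule nn_integral_cmult_indicator) measurable
  also have "\<dots> < \<infinity>" using e by (simp add: ennreal_mult_less_top less_top)
  finally show ?thesis .
qed

text \<open>The constant of \<open>prob_norm_tail_le\<close> times the constant
  \<open>2 * C\<Phi>\<close> that bounds the exponent by \<open>wint\<close>.\<close>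

definition tailc :: "real \<Rightarrow> real" where
  "tailc \<epsilon> = real CARD('d) * (3 * (1 + (\<epsilon> / CARD('d))\<^sup>2) / (\<epsilon> / CARD('d))\<^sup>2) * (2 * C\<Phi>)"

lemma tailc_nonneg: "0 \<le> tailc \<epsilon>" using C\<Phi>(1) by (simp add: tailc_def)

text \<open>With x the integrated exponent, 1 - exp x \<le> -x, and -x is at most a multiple of
  \<open>wint f\<close> times (norm u)^2 + 1, the form that the tail bound takes as input.\<close>

lemma cf_tail:
  fixes f :: "real^'n \<Rightarrow> real^'d^'d"
  assumes [measurable]: "Y \<in> borel_measurable P" "f \<in> borel_measurable borel" and w: "wint f < \<infinity>"
    and cf: "\<And>u. (\<integral>\<omega>. iexp (u \<bullet> Y \<omega>) \<partial>P) = of_real (exp (\<integral>s. \<psi> (transpose (f s) *v u) \<partial>lborel))" and \<epsilon>: "0 < \<epsilon>"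
  shows "prob {\<omega>\<in>space P. \<epsilon> < norm (Y \<omega>)} \<le> tailc \<epsilon> * enn2real (wint f)"
proof -
  have "prob {\<omega>\<in>space P. \<epsilon> < norm (Y \<omega>)} \<le> real CARD('d) * (3 * (1 + (\<epsilon> / CARD('d))\<^sup>2) / (\<epsilon> / CARD('d))\<^sup>2) * (2 * C\<Phi> * enn2real (wint f))"
  proof (rule prob_norm_tail_le[OF _ _ _ \<epsilon>])
    show "0 \<le> 2 * C\<Phi> * enn2real (wint f)" using C\<Phi>(1) by simp
    fix u
    have "1 + (\<integral>s. \<psi> (transpose (f s) *v u) \<partial>lborel) \<le> exp (\<integral>s. \<psi> (transpose (f s) *v u) \<partial>lborel)" by (rule exp_ge_add_one_self)
    with integral_\<psi>_transpose_bound[OF assms(2) w, of u]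
    show "1 - Re (\<integral>\<omega>. iexp (u \<bullet> Y \<omega>) \<partial>P) \<le> 2 * C\<Phi> * enn2real (wint f) * ((norm u)\<^sup>2 + 1)"
      unfolding cf Re_complex_of_real by linarith
  qed simp
  then show ?thesis by (simp add: tailc_def mult_ac)
qed

lemma sint_tail: "sb f \<Longrightarrow> 0 < \<epsilon> \<Longrightarrow> prob {\<omega>\<in>space P. \<epsilon> < norm (sint f \<omega>)} \<le> tailc \<epsilon> * enn2real (wint f)"
  by (intro cf_tail sint_cf(1) sint_measurable sb_measurable sb_wint)

text \<open>Restriction to A only decreases norms, so the \<open>wint\<close> of the restricted
  differences tends to 0 for every A at once, and the tail bound makes the integrals Cauchy in
  probability.\<close>

theorem good_approx_stoch_approx:
  fixes f :: "real^'n \<Rightarrow> real^'d^'d"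
  assumes f[measurable]: "f \<in> borel_measurable borel" and w: "wint f < \<infinity>" and g: "good_approx f fs"
  shows "stoch_approx P M f fs"
  unfolding stoch_approx_def
proof (intro conjI allI ballI)
  show sb: "sb (fs k)" for k using g by (simp add: good_approx_def)
  show "AE s in lborel. (\<lambda>k. fs k s) \<longlonglongrightarrow> f s" using g by (simp add: good_approx_def)
  fix A :: "(real^'n) set" assume A: "A \<in> sets borel"
  let ?g = "\<lambda>k s. indicat_real A s *\<^sub>R fs k s"
  have sbg: "sb (?g k)" for k by (intro sb_indicator sb A)
  have [measurable]: "fs k \<in> borel_measurable borel" for k by (rule sb_measurable[OF sb])
  show "\<exists>Z\<in>borel_measurable P. tendsto_in_prob P (\<lambda>k. sint (?g k)) Z sequentially"
  proof (rule Cauchy_in_prob_imp_convergent)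
    show meas: "sint (?g i) \<in> borel_measurable P" for i by (rule sint_measurable[OF sbg])
    fix \<epsilon> \<eta> :: real assume \<epsilon>: "0 < \<epsilon>" and \<eta>: "0 < \<eta>"
    \<comment> \<open>The difference of two approximations has \<open>wint\<close> at most 4 (c + c)
      = 8 c, so tailc times it stays below \<eta>.\<close>
    define c where "c = \<eta> / (8 * (tailc \<epsilon> + 1))"
    have c: "0 < c" using \<eta> tailc_nonneg[of \<epsilon>] by (simp add: c_def)
    have "0 < ennreal c" using c by simp
    from order_tendstoD(2)[OF good_approx_wint_tendsto[OF f w g] this]
    obtain n0 where n0: "\<And>k. n0 \<le> k \<Longrightarrow> wint (\<lambda>s. fs k s - f s) < ennreal c" by (auto simp: eventually_sequentially)
    have "prob {\<omega>\<in>space P. \<epsilon> < dist (sint (?g m) \<omega>) (sint (?g n) \<omega>)} \<le> \<eta>" if mn: "n0 \<le> m" "n0 \<le> n" for m n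
    proof -
      have "prob {\<omega>\<in>space P. \<epsilon> < dist (sint (?g m) \<omega>) (sint (?g n) \<omega>)} = prob {\<omega>\<in>space P. \<epsilon> < norm (sint (\<lambda>s. ?g m s - ?g n s) \<omega>)}"
        using sint_diff[OF sbg[of m] sbg[of n]] meas sint_measurable[OF sb_diff[OF sbg[of m] sbg[of n]]]
        by (intro finite_measure_eq_AE) (auto simp: dist_norm)
      also have "\<dots> \<le> tailc \<epsilon> * enn2real (wint (\<lambda>s. ?g m s - ?g n s))" by (intro sint_tail sb_diff sbg \<epsilon>)
      also have "\<dots> \<le> tailc \<epsilon> * (8 * c)"
      proof (intro mult_left_mono tailc_nonneg)
        have "wint (\<lambda>s. ?g m s - ?g n s) \<le> 4 * (wint (\<lambda>s. fs m s - f s) + wint (\<lambda>s. fs n s - f s))"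
        proof (rule wint_add_le)
          fix s
          have "norm (fs m s - fs n s) \<le> norm (fs m s - f s) + norm (fs n s - f s)"
            using norm_triangle_ineq4[of "fs m s - f s" "fs n s - f s"] by simp
          then show "norm (?g m s - ?g n s) \<le> norm (fs m s - f s) + norm (fs n s - f s)" by (simp add: indicator_def)
        qed measurable
        also have "\<dots> \<le> 4 * (ennreal c + ennreal c)" by (intro mult_left_mono add_mono less_imp_le n0 mn) auto
        also have "\<dots> = ennreal (8 * c)" using c by (simp add: ennreal_mult' mult_2[symmetric] mult.assoc[symmetric])
        finally show "enn2real (wint (\<lambda>s. ?g m s - ?g n s)) \<le> 8 * c" using c by (intro enn2real_leI) auto
      qed
      also have "\<dots> \<le> \<eta>" using tailc_nonneg[of \<epsilon>] \<eta> by (simp add: c_def field_simps)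
      finally show ?thesis .
    qed
    then show "\<exists>n0. \<forall>m\<ge>n0. \<forall>n\<ge>n0. prob {\<omega>\<in>space P. \<epsilon> < dist (sint (?g m) \<omega>) (sint (?g n) \<omega>)} \<le> \<eta>" by blast
  qed
qed

corollary wint_stoch_integrable:
  assumes "f \<in> borel_measurable borel" "wint f < \<infinity>"
  shows "f \<in> stoch_integrable P M"
  using ex_good_approx[OF assms(1)] good_approx_stoch_approx[OF assms] assms(1) by (auto simp: stoch_integrable_def)

lemma stoch_approx_UNIV:
  assumes "stoch_approx P M f fs"
  shows "\<exists>Z\<in>borel_measurable P. tendsto_in_prob P (\<lambda>k. sint (fs k)) Z sequentially"
  using assms unfolding stoch_approx_def by (auto dest!: bspec[of _ _ UNIV])

corollary ex_has_stoch_integral: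
  assumes "f \<in> borel_measurable borel" "wint f < \<infinity>"
  shows "\<exists>Y. has_stoch_integral P M f Y"
proof -
  obtain fs where fs: "good_approx f fs" using ex_good_approx[OF assms(1)] by blast
  have "stoch_approx P M f fs" by (rule good_approx_stoch_approx[OF assms fs])
  with stoch_approx_UNIV[OF this] assms(1) show ?thesis unfolding has_stoch_integral_def by blast
qed

lemma has_stoch_integral_add:
  assumes "has_stoch_integral P M f Y" "has_stoch_integral P M g Z"
  shows "has_stoch_integral P M (\<lambda>s. f s + g s) (\<lambda>\<omega>. Y \<omega> + Z \<omega>)"
proof -
  obtain fs where f[measurable]: "f \<in> borel_measurable borel" "Y \<in> borel_measurable P" and fs: "stoch_approx P M f fs" "tendsto_in_prob P (\<lambda>k. sint (fs k)) Y sequentially"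
    using assms(1) by (auto simp: has_stoch_integral_def)
  obtain gs where g[measurable]: "g \<in> borel_measurable borel" "Z \<in> borel_measurable P" and gs: "stoch_approx P M g gs" "tendsto_in_prob P (\<lambda>k. sint (gs k)) Z sequentially"
    using assms(2) by (auto simp: has_stoch_integral_def)
  have sb: "sb (fs k)" "sb (gs k)" for k using fs(1) gs(1) by (auto simp: stoch_approx_def)
  have key: "tendsto_in_prob P (\<lambda>k. sint (\<lambda>s. f' k s + g' k s)) (\<lambda>\<omega>. Y' \<omega> + Z' \<omega>) sequentially"
    if "\<And>k. sb (f' k)" "\<And>k. sb (g' k)" and [measurable]: "Y' \<in> borel_measurable P" "Z' \<in> borel_measurable P"
      and "tendsto_in_prob P (\<lambda>k. sint (f' k)) Y' sequentially" "tendsto_in_prob P (\<lambda>k. sint (g' k)) Z' sequentially" for f' g' Y' Z'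
  proof (rule tendsto_in_prob_cong_AE)
    have [measurable]: "sint (f' k) \<in> borel_measurable P" "sint (g' k) \<in> borel_measurable P" for k using that by (auto intro: sint_measurable)
    show "tendsto_in_prob P (\<lambda>k \<omega>. sint (f' k) \<omega> + sint (g' k) \<omega>) (\<lambda>\<omega>. Y' \<omega> + Z' \<omega>) sequentially"
      by (rule tendsto_in_prob_add) (use that in auto)
    show "(\<lambda>\<omega>. sint (f' i) \<omega> + sint (g' i) \<omega>) \<in> borel_measurable P" for i by measurable
    show "sint (\<lambda>s. f' i s + g' i s) \<in> borel_measurable P" for i using that by (intro sint_measurable sb_add)
    show "(\<lambda>\<omega>. Y' \<omega> + Z' \<omega>) \<in> borel_measurable P" by measurable
    show "AE \<omega> in P. sint (f' i) \<omega> + sint (g' i) \<omega> = sint (\<lambda>s. f' i s + g' i s) \<omega>" for i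
      using sint_add[OF that(1)[of i] that(2)[of i]] by eventually_elim simp
  qed
  have "stoch_approx P M (\<lambda>s. f s + g s) (\<lambda>k s. fs k s + gs k s)"
    unfolding stoch_approx_def
  proof (intro conjI allI ballI)
    show "sb (\<lambda>s. fs k s + gs k s)" for k by (intro sb_add sb)
    have "AE s in lborel. (\<lambda>k. fs k s) \<longlonglongrightarrow> f s" "AE s in lborel. (\<lambda>k. gs k s) \<longlonglongrightarrow> g s"
      using fs gs by (auto simp: stoch_approx_def)
    then show "AE s in lborel. (\<lambda>k. fs k s + gs k s) \<longlonglongrightarrow> f s + g s"
      by eventually_elim (rule tendsto_add)
    fix A :: "(real^'n) set" assume A: "A \<in> sets borel"
    obtain Y' Z' where YZ: "Y' \<in> borel_measurable P" "Z' \<in> borel_measurable P"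
      "tendsto_in_prob P (\<lambda>k. sint (\<lambda>s. indicat_real A s *\<^sub>R fs k s)) Y' sequentially"
      "tendsto_in_prob P (\<lambda>k. sint (\<lambda>s. indicat_real A s *\<^sub>R gs k s)) Z' sequentially"
      using fs(1) gs(1) A unfolding stoch_approx_def by blast
    have "tendsto_in_prob P (\<lambda>k. sint (\<lambda>s. indicat_real A s *\<^sub>R fs k s + indicat_real A s *\<^sub>R gs k s)) (\<lambda>\<omega>. Y' \<omega> + Z' \<omega>) sequentially"
      by (rule key) (use YZ sb A in \<open>auto intro: sb_indicator\<close>)
    then show "\<exists>Z\<in>borel_measurable P. tendsto_in_prob P (\<lambda>k. sint (\<lambda>s. indicat_real A s *\<^sub>R (fs k s + gs k s))) Z sequentially"
      using YZ(1,2) by (intro bexI[of _ "\<lambda>\<omega>. Y' \<omega> + Z' \<omega>"]) (auto simp: scaleR_add_right)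
  qed
  moreover have "tendsto_in_prob P (\<lambda>k. sint (\<lambda>s. fs k s + gs k s)) (\<lambda>\<omega>. Y \<omega> + Z \<omega>) sequentially"
    by (rule key) (use sb fs gs in auto)
  ultimately show ?thesis unfolding has_stoch_integral_def by (intro conjI exI[of _ "\<lambda>k s. fs k s + gs k s"]) auto
qed

text \<open>Constant matrix factors from the left give signs, hence differences, and let a vector of
  integrals be encoded in a single one.\<close>

lemma has_stoch_integral_matrix_mult:
  assumes "has_stoch_integral P M f Y"
  shows "has_stoch_integral P M (\<lambda>s. C ** f s) (\<lambda>\<omega>. C *v Y \<omega>)"
proof -
  obtain fs where f[measurable]: "f \<in> borel_measurable borel" "Y \<in> borel_measurable P" and fs: "stoch_approx P M f fs" "tendsto_in_prob P (\<lambda>k. sint (fs k)) Y sequentially"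
    using assms(1) by (auto simp: has_stoch_integral_def)
  have sb: "sb (fs k)" for k using fs(1) by (auto simp: stoch_approx_def)
  have key: "tendsto_in_prob P (\<lambda>k. sint (\<lambda>s. C ** f' k s)) (\<lambda>\<omega>. C *v Y' \<omega>) sequentially"
    if "\<And>k. sb (f' k)" and [measurable]: "Y' \<in> borel_measurable P"
      and "tendsto_in_prob P (\<lambda>k. sint (f' k)) Y' sequentially" for f' Y'
  proof (rule tendsto_in_prob_cong_AE)
    have [measurable]: "sint (f' k) \<in> borel_measurable P" for k using that by (auto intro: sint_measurable)
    show "tendsto_in_prob P (\<lambda>k \<omega>. C *v sint (f' k) \<omega>) (\<lambda>\<omega>. C *v Y' \<omega>) sequentially"
    proof (rule tendsto_in_prob_lipschitz[where L = "norm C + 1" and g = "(*v) C"])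
      fix x y :: "real^'d"
      have "dist (C *v x) (C *v y) \<le> norm C * dist x y"
        using norm_matrix_vector_mult_le[of C "x - y"] by (simp add: dist_norm matrix_vector_mult_diff_distrib)
      also have "\<dots> \<le> (norm C + 1) * dist x y" by (intro mult_right_mono) auto
      finally show "dist (C *v x) (C *v y) \<le> (norm C + 1) * dist x y" .
    qed (use that in \<open>auto simp: add_nonneg_pos\<close>)
    show "(\<lambda>\<omega>. C *v sint (f' i) \<omega>) \<in> borel_measurable P" for i by measurable
    show "sint (\<lambda>s. C ** f' i s) \<in> borel_measurable P" for i using that by (intro sint_measurable sb_matrix_mult)
    show "(\<lambda>\<omega>. C *v Y' \<omega>) \<in> borel_measurable P" by measurable
    show "AE \<omega> in P. C *v sint (f' i) \<omega> = sint (\<lambda>s. C ** f' i s) \<omega>" for i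
      using sint_matrix_mult[OF that(1)[of i], of C] by eventually_elim simp
  qed
  have "stoch_approx P M (\<lambda>s. C ** f s) (\<lambda>k s. C ** fs k s)"
    unfolding stoch_approx_def
  proof (intro conjI allI ballI)
    show "sb (\<lambda>s. C ** fs k s)" for k by (intro sb_matrix_mult sb)
    have "AE s in lborel. (\<lambda>k. fs k s) \<longlonglongrightarrow> f s" using fs by (auto simp: stoch_approx_def)
    then show "AE s in lborel. (\<lambda>k. C ** fs k s) \<longlonglongrightarrow> C ** f s"
      by eventually_elim (intro bounded_bilinear.tendsto[OF bounded_bilinear_matrix_mult] tendsto_const)
    fix A :: "(real^'n) set" assume A: "A \<in> sets borel"
    obtain Y' where Y': "Y' \<in> borel_measurable P"
      "tendsto_in_prob P (\<lambda>k. sint (\<lambda>s. indicat_real A s *\<^sub>R fs k s)) Y' sequentially"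
      using fs(1) A unfolding stoch_approx_def by blast
    have "tendsto_in_prob P (\<lambda>k. sint (\<lambda>s. C ** (indicat_real A s *\<^sub>R fs k s))) (\<lambda>\<omega>. C *v Y' \<omega>) sequentially"
      by (rule key) (use Y' sb A in \<open>auto intro: sb_indicator\<close>)
    then show "\<exists>Z\<in>borel_measurable P. tendsto_in_prob P (\<lambda>k. sint (\<lambda>s. indicat_real A s *\<^sub>R (C ** fs k s))) Z sequentially"
      using Y'(1) by (intro bexI[of _ "\<lambda>\<omega>. C *v Y' \<omega>"]) (auto simp: bounded_bilinear.scaleR_right[OF bounded_bilinear_matrix_mult])
  qed
  moreover have "tendsto_in_prob P (\<lambda>k. sint (\<lambda>s. C ** fs k s)) (\<lambda>\<omega>. C *v Y \<omega>) sequentially"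
    by (rule key) (use sb fs in auto)
  ultimately show ?thesis unfolding has_stoch_integral_def by (intro conjI exI[of _ "\<lambda>k s. C ** fs k s"]) auto
qed

lemma has_stoch_integral_0: "has_stoch_integral P M (\<lambda>s. 0) (\<lambda>\<omega>. 0)"
proof -
  have sb0: "sb (\<lambda>s. 0 :: real^'d^'d)" by (simp add: Bochner_Integration.simple_bochner_integrable.simps)
  have "sint (\<lambda>s. 0) = (\<lambda>\<omega>. 0)" by (auto simp: simple_stoch_integral_def)
  then show ?thesis using sb0
    unfolding has_stoch_integral_def stoch_approx_def
    by (auto intro!: exI[of _ "\<lambda>k s. 0"] bexI[of _ "\<lambda>_. 0"] simp: tendsto_in_prob_def)
qed

lemma has_stoch_integral_sum:
  assumes "finite J" "\<And>j. j \<in> J \<Longrightarrow> has_stoch_integral P M (f j) (Y j)"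
  shows "has_stoch_integral P M (\<lambda>s. \<Sum>j\<in>J. A j ** f j s) (\<lambda>\<omega>. \<Sum>j\<in>J. A j *v Y j \<omega>)"
  using assms
proof (induction J)
  case (insert j J)
  have "has_stoch_integral P M (\<lambda>s. A j ** f j s + (\<Sum>j\<in>J. A j ** f j s)) (\<lambda>\<omega>. A j *v Y j \<omega> + (\<Sum>j\<in>J. A j *v Y j \<omega>))"
    using insert by (intro has_stoch_integral_add has_stoch_integral_matrix_mult) auto
  with insert show ?case by simp
qed (simp add: has_stoch_integral_0)

lemma has_stoch_integral_diff:
  assumes "has_stoch_integral P M f Y" "has_stoch_integral P M g Z"
  shows "has_stoch_integral P M (\<lambda>s. f s - g s) (\<lambda>\<omega>. Y \<omega> - Z \<omega>)"
proof -
  have "has_stoch_integral P M (\<lambda>s. f s + (- mat 1) ** g s) (\<lambda>\<omega>. Y \<omega> + (- mat 1) *v Z \<omega>)"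
    by (intro has_stoch_integral_add has_stoch_integral_matrix_mult assms)
  moreover have "- mat 1 ** B = - B" for B :: "real^'d^'d"
    by (simp add: bounded_bilinear.minus_left[OF bounded_bilinear_matrix_mult])
  moreover have "- mat 1 *v x = - x" for x :: "real^'d"
    by (simp add: bounded_bilinear.minus_left[OF bounded_bilinear_matrix_vector_mult])
  ultimately show ?thesis by simp
qed

end

section \<open>Characteristic functions of stochastic integrals\<close>

context tempered_random_measure
begin

text \<open>The sequence fs behind Y is not dominated, so it is compared with a dominated sequence
  gs. The difference h tends to 0 almost everywhere, and its integral over every Borel set converges
  in probability. By the gliding hump lemma the full exponent of h tends to 0, so fs and gs have the
  same limiting characteristic function at u.\<close>

theorem has_stoch_integral_cf:
  fixes f :: "real^'n \<Rightarrow> real^'d^'d"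
  assumes f[measurable]: "f \<in> borel_measurable borel" and w: "wint f < \<infinity>" and Y: "has_stoch_integral P M f Y"
  shows "(\<integral>\<omega>. iexp (u \<bullet> Y \<omega>) \<partial>P) = of_real (exp (\<integral>s. \<psi> (transpose (f s) *v u) \<partial>lborel))"
proof -
  obtain fs where Ym: "Y \<in> borel_measurable P" and fs: "stoch_approx P M f fs" "tendsto_in_prob P (\<lambda>k. sint (fs k)) Y sequentially"
    using Y by (auto simp: has_stoch_integral_def)
  obtain gs where g: "good_approx f gs" using ex_good_approx[OF f] by blast
  have gs: "stoch_approx P M f gs" by (rule good_approx_stoch_approx[OF f w g])
  have sb: "sb (fs k)" "sb (gs k)" for k using fs(1) gs by (auto simp: stoch_approx_def)
  define h where "h k s = fs k s - gs k s" for k s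
  have sbh: "sb (h k)" for k unfolding h_def by (intro sb_diff sb)
  have [measurable]: "h k \<in> borel_measurable borel" for k by (rule sb_measurable[OF sbh])
  have h0: "AE s in lborel. (\<lambda>k. h k s) \<longlonglongrightarrow> 0"
  proof -
    have "AE s in lborel. (\<lambda>k. fs k s) \<longlonglongrightarrow> f s" "AE s in lborel. (\<lambda>k. gs k s) \<longlonglongrightarrow> f s"
      using fs gs by (auto simp: stoch_approx_def)
    then show ?thesis
    proof eventually_elim
      case (elim s)
      from tendsto_diff[OF elim] show ?case by (simp add: h_def)
    qed
  qed
  \<comment> \<open>At the fixed frequency u, the mass of A is minus the log-characteristic exponent
    of the integral of h k over A.\<close>
  define \<nu> where "\<nu> k = density lborel (\<lambda>s. ennreal (- \<psi> (transpose (h k s) *v u)))" for k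
  have int: "integrable lborel (\<lambda>s. \<psi> (transpose (h k s) *v u))" for k by (rule sint_cf(2)[OF sbh])
  have meas_\<nu>: "measure (\<nu> k) A = (\<integral>s. indicat_real A s * - \<psi> (transpose (h k s) *v u) \<partial>lborel)"
    and fin_\<nu>: "emeasure (\<nu> k) A < \<infinity>" if [measurable]: "A \<in> sets borel" for A k
  proof -
    have i: "integrable lborel (\<lambda>s. indicat_real A s * - \<psi> (transpose (h k s) *v u))"
      using integrable_mult_indicator[of A lborel "\<lambda>s. - \<psi> (transpose (h k s) *v u)"] int by simp
    have "emeasure (\<nu> k) A = (\<integral>\<^sup>+s. ennreal (indicat_real A s * - \<psi> (transpose (h k s) *v u)) \<partial>lborel)"
      unfolding \<nu>_def by (subst emeasure_density, measurable) (auto intro!: nn_integral_cong simp: indicator_def)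
    also have "\<dots> = ennreal (\<integral>s. indicat_real A s * - \<psi> (transpose (h k s) *v u) \<partial>lborel)"
      using i by (rule nn_integral_eq_integral) (intro AE_I2 mult_nonneg_nonneg, auto simp only: indicator_pos_le neg_0_le_iff_le \<psi>_nonpos)
    finally have e: "emeasure (\<nu> k) A = ennreal (\<integral>s. indicat_real A s * - \<psi> (transpose (h k s) *v u) \<partial>lborel)" .
    have "0 \<le> (\<integral>s. indicat_real A s * - \<psi> (transpose (h k s) *v u) \<partial>lborel)"
      by (intro Bochner_Integration.integral_nonneg mult_nonneg_nonneg) (auto simp only: indicator_pos_le neg_0_le_iff_le \<psi>_nonpos)
    then show "measure (\<nu> k) A = (\<integral>s. indicat_real A s * - \<psi> (transpose (h k s) *v u) \<partial>lborel)"
      unfolding measure_def e by simp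
    show "emeasure (\<nu> k) A < \<infinity>" unfolding e by simp
  qed
  have sp\<nu>: "space (\<nu> k) = UNIV" and sets\<nu>: "sets (\<nu> k) = sets borel" for k by (simp_all add: \<nu>_def)
  \<comment> \<open>On B j all h k are bounded by j on a bounded region, so dominated convergence
    applies there. The sets exhaust almost all of space because a convergent sequence is
    bounded.\<close>
  define B where "B j = {s. norm s \<le> real j \<and> (\<forall>k. norm (h k s) \<le> real j)}" for j :: nat
  have mB[measurable]: "B j \<in> sets borel" for j unfolding B_def by measurable
  have "(\<lambda>k. measure (\<nu> k) (space (borel :: (real^'n) measure))) \<longlonglongrightarrow> 0"
  proof (rule gliding_hump[where B = B])
    show "finite_measure (\<nu> k)" for k using fin_\<nu>[of UNIV k] by (intro finite_measureI) (simp add: sp\<nu>)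
    show "sets (\<nu> k) = sets borel" for k by (rule sets\<nu>)
    show "B j \<in> sets borel" for j by (rule mB)
    show "incseq B" unfolding B_def by (rule incseq_SucI) (auto intro: order_trans)
    show "emeasure (\<nu> k) (space borel - (\<Union>j. B j)) = 0" for k
    proof -
      have "AE s in lborel. s \<in> (\<Union>j. B j)"
        using h0
      proof eventually_elim
        case (elim s)
        obtain b where b: "\<And>k. norm (h k s) \<le> b" using convergent_imp_Bseq[OF convergentI[OF elim]] by (auto simp: Bseq_def)
        obtain j where "max (norm s) b \<le> real j" using real_arch_simple by blast
        with b have "s \<in> B j" by (auto simp: B_def intro: order_trans)
        then show ?case by blast
      qed
      moreover have "(\<lambda>s. ennreal (- \<psi> (transpose (h k s) *v u))) \<in> borel_measurable lborel" by measurable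
      ultimately have "AE s in \<nu> k. s \<in> (\<Union>j. B j)" unfolding \<nu>_def by (subst AE_density) auto
      then show ?thesis by (subst (asm) AE_iff_measurable[where N = "space borel - (\<Union>j. B j)"]) (auto simp: sp\<nu> sets\<nu>)
    qed
    show "(\<lambda>k. measure (\<nu> k) (B j)) \<longlonglongrightarrow> 0" for j
    proof -
      let ?c = "2 * C\<Phi> * (max 1 ((norm u)\<^sup>2) * wgt \<alpha> (real j))"
      have "(\<lambda>k. \<integral>s. indicat_real (B j) s * - \<psi> (transpose (h k s) *v u) \<partial>lborel) \<longlonglongrightarrow> (\<integral>s. 0 \<partial>(lborel :: (real^'n) measure))"
      proof (rule integral_dominated_convergence[where w = "\<lambda>s. indicat_real (cball 0 (real j)) s * ?c"])
        show "integrable lborel (\<lambda>s::real^'n. indicat_real (cball 0 (real j)) s * ?c)"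
          using emeasure_bounded_finite[of "cball (0::real^'n) (real j)"]
          by (intro integrable_mult_left integrable_real_indicator) auto
        show "AE s in lborel. norm (indicat_real (B j) s * - \<psi> (transpose (h k s) *v u)) \<le> indicat_real (cball 0 (real j)) s * ?c" for k
        proof (rule AE_I2)
          fix s
          show "norm (indicat_real (B j) s * - \<psi> (transpose (h k s) *v u)) \<le> indicat_real (cball 0 (real j)) s * ?c"
          proof (cases "s \<in> B j")
            case True
            then have "norm (h k s) \<le> real j" "s \<in> cball 0 (real j)" by (auto simp: B_def)
            from this(1) have "wgt \<alpha> (norm (h k s)) \<le> wgt \<alpha> (real j)" by (intro wgt_mono \<alpha>') auto
            then have "2 * C\<Phi> * (max 1 ((norm u)\<^sup>2) * wgt \<alpha> (norm (h k s))) \<le> ?c" using C\<Phi>(1) by (intro mult_left_mono) auto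
            with \<psi>_transpose_bound[of "h k s" u] have "- \<psi> (transpose (h k s) *v u) \<le> ?c" by linarith
            then show ?thesis using True \<open>s \<in> cball 0 (real j)\<close>
              unfolding real_norm_def by (simp only: indicator_simps mult_1_left abs_minus_cancel abs_of_nonpos[OF \<psi>_nonpos])
          next
            case False
            then show ?thesis using C\<Phi>(1) by (simp add: indicator_def)
          qed
        qed
        show "AE s in lborel. (\<lambda>k. indicat_real (B j) s * - \<psi> (transpose (h k s) *v u)) \<longlonglongrightarrow> 0"
          using h0
        proof eventually_elim
          case (elim s)
          have "(\<lambda>k. transpose (h k s) *v u) \<longlonglongrightarrow> transpose 0 *v u"
            by (intro bounded_bilinear.tendsto[OF bounded_bilinear_matrix_vector_mult] bounded_linear.tendsto[OF bounded_linear_transpose] tendsto_const elim)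
          moreover have "transpose (0::real^'d^'d) *v u = 0" by (simp add: vec_eq_iff transpose_def matrix_vector_mult_def)
          ultimately have "(\<lambda>k. transpose (h k s) *v u) \<longlonglongrightarrow> 0" by (simp only:)
          from continuous_\<psi>[OF this] have "(\<lambda>k. \<psi> (transpose (h k s) *v u)) \<longlonglongrightarrow> 0" by (simp only: \<psi>_0)
          from tendsto_minus[OF this] have "(\<lambda>k. - \<psi> (transpose (h k s) *v u)) \<longlonglongrightarrow> 0" by (simp only: minus_zero)
          then show ?case by (rule tendsto_mult_right_zero)
        qed
      qed measurable
      then show ?thesis by (simp add: meas_\<nu>[OF mB])
    qed
    show "convergent (\<lambda>k. exp (- measure (\<nu> k) A))" if A: "A \<in> sets borel" for A
    proof -
      let ?f = "\<lambda>k s. indicat_real A s *\<^sub>R fs k s" and ?g = "\<lambda>k s. indicat_real A s *\<^sub>R gs k s" and ?h = "\<lambda>k s. indicat_real A s *\<^sub>R h k s"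
      obtain Z Z' where Z: "Z \<in> borel_measurable P" "Z' \<in> borel_measurable P"
        "tendsto_in_prob P (\<lambda>k. sint (?f k)) Z sequentially" "tendsto_in_prob P (\<lambda>k. sint (?g k)) Z' sequentially"
        using fs(1) gs A unfolding stoch_approx_def by blast
      have sbs: "sb (?f k)" "sb (?g k)" "sb (?h k)" for k by (intro sb_indicator sb sbh A)+
      note ms = sbs[THEN sint_measurable]
      have "tendsto_in_prob P (\<lambda>k \<omega>. - sint (?g k) \<omega>) (\<lambda>\<omega>. - Z' \<omega>) sequentially"
        by (rule tendsto_in_prob_lipschitz[where g = uminus and L = 1]) (use ms Z in \<open>auto simp: dist_norm norm_minus_commute\<close>)
      then have "tendsto_in_prob P (\<lambda>k \<omega>. sint (?f k) \<omega> + - sint (?g k) \<omega>) (\<lambda>\<omega>. Z \<omega> + - Z' \<omega>) sequentially"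
        using ms Z by (intro tendsto_in_prob_add) auto
      then have "tendsto_in_prob P (\<lambda>k. sint (?h k)) (\<lambda>\<omega>. Z \<omega> + - Z' \<omega>) sequentially"
      proof (rule tendsto_in_prob_cong_AE[rotated -1])
        have "?h k = (\<lambda>s. ?f k s - ?g k s)" for k by (auto simp: h_def scaleR_diff_right)
        then show "AE \<omega> in P. sint (?f k) \<omega> + - sint (?g k) \<omega> = sint (?h k) \<omega>" for k
          using sint_diff[OF sbs(1)[of k] sbs(2)[of k]] by (auto elim!: AE_mp)
      qed (use ms Z in auto)
      then have "(\<lambda>k. \<integral>\<omega>. iexp (u \<bullet> sint (?h k) \<omega>) \<partial>P) \<longlonglongrightarrow> (\<integral>\<omega>. iexp (u \<bullet> (Z \<omega> + - Z' \<omega>)) \<partial>P)"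
        using ms Z by (intro tendsto_in_prob_imp_cf) auto
      moreover have "(\<integral>\<omega>. iexp (u \<bullet> sint (?h k) \<omega>) \<partial>P) = of_real (exp (- measure (\<nu> k) A))" for k
      proof -
        have "\<psi> (transpose (?h k s) *v u) = - (indicat_real A s * - \<psi> (transpose (h k s) *v u))" for s
        proof (cases "s \<in> A")
          case False
          have t0: "transpose (0::real^'d^'d) *v u = 0" by (simp add: vec_eq_iff transpose_def matrix_vector_mult_def)
          have 0: "indicat_real A s = 0" using False by simp
          show ?thesis unfolding 0 scaleR_zero_left t0 \<psi>_0 by simp
        qed simp
        then have "(\<integral>s. \<psi> (transpose (?h k s) *v u) \<partial>lborel) = - measure (\<nu> k) A"
          unfolding meas_\<nu>[OF A] Bochner_Integration.integral_minus[symmetric] by (simp only:)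
        then show ?thesis using sint_cf(1)[OF sbs(3)[of k], of u] by (simp only:)
      qed
      ultimately have "(\<lambda>k. complex_of_real (exp (- measure (\<nu> k) A))) \<longlonglongrightarrow> (\<integral>\<omega>. iexp (u \<bullet> (Z \<omega> + - Z' \<omega>)) \<partial>P)" by (simp only:)
      from tendsto_Re[OF this] show ?thesis unfolding Re_complex_of_real by (rule convergentI)
    qed
  qed
  then have \<nu>0: "(\<lambda>k. measure (\<nu> k) UNIV) \<longlonglongrightarrow> 0" by simp
  have cfh: "(\<integral>\<omega>. iexp (u \<bullet> sint (h k) \<omega>) \<partial>P) = of_real (exp (- measure (\<nu> k) UNIV))" for k
    using meas_\<nu>[of UNIV k] by (simp add: sint_cf(1)[OF sbh])
  let ?cf = "\<lambda>Y. \<integral>\<omega>. iexp (u \<bullet> Y \<omega>) \<partial>P"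
  have "(\<lambda>k. ?cf (sint (fs k)) - ?cf (sint (gs k))) \<longlonglongrightarrow> 0"
  proof (rule LIMSEQ_I)
    fix e :: real assume e: "0 < e"
    have "(\<lambda>k. 1 - exp (- measure (\<nu> k) UNIV)) \<longlonglongrightarrow> 1 - exp (- 0)" by (intro tendsto_intros \<nu>0)
    then have "(\<lambda>k. 1 - exp (- measure (\<nu> k) UNIV)) \<longlonglongrightarrow> 0" by simp
    moreover have "0 < e * e / 8" using e by simp
    ultimately have "eventually (\<lambda>k. 1 - exp (- measure (\<nu> k) UNIV) < e * e / 8) sequentially" by (rule order_tendstoD(2))
    then obtain N where N: "\<And>k. N \<le> k \<Longrightarrow> 1 - exp (- measure (\<nu> k) UNIV) < e * e / 8" by (auto simp: eventually_sequentially)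
    have "norm (?cf (sint (fs k)) - ?cf (sint (gs k)) - 0) < e" if "N \<le> k" for k
    proof -
      have ms: "sint (fs k) \<in> borel_measurable P" "sint (gs k) \<in> borel_measurable P" "sint (h k) \<in> borel_measurable P"
        using sb sbh by (auto intro: sint_measurable)
      \<comment> \<open>The threshold \<delta> = e/2 leaves the coefficient 4/e in front of the
        cosine term, which explains the bound e^2/8 on the latter. The estimate needs the integral
        of h k at the frequency u only.\<close>
      have "norm (?cf (sint (fs k)) - ?cf (sint (gs k))) \<le> e / 2 + 2 / (e / 2) * (1 - Re (\<integral>\<omega>. iexp (u \<bullet> (sint (fs k) \<omega> - sint (gs k) \<omega>)) \<partial>P))"
        using e ms by (intro norm_expectation_iexp_diff_le_cos) auto
      also have "(\<integral>\<omega>. iexp (u \<bullet> (sint (fs k) \<omega> - sint (gs k) \<omega>)) \<partial>P) = ?cf (sint (h k))"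
        using sint_diff[OF sb(1)[of k] sb(2)[of k]] ms
        by (intro integral_cong_AE) (auto simp: h_def[abs_def] elim!: AE_mp)
      also have "\<dots> = of_real (exp (- measure (\<nu> k) UNIV))" by (rule cfh)
      also have "e / 2 + 2 / (e / 2) * (1 - Re (complex_of_real (exp (- measure (\<nu> k) UNIV)))) = e / 2 + 4 / e * (1 - exp (- measure (\<nu> k) UNIV))" by simp
      also have "\<dots> < e / 2 + 4 / e * (e * e / 8)" using N[OF that] e by (intro add_strict_left_mono mult_strict_left_mono) auto
      also have "\<dots> = e" using e by (simp add: field_simps)
      finally show ?thesis by simp
    qed
    then show "\<exists>no. \<forall>k\<ge>no. norm (?cf (sint (fs k)) - ?cf (sint (gs k)) - 0) < e" by blast
  qed
  moreover have "(\<lambda>k. ?cf (sint (gs k))) \<longlonglongrightarrow> of_real (exp (\<integral>s. \<psi> (transpose (f s) *v u) \<partial>lborel))"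
    unfolding sint_cf(1)[OF sb(2)] by (intro tendsto_of_real tendsto_exp good_approx_\<psi>_tendsto[OF f w g])
  ultimately have "(\<lambda>k. ?cf (sint (fs k)) - ?cf (sint (gs k)) + ?cf (sint (gs k))) \<longlonglongrightarrow> 0 + of_real (exp (\<integral>s. \<psi> (transpose (f s) *v u) \<partial>lborel))"
    by (rule tendsto_add)
  then have "(\<lambda>k. ?cf (sint (fs k))) \<longlonglongrightarrow> of_real (exp (\<integral>s. \<psi> (transpose (f s) *v u) \<partial>lborel))" by simp
  moreover have "(\<lambda>k. ?cf (sint (fs k))) \<longlonglongrightarrow> ?cf Y"
    by (rule tendsto_in_prob_imp_cf[OF sint_measurable[OF sb(1)] Ym fs(2)])
  ultimately show ?thesis using LIMSEQ_unique by blast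
qed

lemma wint_add:
  fixes f g :: "real^'n \<Rightarrow> real^'d^'d"
  assumes "f \<in> borel_measurable borel" "g \<in> borel_measurable borel" "wint f < \<infinity>" "wint g < \<infinity>"
  shows "wint (\<lambda>s. f s + g s) < \<infinity>" "wint (\<lambda>s. f s - g s) < \<infinity>"
proof -
  have "4 * (wint f + wint g) < \<infinity>" using assms by (simp add: ennreal_mult_less_top)
  then show "wint (\<lambda>s. f s + g s) < \<infinity>" "wint (\<lambda>s. f s - g s) < \<infinity>"
    by (auto intro!: le_less_trans[OF wint_add_le[OF assms(1,2)]] norm_triangle_ineq norm_triangle_ineq4)
qed

lemma wint_sum:
  fixes f :: "'j \<Rightarrow> real^'n \<Rightarrow> real^'d^'d" and A :: "'j \<Rightarrow> real^'d^'d"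
  assumes "finite J" "\<And>j. j \<in> J \<Longrightarrow> f j \<in> borel_measurable borel" "\<And>j. j \<in> J \<Longrightarrow> wint (f j) < \<infinity>"
  shows "wint (\<lambda>s. \<Sum>j\<in>J. A j ** f j s) < \<infinity>"
  using assms
proof (induction J)
  case empty
  then show ?case by (simp add: wint_def)
next
  case (insert j J)
  have [measurable]: "\<And>j. j \<in> J \<Longrightarrow> f j \<in> borel_measurable borel" "f j \<in> borel_measurable borel" using insert by auto
  have "wint (\<lambda>s. A j ** f j s + (\<Sum>j\<in>J. A j ** f j s)) < \<infinity>"
    using insert by (intro wint_add(1) wint_matrix_mult borel_measurable_sum borel_measurable_matrix_mult_raw borel_measurable_const) auto
  with insert show ?case by simp
qed

text \<open>A reduction in the manner of Cramer and Wold: U j becomes one row of a matrix A j whose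
  other rows vanish, so the scalar product of U with the vector of integrals is one coordinate of
  the single integral of the sum of the A j ** f j.\<close>

theorem joint_cf:
  fixes f :: "'k::finite \<Rightarrow> real^'n \<Rightarrow> real^'d^'d" and U :: "(real^'d)^'k"
  assumes f: "\<And>j. f j \<in> borel_measurable borel" and w: "\<And>j. wint (f j) < \<infinity>" and Y: "\<And>j. has_stoch_integral P M (f j) (Y j)"
  shows "(\<integral>\<omega>. iexp (U \<bullet> (\<chi> j. Y j \<omega>)) \<partial>P) = of_real (exp (\<integral>s. \<psi> (\<Sum>j\<in>UNIV. transpose (f j s) *v (U $ j)) \<partial>lborel))"
proof -
  note [measurable] = f
  let ?i = "undefined :: 'd"
  let ?e = "axis ?i 1 :: real^'d"
  define A where "A j = (\<chi> i. if i = ?i then U $ j else 0)" for j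
  have Ae: "transpose (A j) *v ?e = U $ j" for j
    by (simp add: vec_eq_iff A_def transpose_def matrix_vector_mult_def axis_def if_distrib cong: if_cong)
  have h: "has_stoch_integral P M (\<lambda>s. \<Sum>j\<in>UNIV. A j ** f j s) (\<lambda>\<omega>. \<Sum>j\<in>UNIV. A j *v Y j \<omega>)"
    by (rule has_stoch_integral_sum) (use Y in auto)
  have "(\<integral>\<omega>. iexp (?e \<bullet> (\<Sum>j\<in>UNIV. A j *v Y j \<omega>)) \<partial>P) =
    of_real (exp (\<integral>s. \<psi> (transpose (\<Sum>j\<in>UNIV. A j ** f j s) *v ?e) \<partial>lborel))"
    by (rule has_stoch_integral_cf[OF _ wint_sum h]) (use f w in auto)
  moreover have "?e \<bullet> (\<Sum>j\<in>UNIV. A j *v Y j \<omega>) = U \<bullet> (\<chi> j. Y j \<omega>)" for \<omega>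
  proof -
    have "?e \<bullet> (\<Sum>j\<in>UNIV. A j *v Y j \<omega>) = (\<Sum>j\<in>UNIV. (transpose (A j) *v ?e) \<bullet> Y j \<omega>)"
      by (simp add: inner_sum_right dot_lmul_matrix transpose_matrix_vector)
    then show ?thesis unfolding Ae by (simp add: inner_vec_def)
  qed
  moreover have "transpose (\<Sum>j\<in>UNIV. A j ** f j s) *v ?e = (\<Sum>j\<in>UNIV. transpose (f j s) *v (U $ j))" for s
  proof -
    have "transpose (\<Sum>j\<in>UNIV. A j ** f j s) *v ?e = (\<Sum>j\<in>UNIV. transpose (A j ** f j s) *v ?e)"
      by (simp only: linear_sum[OF bounded_linear.linear[OF bounded_linear_transpose]] bounded_bilinear.sum_left[OF bounded_bilinear_matrix_vector_mult])
    also have "\<dots> = (\<Sum>j\<in>UNIV. transpose (f j s) *v (transpose (A j) *v ?e))"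
      by (simp only: matrix_transpose_mul matrix_vector_mul_assoc)
    finally show ?thesis by (simp only: Ae)
  qed
  ultimately show ?thesis by (simp only:)
qed

lemma has_stoch_integral_tail:
  fixes f :: "real^'n \<Rightarrow> real^'d^'d"
  assumes "f \<in> borel_measurable borel" "wint f < \<infinity>" "has_stoch_integral P M f Y" "0 < \<epsilon>"
  shows "prob {\<omega>\<in>space P. \<epsilon> < norm (Y \<omega>)} \<le> tailc \<epsilon> * enn2real (wint f)"
  using assms by (intro cf_tail has_stoch_integral_cf) (auto simp: has_stoch_integral_def)

end

section \<open>Disintegration\<close>

lemma (in finite_measure) AE_le_if_set_integrals_le:
  fixes f g :: "'a \<Rightarrow> ennreal"
  assumes [measurable]: "f \<in> borel_measurable M" "g \<in> borel_measurable M"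
    and fin: "(\<integral>\<^sup>+x. g x \<partial>M) < \<infinity>"
    and le: "\<And>A. A \<in> sets M \<Longrightarrow> (\<integral>\<^sup>+x. f x * indicator A x \<partial>M) \<le> (\<integral>\<^sup>+x. g x * indicator A x \<partial>M)"
  shows "AE x in M. f x \<le> g x"
proof -
  let ?A = "{x\<in>space M. g x < f x}"
  have A[measurable]: "?A \<in> sets M" by measurable
  have gA: "(\<integral>\<^sup>+x. g x * indicator ?A x \<partial>M) < \<infinity>"
    by (rule le_less_trans[OF nn_integral_mono fin]) (auto simp: indicator_def)
  have fA: "(\<integral>\<^sup>+x. f x * indicator ?A x \<partial>M) < \<infinity>" using le[OF A] gA by (rule le_less_trans)
  have "(\<integral>\<^sup>+x. f x * indicator ?A x - g x * indicator ?A x \<partial>M) = (\<integral>\<^sup>+x. f x * indicator ?A x \<partial>M) - (\<integral>\<^sup>+x. g x * indicator ?A x \<partial>M)"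
    by (rule nn_integral_diff) (use gA in \<open>auto simp: indicator_def intro: less_imp_le\<close>)
  also have "\<dots> = 0" using le[OF A] fA unfolding diff_eq_0_iff_ennreal infinity_ennreal_def by blast
  finally have "AE x in M. f x * indicator ?A x - g x * indicator ?A x = 0"
    by (subst (asm) nn_integral_0_iff_AE) auto

  then show ?thesis using AE_space[of M]
  proof eventually_elim
    case (elim x)
    show ?case
    proof (rule ccontr)
      assume n: "\<not> f x \<le> g x"
      with elim have "f x - g x = 0" by simp
      with n show False using ennreal_minus_eq_0 by blast
    qed
  qed
qed

text \<open>The least multiple of 2^(-n) strictly above r. The values decrease to r while staying
  above it, which produces right limits along countably many rational levels.\<close>

definition dyadic_above :: "nat \<Rightarrow> real \<Rightarrow> rat" where
  "dyadic_above n r = (of_int \<lfloor>2 ^ n * r\<rfloor> + 1) / 2 ^ n"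

lemma real_dyadic_above: "real_of_rat (dyadic_above n r) = (of_int \<lfloor>2 ^ n * r\<rfloor> + 1) / 2 ^ n"
  by (simp add: dyadic_above_def of_rat_divide of_rat_add of_rat_power)

lemma dyadic_above_gt: "r < of_rat (dyadic_above n r)"
proof -
  have "2 ^ n * r < of_int \<lfloor>2 ^ n * r\<rfloor> + 1" by linarith
  then show ?thesis by (simp add: real_dyadic_above field_simps)
qed

lemma dyadic_above_le: "of_rat (dyadic_above n r) \<le> r + 1 / 2 ^ n"
proof -
  have "of_int \<lfloor>2 ^ n * r\<rfloor> + 1 \<le> 2 ^ n * r + 1" by linarith
  then have "(of_int \<lfloor>2 ^ n * r\<rfloor> + 1) / 2 ^ n \<le> (2 ^ n * r + 1) / 2 ^ n" by (intro divide_right_mono) auto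
  then show ?thesis by (simp add: real_dyadic_above add_divide_distrib)
qed

lemma dyadic_above_mono: "r \<le> s \<Longrightarrow> dyadic_above n r \<le> dyadic_above n s"
  unfolding dyadic_above_def by (intro divide_right_mono add_right_mono) (auto intro!: floor_mono mult_left_mono)

lemma dyadic_above_decreasing: "dyadic_above (Suc n) r \<le> dyadic_above n r"
proof -
  have "\<lfloor>2 * x\<rfloor> + 1 \<le> 2 * (\<lfloor>x\<rfloor> + 1)" for x :: real
  proof -
    have "2 * x < of_int (2 * (\<lfloor>x\<rfloor> + 1))" by simp linarith
    then have "\<lfloor>2 * x\<rfloor> < 2 * (\<lfloor>x\<rfloor> + 1)" by (simp only: floor_less_iff)
    then show ?thesis by simp
  qed
  from this[of "2 ^ n * r"] have "of_int (\<lfloor>2 ^ Suc n * r\<rfloor> + 1) \<le> (of_int (2 * (\<lfloor>2 ^ n * r\<rfloor> + 1)) :: rat)"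
    by (subst of_int_le_iff) (simp add: mult.assoc)
  then have "(of_int \<lfloor>2 ^ Suc n * r\<rfloor> + 1 :: rat) / 2 ^ Suc n \<le> (2 * (of_int \<lfloor>2 ^ n * r\<rfloor> + 1)) / 2 ^ Suc n"
    by (intro divide_right_mono) simp_all
  also have "(2 * (of_int \<lfloor>2 ^ n * r\<rfloor> + 1)) / 2 ^ Suc n = dyadic_above n r"
    unfolding dyadic_above_def power_Suc by (rule mult_divide_mult_cancel_left) simp
  finally show ?thesis by (simp add: dyadic_above_def)
qed

text \<open>A monotone function on the rationals need not be right-continuous; taking the infimum
  over strictly larger rational levels regularises it, and the limits 0 and 1 at the ends carry
  over.\<close>

lemma cdf_from_rationals:
  fixes G :: "rat \<Rightarrow> ennreal"
  assumes mono: "\<And>p q. p \<le> q \<Longrightarrow> G p \<le> G q" and le1: "\<And>q. G q \<le> 1"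
    and top: "(SUP n::nat. G (of_nat n)) = 1" and bot: "(INF n::nat. G (- of_nat n)) = 0"
  defines "F \<equiv> \<lambda>r. enn2real (INF n. G (dyadic_above n r))"
  shows "real_distribution (interval_measure F)" "emeasure (interval_measure F) {..r} = (INF n. G (dyadic_above n r))"
proof -
  let ?F = "\<lambda>r. INF n. G (dyadic_above n r)"
  have F1: "?F r \<le> 1" for r by (rule order_trans[OF INF_lower[of 0] le1]) simp
  then have FF: "?F r = ennreal (F r)" for r unfolding F_def
    by (metis ennreal_enn2real ennreal_one_less_top order_le_less_trans)
  have F0: "0 \<le> F r" "F r \<le> 1" for r using F1[of r] by (simp_all add: F_def enn2real_leI)
  have Fmono: "F r \<le> F s" if "r \<le> s" for r s
  proof -
    have "?F r \<le> ?F s" by (intro INF_mono' mono dyadic_above_mono that)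
    then show ?thesis by (simp add: FF F0)
  qed
  have upper: "?F r \<le> G q" if "r < of_rat q" for r q
  proof -
    obtain n where "(1 / 2) ^ n < of_rat q - r" using real_arch_pow_inv[of "of_rat q - r" "1 / 2"] \<open>r < of_rat q\<close> by auto
    then have "real_of_rat (dyadic_above n r) \<le> of_rat q" using dyadic_above_le[of n r] by (simp add: power_one_over)
    then have "dyadic_above n r \<le> q" by (simp add: of_rat_less_eq)
    then show ?thesis by (intro order_trans[OF INF_lower[of n]] mono) auto
  qed
  have lower: "G q \<le> ?F r" if "of_rat q \<le> r" for r q
  proof (rule INF_greatest)
    fix n
    have "real_of_rat q < of_rat (dyadic_above n r)" using dyadic_above_gt[of r n] that by linarith
    then show "G q \<le> G (dyadic_above n r)" by (intro mono) (simp add: of_rat_less)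
  qed
  have rc: "continuous (at_right r) F" for r
    unfolding continuous_within
  proof (rule order_tendstoI)
    fix a assume "a < F r"
    then show "eventually (\<lambda>s. a < F s) (at_right r)"
      unfolding eventually_at_right_field by (intro exI[of _ "r + 1"]) (use Fmono in \<open>auto intro: less_le_trans\<close>)
  next
    fix a assume a: "F r < a"
    then have "?F r < ennreal a" by (simp add: FF F0 ennreal_lessI le_less_trans[OF F0(1)])
    then obtain n where n: "G (dyadic_above n r) < ennreal a" by (auto simp: INF_less_iff)
    have "F s < a" if "r < s" "s < of_rat (dyadic_above n r)" for s
    proof -
      have "ennreal (F s) < ennreal a" unfolding FF[symmetric] using upper[OF that(2)] n by (rule le_less_trans)
      then show ?thesis using F0(1)[of s] by (simp add: ennreal_less_iff)
    qed
    then show "eventually (\<lambda>s. F s < a) (at_right r)"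
      using dyadic_above_gt[of r n] by (auto simp: eventually_at_right_field)
  qed
  have lb: "(F \<longlongrightarrow> 0) at_bot"
  proof (rule order_tendstoI)
    fix a :: real assume "a < 0" then show "eventually (\<lambda>s. a < F s) at_bot" using F0 by (intro always_eventually) (auto intro: less_le_trans)
  next
    fix a :: real assume a: "0 < a"
    then have "(INF n::nat. G (- of_nat n)) < ennreal a" unfolding bot by simp
    then obtain n :: nat where n: "G (- of_nat n) < ennreal a" by (auto simp: INF_less_iff)
    have "F s < a" if "s < - real n" for s
    proof -
      have "s < real_of_rat (- of_nat n)" using that by (simp add: of_rat_minus)
      then have "ennreal (F s) < ennreal a" unfolding FF[symmetric] using upper n by (meson le_less_trans)
      then show ?thesis using F0(1)[of s] by (simp add: ennreal_less_iff)
    qed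
    then show "eventually (\<lambda>s. F s < a) at_bot" by (auto simp: eventually_at_bot_dense)
  qed
  have lt: "(F \<longlongrightarrow> 1) at_top"
  proof (rule order_tendstoI)
    fix a :: real assume "1 < a" then show "eventually (\<lambda>s. F s < a) at_top" using F0 by (intro always_eventually) (auto intro: le_less_trans)
  next
    fix a :: real assume a: "a < 1"
    have "\<exists>n::nat. ennreal a < G (of_nat n)"
    proof (cases "0 \<le> a")
      case True
      then have "ennreal a < (SUP n::nat. G (of_nat n))" unfolding top using a by (simp add: ennreal_lessI flip: ennreal_1)
      then show ?thesis by (auto simp: less_SUP_iff)
    next
      case False
      have "0 < (SUP n::nat. G (of_nat n))" unfolding top by simp
      then show ?thesis using False by (auto simp: less_SUP_iff ennreal_neg)
    qed
    then obtain n :: nat where n: "ennreal a < G (of_nat n)" by blast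
    have "a < F s" if "real n \<le> s" for s
    proof -
      have "G (of_nat n) \<le> ?F s" by (rule lower) (use that in simp)
      with n have "ennreal a < ennreal (F s)" unfolding FF[symmetric] by (rule less_le_trans)
      then show ?thesis using F0(1)[of s] by (cases "0 \<le> a") (auto simp: ennreal_less_iff)
    qed
    then show "eventually (\<lambda>s. a < F s) at_top" by (auto simp: eventually_at_top_linorder)
  qed
  show "real_distribution (interval_measure F)"
    by (rule real_distribution_interval_measure[OF Fmono rc lb lt])
  show "emeasure (interval_measure F) {..r} = ?F r"
    unfolding FF by (rule emeasure_interval_measure_Iic[OF Fmono rc lb])
qed

text \<open>The conditional distribution function at level c is the Radon-Nikodym density of A
  \<mapsto> \<mu> (A \<times> {..c}) with respect to the first marginal. Monotonicity and the limits
  hold almost everywhere simultaneously on the rational levels, which suffices to assemble a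
  probability measure for almost every x.\<close>

theorem disintegration_real:
  fixes \<mu> :: "('a \<times> real) measure"
  assumes fin: "finite_measure \<mu>" and sets: "sets \<mu> = sets (X \<Otimes>\<^sub>M borel)"
  shows "\<exists>K. K \<in> X \<rightarrow>\<^sub>M prob_algebra borel \<and> (\<forall>f\<in>borel_measurable (X \<Otimes>\<^sub>M borel).
     (\<integral>\<^sup>+z. f z \<partial>\<mu>) = (\<integral>\<^sup>+x. \<integral>\<^sup>+y. f (x, y) \<partial>K x \<partial>distr \<mu> X fst))"
proof -
  interpret \<mu>: finite_measure \<mu> by fact
  have [measurable_cong]: "sets \<mu> = sets (X \<Otimes>\<^sub>M borel)" by fact
  have sp\<mu>: "space \<mu> = space X \<times> UNIV" using sets_eq_imp_space_eq[OF sets] by (simp add: space_pair_measure)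
  define S where "S = distr \<mu> X fst"
  interpret S: finite_measure S unfolding S_def by (rule \<mu>.finite_measure_distr) measurable
  have setsS[measurable_cong, simp]: "sets S = sets X" and spS[simp]: "space S = space X" by (simp_all add: S_def)
  have mrect[measurable]: "A \<times> {..c} \<in> sets \<mu>" if "A \<in> sets X" for A and c :: real using that by simp
  define N where "N c = distr (density \<mu> (indicator (space X \<times> {..c}))) X fst" for c :: real
  have N: "emeasure (N c) A = emeasure \<mu> (A \<times> {..c})" if [measurable]: "A \<in> sets X" for c A
  proof -
    have "emeasure (N c) A = emeasure (density \<mu> (indicator (space X \<times> {..c}))) (fst -` A \<inter> space \<mu>)"
      unfolding N_def by (subst emeasure_distr) auto
    also have "\<dots> = (\<integral>\<^sup>+z. indicator (space X \<times> {..c}) z * indicator (fst -` A \<inter> space \<mu>) z \<partial>\<mu>)"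
      by (subst emeasure_density) (auto intro!: measurable_sets[of fst \<mu> X])
    also have "\<dots> = (\<integral>\<^sup>+z. indicator (A \<times> {..c}) z \<partial>\<mu>)"
      using sets.sets_into_space[OF that] by (intro nn_integral_cong) (auto simp: indicator_def sp\<mu>)
    finally show ?thesis by simp
  qed
  have S: "emeasure S A = emeasure \<mu> (A \<times> UNIV)" if "A \<in> sets X" for A
  proof -
    have "fst -` A \<inter> space \<mu> = A \<times> UNIV" using sets.sets_into_space[OF that] by (auto simp: sp\<mu>)
    then show ?thesis using that unfolding S_def by (subst emeasure_distr) auto
  qed
  have "absolutely_continuous S (N c)" for c
    unfolding absolutely_continuous_def
  proof
    fix A assume "A \<in> null_sets S"
    then have A: "A \<in> sets X" "emeasure \<mu> (A \<times> UNIV) = 0" using S by (auto simp: null_sets_def)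
    have "emeasure \<mu> (A \<times> {..c}) \<le> emeasure \<mu> (A \<times> UNIV)" using A by (intro emeasure_mono) auto
    then show "A \<in> null_sets (N c)" using A N by (auto simp: null_sets_def N_def)
  qed
  then have "\<exists>g\<in>borel_measurable S. density S g = N c" for c by (rule S.Radon_Nikodym) (simp add: N_def)
  then obtain g where g[measurable]: "\<And>c. g c \<in> borel_measurable S" and dg: "\<And>c. density S (g c) = N c" by metis
  have gA: "(\<integral>\<^sup>+x. g c x * indicator A x \<partial>S) = emeasure \<mu> (A \<times> {..c})" if "A \<in> sets X" for c A
    using N[OF that, of c] that unfolding dg[symmetric] by (subst (asm) emeasure_density) auto
  define G where "G q = g (real_of_rat q)" for q
  have [measurable]: "G q \<in> borel_measurable X" for q using g[of "of_rat q"] unfolding G_def by (simp cong: measurable_cong_sets)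
  have GA: "(\<integral>\<^sup>+x. G q x * indicator A x \<partial>S) = emeasure \<mu> (A \<times> {..of_rat q})" if "A \<in> sets X" for q A
    unfolding G_def by (rule gA[OF that])
  have Gfin: "(\<integral>\<^sup>+x. G q x \<partial>S) < \<infinity>" for q
  proof -
    have "(\<integral>\<^sup>+x. G q x \<partial>S) = (\<integral>\<^sup>+x. G q x * indicator (space X) x \<partial>S)" by (intro nn_integral_cong) auto
    then show ?thesis by (simp add: GA less_top[symmetric])
  qed
  have mono: "AE x in S. G p x \<le> G q x" if "p \<le> q" for p q
  proof (rule S.AE_le_if_set_integrals_le)
    fix A assume "A \<in> sets S"
    then show "(\<integral>\<^sup>+x. G p x * indicator A x \<partial>S) \<le> (\<integral>\<^sup>+x. G q x * indicator A x \<partial>S)"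
      using that by (simp add: GA) (intro emeasure_mono, auto simp: of_rat_less_eq intro: order_trans)
  qed (use Gfin in auto)
  have le1: "AE x in S. G q x \<le> 1" for q
  proof (rule S.AE_le_if_set_integrals_le)
    fix A assume "A \<in> sets S"
    then show "(\<integral>\<^sup>+x. G q x * indicator A x \<partial>S) \<le> (\<integral>\<^sup>+x. 1 * indicator A x \<partial>S)"
      by (simp add: GA S) (intro emeasure_mono, auto)
  qed (auto simp: less_top[symmetric])
  have mono_all: "AE x in S. \<forall>p q. p \<le> q \<longrightarrow> G p x \<le> G q x"
    unfolding AE_all_countable using mono by auto
  have le1_all: "AE x in S. \<forall>q. G q x \<le> 1" unfolding AE_all_countable using le1 by auto
  have top: "AE x in S. 1 \<le> (SUP n::nat. G (of_nat n) x)"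
  proof (rule S.AE_le_if_set_integrals_le)
    show "(\<integral>\<^sup>+x. (SUP n::nat. G (of_nat n) x) \<partial>S) < \<infinity>"
    proof -
      have "(\<integral>\<^sup>+x. (SUP n::nat. G (of_nat n) x) \<partial>S) \<le> (\<integral>\<^sup>+x. 1 \<partial>S)"
        using le1_all by (intro nn_integral_mono_AE) (auto elim!: AE_mp intro!: SUP_least)
      also have "\<dots> < \<infinity>" by (simp add: less_top[symmetric])
      finally show ?thesis .
    qed
    fix A assume A: "A \<in> sets S"
    have "(\<integral>\<^sup>+x. 1 * indicator A x \<partial>S) = emeasure \<mu> (\<Union>n::nat. A \<times> {..real n})"
    proof -
      have "(\<Union>n::nat. A \<times> {..real n}) = A \<times> UNIV" using real_arch_simple by auto
      then show ?thesis using A by (simp add: S)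
    qed
    also have "\<dots> = (SUP n::nat. emeasure \<mu> (A \<times> {..real n}))"
      using A by (intro SUP_emeasure_incseq[symmetric]) (auto simp: incseq_def)
    also have "\<dots> \<le> (\<integral>\<^sup>+x. (SUP n::nat. G (of_nat n) x) * indicator A x \<partial>S)"
    proof (rule SUP_least)
      fix n :: nat
      have "emeasure \<mu> (A \<times> {..real n}) = (\<integral>\<^sup>+x. G (of_nat n) x * indicator A x \<partial>S)" using A by (simp add: GA)
      also have "\<dots> \<le> (\<integral>\<^sup>+x. (SUP n::nat. G (of_nat n) x) * indicator A x \<partial>S)"
        by (intro nn_integral_mono mult_right_mono SUP_upper) auto
      finally show "emeasure \<mu> (A \<times> {..real n}) \<le> (\<integral>\<^sup>+x. (SUP n::nat. G (of_nat n) x) * indicator A x \<partial>S)" .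
    qed
    finally show "(\<integral>\<^sup>+x. 1 * indicator A x \<partial>S) \<le> (\<integral>\<^sup>+x. (SUP n::nat. G (of_nat n) x) * indicator A x \<partial>S)" .
  qed auto
  have bot: "AE x in S. (INF n::nat. G (- of_nat n) x) = 0"
  proof -
    have "(\<integral>\<^sup>+x. (INF n::nat. G (- of_nat n) x) \<partial>S) \<le> (INF n::nat. emeasure \<mu> (space X \<times> {..- real n}))"
    proof (rule INF_greatest)
      fix n :: nat
      have "(\<integral>\<^sup>+x. (INF n::nat. G (- of_nat n) x) \<partial>S) \<le> (\<integral>\<^sup>+x. G (- of_nat n) x * indicator (space X) x \<partial>S)"
        by (intro nn_integral_mono) (auto intro: INF_lower)
      also have "\<dots> = emeasure \<mu> (space X \<times> {..- real n})" by (simp add: GA of_rat_minus)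
      finally show "(\<integral>\<^sup>+x. (INF n::nat. G (- of_nat n) x) \<partial>S) \<le> emeasure \<mu> (space X \<times> {..- real n})" .
    qed
    also have "\<dots> = emeasure \<mu> (\<Inter>n::nat. space X \<times> {..- real n})"
      by (intro INF_emeasure_decseq) (auto simp: decseq_def)
    also have "(\<Inter>n::nat. space X \<times> {..- real n}) = {}"
    proof -
      have "\<exists>n::nat. \<not> y \<le> - real n" for y :: real
      proof -
        obtain n :: nat where "- y < real n" using reals_Archimedean2 by blast
        then show ?thesis by (intro exI[of _ n]) simp
      qed
      then show ?thesis by fastforce
    qed
    finally have "(\<integral>\<^sup>+x. (INF n::nat. G (- of_nat n) x) \<partial>S) = 0" by simp
    then show ?thesis by (subst (asm) nn_integral_0_iff_AE) auto
  qed
  \<comment> \<open>All countably many conditions in one measurable predicate, so that the kernel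
    can be defined by cases.\<close>
  define good where "good x \<longleftrightarrow> (\<forall>p q. p \<le> q \<longrightarrow> G p x \<le> G q x) \<and> (\<forall>q. G q x \<le> 1) \<and>
    1 \<le> (SUP n::nat. G (of_nat n) x) \<and> (INF n::nat. G (- of_nat n) x) = 0" for x
  have good: "AE x in S. good x" using mono_all le1_all top bot unfolding good_def by eventually_elim auto
  have [measurable]: "Measurable.pred X good" unfolding good_def[abs_def] by measurable
  define F where "F x r = enn2real (INF n. G (dyadic_above n r) x)" for x r
  \<comment> \<open>On the exceptional null set any probability measure will do; a point mass keeps
    K a measurable kernel everywhere.\<close>
  define K where "K x = (if good x then interval_measure (F x) else return borel 0)" for x
  have K: "real_distribution (K x)" for x
  proof (cases "good x")
    case True
    then have "(SUP n::nat. G (of_nat n) x) = 1" by (intro antisym SUP_least) (auto simp: good_def)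
    then show ?thesis using True cdf_from_rationals(1)[of "\<lambda>q. G q x"] by (simp add: K_def F_def[abs_def] good_def)
  qed (simp add: K_def real_distribution_def real_distribution_axioms_def prob_space_return)
  have Kr: "emeasure (K x) {..r} = (INF n. G (dyadic_above n r) x)" if "good x" for x r
  proof -
    have "(SUP n::nat. G (of_nat n) x) = 1" using that by (intro antisym SUP_least) (auto simp: good_def)
    then show ?thesis using that cdf_from_rationals(2)[of "\<lambda>q. G q x"] by (simp add: K_def F_def[abs_def] good_def)
  qed
  have Km: "K \<in> X \<rightarrow>\<^sub>M prob_algebra borel"
  proof (rule measurable_prob_algebra_generated[where G = "range (\<lambda>r::real. {..r})" and \<Omega> = UNIV])
    show "sets borel = sigma_sets UNIV (range (\<lambda>r::real. {..r}))" by (subst borel_eq_atMost) simp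
    show "Int_stable (range (\<lambda>r::real. {..r}))"
      unfolding Int_stable_def by (auto intro!: image_eqI[where x = "min _ _"])
    show "prob_space (K x)" "sets (K x) = sets borel" for x using K[of x] by (auto simp: real_distribution_def real_distribution_axioms_def)
    fix A assume "A \<in> range (\<lambda>r::real. {..r})"
    then obtain r where A: "A = {..r}" by auto
    have "(\<lambda>x. emeasure (K x) A) = (\<lambda>x. if good x then (INF n. G (dyadic_above n r) x) else indicator A 0)"
    proof
      show "emeasure (K x) A = (if good x then (INF n. G (dyadic_above n r) x) else indicator A 0)" for x
      proof (cases "good x")
        case True then show ?thesis using Kr[of x r] by (simp add: A)
      next
        case False then show ?thesis by (simp add: K_def A)
      qed
    qed
    also have "\<dots> \<in> borel_measurable X" by measurable
    finally show "(\<lambda>x. emeasure (K x) A) \<in> borel_measurable X" .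
  qed auto
  then have Ks[measurable]: "K \<in> X \<rightarrow>\<^sub>M subprob_algebra borel" by (rule measurable_prob_algebraD)
  define \<mu>' where "\<mu>' = S \<bind> (\<lambda>x. distr (K x) (X \<Otimes>\<^sub>M borel) (Pair x))"
  have Dm[measurable]: "(\<lambda>x. distr (K x) (X \<Otimes>\<^sub>M borel) (Pair x)) \<in> X \<rightarrow>\<^sub>M subprob_algebra (X \<Otimes>\<^sub>M borel)"
  proof (rule measurable_distr2[OF _ Ks])
    have "case_prod Pair = (\<lambda>z :: 'a \<times> real. z)" by auto
    then show "case_prod Pair \<in> X \<Otimes>\<^sub>M borel \<rightarrow>\<^sub>M X \<Otimes>\<^sub>M (borel :: real measure)" by simp
  qed
  then have DmS: "(\<lambda>x. distr (K x) (X \<Otimes>\<^sub>M borel) (Pair x)) \<in> S \<rightarrow>\<^sub>M subprob_algebra (X \<Otimes>\<^sub>M borel)"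
    by (simp cong: measurable_cong_sets)
  have nn\<mu>': "(\<integral>\<^sup>+z. f z \<partial>\<mu>') = (\<integral>\<^sup>+x. \<integral>\<^sup>+y. f (x, y) \<partial>K x \<partial>S)" if [measurable]: "f \<in> borel_measurable (X \<Otimes>\<^sub>M borel)" for f
  proof -
    have "(\<integral>\<^sup>+z. f z \<partial>\<mu>') = (\<integral>\<^sup>+x. \<integral>\<^sup>+z. f z \<partial>distr (K x) (X \<Otimes>\<^sub>M borel) (Pair x) \<partial>S)"
      unfolding \<mu>'_def by (rule nn_integral_bind[OF that DmS])
    also have "\<dots> = (\<integral>\<^sup>+x. \<integral>\<^sup>+y. f (x, y) \<partial>K x \<partial>S)"
    proof (rule nn_integral_cong)
      fix x assume x: "x \<in> space S"
      have [measurable_cong]: "sets (K x) = sets borel" using K[of x] by (auto simp: real_distribution_def real_distribution_axioms_def)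
      show "(\<integral>\<^sup>+z. f z \<partial>distr (K x) (X \<Otimes>\<^sub>M borel) (Pair x)) = (\<integral>\<^sup>+y. f (x, y) \<partial>K x)"
        using x by (intro nn_integral_distr) auto
    qed
    finally show ?thesis .
  qed
  \<comment> \<open>The monadic bind has the expected sigma-algebra on a nonempty space; on the
    empty space both integrals vanish.\<close>
  have "\<mu> = \<mu>'" if ne: "space X \<noteq> {}"
  proof (rule measure_eqI_generator_eq)
    let ?E = "{A \<times> {..r::real} | A r. A \<in> sets X}"
    have sets\<mu>': "sets \<mu>' = sets (X \<Otimes>\<^sub>M borel)" unfolding \<mu>'_def using ne by (intro sets_bind) (auto)
    have gen: "sets (X \<Otimes>\<^sub>M (borel :: real measure)) = sigma_sets (space X \<times> UNIV) ?E"
    proof -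
      have "sets (X \<Otimes>\<^sub>M (borel :: real measure)) = sets (sigma (space X \<times> space (borel :: real measure)) {a \<times> b | a b. a \<in> sets X \<and> b \<in> range (\<lambda>r::real. {..r})})"
      proof (rule sets_pair_eq)
        show "sets X \<subseteq> Pow (space X)" using sets.sets_into_space by auto
        show "sets X = sigma_sets (space X) (sets X)" by (simp add: sets.sigma_sets_eq)
        show "countable {space X}" "{space X} \<subseteq> sets X" "\<Union>{space X} = space X" by auto
        show "range (\<lambda>r::real. {..r}) \<subseteq> Pow (space borel)" by simp
        show "sets borel = sigma_sets (space borel) (range (\<lambda>r::real. {..r}))"
          by (subst borel_eq_atMost) simp
        show "countable (range (\<lambda>n::nat. {..real n}))" "range (\<lambda>n::nat. {..real n}) \<subseteq> range (\<lambda>r::real. {..r})" by auto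
        show "\<Union>(range (\<lambda>n::nat. {..real n})) = space borel" using real_arch_simple by auto
      qed
      also have "space (borel :: real measure) = UNIV" by simp
      also have "{a \<times> b | a b. a \<in> sets X \<and> b \<in> range (\<lambda>r::real. {..r})} = ?E" by auto
      also have "sets (sigma (space X \<times> UNIV) ?E) = sigma_sets (space X \<times> UNIV) ?E"
        by (rule sets_measure_of) (use sets.sets_into_space in blast)
      finally show ?thesis .
    qed
    show "sets \<mu> = sigma_sets (space X \<times> UNIV) ?E" "sets \<mu>' = sigma_sets (space X \<times> UNIV) ?E"
      using gen sets sets\<mu>' by simp_all
    show "?E \<subseteq> Pow (space X \<times> UNIV)" using sets.sets_into_space by blast
    show "Int_stable ?E"
      unfolding Int_stable_def
    proof (intro ballI)
      fix a b assume "a \<in> ?E" "b \<in> ?E"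
      then obtain A r B s where ab: "a = A \<times> {..r}" "b = B \<times> {..s}" "A \<in> sets X" "B \<in> sets X" by blast
      then have "a \<inter> b = (A \<inter> B) \<times> {..min r s}" by auto
      then show "a \<inter> b \<in> ?E" using ab by blast
    qed
    show "range (\<lambda>n::nat. space X \<times> {..real n}) \<subseteq> ?E" by auto
    show "(\<Union>n::nat. space X \<times> {..real n}) = space X \<times> UNIV" using real_arch_simple by auto
    show "emeasure \<mu> (space X \<times> {..real n}) \<noteq> \<infinity>" for n by simp
    fix Z assume "Z \<in> ?E"
    then obtain A r where Z: "Z = A \<times> {..r}" and A[measurable]: "A \<in> sets X" by auto
    have "emeasure \<mu>' Z = (\<integral>\<^sup>+z. indicator Z z \<partial>\<mu>')" using sets\<mu>' by (simp add: Z)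
    also have "\<dots> = (\<integral>\<^sup>+x. \<integral>\<^sup>+y. indicator Z (x, y) \<partial>K x \<partial>S)" by (rule nn\<mu>') (simp add: Z)
    also have "\<dots> = (\<integral>\<^sup>+x. (INF n. G (dyadic_above n r) x * indicator A x) \<partial>S)"
    proof (rule nn_integral_cong_AE, use good in eventually_elim)
      case (elim x)
      have [measurable_cong]: "sets (K x) = sets borel" using K[of x] by (auto simp: real_distribution_def real_distribution_axioms_def)
      have "(\<integral>\<^sup>+y. indicator Z (x, y) \<partial>K x) = (\<integral>\<^sup>+y. indicator A x * indicator {..r} y \<partial>K x)"
        by (intro nn_integral_cong) (auto simp: Z indicator_def)
      also have "\<dots> = indicator A x * (\<integral>\<^sup>+y. indicator {..r} y \<partial>K x)" using K[of x]
        by (intro nn_integral_cmult borel_measurable_indicator) (auto simp: real_distribution_def real_distribution_axioms_def)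
      also have "\<dots> = indicator A x * emeasure (K x) {..r}" using K[of x]
        by (subst nn_integral_indicator) (auto simp: real_distribution_def real_distribution_axioms_def)
      also have "\<dots> = (INF n. G (dyadic_above n r) x * indicator A x)" using Kr[OF elim, of r] by (simp add: indicator_def)
      finally show ?case .
    qed
    also have "\<dots> = (INF n. (\<integral>\<^sup>+x. G (dyadic_above n r) x * indicator A x \<partial>S))"
    proof (rule nn_integral_monotone_convergence_INF_AE')
      show "AE x in S. G (dyadic_above (Suc n) r) x * indicator A x \<le> G (dyadic_above n r) x * indicator A x" for n
        using mono[OF dyadic_above_decreasing[of n r]] by eventually_elim (auto intro: mult_right_mono)
      show "(\<integral>\<^sup>+x. G (dyadic_above 0 r) x * indicator A x \<partial>S) < \<infinity>" by (simp add: GA less_top[symmetric])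
    qed measurable
    also have "\<dots> = (INF n. emeasure \<mu> (A \<times> {..of_rat (dyadic_above n r)}))" by (simp add: GA)
    also have "\<dots> = emeasure \<mu> (\<Inter>n. A \<times> {..of_rat (dyadic_above n r)})"
    proof (rule INF_emeasure_decseq)
      show "decseq (\<lambda>n. A \<times> {..real_of_rat (dyadic_above n r)})"
      proof (rule decseq_SucI)
        fix n
        have "real_of_rat (dyadic_above (Suc n) r) \<le> of_rat (dyadic_above n r)" using dyadic_above_decreasing by (simp only: of_rat_less_eq)
        then show "A \<times> {..real_of_rat (dyadic_above (Suc n) r)} \<le> A \<times> {..real_of_rat (dyadic_above n r)}" by auto
      qed
    qed auto
    also have "(\<Inter>n. A \<times> {..real_of_rat (dyadic_above n r)}) = A \<times> {..r}"
    proof -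
      have "y \<le> r" if y: "\<And>n. y \<le> of_rat (dyadic_above n r)" for y
      proof (rule ccontr)
        assume "\<not> y \<le> r"
        then obtain n where "(1 / 2) ^ n < y - r" using real_arch_pow_inv[of "y - r" "1 / 2"] by auto
        then show False using y[of n] dyadic_above_le[of n r] by (simp add: power_one_over)
      qed
      moreover have "y \<le> of_rat (dyadic_above n r)" if "y \<le> r" for y n using dyadic_above_gt[of r n] that by linarith
      ultimately have iff: "(\<forall>n. y \<le> real_of_rat (dyadic_above n r)) \<longleftrightarrow> y \<le> r" for y
        by (intro iffI allI; simp)
      show ?thesis
      proof (rule set_eqI)
        show "z \<in> (\<Inter>n. A \<times> {..real_of_rat (dyadic_above n r)}) \<longleftrightarrow> z \<in> A \<times> {..r}" for z
          by (cases z) (simp add: iff)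
      qed
    qed
    finally show "emeasure \<mu> Z = emeasure \<mu>' Z" by (simp add: Z)
  qed
  moreover have "(\<integral>\<^sup>+z. f z \<partial>\<mu>) = (\<integral>\<^sup>+x. \<integral>\<^sup>+y. f (x, y) \<partial>K x \<partial>S)" if "space X = {}" for f
    using that by (simp add: nn_integral_empty sp\<mu>)
  ultimately have "(\<integral>\<^sup>+z. f z \<partial>\<mu>) = (\<integral>\<^sup>+x. \<integral>\<^sup>+y. f (x, y) \<partial>K x \<partial>S)"
    if "f \<in> borel_measurable (X \<Otimes>\<^sub>M borel)" for f
    using nn\<mu>'[OF that] by (cases "space X = {}") auto
  note main = this
  show ?thesis unfolding S_def[symmetric]
  proof (intro exI[of _ K] conjI ballI)
    show "K \<in> X \<rightarrow>\<^sub>M prob_algebra borel" by (rule Km)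
  qed (rule main)
qed

text \<open>Positivity must hold for every x and not just almost every x, because the definition of
  a tempered stable law asks for complete monotonicity in every direction.\<close>

corollary disintegration_pos:
  fixes \<mu> :: "('a \<times> real) measure"
  assumes fin: "finite_measure \<mu>" and sets: "sets \<mu> = sets (X \<Otimes>\<^sub>M borel)"
    and null: "emeasure \<mu> (space X \<times> {..0}) = 0"
  shows "\<exists>K. K \<in> X \<rightarrow>\<^sub>M prob_algebra borel \<and> (\<forall>x\<in>space X. AE y in K x. 0 < y) \<and>
    (\<forall>f\<in>borel_measurable (X \<Otimes>\<^sub>M borel).
     (\<integral>\<^sup>+z. f z \<partial>\<mu>) = (\<integral>\<^sup>+x. \<integral>\<^sup>+y. f (x, y) \<partial>K x \<partial>distr \<mu> X fst))"
proof -
  obtain K where K[measurable]: "K \<in> X \<rightarrow>\<^sub>M prob_algebra borel" and eq: "\<And>f. f \<in> borel_measurable (X \<Otimes>\<^sub>M borel) \<Longrightarrow>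
     (\<integral>\<^sup>+z. f z \<partial>\<mu>) = (\<integral>\<^sup>+x. \<integral>\<^sup>+y. f (x, y) \<partial>K x \<partial>distr \<mu> X fst)"
    using disintegration_real[OF fin sets] by blast
  have Ks[measurable]: "K \<in> X \<rightarrow>\<^sub>M subprob_algebra borel" by (rule measurable_prob_algebraD[OF K])
  have [measurable_cong]: "sets \<mu> = sets (X \<Otimes>\<^sub>M borel)" by fact
  have sK: "sets (K x) = sets borel" "prob_space (K x)" if "x \<in> space X" for x
    using measurable_space[OF K that] by (auto simp: space_prob_algebra)
  let ?P = "\<lambda>x. emeasure (K x) {..0} = 0"
  have [measurable]: "Measurable.pred X ?P" by measurable
  \<comment> \<open>The kernel is changed on a null set of points x to the point mass at 1, an
    arbitrary positive rate.\<close>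
  define L where "L x = (if ?P x then K x else return borel 1)" for x
  have "0 = (\<integral>\<^sup>+z. indicator (space X \<times> {..0}) z \<partial>\<mu>)"
    by (simp add: null sets)
  also have "\<dots> = (\<integral>\<^sup>+x. \<integral>\<^sup>+y. indicator (space X \<times> {..0}) (x, y) \<partial>K x \<partial>distr \<mu> X fst)"
    by (rule eq) measurable
  also have "\<dots> = (\<integral>\<^sup>+x. emeasure (K x) {..0} \<partial>distr \<mu> X fst)"
  proof (rule nn_integral_cong)
    fix x assume "x \<in> space (distr \<mu> X fst)"
    then have x: "x \<in> space X" by simp
    then have "(\<integral>\<^sup>+y. indicator (space X \<times> {..0}) (x, y) \<partial>K x) = (\<integral>\<^sup>+y. indicator {..0} y \<partial>K x)"
      by (intro nn_integral_cong) (auto simp: indicator_def)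
    then show "(\<integral>\<^sup>+y. indicator (space X \<times> {..0}) (x, y) \<partial>K x) = emeasure (K x) {..0}" using sK[OF x] by simp
  qed
  finally have "(\<integral>\<^sup>+x. emeasure (K x) {..0} \<partial>distr \<mu> X fst) = 0" by simp
  then have ae: "AE x in distr \<mu> X fst. ?P x" by (subst (asm) nn_integral_0_iff_AE) auto
  have "L \<in> X \<rightarrow>\<^sub>M prob_algebra borel" unfolding L_def[abs_def] by measurable
  moreover have "AE y in L x. 0 < y" if "x \<in> space X" for x
  proof (cases "?P x")
    case True
    then show ?thesis using sK[OF that] by (intro AE_I[of _ _ "{..0}"]) (auto simp: L_def)
  next
    case False
    then have "L x = return borel 1" by (simp add: L_def)
    then show ?thesis by (subst \<open>L x = return borel 1\<close>, subst AE_return) auto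
  qed
  moreover have "(\<integral>\<^sup>+z. f z \<partial>\<mu>) = (\<integral>\<^sup>+x. \<integral>\<^sup>+y. f (x, y) \<partial>L x \<partial>distr \<mu> X fst)"
    if "f \<in> borel_measurable (X \<Otimes>\<^sub>M borel)" for f
    unfolding eq[OF that] by (rule nn_integral_cong_AE, use ae in eventually_elim) (simp add: L_def)
  ultimately show ?thesis by blast
qed

section \<open>Laplace transforms\<close>

lemma exp_second_order_bound: "\<bar>exp x - 1 - x\<bar> \<le> x\<^sup>2 * exp \<bar>x\<bar>" for x :: real
proof -
  have "(1 - x) * exp x \<le> exp (- x) * exp x" using exp_ge_add_one_self[of "- x"] by (intro mult_right_mono) auto
  then have up: "exp x - 1 - x \<le> x * (exp x - 1)" by (simp add: exp_minus algebra_simps)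
  have lo: "0 \<le> exp x - 1 - x" using exp_ge_add_one_self[of x] by linarith
  have "x * (exp x - 1) \<le> x\<^sup>2 * exp \<bar>x\<bar>"
  proof (cases "0 \<le> x")
    case True
    have "exp x - 1 \<le> x * exp x" using up by (simp add: algebra_simps)
    then have "x * (exp x - 1) \<le> x * (x * exp x)" using True by (rule mult_left_mono)
    then show ?thesis using True by (simp add: power2_eq_square mult.assoc)
  next
    case False
    have "x * (exp x - 1) \<le> x * x" using False lo by (intro mult_left_mono_neg) auto
    also have "\<dots> \<le> x\<^sup>2 * exp \<bar>x\<bar>" using mult_left_mono[of 1 "exp \<bar>x\<bar>" "x\<^sup>2"] by (simp add: power2_eq_square)
    finally show ?thesis .
  qed
  then show ?thesis using up lo by linarith
qed

text \<open>Half of the exponential is spent on the power: (x/j)^j \<le> exp x with x = \<kappa> r /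
  2. The case j = 0 relies on the zeroth power being 1.\<close>

lemma power_mult_exp_le:
  fixes \<kappa> r :: real
  assumes "0 < \<kappa>" "0 < r"
  shows "\<kappa> ^ j * exp (- (\<kappa> * r)) \<le> (2 * real j / r) ^ j * exp (- (\<kappa> * (r / 2)))"
proof -
  let ?x = "\<kappa> * (r / 2)"
  have "\<kappa> ^ j \<le> (2 * real j / r) ^ j * exp ?x"
  proof (cases "j = 0")
    case False
    have "(?x / j) ^ j \<le> (1 + ?x / j) ^ j" using assms by (intro power_mono) auto
    also have "\<dots> \<le> exp ?x"
    proof (rule exp_ge_one_plus_x_over_n_power_n)
      have "0 \<le> ?x" using assms by simp
      then show "- real j \<le> ?x" by linarith
    qed (use False in simp)
    finally have "(2 * real j / r) ^ j * (?x / j) ^ j \<le> (2 * real j / r) ^ j * exp ?x" using assms by (intro mult_left_mono) auto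
    moreover have "(2 * real j / r) * (?x / j) = \<kappa>" using assms False by (simp add: field_simps)
    ultimately show ?thesis by (simp only: power_mult_distrib[symmetric])
  qed (use assms in simp)
  then have "\<kappa> ^ j * exp (- (\<kappa> * r)) \<le> (2 * real j / r) ^ j * exp ?x * exp (- (\<kappa> * r))" by (intro mult_right_mono) auto
  also have "exp ?x * exp (- (\<kappa> * r)) = exp (- ?x)" by (simp add: exp_add[symmetric])
  then have "(2 * real j / r) ^ j * exp ?x * exp (- (\<kappa> * r)) = (2 * real j / r) ^ j * exp (- ?x)" by (simp only: mult.assoc)
  finally show ?thesis .
qed

text \<open>The measure itself may have infinite mass; only its exponential moments are finite. This
  matters below, where a probability law of rates is multiplied by an unbounded weight.\<close>

locale laplace_transform =
  fixes \<nu> :: "real measure"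
  assumes sets_\<nu>[measurable_cong, simp]: "sets \<nu> = sets borel"
    and pos: "AE \<kappa> in \<nu>. 0 < \<kappa>"
    and nonzero: "emeasure \<nu> (space \<nu>) \<noteq> 0"
    and integrable_exp: "0 < r \<Longrightarrow> integrable \<nu> (\<lambda>\<kappa>. exp (- (\<kappa> * r)))"
begin

abbreviation L :: "nat \<Rightarrow> real \<Rightarrow> real" where "L j r \<equiv> (\<integral>\<kappa>. \<kappa> ^ j * exp (- (\<kappa> * r)) \<partial>\<nu>)"

lemma integrable_L:
  assumes "0 < r" shows "integrable \<nu> (\<lambda>\<kappa>. \<kappa> ^ j * exp (- (\<kappa> * r)))"
proof (rule Bochner_Integration.integrable_bound)
  show "integrable \<nu> (\<lambda>\<kappa>. (2 * real j / r) ^ j * exp (- (\<kappa> * (r / 2))))"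
    by (intro integrable_mult_right integrable_exp) (use assms in simp)
  show "AE \<kappa> in \<nu>. norm (\<kappa> ^ j * exp (- (\<kappa> * r))) \<le> norm ((2 * real j / r) ^ j * exp (- (\<kappa> * (r / 2))))"
    using pos
  proof eventually_elim
    case (elim \<kappa>)
    have "norm (\<kappa> ^ j * exp (- (\<kappa> * r))) = \<kappa> ^ j * exp (- (\<kappa> * r))" using elim by simp
    also have "\<dots> \<le> (2 * real j / r) ^ j * exp (- (\<kappa> * (r / 2)))" by (rule power_mult_exp_le[OF elim assms])
    finally show ?case unfolding real_norm_def by linarith
  qed
qed measurable

lemma L_pos:
  assumes "0 < r" shows "0 < L j r"
proof -
  have nn: "AE \<kappa> in \<nu>. 0 \<le> \<kappa> ^ j * exp (- (\<kappa> * r))" using pos by eventually_elim simp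
  have "L j r \<noteq> 0"
  proof
    assume "L j r = 0"
    then have "AE \<kappa> in \<nu>. \<kappa> ^ j * exp (- (\<kappa> * r)) = 0"
      using integral_nonneg_eq_0_iff_AE[OF integrable_L[OF assms] nn] by simp
    with pos have "AE \<kappa> in \<nu>. False" by eventually_elim auto
    then show False using nonzero unfolding ae_filter_eq_bot_iff[symmetric] trivial_limit_def by blast
  qed
  moreover have "0 \<le> L j r" by (rule integral_nonneg_AE[OF nn])
  ultimately show ?thesis by linarith
qed

text \<open>Differentiation under the integral by a second-order remainder: for |h| \<le> r/2 the
  remainder is at most h^2 \<kappa>^(j+2) exp (-\<kappa> r / 2), which is integrable.\<close>

lemma L_deriv:
  assumes r: "0 < r" shows "(L j has_real_derivative - L (Suc j) r) (at r)"
proof -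
  have bnd: "norm ((L j (r + h) - L j r) / h - - L (Suc j) r) \<le> \<bar>h\<bar> * L (j + 2) (r / 2)" if h: "h \<noteq> 0" "\<bar>h\<bar> \<le> r / 2" for h
  proof -
    have rh: "0 < r + h" using h r by (auto simp: abs_le_iff)
    have eq: "L j (r + h) - L j r + h * L (Suc j) r
        = (\<integral>\<kappa>. \<kappa> ^ j * exp (- (\<kappa> * (r + h))) - \<kappa> ^ j * exp (- (\<kappa> * r)) + h * (\<kappa> ^ Suc j * exp (- (\<kappa> * r))) \<partial>\<nu>)"
      using integrable_L[OF rh, of j] integrable_L[OF r, of j] integrable_L[OF r, of "Suc j"] by simp
    have "norm (L j (r + h) - L j r + h * L (Suc j) r) \<le> (\<integral>\<kappa>. h\<^sup>2 * (\<kappa> ^ (j + 2) * exp (- (\<kappa> * (r / 2)))) \<partial>\<nu>)"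
      unfolding eq
    proof (rule order_trans[OF integral_norm_bound integral_mono_AE], rule integrable_norm)
      show "AE \<kappa> in \<nu>. norm (\<kappa> ^ j * exp (- (\<kappa> * (r + h))) - \<kappa> ^ j * exp (- (\<kappa> * r)) + h * (\<kappa> ^ Suc j * exp (- (\<kappa> * r))))
          \<le> h\<^sup>2 * (\<kappa> ^ (j + 2) * exp (- (\<kappa> * (r / 2))))"
        using pos
      proof eventually_elim
        case (elim \<kappa>)
        let ?x = "- (\<kappa> * h)"
        have "\<kappa> ^ j * exp (- (\<kappa> * (r + h))) - \<kappa> ^ j * exp (- (\<kappa> * r)) + h * (\<kappa> ^ Suc j * exp (- (\<kappa> * r)))
            = \<kappa> ^ j * exp (- (\<kappa> * r)) * (exp ?x - 1 - ?x)"
          by (simp add: algebra_simps exp_add[symmetric])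
        also have "norm \<dots> = \<kappa> ^ j * exp (- (\<kappa> * r)) * \<bar>exp ?x - 1 - ?x\<bar>" using elim by (simp add: abs_mult)
        also have "\<dots> \<le> \<kappa> ^ j * exp (- (\<kappa> * r)) * (?x\<^sup>2 * exp \<bar>?x\<bar>)"
          using elim by (intro mult_left_mono exp_second_order_bound) auto
        also have "\<dots> = h\<^sup>2 * \<kappa> ^ (j + 2) * exp (- (\<kappa> * r) + \<bar>?x\<bar>)"
          unfolding exp_add power_add power2_eq_square by (simp only: minus_mult_minus mult.assoc mult.left_commute mult.commute)
        also have "\<dots> \<le> h\<^sup>2 * \<kappa> ^ (j + 2) * exp (- (\<kappa> * (r / 2)))"
        proof (intro mult_left_mono)
          have "\<kappa> * \<bar>h\<bar> \<le> \<kappa> * (r / 2)" using elim h by (intro mult_left_mono) auto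
          moreover have "\<bar>?x\<bar> = \<kappa> * \<bar>h\<bar>" using elim by (simp add: abs_mult)
          ultimately show "exp (- (\<kappa> * r) + \<bar>?x\<bar>) \<le> exp (- (\<kappa> * (r / 2)))" by simp
        qed (use elim in auto)
        finally show ?case by (simp add: mult.assoc)
      qed
      show "integrable \<nu> (\<lambda>\<kappa>. h\<^sup>2 * (\<kappa> ^ (j + 2) * exp (- (\<kappa> * (r / 2)))))"
        using r by (intro integrable_mult_right integrable_L) auto
      show "integrable \<nu> (\<lambda>\<kappa>. \<kappa> ^ j * exp (- (\<kappa> * (r + h))) - \<kappa> ^ j * exp (- (\<kappa> * r)) + h * (\<kappa> ^ Suc j * exp (- (\<kappa> * r))))"
        by (intro Bochner_Integration.integrable_add Bochner_Integration.integrable_diff integrable_mult_right integrable_L rh r)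
    qed
    then have *: "\<bar>L j (r + h) - L j r + h * L (Suc j) r\<bar> \<le> h\<^sup>2 * L (j + 2) (r / 2)"
      by (simp only: integral_mult_right_zero real_norm_def)
    have "(L j (r + h) - L j r) / h - - L (Suc j) r = (L j (r + h) - L j r + h * L (Suc j) r) / h"
      using h(1) by (simp add: add_divide_distrib)
    then have "norm ((L j (r + h) - L j r) / h - - L (Suc j) r) = \<bar>L j (r + h) - L j r + h * L (Suc j) r\<bar> / \<bar>h\<bar>"
      by (simp only: real_norm_def abs_divide)
    also have "\<dots> \<le> h\<^sup>2 * L (j + 2) (r / 2) / \<bar>h\<bar>" using * by (rule divide_right_mono) simp
    also have "\<dots> = \<bar>h\<bar> * \<bar>h\<bar> * L (j + 2) (r / 2) / \<bar>h\<bar>" by (simp add: power2_eq_square)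
    also have "\<dots> = \<bar>h\<bar> * L (j + 2) (r / 2)"
      by (subst mult.assoc, rule nonzero_mult_div_cancel_left) (use h(1) in simp)
    finally show ?thesis .
  qed
  have "((\<lambda>h. (L j (r + h) - L j r) / h - - L (Suc j) r) \<longlongrightarrow> 0) (at 0)"
  proof (rule Lim_null_comparison)
    show "eventually (\<lambda>h. norm ((L j (r + h) - L j r) / h - - L (Suc j) r) \<le> \<bar>h\<bar> * L (j + 2) (r / 2)) (at 0)"
      unfolding eventually_at by (intro exI[of _ "r / 2"] conjI ballI impI bnd) (use r in auto)
    show "((\<lambda>h. \<bar>h\<bar> * L (j + 2) (r / 2)) \<longlongrightarrow> 0) (at 0)"      by (rule tendsto_mult_left_zero[OF tendsto_rabs_zero[OF tendsto_ident_at]])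
  qed
  then have "((\<lambda>h. (L j (r + h) - L j r) / h) \<longlongrightarrow> - L (Suc j) r) (at 0)" by (rule LIM_zero_cancel)
  then show ?thesis by (simp only: DERIV_def)
qed

lemma deriv_funpow_L: "0 < r \<Longrightarrow> (deriv ^^ k) (L 0) r = (- 1) ^ k * L k r"
proof (induction k arbitrary: r)
  case (Suc k)
  have "(deriv ^^ Suc k) (L 0) r = deriv ((deriv ^^ k) (L 0)) r" by simp
  also have "\<dots> = deriv (\<lambda>r. (- 1) ^ k * L k r) r"
    by (rule deriv_cong_ev[OF eventually_mono[OF eventually_nhds_in_open[of "{0<..}"]] refl])
      (use Suc in \<open>auto simp del: power_0\<close>)
  also have "\<dots> = (- 1) ^ k * (- L (Suc k) r)" by (intro DERIV_imp_deriv DERIV_cmult L_deriv Suc.prems)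
  finally show ?case by simp
qed simp

lemma completely_monotone:
  assumes "0 < r"
  shows "(deriv ^^ k) (L 0) differentiable (at r)" "0 < (- 1) ^ k * (deriv ^^ k) (L 0) r"
proof -
  have "((\<lambda>r. (- 1) ^ k * L k r) has_real_derivative (- 1) ^ k * (- L (Suc k) r)) (at r)"
    by (intro DERIV_cmult L_deriv assms)
  then have "((deriv ^^ k) (L 0) has_real_derivative (- 1) ^ k * (- L (Suc k) r)) (at r)"
    by (rule has_field_derivative_transform_within_open[of _ _ _ "{0<..}"])
      (use assms in \<open>auto simp: deriv_funpow_L simp del: power_0\<close>)
  then show "(deriv ^^ k) (L 0) differentiable (at r)" by (auto simp: real_differentiable_def)
  show "0 < (- 1) ^ k * (deriv ^^ k) (L 0) r"
    unfolding deriv_funpow_L[OF assms] mult.assoc[symmetric] power_mult_distrib[symmetric] using L_pos[OF assms, of k] by simp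
qed

lemma tendsto_L_0: "(L 0 \<longlongrightarrow> 0) at_top"
proof -
  have "((\<lambda>r. \<integral>\<kappa>. exp (- (\<kappa> * r)) \<partial>\<nu>) \<longlongrightarrow> (\<integral>\<kappa>. 0 \<partial>\<nu>)) at_top"
  proof (rule integral_dominated_convergence_at_top)
    show "integrable \<nu> (\<lambda>\<kappa>. exp (- (\<kappa> * 1)))" by (rule integrable_exp) simp
    show "\<forall>\<^sub>F r in at_top. AE \<kappa> in \<nu>. norm (exp (- (\<kappa> * r))) \<le> exp (- (\<kappa> * 1))"
      using eventually_ge_at_top[of 1]
    proof eventually_elim
      case (elim r)
      show ?case using pos by eventually_elim (use elim in simp)
    qed
    show "AE \<kappa> in \<nu>. ((\<lambda>r. exp (- (\<kappa> * r))) \<longlongrightarrow> 0) at_top"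
      using pos
    proof eventually_elim
      case (elim \<kappa>)
      have "filterlim (\<lambda>r. \<kappa> * r) at_top at_top"
        by (rule filterlim_tendsto_pos_mult_at_top[OF tendsto_const elim filterlim_ident])
      then have "filterlim (\<lambda>r. - (\<kappa> * r)) at_bot at_top" by (simp add: filterlim_uminus_at_top)
      then show ?case by (rule filterlim_compose[OF exp_at_bot])
    qed
  qed auto
  then show ?thesis by simp
qed

end

section \<open>Levy measures of stochastic integrals\<close>

lemma max_powr_le: "0 < \<kappa> \<Longrightarrow> 0 < \<alpha> \<Longrightarrow> \<alpha> < 2 \<Longrightarrow> max (\<kappa> powr (2 - \<alpha>)) 1 \<le> 1 + \<kappa>\<^sup>2" for \<kappa> \<alpha> :: real
proof (cases "\<kappa> \<le> 1")
  case False
  assume a: "0 < \<kappa>" "0 < \<alpha>" "\<alpha> < 2"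
  then have "\<kappa> powr (2 - \<alpha>) \<le> \<kappa> powr 2" using False by (intro powr_mono) auto
  then show ?thesis using a by (simp add: max_def)
next
  case True
  assume a: "0 < \<kappa>" "0 < \<alpha>" "\<alpha> < 2"
  then have "\<kappa> powr (2 - \<alpha>) \<le> 1" using True by (intro powr_le1) auto
  then show ?thesis by (simp add: max_def)
qed

text \<open>A ray stretched by a has the rate \<kappa> = lam / a, so the factor is
  \<open>max ((\<kappa> / lam) powr (2 - \<alpha>)) 1\<close>. It is the quotient of a^\<alpha>, the
  Jacobian weight of the stretched ray, by the integrable weight
  \<open>wgt \<alpha> a\<close>.\<close>

lemma wgt_powr_cancel:
  assumes "0 < a" "0 < \<alpha>" "\<alpha> < 2"
  shows "wgt \<alpha> a * max ((1 / a) powr (2 - \<alpha>)) 1 = a powr \<alpha>"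
proof -
  have inv: "(1 / a) powr (2 - \<alpha>) = a powr (\<alpha> - 2)"
    using assms by (simp add: powr_divide powr_minus_divide[symmetric])
  have sq: "a\<^sup>2 * a powr (\<alpha> - 2) = a powr \<alpha>"
    using assms by (simp add: powr_diff)
  show ?thesis
  proof (cases "a \<le> 1")
    case True
    have "a\<^sup>2 \<le> a powr \<alpha>" using powr_mono'[of \<alpha> 2 a] True assms by simp
    moreover have "1 \<le> a powr (\<alpha> - 2)" using powr_mono'[of "\<alpha> - 2" 0 a] True assms by simp
    ultimately show ?thesis using sq by (simp add: wgt_def inv max_def min_def)
  next
    case False
    have "a powr \<alpha> \<le> a\<^sup>2" using powr_mono[of \<alpha> 2 a] False assms by simp
    moreover have "a powr (\<alpha> - 2) \<le> 1" using powr_mono[of "\<alpha> - 2" 0 a] False assms by simp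
    ultimately show ?thesis by (simp add: wgt_def inv max_def min_def)
  qed
qed

context tempered_levy
begin

text \<open>Substitution r = a t: the power of r and the length element contribute a^(-\<alpha>),
  which cancels against \<open>wgt\<close> times the rate factor.\<close>

lemma nn_integral_radial_scale:
  fixes g :: "real \<Rightarrow> ennreal"
  assumes [measurable]: "g \<in> borel_measurable borel" and a: "0 < a"
  shows "ennreal (wgt \<alpha> a) * (\<integral>\<^sup>+r. ennreal (r powr (- \<alpha> - 1) * (max ((1 / a) powr (2 - \<alpha>)) 1 * exp (- (lam / a * r)))) * g r * indicator {0<..} r \<partial>lborel)
    = (\<integral>\<^sup>+t. ennreal (t powr (- \<alpha> - 1) * exp (- lam * t)) * g (a * t) * indicator {0<..} t \<partial>lborel)"
proof -
  define w where "w = max ((1 / a) powr (2 - \<alpha>)) 1"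
  define h where "h r = ennreal (r powr (- \<alpha> - 1) * (w * exp (- (lam / a * r)))) * g r * indicator {0<..} r" for r
  have [measurable]: "h \<in> borel_measurable borel" unfolding h_def[abs_def] by measurable
  have e: "wgt \<alpha> a * (a * ((a * t) powr (- \<alpha> - 1) * (w * exp (- (lam / a * (a * t)))))) = t powr (- \<alpha> - 1) * exp (- lam * t)" if t: "0 < t" for t
  proof -
    have 1: "(a * t) powr (- \<alpha> - 1) = a powr (- \<alpha> - 1) * t powr (- \<alpha> - 1)" by (rule powr_mult)
    have 2: "lam / a * (a * t) = lam * t" using a by simp
    have 3: "wgt \<alpha> a * w = a powr \<alpha>" unfolding w_def by (rule wgt_powr_cancel[OF a \<alpha>])
    have 4: "a * a powr (- \<alpha> - 1) = a powr (- \<alpha>)" using a by (simp add: powr_diff)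
    have 5: "a powr \<alpha> * a powr (- \<alpha>) = 1" using a by (simp add: powr_add[symmetric])
    have "wgt \<alpha> a * (a * ((a * t) powr (- \<alpha> - 1) * (w * exp (- (lam / a * (a * t)))))) =
       (wgt \<alpha> a * w) * (a * a powr (- \<alpha> - 1)) * t powr (- \<alpha> - 1) * exp (- (lam * t))"
      unfolding 1 2 by (simp only: mult.assoc mult.left_commute)
    then show ?thesis unfolding 3 4 5 by simp
  qed
  have "ennreal (wgt \<alpha> a) * (ennreal \<bar>a\<bar> * h (0 + a * t)) = ennreal (t powr (- \<alpha> - 1) * exp (- lam * t)) * g (a * t) * indicator {0<..} t" for t
  proof (cases "0 < t")
    case True
    have "ennreal (wgt \<alpha> a) * (ennreal \<bar>a\<bar> * ennreal ((a * t) powr (- \<alpha> - 1) * (w * exp (- (lam / a * (a * t))))))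
      = ennreal (wgt \<alpha> a * (a * ((a * t) powr (- \<alpha> - 1) * (w * exp (- (lam / a * (a * t)))))))"
      using a by (simp only: abs_of_pos ennreal_mult' wgt_nonneg less_imp_le)
    also have "\<dots> = ennreal (t powr (- \<alpha> - 1) * exp (- lam * t))" unfolding e[OF True] ..
    finally have "ennreal (wgt \<alpha> a) * (ennreal \<bar>a\<bar> * ennreal ((a * t) powr (- \<alpha> - 1) * (w * exp (- (lam / a * (a * t)))))) * g (a * t)
      = ennreal (t powr (- \<alpha> - 1) * exp (- lam * t)) * g (a * t)" by (rule arg_cong)
    moreover have "0 < a * t" using True a by simp
    ultimately show ?thesis using True by (simp only: h_def add_0 indicator_simps greaterThan_iff mult_1_right mult.assoc)
  next
    case False
    then have "\<not> 0 < a * t" using a by (simp add: zero_less_mult_iff)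
    then show ?thesis using False by (auto simp: h_def indicator_def)
  qed
  note eq = this
  have "(\<integral>\<^sup>+r. h r \<partial>lborel) = ennreal \<bar>a\<bar> * (\<integral>\<^sup>+t. h (0 + a * t) \<partial>lborel)"
    using a by (intro nn_integral_real_affine) auto
  then have "ennreal (wgt \<alpha> a) * (\<integral>\<^sup>+r. h r \<partial>lborel) = (\<integral>\<^sup>+t. ennreal (wgt \<alpha> a) * (ennreal \<bar>a\<bar> * h (0 + a * t)) \<partial>lborel)"
    by (simp add: nn_integral_cmult)
  then show ?thesis unfolding eq unfolding h_def w_def .
qed

text \<open>The pairs (s, \<theta>) are mapped to a direction and a rate under the finite weight
  \<open>wgt\<close>, and the rates are disintegrated over the directions. The identity is stated
  through integrals with the origin removed, because linear maps may send mass to 0, where a Levy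
  measure has none; h is a scalar majorant of the operator norms.\<close>

lemma ex_polar_levy:
  fixes F :: "'s::euclidean_space \<Rightarrow> real^'d \<Rightarrow> 'b::euclidean_space" and h :: "'s \<Rightarrow> real"
  assumes F: "(\<lambda>z. F (fst z) (snd z)) \<in> borel_measurable (borel \<Otimes>\<^sub>M borel)"
    and lin: "\<And>s. linear (F s)"
    and hm[measurable]: "h \<in> borel_measurable borel" and hF: "\<And>s x. norm (F s x) \<le> h s * norm x"
    and hfin: "(\<integral>\<^sup>+s. ennreal (wgt \<alpha> (h s)) \<partial>lborel) < \<infinity>"
  shows "\<exists>q \<sigma>'. sphere_measure \<sigma>' \<and>
    (\<lambda>(r, \<xi>). q r \<xi>) \<in> borel_measurable (restrict_space borel {0<..} \<Otimes>\<^sub>M restrict_space borel (sphere 0 1)) \<and>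
    (\<forall>\<xi>\<in>sphere 0 1. (\<forall>k. \<forall>r>0. (deriv ^^ k) (\<lambda>r. q r \<xi>) differentiable (at r) \<and>
       0 < (- 1) ^ k * (deriv ^^ k) (\<lambda>r. q r \<xi>) r) \<and> ((\<lambda>r. q r \<xi>) \<longlongrightarrow> 0) at_top) \<and>
    (\<forall>g\<in>borel_measurable borel. (\<integral>\<^sup>+y. g y \<partial>polar_measure \<alpha> q \<sigma>') = (\<integral>\<^sup>+s. \<integral>\<^sup>+x. g (F s x) * indicator (- {0}) (F s x) \<partial>\<Phi> \<partial>lborel))"
proof -
  define X where "X = restrict_space borel (sphere 0 1 :: 'b set)"
  have spX: "space X = sphere 0 1" by (simp add: X_def space_restrict_space)
  have idX: "(\<lambda>x. x) \<in> X \<rightarrow>\<^sub>M borel" unfolding X_def by (rule measurable_restrict_space1) simp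
  have id\<sigma>: "(\<lambda>x. x) \<in> \<sigma> \<rightarrow>\<^sub>M borel"
    using measurable_restrict_space1[of "\<lambda>x. x" borel borel "sphere 0 1"] by (subst measurable_cong_sets[OF sets_\<sigma> refl]) simp
  define base where "base = (lborel :: 's measure) \<Otimes>\<^sub>M \<sigma>"
  define G where "G z = F (fst z) (snd z)" for z
  have pm: "(\<lambda>z. (fst z, snd z)) \<in> base \<rightarrow>\<^sub>M borel \<Otimes>\<^sub>M borel"
    unfolding base_def by (intro measurable_Pair measurable_compose[OF measurable_snd id\<sigma>]) simp
  have G[measurable]: "G \<in> borel_measurable base"
    using measurable_compose[OF pm F] by (simp add: G_def[abs_def])
  obtain e :: 'b where e: "norm e = 1" using norm_Basis SOME_Basis by blast
  \<comment> \<open>Where G vanishes, a fixed unit vector and the rate 1 are placeholders; the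
    weight \<open>wgt \<alpha> 0 = 0\<close> removes them.\<close>
  define u where "u z = (if G z = 0 then e else G z /\<^sub>R norm (G z))" for z
  define k where "k z = (if G z = 0 then 1 else lam / norm (G z))" for z
  have [measurable]: "u \<in> base \<rightarrow>\<^sub>M X"
    unfolding X_def by (rule measurable_restrict_space2) (auto simp: u_def e, simp add: u_def[abs_def])
  have [measurable]: "k \<in> borel_measurable base" unfolding k_def[abs_def] by measurable
  have k: "0 < k z" for z using lam by (simp add: k_def)
  define \<mu> where "\<mu> = distr (density base (\<lambda>z. ennreal (wgt \<alpha> (norm (G z))))) (X \<Otimes>\<^sub>M borel) (\<lambda>z. (u z, k z))"
  have sets\<mu>: "sets \<mu> = sets (X \<Otimes>\<^sub>M borel)" by (simp add: \<mu>_def)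
  have nn\<mu>: "(\<integral>\<^sup>+z. f z \<partial>\<mu>) = (\<integral>\<^sup>+z. ennreal (wgt \<alpha> (norm (G z))) * f (u z, k z) \<partial>base)"
    if [measurable]: "f \<in> borel_measurable (X \<Otimes>\<^sub>M borel)" for f
    unfolding \<mu>_def by (subst nn_integral_distr, simp_all, subst nn_integral_density) simp_all
  have base: "(\<integral>\<^sup>+z. f z \<partial>base) = (\<integral>\<^sup>+s. \<integral>\<^sup>+\<theta>. f (s, \<theta>) \<partial>\<sigma> \<partial>lborel)" if "f \<in> borel_measurable base" for f
    using S.nn_integral_fst[OF that[unfolded base_def]] unfolding base_def by simp
  have fin: "finite_measure \<mu>"
  proof
    have "emeasure \<mu> (space \<mu>) = (\<integral>\<^sup>+z. 1 \<partial>\<mu>)" by simp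
    also have "\<dots> = (\<integral>\<^sup>+z. ennreal (wgt \<alpha> (norm (G z))) \<partial>base)" by (subst nn\<mu>) simp_all
    also have "\<dots> = (\<integral>\<^sup>+s. \<integral>\<^sup>+\<theta>. ennreal (wgt \<alpha> (norm (G (s, \<theta>)))) \<partial>\<sigma> \<partial>lborel)" by (rule base) measurable
    also have "\<dots> \<le> (\<integral>\<^sup>+s. \<integral>\<^sup>+\<theta>. ennreal (wgt \<alpha> (h s)) \<partial>\<sigma> \<partial>lborel)"
    proof (intro nn_integral_mono ennreal_leI wgt_mono)
      fix s \<theta> assume "\<theta> \<in> space \<sigma>"
      then show "norm (G (s, \<theta>)) \<le> h s" using hF[of s \<theta>] by (simp add: G_def space_\<sigma>)
    qed (use \<alpha> in auto)
    also have "\<dots> = emeasure \<sigma> (space \<sigma>) * (\<integral>\<^sup>+s. ennreal (wgt \<alpha> (h s)) \<partial>lborel)"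
      by (simp add: nn_integral_multc nn_integral_cmult mult.commute)
    also have "\<dots> < \<infinity>"
    proof -
      have "emeasure \<sigma> (space \<sigma>) < \<top>" by (simp add: less_top[symmetric])
      then show ?thesis using hfin by (simp add: ennreal_mult_less_top)
    qed
    finally show "emeasure \<mu> (space \<mu>) \<noteq> \<infinity>" by simp
  qed
  have null: "emeasure \<mu> (space X \<times> {..0}) = 0"
  proof -
    have 0: "ennreal (wgt \<alpha> (norm (G z))) * indicator (space X \<times> {..0}) (u z, k z) = 0" for z
      using k[of z] by (auto simp: indicator_def)
    have "emeasure \<mu> (space X \<times> {..0}) = (\<integral>\<^sup>+z. indicator (space X \<times> {..0}) z \<partial>\<mu>)" by (simp add: sets\<mu>)
    also have "\<dots> = (\<integral>\<^sup>+z. ennreal (wgt \<alpha> (norm (G z))) * indicator (space X \<times> {..0}) (u z, k z) \<partial>base)"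
      by (rule nn\<mu>) measurable
    finally show ?thesis unfolding 0 by simp
  qed
  obtain K where K: "K \<in> X \<rightarrow>\<^sub>M prob_algebra borel" and Kpos: "\<And>\<xi>. \<xi> \<in> space X \<Longrightarrow> AE y in K \<xi>. 0 < y"
    and dis: "\<And>f. f \<in> borel_measurable (X \<Otimes>\<^sub>M borel) \<Longrightarrow> (\<integral>\<^sup>+z. f z \<partial>\<mu>) = (\<integral>\<^sup>+\<xi>. \<integral>\<^sup>+y. f (\<xi>, y) \<partial>K \<xi> \<partial>distr \<mu> X fst)"
    using disintegration_pos[OF fin sets\<mu> null] by blast
  have Ks: "K \<in> X \<rightarrow>\<^sub>M subprob_algebra borel" by (rule measurable_prob_algebraD[OF K])
  have sK: "sets (K \<xi>) = sets borel" and pK: "prob_space (K \<xi>)" if "\<xi> \<in> space X" for \<xi>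
    using measurable_space[OF K that] by (auto simp: space_prob_algebra)
  define \<sigma>' where "\<sigma>' = distr \<mu> X fst"
  have \<sigma>': "sphere_measure \<sigma>'"
  proof -
    interpret m: finite_measure \<mu> by (rule fin)
    have "fst \<in> \<mu> \<rightarrow>\<^sub>M X" by (subst measurable_cong_sets[OF sets\<mu> refl]) simp
    then show ?thesis unfolding sphere_measure_def \<sigma>'_def
      by (auto intro!: m.finite_measure_distr simp: X_def)
  qed
  have sp\<sigma>': "space \<sigma>' = space X" by (simp add: \<sigma>'_def)
  \<comment> \<open>The correction of the \<open>wgt\<close> weight, written as a function of the
    rate alone so that it can be absorbed into the measure of rates for each direction.\<close>
  define w where "w \<kappa> = max ((\<kappa> / lam) powr (2 - \<alpha>)) 1" for \<kappa>
  have [measurable]: "w \<in> borel_measurable borel" unfolding w_def[abs_def] by measurable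
  have w1: "1 \<le> w \<kappa>" for \<kappa> by (simp add: w_def)
  then have w0: "0 \<le> w \<kappa>" for \<kappa> by (rule order_trans[rotated]) simp
  define \<nu> where "\<nu> \<xi> = density (K \<xi>) (\<lambda>\<kappa>. ennreal (w \<kappa>))" for \<xi>
  have lap: "laplace_transform (\<nu> \<xi>)" if \<xi>: "\<xi> \<in> space X" for \<xi>
  proof
    note [measurable_cong] = sK[OF \<xi>]
    interpret K: prob_space "K \<xi>" by (rule pK[OF \<xi>])
    show "sets (\<nu> \<xi>) = sets borel" by (simp add: \<nu>_def sK[OF \<xi>])
    show "AE \<kappa> in \<nu> \<xi>. 0 < \<kappa>" unfolding \<nu>_def using Kpos[OF \<xi>] by (subst AE_density) auto
    have "(\<integral>\<^sup>+\<kappa>. 1 \<partial>K \<xi>) \<le> (\<integral>\<^sup>+\<kappa>. ennreal (w \<kappa>) \<partial>K \<xi>)" using w1 by (intro nn_integral_mono) simp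
    also have "\<dots> = emeasure (\<nu> \<xi>) (space (\<nu> \<xi>))"
      unfolding \<nu>_def by (subst emeasure_density) (auto intro!: nn_integral_cong)
    finally show "emeasure (\<nu> \<xi>) (space (\<nu> \<xi>)) \<noteq> 0" using K.emeasure_space_1 by auto
    fix r :: real assume r: "0 < r"
    have "integrable (K \<xi>) (\<lambda>\<kappa>. w \<kappa> * exp (- (\<kappa> * r)))"
    proof (rule K.integrable_const_bound)
      show "AE \<kappa> in K \<xi>. norm (w \<kappa> * exp (- (\<kappa> * r))) \<le> 1 + (2 * real 2 / r)\<^sup>2 / lam\<^sup>2"
        using Kpos[OF \<xi>]
      proof eventually_elim
        case (elim \<kappa>)
        have "w \<kappa> \<le> 1 + (\<kappa> / lam)\<^sup>2" unfolding w_def using elim lam \<alpha> by (intro max_powr_le) auto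
        then have "w \<kappa> * exp (- (\<kappa> * r)) \<le> (1 + (\<kappa> / lam)\<^sup>2) * exp (- (\<kappa> * r))" by (rule mult_right_mono) simp
        also have "\<dots> = exp (- (\<kappa> * r)) + \<kappa>\<^sup>2 * exp (- (\<kappa> * r)) / lam\<^sup>2" by (simp add: power_divide algebra_simps)
        also have "\<dots> \<le> 1 + (2 * real 2 / r)\<^sup>2 / lam\<^sup>2"
        proof (intro add_mono divide_right_mono)
          have "\<kappa>\<^sup>2 * exp (- (\<kappa> * r)) \<le> (2 * real 2 / r)\<^sup>2 * exp (- (\<kappa> * (r / 2)))" by (rule power_mult_exp_le[OF elim r])
          also have "\<dots> \<le> (2 * real 2 / r)\<^sup>2 * 1" using elim r by (intro mult_left_mono) auto
          finally show "\<kappa>\<^sup>2 * exp (- (\<kappa> * r)) \<le> (2 * real 2 / r)\<^sup>2" by simp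
        qed (use elim r in auto)
        finally show ?case using w0[of \<kappa>] by (simp add: abs_mult)
      qed
    qed measurable
    then show "integrable (\<nu> \<xi>) (\<lambda>\<kappa>. exp (- (\<kappa> * r)))"
      unfolding \<nu>_def using w0 by (subst integrable_density) auto
  qed
  \<comment> \<open>The factor \<open>\<kappa> ^ 0\<close> keeps the literal shape of the zeroth
    transform, to which the complete monotonicity results refer.\<close>
  define q where "q r \<xi> = (\<integral>\<kappa>. \<kappa> ^ 0 * exp (- (\<kappa> * r)) \<partial>\<nu> \<xi>)" for r \<xi>
  have q: "ennreal (q r \<xi>) = (\<integral>\<^sup>+\<kappa>. ennreal (w \<kappa> * exp (- (\<kappa> * r))) \<partial>K \<xi>)" if r: "0 < r" and \<xi>: "\<xi> \<in> space X" for r \<xi>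
  proof -
    note [measurable_cong] = sK[OF \<xi>]
    have "ennreal (q r \<xi>) = (\<integral>\<^sup>+\<kappa>. ennreal (exp (- (\<kappa> * r))) \<partial>\<nu> \<xi>)"
      unfolding q_def by (subst nn_integral_eq_integral[OF laplace_transform.integrable_exp[OF lap[OF \<xi>] r]]) auto
    also have "\<dots> = (\<integral>\<^sup>+\<kappa>. ennreal (w \<kappa>) * ennreal (exp (- (\<kappa> * r))) \<partial>K \<xi>)"
      unfolding \<nu>_def by (rule nn_integral_density) measurable
    finally show ?thesis using w0 by (simp add: ennreal_mult')
  qed
  \<comment> \<open>For positive r the integral equals a nonnegative one, which is jointly
    measurable because K is a kernel.\<close>
  have qm: "(\<lambda>(r, \<xi>). q r \<xi>) \<in> borel_measurable (restrict_space borel {0<..} \<Otimes>\<^sub>M restrict_space borel (sphere 0 1))"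
    unfolding X_def[symmetric]
  proof (subst measurable_cong)
    let ?R = "restrict_space borel {0<..} \<Otimes>\<^sub>M X :: (real \<times> 'b) measure"
    fix z assume "z \<in> space ?R"
    then have z: "0 < fst z" "snd z \<in> space X" by (auto simp: space_pair_measure space_restrict_space)
    have "0 \<le> q (fst z) (snd z)" unfolding q_def using laplace_transform.L_pos[OF lap[OF z(2)] z(1), of 0] by simp
    then show "(case z of (r, \<xi>) \<Rightarrow> q r \<xi>) = enn2real (\<integral>\<^sup>+\<kappa>. ennreal (w \<kappa> * exp (- (\<kappa> * fst z))) \<partial>K (snd z))"
      unfolding q[OF z, symmetric] by (simp add: split_beta)
  next
    let ?R = "restrict_space borel {0<..} \<Otimes>\<^sub>M X :: (real \<times> 'b) measure"
    have f: "fst \<in> borel_measurable ?R"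
      by (rule measurable_compose[OF measurable_fst]) (simp add: measurable_restrict_space1)
    have "(\<lambda>z. \<integral>\<^sup>+\<kappa>. ennreal (w \<kappa> * exp (- (\<kappa> * fst z))) \<partial>K (snd z)) \<in> borel_measurable ?R"
    proof (rule nn_integral_measurable_subprob_algebra2)
      show "(\<lambda>z. K (snd z)) \<in> ?R \<rightarrow>\<^sub>M subprob_algebra borel" by (rule measurable_compose[OF measurable_snd Ks])
      have [measurable]: "(\<lambda>x. fst (fst x)) \<in> borel_measurable (?R \<Otimes>\<^sub>M borel)" by (rule measurable_compose[OF measurable_fst f])
      show "(\<lambda>(z, \<kappa>). ennreal (w \<kappa> * exp (- (\<kappa> * fst z)))) \<in> borel_measurable (?R \<Otimes>\<^sub>M borel)"
        unfolding split_beta' by measurable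
    qed
    then show "(\<lambda>z. enn2real (\<integral>\<^sup>+\<kappa>. ennreal (w \<kappa> * exp (- (\<kappa> * fst z))) \<partial>K (snd z))) \<in> borel_measurable ?R" by simp
  qed
  have int: "(\<integral>\<^sup>+y. g y \<partial>polar_measure \<alpha> q \<sigma>') = (\<integral>\<^sup>+s. \<integral>\<^sup>+x. g (F s x) * indicator (- {0}) (F s x) \<partial>\<Phi> \<partial>lborel)"
    if g: "g \<in> borel_measurable borel" for g
  proof -
    \<comment> \<open>A polar measure does not see the origin, so g may be replaced by its
      restriction off 0; this removes the points where G vanishes.\<close>
    define g0 where "g0 y = g y * indicator (- {0}) y" for y
    have [measurable]: "g0 \<in> borel_measurable borel" using g unfolding g0_def[abs_def] by measurable
    define J where "J \<xi> \<kappa> = (\<integral>\<^sup>+r. ennreal (r powr (- \<alpha> - 1) * (w \<kappa> * exp (- (\<kappa> * r)))) * g0 (r *\<^sub>R \<xi>) * indicator {0<..} r \<partial>lborel)" for \<xi> :: 'b and \<kappa>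
    have Jm: "(\<lambda>z. J (fst z) (snd z)) \<in> borel_measurable (X \<Otimes>\<^sub>M borel)"
    proof -
      have [measurable]: "(\<lambda>x. fst (fst x)) \<in> borel_measurable ((X \<Otimes>\<^sub>M borel) \<Otimes>\<^sub>M lborel)"
        by (rule measurable_compose[OF measurable_fst measurable_compose[OF measurable_fst idX]])
      show ?thesis unfolding J_def by measurable
    qed
    have "(\<integral>\<^sup>+y. g y \<partial>polar_measure \<alpha> q \<sigma>') = (\<integral>\<^sup>+\<xi>. \<integral>\<^sup>+r. ennreal (r powr (- \<alpha> - 1) * q r \<xi>) * g (r *\<^sub>R \<xi>) * indicator {0<..} r \<partial>lborel \<partial>\<sigma>')"
      by (rule nn_integral_polar_measure[OF \<sigma>' qm g])
    also have "\<dots> = (\<integral>\<^sup>+\<xi>. \<integral>\<^sup>+\<kappa>. J \<xi> \<kappa> \<partial>K \<xi> \<partial>\<sigma>')"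
    proof (rule nn_integral_cong)
      fix \<xi> assume "\<xi> \<in> space \<sigma>'"
      then have \<xi>: "\<xi> \<in> space X" by (simp add: sp\<sigma>')
      note [measurable_cong] = sK[OF \<xi>]
      interpret K: prob_space "K \<xi>" by (rule pK[OF \<xi>])
      interpret Pr: pair_sigma_finite lborel "K \<xi>" ..
      have n\<xi>: "\<xi> \<noteq> 0" using \<xi> by (auto simp: spX)
      have "(\<integral>\<^sup>+r. ennreal (r powr (- \<alpha> - 1) * q r \<xi>) * g (r *\<^sub>R \<xi>) * indicator {0<..} r \<partial>lborel)
        = (\<integral>\<^sup>+r. \<integral>\<^sup>+\<kappa>. ennreal (r powr (- \<alpha> - 1) * (w \<kappa> * exp (- (\<kappa> * r)))) * g0 (r *\<^sub>R \<xi>) * indicator {0<..} r \<partial>K \<xi> \<partial>lborel)"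
      proof (rule nn_integral_cong)
        fix r :: real
        show "ennreal (r powr (- \<alpha> - 1) * q r \<xi>) * g (r *\<^sub>R \<xi>) * indicator {0<..} r
          = (\<integral>\<^sup>+\<kappa>. ennreal (r powr (- \<alpha> - 1) * (w \<kappa> * exp (- (\<kappa> * r)))) * g0 (r *\<^sub>R \<xi>) * indicator {0<..} r \<partial>K \<xi>)"
        proof (cases "0 < r")
          case True
          have "(\<integral>\<^sup>+\<kappa>. ennreal (r powr (- \<alpha> - 1) * (w \<kappa> * exp (- (\<kappa> * r)))) * (g0 (r *\<^sub>R \<xi>) * indicator {0<..} r) \<partial>K \<xi>)
            = (\<integral>\<^sup>+\<kappa>. ennreal (r powr (- \<alpha> - 1)) * ennreal (w \<kappa> * exp (- (\<kappa> * r))) \<partial>K \<xi>) * (g0 (r *\<^sub>R \<xi>) * indicator {0<..} r)"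
            by (subst nn_integral_multc) (simp_all add: ennreal_mult')
          also have "\<dots> = ennreal (r powr (- \<alpha> - 1)) * ennreal (q r \<xi>) * (g0 (r *\<^sub>R \<xi>) * indicator {0<..} r)"
            unfolding q[OF True \<xi>] by (subst nn_integral_cmult) simp_all
          also have "\<dots> = ennreal (r powr (- \<alpha> - 1) * q r \<xi>) * g (r *\<^sub>R \<xi>) * indicator {0<..} r"
            using True n\<xi> by (simp add: g0_def ennreal_mult' mult.assoc)
          finally show ?thesis by (simp only: mult.assoc)
        qed simp
      qed
      also have "\<dots> = (\<integral>\<^sup>+\<kappa>. \<integral>\<^sup>+r. ennreal (r powr (- \<alpha> - 1) * (w \<kappa> * exp (- (\<kappa> * r)))) * g0 (r *\<^sub>R \<xi>) * indicator {0<..} r \<partial>lborel \<partial>K \<xi>)"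
        by (rule Pr.Fubini'[symmetric]) (simp add: split_beta', measurable)
      finally show "(\<integral>\<^sup>+r. ennreal (r powr (- \<alpha> - 1) * q r \<xi>) * g (r *\<^sub>R \<xi>) * indicator {0<..} r \<partial>lborel) = (\<integral>\<^sup>+\<kappa>. J \<xi> \<kappa> \<partial>K \<xi>)"
        unfolding J_def .
    qed
    also have "\<dots> = (\<integral>\<^sup>+z. J (fst z) (snd z) \<partial>\<mu>)" unfolding \<sigma>'_def by (subst dis[OF Jm]) simp
    also have "\<dots> = (\<integral>\<^sup>+z. ennreal (wgt \<alpha> (norm (G z))) * J (u z) (k z) \<partial>base)" by (subst nn\<mu>[OF Jm]) simp
    also have "\<dots> = (\<integral>\<^sup>+z. \<integral>\<^sup>+t. ennreal (t powr (- \<alpha> - 1) * exp (- lam * t)) * g0 (t *\<^sub>R G z) * indicator {0<..} t \<partial>lborel \<partial>base)"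
    proof (rule nn_integral_cong)
      fix z
      show "ennreal (wgt \<alpha> (norm (G z))) * J (u z) (k z) = (\<integral>\<^sup>+t. ennreal (t powr (- \<alpha> - 1) * exp (- lam * t)) * g0 (t *\<^sub>R G z) * indicator {0<..} t \<partial>lborel)"
      proof (cases "G z = 0")
        case True
        then show ?thesis by (simp add: g0_def)
      next
        case False
        then have a: "0 < norm (G z)" by simp
        have kl: "k z / lam = 1 / norm (G z)" "k z = lam / norm (G z)" using False lam by (simp_all add: k_def)
        have sc: "(norm (G z) * t) *\<^sub>R u z = t *\<^sub>R G z" for t using False by (simp add: u_def)
        show ?thesis unfolding J_def w_def kl(1) unfolding kl(2)
          by (subst nn_integral_radial_scale[OF _ a, of "\<lambda>r. g0 (r *\<^sub>R u z)"]) (simp_all only: sc, measurable)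
      qed
    qed
    also have "\<dots> = (\<integral>\<^sup>+s. \<integral>\<^sup>+\<theta>. \<integral>\<^sup>+t. ennreal (t powr (- \<alpha> - 1) * exp (- lam * t)) * g0 (t *\<^sub>R G (s, \<theta>)) * indicator {0<..} t \<partial>lborel \<partial>\<sigma> \<partial>lborel)"
      by (rule base) measurable
    also have "\<dots> = (\<integral>\<^sup>+s. \<integral>\<^sup>+x. g0 (F s x) \<partial>\<Phi> \<partial>lborel)"
    proof (rule nn_integral_cong)
      fix s
      have "F s \<in> borel_measurable borel"
        using lin[of s] by (intro borel_measurable_continuous_onI linear_continuous_on) (simp add: linear_conv_bounded_linear)
      then have "(\<lambda>x. g0 (F s x)) \<in> borel_measurable borel" by measurable
      from nn_integral_\<Phi>[OF this] show "(\<integral>\<^sup>+\<theta>. \<integral>\<^sup>+t. ennreal (t powr (- \<alpha> - 1) * exp (- lam * t)) * g0 (t *\<^sub>R G (s, \<theta>)) * indicator {0<..} t \<partial>lborel \<partial>\<sigma>) = (\<integral>\<^sup>+x. g0 (F s x) \<partial>\<Phi>)"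
        by (simp add: G_def linear_scale[OF lin])
    qed
    finally show ?thesis unfolding g0_def .
  qed
  show ?thesis
  proof (intro exI[of _ q] exI[of _ \<sigma>'] conjI ballI allI impI)
    show "sphere_measure \<sigma>'" by (rule \<sigma>')
    show "(\<lambda>(r, \<xi>). q r \<xi>) \<in> borel_measurable (restrict_space borel {0<..} \<Otimes>\<^sub>M restrict_space borel (sphere 0 1))" by (rule qm)
  next
    fix \<xi> :: 'b and k and r :: real assume \<xi>: "\<xi> \<in> sphere 0 1" and r: "0 < r"
    have "laplace_transform (\<nu> \<xi>)" using \<xi> by (intro lap) (simp add: spX)
    from laplace_transform.completely_monotone[OF this r, of k]
    show "(deriv ^^ k) (\<lambda>r. q r \<xi>) differentiable (at r)" "0 < (- 1) ^ k * (deriv ^^ k) (\<lambda>r. q r \<xi>) r"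
      unfolding q_def by blast+
  next
    fix \<xi> :: 'b assume "\<xi> \<in> sphere 0 1"
    then have "laplace_transform (\<nu> \<xi>)" by (intro lap) (simp add: spX)
    from laplace_transform.tendsto_L_0[OF this] show "((\<lambda>r. q r \<xi>) \<longlongrightarrow> 0) at_top" unfolding q_def .
  qed (rule int)
qed

end

section \<open>Tempered stability of stochastic integrals\<close>

lemma borel_measurable_vec_lambda:
  fixes g :: "'k::finite \<Rightarrow> 'a \<Rightarrow> 'b::euclidean_space"
  assumes "\<And>j. g j \<in> borel_measurable M"
  shows "(\<lambda>x. \<chi> j. g j x) \<in> borel_measurable M"
proof (subst borel_measurable_euclidean_space, rule ballI)
  fix i :: "'b^'k" assume "i \<in> Basis"
  then obtain k b where i: "i = axis k b" by (auto simp: Basis_vec_def)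
  show "(\<lambda>x. (\<chi> j. g j x) \<bullet> i) \<in> borel_measurable M"
    unfolding i inner_axis using assms[of k] by simp
qed

lemma nn_integral_lborel_scale:
  fixes g :: "'a::euclidean_space \<Rightarrow> ennreal"
  assumes [measurable]: "g \<in> borel_measurable borel" and c: "0 < c"
  shows "(\<integral>\<^sup>+s. g s \<partial>lborel) = ennreal (c ^ DIM('a)) * (\<integral>\<^sup>+s. g (c *\<^sub>R s) \<partial>lborel)"
  using c by (subst lborel_affine[of c 0]) (simp_all add: nn_integral_density nn_integral_distr nn_integral_cmult)

lemma prod_char_fun:
  fixes \<nu> :: "'a::euclidean_space measure"
  assumes "prob_space \<nu>" and sets: "sets \<nu> = sets borel"
  shows "prob_space (distr (\<Pi>\<^sub>M i\<in>{..<m::nat}. \<nu>) borel (\<lambda>x. \<Sum>i<m. x i))"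
    and "char_fun (distr (\<Pi>\<^sub>M i\<in>{..<m}. \<nu>) borel (\<lambda>x. \<Sum>i<m. x i)) u = char_fun \<nu> u ^ m"
proof -
  interpret \<nu>: prob_space \<nu> by fact
  interpret Q: product_prob_space "\<lambda>_. \<nu>" "{..<m}" by unfold_locales

  have [measurable_cong]: "sets \<nu> = sets borel" by fact
  have m: "(\<lambda>x. \<Sum>i<m. x i) \<in> borel_measurable (\<Pi>\<^sub>M i\<in>{..<m}. \<nu>)"
  proof (rule borel_measurable_sum)
    fix i assume "i \<in> {..<m}"
    then have "(\<lambda>x. x i) \<in> (\<Pi>\<^sub>M i\<in>{..<m}. \<nu>) \<rightarrow>\<^sub>M \<nu>" by (rule measurable_component_singleton)
    then show "(\<lambda>x. x i) \<in> borel_measurable (\<Pi>\<^sub>M i\<in>{..<m}. \<nu>)"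
      by (subst measurable_cong_sets[OF refl sets[symmetric]])
  qed
  show "prob_space (distr (\<Pi>\<^sub>M i\<in>{..<m::nat}. \<nu>) borel (\<lambda>x. \<Sum>i<m. x i))"
    by (rule Q.prob_space_distr[OF m])
  have "char_fun (distr (\<Pi>\<^sub>M i\<in>{..<m}. \<nu>) borel (\<lambda>x. \<Sum>i<m. x i)) u
    = (\<integral>x. iexp (u \<bullet> (\<Sum>i<m. x i)) \<partial>(\<Pi>\<^sub>M i\<in>{..<m}. \<nu>))" by (rule char_fun_distr[OF m])
  also have "\<dots> = (\<integral>x. (\<Prod>i<m. iexp (u \<bullet> x i)) \<partial>(\<Pi>\<^sub>M i\<in>{..<m}. \<nu>))"
    by (simp add: inner_sum_right sum_distrib_left exp_sum)
  also have "\<dots> = (\<Prod>i<m. \<integral>x. iexp (u \<bullet> x) \<partial>\<nu>)"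
    by (rule Q.product_integral_prod) (auto intro!: \<nu>.integrable_iexp[of "\<lambda>x. x"])
  also have "\<dots> = char_fun \<nu> u ^ m" by (simp add: char_fun_def)
  finally show "char_fun (distr (\<Pi>\<^sub>M i\<in>{..<m}. \<nu>) borel (\<lambda>x. \<Sum>i<m. x i)) u = char_fun \<nu> u ^ m" .
qed

text \<open>A symmetric Levy measure has a real exponent, so no shift is needed.\<close>

lemma symmetric_levy_exponent:
  fixes L :: "'a::euclidean_space measure"
  assumes levy: "levy_measure L" and sym: "distr L borel uminus = L"
  shows "(\<integral>x. (iexp (u \<bullet> x) - 1 - \<i> * complex_of_real ((u \<bullet> x) * indicat_real (cball 0 1) x)) \<partial>L)
    = complex_of_real (- enn2real (\<integral>\<^sup>+x. ennreal (1 - cos (u \<bullet> x)) \<partial>L))"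
proof -
  have [measurable_cong]: "sets L = sets borel" using levy by (simp add: levy_measure_def)
  define z where "z x = iexp (u \<bullet> x) - 1 - \<i> * complex_of_real ((u \<bullet> x) * indicat_real (cball 0 1) x)" for x
  have [measurable]: "cball (0::'a) 1 \<in> sets borel" by simp
  have zm: "z \<in> borel_measurable borel" unfolding z_def[abs_def] by measurable
  have "integrable L (\<lambda>x. min 1 ((norm x)\<^sup>2))"
    using levy by (intro integrableI_bounded) (auto simp: levy_measure_def)
  \<comment> \<open>The summand 2 bounds the integrand outside the unit ball, where there is no
    compensator; (norm u)^2 bounds the second-order remainder inside.\<close>
  then have bint: "integrable L (\<lambda>x. (2 + (norm u)\<^sup>2) * min 1 ((norm x)\<^sup>2))" by simp
  have zint: "integrable L z"
  proof (rule Bochner_Integration.integrable_bound[OF bint])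
    show "z \<in> borel_measurable L" using zm by simp
    show "AE x in L. norm (z x) \<le> norm ((2 + (norm u)\<^sup>2) * min 1 ((norm x)\<^sup>2))"
    proof (rule AE_I2)
      fix x
      have "norm (z x) \<le> (2 + (norm u)\<^sup>2) * min 1 ((norm x)\<^sup>2)"
      proof (cases "norm x \<le> 1")
        case True
        have "norm (z x) = cmod (iexp (u \<bullet> x) - (\<Sum>k\<le>1. (\<i> * (u \<bullet> x)) ^ k / fact k))" using True by (simp add: z_def algebra_simps)
        also have "\<dots> \<le> \<bar>u \<bullet> x\<bar> ^ Suc 1 / fact (Suc 1)" by (rule iexp_approx1)
        also have "\<dots> = \<bar>u \<bullet> x\<bar>\<^sup>2 / 2" by (simp add: numeral_2_eq_2)
        also have "\<dots> \<le> \<bar>u \<bullet> x\<bar>\<^sup>2" by simp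
        also have "\<dots> \<le> (norm u * norm x)\<^sup>2" by (intro power_mono Cauchy_Schwarz_ineq2) simp
        also have "\<dots> \<le> (2 + (norm u)\<^sup>2) * (norm x)\<^sup>2" by (simp add: power_mult_distrib mult_right_mono)
        also have "(norm x)\<^sup>2 = min 1 ((norm x)\<^sup>2)" using True by (simp add: power_le_one)
        finally show ?thesis .
      next
        case False
        then have "z x = iexp (u \<bullet> x) - 1" by (simp add: z_def)
        also have "norm \<dots> \<le> norm (iexp (u \<bullet> x)) + norm (1::complex)" by (rule norm_triangle_ineq4)
        also have "\<dots> = 2" by simp
        also have "\<dots> \<le> (2 + (norm u)\<^sup>2) * 1" by simp
        also have "1 = min 1 ((norm x)\<^sup>2)" using False by simp
        finally show ?thesis by simp
      qed
      then show "norm (z x) \<le> norm ((2 + (norm u)\<^sup>2) * min 1 ((norm x)\<^sup>2))" unfolding real_norm_def by linarith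
    qed
  qed
  have zc: "z (- x) = cnj (z x)" for x by (simp add: z_def exp_cnj indicator_def)
  have "(\<integral>x. z x \<partial>L) = (\<integral>x. z x \<partial>distr L borel uminus)" unfolding sym ..
  also have "\<dots> = (\<integral>x. cnj (z x) \<partial>L)" using zm by (subst integral_distr) (simp_all add: zc)
  also have "\<dots> = cnj (\<integral>x. z x \<partial>L)" by simp
  \<comment> \<open>By symmetry of L the integral equals its own conjugate.\<close>
  finally have im: "Im (\<integral>x. z x \<partial>L) = 0" by (metis complex_cnj_cancel_iff complex_In_mult_cnj_zero cnj.simps(2) equal_neg_zero)
  have "Re (z x) = - (1 - cos (u \<bullet> x))" for x by (simp add: z_def Re_exp)
  then have "Re (\<integral>x. z x \<partial>L) = - (\<integral>x. 1 - cos (u \<bullet> x) \<partial>L)"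
    by (subst integral_Re[OF zint, symmetric]) (simp del: minus_diff_eq)
  also have "(\<integral>x. 1 - cos (u \<bullet> x) \<partial>L) = enn2real (\<integral>\<^sup>+x. ennreal (1 - cos (u \<bullet> x)) \<partial>L)"
    by (rule integral_eq_nn_integral) auto
  finally show ?thesis unfolding z_def[symmetric] using im by (simp add: complex_eq_iff)
qed

context tempered_levy
begin

text \<open>Reflection acts on the direction only, so symmetry of \<sigma> suffices. It makes the
  image Levy measures symmetric, and hence their laws need no shift.\<close>

lemma nn_integral_\<Phi>_uminus:
  assumes [measurable]: "f \<in> borel_measurable borel"
  shows "(\<integral>\<^sup>+x. f (- x) \<partial>\<Phi>) = (\<integral>\<^sup>+x. f x \<partial>\<Phi>)"
proof -
  define R where "R \<theta> = (\<integral>\<^sup>+r. ennreal (r powr (- \<alpha> - 1) * exp (- lam * r)) * f (r *\<^sub>R \<theta>) * indicator {0<..} r \<partial>lborel)" for \<theta>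
  have Rm: "R \<in> borel_measurable borel" unfolding R_def[abs_def] by measurable
  have id\<sigma>: "(\<lambda>x. x) \<in> \<sigma> \<rightarrow>\<^sub>M borel"
    using measurable_restrict_space1[of "\<lambda>x. x" borel borel "sphere 0 1"] by (subst measurable_cong_sets[OF sets_\<sigma> refl]) simp
  have R\<sigma>: "R \<in> borel_measurable \<sigma>" using measurable_compose[OF id\<sigma> Rm] by simp
  have um: "uminus \<in> \<sigma> \<rightarrow>\<^sub>M \<sigma>"
  proof -
    have "uminus \<in> \<sigma> \<rightarrow>\<^sub>M restrict_space borel (sphere 0 1)"
      by (rule measurable_restrict_space2) (auto simp: space_\<sigma> intro: borel_measurable_uminus id\<sigma>)
    then show ?thesis by (subst measurable_cong_sets[OF refl sets_\<sigma>])
  qed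
  have "(\<integral>\<^sup>+x. f (- x) \<partial>\<Phi>) = (\<integral>\<^sup>+\<theta>. R (- \<theta>) \<partial>\<sigma>)"
    by (subst nn_integral_\<Phi>) (simp_all add: R_def)
  also have "\<dots> = (\<integral>\<^sup>+\<theta>. R \<theta> \<partial>distr \<sigma> \<sigma> uminus)" using nn_integral_distr[OF um, of R] R\<sigma> by simp
  also have "\<dots> = (\<integral>\<^sup>+x. f x \<partial>\<Phi>)" unfolding sym by (subst nn_integral_\<Phi>) (simp_all add: R_def[abs_def])
  finally show ?thesis .
qed

lemma integral_\<psi>_eq: "v \<in> borel_measurable borel \<Longrightarrow> (\<integral>s. \<psi> (v s) \<partial>lborel) = - enn2real (\<integral>\<^sup>+s. ennreal (- \<psi> (v s)) \<partial>lborel)"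
  using integral_eq_nn_integral[of "\<lambda>s. - \<psi> (v s)" lborel] \<psi>_nonpos by simp

lemma norm_sum_wgt_finite:
  fixes f :: "'k \<Rightarrow> real^'n \<Rightarrow> real^'d^'e"
  assumes "finite J" "\<And>j. j \<in> J \<Longrightarrow> f j \<in> borel_measurable borel" "\<And>j. j \<in> J \<Longrightarrow> wint (f j) < \<infinity>"
  shows "(\<integral>\<^sup>+s. ennreal (wgt \<alpha> (\<Sum>j\<in>J. norm (f j s))) \<partial>lborel) < \<infinity>"
  using assms
proof (induction J)
  case (insert i J)
  note [measurable] = insert.prems(1)
  have "(\<integral>\<^sup>+s. ennreal (wgt \<alpha> (\<Sum>j\<in>insert i J. norm (f j s))) \<partial>lborel)
    \<le> (\<integral>\<^sup>+s. 4 * (ennreal (wgt \<alpha> (norm (f i s))) + ennreal (wgt \<alpha> (\<Sum>j\<in>J. norm (f j s)))) \<partial>lborel)"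
  proof (rule nn_integral_mono)
    fix s
    have "wgt \<alpha> (\<Sum>j\<in>insert i J. norm (f j s)) \<le> 4 * (wgt \<alpha> (norm (f i s)) + wgt \<alpha> (\<Sum>j\<in>J. norm (f j s)))"
      using insert.hyps wgt_add_le[OF \<alpha>', of "norm (f i s)" "\<Sum>j\<in>J. norm (f j s)"] by (simp add: sum_nonneg)
    from ennreal_leI[OF this] show "ennreal (wgt \<alpha> (\<Sum>j\<in>insert i J. norm (f j s))) \<le> 4 * (ennreal (wgt \<alpha> (norm (f i s))) + ennreal (wgt \<alpha> (\<Sum>j\<in>J. norm (f j s))))"
      by (simp add: ennreal_mult' ennreal_plus del: ennreal_plus[symmetric])
  qed
  also have "\<dots> = 4 * (wint (f i) + (\<integral>\<^sup>+s. ennreal (wgt \<alpha> (\<Sum>j\<in>J. norm (f j s))) \<partial>lborel))"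
    unfolding wint_def using insert.prems(1)
    by (subst nn_integral_cmult, measurable, subst nn_integral_add) (auto intro!: measurable_compose[OF _ borel_measurable_wgt] measurable_compose[OF _ measurable_ennreal] borel_measurable_sum borel_measurable_norm)
  also have "\<dots> < \<infinity>" using insert by (simp add: ennreal_mult_less_top)
  finally show ?case .
qed simp

end

context tempered_random_measure
begin

text \<open>The stacked map F s x collects all f j s applied to x, so one polar representation
  serves the whole vector. Convolution roots are again laws of integrals against the same M, with
  dilated integrands, and uniqueness of characteristic functions identifies their convolution power
  with the given law.\<close>

theorem tempered_stable_integrals:
  fixes f :: "'k::finite \<Rightarrow> real^'n \<Rightarrow> real^'d^'d"
  assumes f[measurable]: "\<And>j. f j \<in> borel_measurable borel" and w: "\<And>j. wint (f j) < \<infinity>" and Y: "\<And>j. has_stoch_integral P M (f j) (Y j)"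
  shows "tempered_stable \<alpha> (distr P borel (\<lambda>\<omega>. \<chi> j. Y j \<omega>))"
proof -
  define F where "F s x = (\<chi> j. f j s *v x)" for s x
  define h where "h s = (\<Sum>j\<in>UNIV. norm (f j s))" for s
  define v where "v U s = (\<Sum>j\<in>UNIV. transpose (f j s) *v (U $ j))" for U :: "(real^'d)^'k" and s
  have [measurable]: "h \<in> borel_measurable borel" unfolding h_def[abs_def] by measurable
  have vm[measurable]: "v U \<in> borel_measurable borel" for U unfolding v_def[abs_def] by measurable
  have Fm: "(\<lambda>z. F (fst z) (snd z)) \<in> borel_measurable (borel \<Otimes>\<^sub>M borel)"
    unfolding F_def by (intro borel_measurable_vec_lambda) measurable
  have lin: "linear (F s)" for s
    by (rule linearI) (simp_all add: F_def vec_eq_iff matrix_vector_right_distrib matrix_vector_mult_scaleR)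
  have Fb: "norm (F s x) \<le> h s * norm x" for s x
  proof -
    have "norm (F s x) \<le> (\<Sum>j\<in>UNIV. norm (F s x $ j))" unfolding norm_vec_def by (rule L2_set_le_sum) simp
    also have "\<dots> \<le> (\<Sum>j\<in>UNIV. norm (f j s) * norm x)" unfolding F_def by (intro sum_mono) (simp add: norm_matrix_vector_mult_le)
    finally show ?thesis by (simp add: h_def sum_distrib_right)
  qed
  have hfin: "(\<integral>\<^sup>+s. ennreal (wgt \<alpha> (h s)) \<partial>lborel) < \<infinity>" unfolding h_def by (rule norm_sum_wgt_finite) (use w in auto)
  obtain q \<sigma>' where \<sigma>': "sphere_measure \<sigma>'"
    and qm: "(\<lambda>(r, \<xi>). q r \<xi>) \<in> borel_measurable (restrict_space borel {0<..} \<Otimes>\<^sub>M restrict_space borel (sphere 0 1))"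
    and qcm: "\<forall>\<xi>\<in>sphere 0 1. (\<forall>k. \<forall>r>0. (deriv ^^ k) (\<lambda>r. q r \<xi>) differentiable (at r) \<and>
       0 < (- 1) ^ k * (deriv ^^ k) (\<lambda>r. q r \<xi>) r) \<and> ((\<lambda>r. q r \<xi>) \<longlongrightarrow> 0) at_top"
    and int: "\<And>g. g \<in> borel_measurable borel \<Longrightarrow> (\<integral>\<^sup>+y. g y \<partial>polar_measure \<alpha> q \<sigma>') = (\<integral>\<^sup>+s. \<integral>\<^sup>+x. g (F s x) * indicator (- {0}) (F s x) \<partial>\<Phi> \<partial>lborel)"
    using ex_polar_levy[OF Fm lin _ Fb hfin] by (auto simp del: mem_sphere_0)
  define L where "L = polar_measure \<alpha> q \<sigma>'"
  have setsL[measurable_cong, simp]: "sets L = sets borel" by (simp add: L_def polar_measure_def)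
  have [measurable]: "F s \<in> borel_measurable borel" for s
    using lin[of s] by (intro borel_measurable_continuous_onI linear_continuous_on) (simp add: linear_conv_bounded_linear)
  \<comment> \<open>A function that vanishes at 0 does not notice the removal of the origin.\<close>
  have intL: "(\<integral>\<^sup>+y. g y \<partial>L) = (\<integral>\<^sup>+s. \<integral>\<^sup>+x. g (F s x) \<partial>\<Phi> \<partial>lborel)" if "g \<in> borel_measurable borel" "g 0 = 0" for g
  proof -
    have "g y * indicator (- {0}) y = g y" for y using that(2) by (cases "y = 0") auto
    then show ?thesis unfolding L_def int[OF that(1)] by simp
  qed
  have levy: "levy_measure L"
    unfolding levy_measure_def
  proof (intro conjI)
    have 0: "indicator {0} y * indicator (- {0}) y = (0 :: ennreal)" for y :: "(real^'d)^'k" by (simp add: indicator_def)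
    have "emeasure L {0} = (\<integral>\<^sup>+y. indicator {0} y \<partial>L)" by simp
    also have "\<dots> = (\<integral>\<^sup>+s. \<integral>\<^sup>+x. indicator {0} (F s x) * indicator (- {0}) (F s x) \<partial>\<Phi> \<partial>lborel)"
      unfolding L_def by (rule int) measurable
    finally show "emeasure L {0} = 0" unfolding 0 by simp
    have "(\<integral>\<^sup>+y. ennreal (min 1 ((norm y)\<^sup>2)) \<partial>L) = (\<integral>\<^sup>+s. \<integral>\<^sup>+x. ennreal (min 1 ((norm (F s x))\<^sup>2)) \<partial>\<Phi> \<partial>lborel)"
      by (rule intL) auto
    also have "\<dots> \<le> (\<integral>\<^sup>+s. ennreal (C\<Phi> * wgt \<alpha> (h s)) \<partial>lborel)"
    proof (rule nn_integral_mono)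
      fix s
      have "(\<integral>\<^sup>+x. ennreal (min 1 ((norm (F s x))\<^sup>2)) \<partial>\<Phi>) \<le> (\<integral>\<^sup>+x. ennreal (min 1 ((h s)\<^sup>2 * (norm x)\<^sup>2)) \<partial>\<Phi>)"
        using power_mono[OF Fb, of _ _ 2] by (intro nn_integral_mono ennreal_leI min.mono) (auto simp: power_mult_distrib)
      also have "\<dots> \<le> ennreal (C\<Phi> * wgt \<alpha> (h s))" by (rule C\<Phi>(2)) (simp add: h_def sum_nonneg)
      finally show "(\<integral>\<^sup>+x. ennreal (min 1 ((norm (F s x))\<^sup>2)) \<partial>\<Phi>) \<le> ennreal (C\<Phi> * wgt \<alpha> (h s))" .
    qed
    also have "\<dots> = ennreal C\<Phi> * (\<integral>\<^sup>+s. ennreal (wgt \<alpha> (h s)) \<partial>lborel)"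
      using C\<Phi>(1) by (subst nn_integral_cmult[symmetric]) (auto simp: ennreal_mult')
    also have "\<dots> < \<infinity>" using hfin by (simp add: ennreal_mult_less_top)
    finally show "(\<integral>\<^sup>+y. ennreal (min 1 ((norm y)\<^sup>2)) \<partial>L) < \<infinity>" .
  qed simp
  have sym: "distr L borel uminus = L"
  proof (rule measure_eqI)
    fix A assume "A \<in> sets (distr L borel uminus)"
    then have A[measurable]: "A \<in> sets borel" by simp
    let ?g = "\<lambda>y. indicator A y * indicator (- {0}) y :: ennreal"
    have A0: "emeasure N A = (\<integral>\<^sup>+y. ?g y \<partial>N)" if [measurable_cong]: "sets N = sets borel" and 0: "emeasure N {0} = 0" for N :: "((real^'d)^'k) measure"
    proof -
      have "emeasure N A = (\<integral>\<^sup>+y. indicator A y \<partial>N)" by (simp add: that)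
      also have "\<dots> = (\<integral>\<^sup>+y. ?g y \<partial>N)"
        by (intro nn_integral_cong_AE AE_I[of _ _ "{0}"]) (auto simp: that 0 split: split_indicator_asm)
      finally show ?thesis .
    qed
    have 0: "emeasure L {0} = 0" using levy by (simp add: levy_measure_def)
    have "emeasure (distr L borel uminus) {0} = 0"
    proof -
      have "uminus -` {0} \<inter> space L = {0 :: (real^'d)^'k}" using sets_eq_imp_space_eq[OF setsL] by auto
      then show ?thesis using 0 by (subst emeasure_distr) auto
    qed
    then have "emeasure (distr L borel uminus) A = (\<integral>\<^sup>+y. ?g y \<partial>distr L borel uminus)" by (intro A0) simp_all
    also have "\<dots> = (\<integral>\<^sup>+y. ?g (- y) \<partial>L)" by (rule nn_integral_distr) measurable
    also have "\<dots> = (\<integral>\<^sup>+s. \<integral>\<^sup>+x. ?g (- F s x) \<partial>\<Phi> \<partial>lborel)" by (rule intL) auto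
    also have "\<dots> = (\<integral>\<^sup>+s. \<integral>\<^sup>+x. ?g (F s (- x)) \<partial>\<Phi> \<partial>lborel)" by (simp only: linear_neg[OF lin])
    also have "\<dots> = (\<integral>\<^sup>+s. \<integral>\<^sup>+x. ?g (F s x) \<partial>\<Phi> \<partial>lborel)"
      by (intro nn_integral_cong nn_integral_\<Phi>_uminus) measurable
    also have "\<dots> = (\<integral>\<^sup>+y. ?g y \<partial>L)" by (rule intL[symmetric]) auto
    also have "\<dots> = emeasure L A" by (rule A0[symmetric]) (simp_all add: 0)
    finally show "emeasure (distr L borel uminus) A = emeasure L A" .
  qed simp
  have vF: "U \<bullet> F s x = v U s \<bullet> x" for U s x
    unfolding F_def v_def inner_vec_def[of U] by (simp add: inner_sum_left dot_lmul_matrix[symmetric] transpose_matrix_vector)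
  have expo: "(\<integral>s. \<psi> (v U s) \<partial>lborel) = - enn2real (\<integral>\<^sup>+y. ennreal (1 - cos (U \<bullet> y)) \<partial>L)" for U
    unfolding integral_\<psi>_eq[OF vm] ennreal_minus_\<psi> by (subst intL) (simp_all add: vF)
  have Ym: "Y j \<in> borel_measurable P" for j using Y[of j] by (simp add: has_stoch_integral_def)
  have YM: "(\<lambda>\<omega>. \<chi> j. Y j \<omega>) \<in> borel_measurable P" by (intro borel_measurable_vec_lambda Ym)
  define \<mu> where "\<mu> = distr P borel (\<lambda>\<omega>. \<chi> j. Y j \<omega>)"
  have cf: "char_fun \<mu> U = complex_of_real (exp (\<integral>s. \<psi> (v U s) \<partial>lborel))" for U
    unfolding \<mu>_def char_fun_distr[OF YM] v_def by (rule joint_cf[OF f w Y])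
  have p\<mu>: "prob_space \<mu>" unfolding \<mu>_def by (rule prob_space_distr[OF YM])
  have "infinitely_divisible \<mu>"
    unfolding infinitely_divisible_def
  proof (intro conjI allI impI p\<mu>)
    show "sets \<mu> = sets borel" by (simp add: \<mu>_def)
    fix m :: nat assume m: "1 \<le> m"
    \<comment> \<open>Dilation by c in dimension n multiplies volumes by c^n = m, so the dilated
      integrands have the m-th part of the exponent.\<close>
    define c where "c = root (CARD('n)) (real m)"
    have c: "0 < c" "c ^ CARD('n) = real m" using m by (simp_all add: c_def)
    have scale: "(\<integral>\<^sup>+s. g s \<partial>lborel) = ennreal (real m) * (\<integral>\<^sup>+s. g (c *\<^sub>R s) \<partial>lborel)" if "g \<in> borel_measurable borel" for g :: "real^'n \<Rightarrow> ennreal"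
      using nn_integral_lborel_scale[OF that c(1)] by (simp add: c(2))
    define f' where "f' j s = f j (c *\<^sub>R s)" for j s
    have [measurable]: "f' j \<in> borel_measurable borel" for j unfolding f'_def[abs_def] by measurable
    have "wint (f j) = ennreal (real m) * wint (f' j)" for j
      unfolding wint_def f'_def by (rule scale) measurable
    then have w': "wint (f' j) < \<infinity>" for j
      using w[of j] m by (auto simp: ennreal_mult_less_top)
    have "\<exists>Z. has_stoch_integral P M (f' j) Z" for j by (rule ex_has_stoch_integral) (use w' in auto)
    then obtain Z where Z: "\<And>j. has_stoch_integral P M (f' j) (Z j)" by metis
    then have Zm: "Z j \<in> borel_measurable P" for j by (simp add: has_stoch_integral_def)
    have ZM: "(\<lambda>\<omega>. \<chi> j. Z j \<omega>) \<in> borel_measurable P" by (intro borel_measurable_vec_lambda Zm)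
    define \<nu> where "\<nu> = distr P borel (\<lambda>\<omega>. \<chi> j. Z j \<omega>)"
    have p\<nu>: "prob_space \<nu>" unfolding \<nu>_def by (rule prob_space_distr[OF ZM])
    have s\<nu>: "sets \<nu> = sets borel" by (simp add: \<nu>_def)
    have cf': "char_fun \<nu> U = complex_of_real (exp (\<integral>s. \<psi> (v U (c *\<^sub>R s)) \<partial>lborel))" for U
      unfolding \<nu>_def char_fun_distr[OF ZM] v_def f'_def[symmetric] by (rule joint_cf) (use w' Z in auto)
    have sc\<psi>: "(\<integral>s. \<psi> (v U s) \<partial>lborel) = real m * (\<integral>s. \<psi> (v U (c *\<^sub>R s)) \<partial>lborel)" for U
    proof -
      have "(\<lambda>s. v U (c *\<^sub>R s)) \<in> borel_measurable borel" by measurable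
      note * = integral_\<psi>_eq[OF this]
      show ?thesis unfolding integral_\<psi>_eq[OF vm] *
        by (subst scale) (simp_all add: enn2real_mult)
    qed
    have "\<mu> = distr (\<Pi>\<^sub>M i\<in>{..<m}. \<nu>) borel (\<lambda>x. \<Sum>i<m. x i)"
    proof (rule char_fun_unique)
      show "char_fun \<mu> U = char_fun (distr (\<Pi>\<^sub>M i\<in>{..<m}. \<nu>) borel (\<lambda>x. \<Sum>i<m. x i)) U" for U
        unfolding prod_char_fun(2)[OF p\<nu> s\<nu>] cf cf' sc\<psi> exp_of_nat_mult by simp
    qed (use p\<mu> prod_char_fun(1)[OF p\<nu> s\<nu>] in \<open>simp_all add: \<mu>_def\<close>)
    then show "\<exists>\<nu>. prob_space \<nu> \<and> sets \<nu> = sets borel \<and> \<mu> = distr (\<Pi>\<^sub>M i\<in>{..<m}. \<nu>) borel (\<lambda>x. \<Sum>i<m. x i)"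
      using p\<nu> s\<nu> by blast
  qed
  moreover have "char_fun \<mu> U = exp (\<i> * complex_of_real (U \<bullet> 0) +
     (\<integral>x. (iexp (U \<bullet> x) - 1 - \<i> * complex_of_real ((U \<bullet> x) * indicat_real (cball 0 1) x)) \<partial>L))" for U
    unfolding symmetric_levy_exponent[OF levy sym] cf expo by (simp add: exp_of_real[symmetric])
  ultimately have "inf_div_no_gauss \<mu> 0 L" using levy unfolding inf_div_no_gauss_def by blast
  then show ?thesis unfolding tempered_stable_def \<mu>_def[symmetric]
    using \<sigma>' qm qcm unfolding L_def by blast
qed

end

section \<open>Fullness and stationarity\<close>

text \<open>By continuity a nonzero value would persist on a nonempty open set, which is not
  negligible.\<close>

lemma AE_lborel_zero_imp_zero:
  fixes f :: "'a::euclidean_space \<Rightarrow> 'b::real_normed_vector"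
  assumes ae: "AE x in lborel. f x = 0" and S: "open S" and cont: "continuous_on S f" and x: "x \<in> S"
  shows "f x = 0"
proof (rule ccontr)
  assume "f x \<noteq> 0"
  let ?U = "S \<inter> f -` (- {0})"
  have U: "open ?U" by (intro continuous_open_preimage cont S) auto
  have "x \<in> ?U" using x \<open>f x \<noteq> 0\<close> by simp
  then have "\<not> negligible ?U" using open_not_negligible[OF U] by blast
  moreover have "AE x in lborel. x \<notin> ?U" using ae by eventually_elim simp
  then have "?U \<in> null_sets lborel" using U by (subst AE_iff_null_sets) auto
  then have "negligible ?U" by (simp add: negligible_iff_null_sets null_sets_completionI)
  ultimately show False by blast
qed

text \<open>B and its transpose are singular together, as their determinants agree, and a real
  kernel vector of B is a complex eigenvector for 0.\<close>

lemma zero_eigenvalue: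
  fixes B :: "real^'d^'d"
  assumes "transpose B *v w = 0" "w \<noteq> 0"
  shows "0 \<in> complex_eigenvalues B"
proof -
  have "\<not> invertible (transpose B)"
  proof
    assume "invertible (transpose B)"
    then obtain C where "C ** transpose B = mat 1" unfolding invertible_def by blast
    then show False using assms matrix_left_invertible_ker[of "transpose B"] by blast
  qed
  then have "\<not> invertible B" by (simp add: invertible_det_nz)
  then obtain x where x: "x \<noteq> 0" "B *v x = 0"
    using matrix_left_invertible_ker[of B] invertible_left_inverse[of B] by blast
  define v :: "complex^'d" where "v = (\<chi> i. of_real (x $ i))"
  have "map_matrix complex_of_real B *v v = 0"
  proof -
    have "(map_matrix complex_of_real B *v v) $ i = of_real ((B *v x) $ i)" for i
      by (simp add: matrix_vector_mult_def v_def map_matrix_def)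
    then show ?thesis using x(2) by (simp add: vec_eq_iff)
  qed
  moreover have "v \<noteq> 0" using x(1) by (simp add: v_def vec_eq_iff)
  ultimately show ?thesis unfolding complex_eigenvalues_def by (auto intro!: exI[of _ v])
qed

text \<open>With c = exp t the orbit of w is constant; its derivative at t = 0 is the transpose of B
  applied to w.\<close>

lemma scalar_mpow_fixed_imp_kernel:
  fixes B :: "real^'d^'d"
  assumes inv: "\<And>c. 0 < c \<Longrightarrow> transpose (scalar_mpow c B) *v w = w"
  shows "transpose B *v w = 0"
proof -
  have bl: "bounded_linear (\<lambda>A :: real^'d^'d. transpose A *v w)"
    by (rule bounded_linear_compose[OF bounded_bilinear.bounded_linear_left[OF bounded_bilinear_matrix_vector_mult] bounded_linear_transpose])
  have "transpose (mat_exp (t *\<^sub>R B)) *v w = w" for t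
    using inv[of "exp t"] by (simp add: scalar_mpow_def)
  moreover have "((\<lambda>t. transpose (mat_exp (t *\<^sub>R B)) *v w) has_vector_derivative transpose (B ** mat_exp (0 *\<^sub>R B)) *v w) (at 0)"
    by (rule bounded_linear.has_vector_derivative[OF bl mat_exp_has_vector_derivative])
  ultimately have "((\<lambda>t. w) has_vector_derivative transpose B *v w) (at (0::real))" by simp
  then show ?thesis using vector_derivative_unique_at[OF _ has_vector_derivative_const] by blast
qed

lemma transpose_matrix_vector_diff: "transpose (A - B) *v u = transpose A *v u - transpose B *v (u :: real^'d)" for A B :: "real^'e^'d"
proof -
  have "transpose (A - B) = transpose A - transpose B" by (simp add: transpose_def vec_eq_iff)
  then show ?thesis by (simp only: matrix_vector_mult_diff_rdistrib)
qed

context admissible_kernel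
begin

lemma ma_kernel_kernel_trivial:
  assumes ae: "AE s in lborel. transpose (ma_kernel \<phi> B t s) *v u = 0" and t: "t \<noteq> 0" and eig: "0 \<notin> complex_eigenvalues B"
  shows "u = 0"
proof -
  define R where "R c = transpose (scalar_mpow c B) *v u" for c
  \<comment> \<open>The limit at 0 is known beforehand: away from 0 and -t, R (\<phi> x) equals R
    (\<phi> (t + x)), which is continuous at x = 0.\<close>
  define w where "w = R (\<phi> t)"
  have bl: "bounded_linear (\<lambda>A :: real^'d^'d. transpose A *v u)"
    by (rule bounded_linear_compose[OF bounded_bilinear.bounded_linear_left[OF bounded_bilinear_matrix_vector_mult] bounded_linear_transpose])
  have contR: "continuous_on {0<..} R"
    unfolding R_def[abs_def] by (rule bounded_linear.continuous_on[OF bl continuous_on_scalar_mpow])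
  have R\<phi>: "continuous_on S (\<lambda>s. R (\<phi> (g s)))" if "continuous_on S g" "\<And>s. s \<in> S \<Longrightarrow> g s \<noteq> 0" for g :: "real^'n \<Rightarrow> real^'n" and S
    by (rule continuous_on_compose2[OF contR continuous_on_compose2[OF continuous_\<phi>[of UNIV] that(1)]]) (use that(2) \<phi>_pos in auto)
  have eq: "transpose (ma_kernel \<phi> B t s) *v u = R (\<phi> (t - s)) - R (\<phi> (- s))" for s
    by (simp only: ma_kernel_def R_def transpose_matrix_vector_diff)
  \<comment> \<open>Continuity off the two singular points upgrades almost everywhere to
    everywhere.\<close>
  have same: "R (\<phi> (t - s)) - R (\<phi> (- s)) = 0" if "s \<noteq> 0" "s \<noteq> t" for s
  proof (rule AE_lborel_zero_imp_zero[where f = "\<lambda>s. R (\<phi> (t - s)) - R (\<phi> (- s))" and S = "- {0, t}"])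
    show "AE s in lborel. R (\<phi> (t - s)) - R (\<phi> (- s)) = 0" using ae unfolding eq .
    show "continuous_on (- {0, t}) (\<lambda>s. R (\<phi> (t - s)) - R (\<phi> (- s)))"
      by (intro continuous_on_diff R\<phi> continuous_intros) auto
  qed (use that in \<open>auto intro: open_Compl finite_imp_closed\<close>)
  have lim: "((\<lambda>x. R (\<phi> x)) \<longlongrightarrow> w) (at 0)"
  proof (rule Lim_transform_eventually)
    have "isCont (\<lambda>x. R (\<phi> (t + x))) 0"
    proof (rule continuous_on_interior[of "- {- t}"])
      show "continuous_on (- {- t}) (\<lambda>x. R (\<phi> (t + x)))"
        by (rule R\<phi>) (auto intro!: continuous_intros simp: add_eq_0_iff)
      show "0 \<in> interior (- {- t})" using t by (subst interior_open) auto
    qed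
    then show "((\<lambda>x. R (\<phi> (t + x))) \<longlongrightarrow> w) (at 0)" by (simp add: isCont_def w_def)
    have "eventually (\<lambda>x. x \<noteq> - t) (at 0)"
      using t by (intro eventually_neq_at_within)
    then show "eventually (\<lambda>x. R (\<phi> (t + x)) = R (\<phi> x)) (at 0)"
      using eventually_neq_at_within[of 0 0 UNIV]
    proof eventually_elim
      case (elim x)
      then have "- x \<noteq> t" by (metis minus_minus)
      then show ?case using same[of "- x"] elim by simp
    qed
  qed
  have inv: "transpose (scalar_mpow c B) *v w = w" if c: "0 < c" for c
  proof (rule tendsto_unique[OF trivial_limit_at])
    have nz: "pw c *v x \<noteq> 0" if "x \<noteq> 0" for x
    proof
      assume "pw c *v x = 0"
      then have "(pw (1 / c) ** pw c) *v x = 0" by (simp add: matrix_vector_mul_assoc[symmetric])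
      then show False using that scalar_mpow_inverse_left[OF c, of E] by simp
    qed
    have "((\<lambda>x. pw c *v x) \<longlongrightarrow> pw c *v 0) (at 0)"
      by (intro bounded_linear.tendsto[OF matrix_vector_mul_bounded_linear] tendsto_ident_at)
    then have "filterlim (\<lambda>x. pw c *v x) (at 0) (at 0)"
      unfolding filterlim_at using nz by (auto simp: eventually_at_filter)
    from filterlim_compose[OF lim this] have limc: "((\<lambda>x. R (\<phi> (pw c *v x))) \<longlongrightarrow> w) (at 0)" .
    have Rc: "R (\<phi> (pw c *v x)) = transpose (scalar_mpow c B) *v R (\<phi> x)" if "x \<noteq> 0" for x
    proof -
      have "scalar_mpow (c * \<phi> x) B = scalar_mpow (\<phi> x) B ** scalar_mpow c B"
        using scalar_mpow_mult[OF \<phi>_pos[OF that] c] by (simp add: mult.commute)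
      then show ?thesis unfolding R_def \<phi>_scale[OF c that] by (simp only: matrix_transpose_mul matrix_vector_mul_assoc)
    qed
    show "((\<lambda>x. transpose (scalar_mpow c B) *v R (\<phi> x)) \<longlongrightarrow> w) (at 0)"
    proof (rule Lim_transform_eventually[OF limc])
      show "eventually (\<lambda>x. R (\<phi> (pw c *v x)) = transpose (scalar_mpow c B) *v R (\<phi> x)) (at 0)"
        using eventually_neq_at_within[of 0 0 UNIV] by eventually_elim (rule Rc)
    qed
    show "((\<lambda>x. transpose (scalar_mpow c B) *v R (\<phi> x)) \<longlongrightarrow> transpose (scalar_mpow c B) *v w) (at 0)"
      by (intro bounded_linear.tendsto[OF matrix_vector_mul_bounded_linear] lim)
  qed
  have "w = 0" using zero_eigenvalue[OF scalar_mpow_fixed_imp_kernel[OF inv]] eig by blast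
  have p: "0 < \<phi> t" by (rule \<phi>_pos[OF t])
  \<comment> \<open>w is the image of u under an invertible matrix, so w = 0 forces u = 0.\<close>
  have "transpose (scalar_mpow (1 / \<phi> t) B) *v w = transpose (scalar_mpow (\<phi> t) B ** scalar_mpow (1 / \<phi> t) B) *v u"
    by (simp only: w_def R_def matrix_transpose_mul matrix_vector_mul_assoc)
  also have "\<dots> = u" unfolding scalar_mpow_inverse_right[OF p] by (simp only: transpose_mat matrix_vector_mul_lid)
  finally show ?thesis using \<open>w = 0\<close> by simp
qed

end

context tempered_random_measure
begin

text \<open>An almost surely constant projection has a characteristic function of modulus 1, so the
  exponent vanishes. Its integrand has a constant sign and is therefore 0 almost everywhere, and
  \<psi> vanishes only at 0.\<close>

lemma hyperplane_imp_kernel: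
  assumes f[measurable]: "f \<in> borel_measurable borel" and w: "wint f < \<infinity>" and Y: "has_stoch_integral P M f Y"
    and ae: "AE \<omega> in P. u \<bullet> Y \<omega> = c"
  shows "AE s in lborel. transpose (f s) *v u = 0"
proof -
  let ?I = "\<integral>s. \<psi> (transpose (f s) *v u) \<partial>lborel"
  have Ym[measurable]: "Y \<in> borel_measurable P" using Y by (simp add: has_stoch_integral_def)
  have "complex_of_real (exp ?I) = (\<integral>\<omega>. iexp (u \<bullet> Y \<omega>) \<partial>P)" by (rule has_stoch_integral_cf[OF f w Y, symmetric])
  also have "\<dots> = (\<integral>\<omega>. iexp c \<partial>P)" by (rule integral_cong_AE) (use ae in \<open>auto elim!: eventually_mono\<close>)
  also have "\<dots> = iexp c" by (simp add: prob_space)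
  finally have "norm (complex_of_real (exp ?I)) = 1" by simp
  then have I: "?I = 0" by simp
  have int: "integrable lborel (\<lambda>s. - \<psi> (transpose (f s) *v u))" using integrable_\<psi>_transpose[OF f w, of u] by simp
  have "(\<integral>s. - \<psi> (transpose (f s) *v u) \<partial>lborel) = 0" using I by simp
  then have "AE s in lborel. - \<psi> (transpose (f s) *v u) = 0"
    by (subst (asm) integral_nonneg_eq_0_iff_AE[OF int]) (auto simp: \<psi>_nonpos)
  then show ?thesis by eventually_elim (auto intro: \<psi>_eq_0_imp)
qed

text \<open>The joint exponent is an integral over the parameter space, so translation invariance of
  Lebesgue measure makes it insensitive to a common shift of all integrands.\<close>

lemma fin_dim_dist_eqI:
  fixes f g :: "'k::finite \<Rightarrow> real^'n \<Rightarrow> real^'d^'d"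
  assumes f: "\<And>j. f j \<in> borel_measurable borel" "\<And>j. wint (f j) < \<infinity>" "\<And>j. has_stoch_integral P M (f j) (Y j)"
    and g: "\<And>j. g j \<in> borel_measurable borel" "\<And>j. wint (g j) < \<infinity>" "\<And>j. has_stoch_integral P M (g j) (Z j)"
    and shift: "\<And>j s. f j (h + s) = g j s"
  shows "distr P borel (\<lambda>\<omega>. \<chi> j. Y j \<omega>) = distr P borel (\<lambda>\<omega>. \<chi> j. Z j \<omega>)"
proof (rule char_fun_unique)
  have YM: "(\<lambda>\<omega>. \<chi> j. Y j \<omega>) \<in> borel_measurable P" and ZM: "(\<lambda>\<omega>. \<chi> j. Z j \<omega>) \<in> borel_measurable P"
    using f(3) g(3) by (auto intro!: borel_measurable_vec_lambda simp: has_stoch_integral_def)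
  show "prob_space (distr P borel (\<lambda>\<omega>. \<chi> j. Y j \<omega>))" "prob_space (distr P borel (\<lambda>\<omega>. \<chi> j. Z j \<omega>))"
    by (rule prob_space_distr[OF YM], rule prob_space_distr[OF ZM])
  fix U
  let ?v = "\<lambda>s. \<psi> (\<Sum>j\<in>UNIV. transpose (f j s) *v (U $ j))"
  note [measurable] = f(1)
  have vm: "?v \<in> borel_measurable borel" by measurable
  have "(\<integral>s. ?v s \<partial>lborel) = (\<integral>s. ?v s \<partial>distr lborel borel ((+) h))" unfolding lborel_distr_plus ..
  also have "\<dots> = (\<integral>s. ?v (h + s) \<partial>lborel)" by (rule integral_distr) (use vm in auto)
  finally have "(\<integral>s. ?v s \<partial>lborel) = (\<integral>s. \<psi> (\<Sum>j\<in>UNIV. transpose (g j s) *v (U $ j)) \<partial>lborel)" by (simp only: shift)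
  then show "char_fun (distr P borel (\<lambda>\<omega>. \<chi> j. Y j \<omega>)) U = char_fun (distr P borel (\<lambda>\<omega>. \<chi> j. Z j \<omega>)) U"
    unfolding char_fun_distr[OF YM] char_fun_distr[OF ZM] joint_cf[OF f] joint_cf[OF g] by simp
qed simp_all

end

text \<open>Integrals are determined only up to almost sure equality, hence the quantification over
  all families \<open>X\<close> of versions; integrability of the kernels is the separate first
  conjunct.\<close>

theorem theorem3p3:
  fixes P :: "'w measure"
    and \<alpha> lam \<beta> q H :: real
    and \<sigma> :: "(real^'d) measure"
    and M :: "(real^'n) set \<Rightarrow> 'w \<Rightarrow> real^'d"
    and E :: "real^'n^'n"
    and N :: "real^'n \<Rightarrow> real"
    and \<phi> :: "real^'n \<Rightarrow> real"
    and D :: "real^'d^'d"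
  assumes "0 < \<alpha>" and "\<alpha> < 2" and "0 < lam"
    and "sphere_measure \<sigma>"
    and "distr \<sigma> \<sigma> uminus = \<sigma>"
    and "\<And>V. subspace V \<Longrightarrow> dim V = CARD('d) - 1 \<Longrightarrow> 0 < emeasure \<sigma> (sphere 0 1 - V)"
    and "prob_space P"
    and "exp_tempered_random_measure P \<alpha> lam \<sigma> M"
    and "E \<in> pos_spectrum" and "q = trace E"
    and "polar_norm E N"
    and "\<And>x. 0 \<le> \<phi> x"
    and "homogeneous_fun E \<phi>"
    and "0 < \<beta>" and "admissible_fun \<beta> E N \<phi>"
    and "D \<in> pos_spectrum"
    and "H = Max (Re ` complex_eigenvalues D)"
    and "H < \<beta> + q * (1 / \<alpha> - 1 / 2)"
  shows "(\<forall>t. ma_kernel \<phi> (D - (q / \<alpha>) *\<^sub>R mat 1) t \<in> stoch_integrable P M) \<and>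
    (\<forall>X. (\<forall>t. has_stoch_integral P M (ma_kernel \<phi> (D - (q / \<alpha>) *\<^sub>R mat 1) t) (X t)) \<longrightarrow>
       (\<forall>t::'k::finite \<Rightarrow> real^'n. tempered_stable \<alpha> (fin_dim_dist P X t)) \<and>
       (\<forall>t. tendsto_in_prob P X (X t) (at t)) \<and>
       (\<forall>h. \<forall>t::'k \<Rightarrow> real^'n.
          fin_dim_dist P (\<lambda>s \<omega>. X (s + h) \<omega> - X h \<omega>) t = fin_dim_dist P X t) \<and>
       (complex_of_real (q / \<alpha>) \<notin> complex_eigenvalues D \<longrightarrow>
          (\<forall>t. t \<noteq> 0 \<longrightarrow> full_law (distr P borel (X t)))))"
proof -
  define B where "B = D - (q / \<alpha>) *\<^sub>R mat 1"
  have eigB: "z + of_real (q / \<alpha>) \<in> complex_eigenvalues D" if "z \<in> complex_eigenvalues B" for z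
    using that unfolding B_def complex_eigenvalues_diff_mat by auto
  \<comment> \<open>The growth bound needs an exponent strictly above all real parts, and the strict
    inequality for H leaves room for one.\<close>
  obtain H' where H': "H < H'" "H' < \<beta> + q * (1 / \<alpha> - 1 / 2)" using dense assms(18) by blast
  obtain h0 where h0: "0 < h0" "\<And>z. z \<in> complex_eigenvalues D \<Longrightarrow> h0 < Re z"
    using pos_spectrum_lower_bound[OF assms(16)] by blast
  interpret A: admissible_kernel E N \<phi> B \<alpha> \<beta> "H' - q / \<alpha>" "h0 - q / \<alpha>"
  proof
    fix z assume "z \<in> complex_eigenvalues B"
    then have z: "z + of_real (q / \<alpha>) \<in> complex_eigenvalues D" by (rule eigB)
    show "h0 - q / \<alpha> < Re z" using h0(2)[OF z] by simp
    have "Re (z + of_real (q / \<alpha>)) \<le> H" unfolding assms(17) by (intro Max_ge finite_imageI finite_complex_eigenvalues imageI z)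
    then show "Re z < H' - q / \<alpha>" using H'(1) by simp
  next
    \<comment> \<open>As q is the trace of E, the expression equals h0 \<alpha>: subtracting
      q/\<alpha> in the exponent is exactly compensated by the volume growth.\<close>
    show "0 < (h0 - q / \<alpha>) * \<alpha> + trace E" using h0(1) assms(1,10) by (simp add: algebra_simps)
    have "2 * H' < 2 * (\<beta> + q * (1 / \<alpha> - 1 / 2))" using H'(2) by simp
    then show "2 * (H' - q / \<alpha> - \<beta>) + trace E < 0" using assms(10) by (simp add: algebra_simps)
  qed (use assms in auto)
  interpret T: tempered_random_measure \<alpha> lam \<sigma> P M
    using assms by (intro tempered_random_measure.intro tempered_levy.intro tempered_random_measure_axioms.intro)
  let ?k = "ma_kernel \<phi> B"
  have km[measurable]: "?k t \<in> borel_measurable borel" for t by (rule A.borel_measurable_ma_kernel)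
  have kw: "T.wint (?k t) < \<infinity>" for t unfolding T.wint_def by (rule A.ma_kernel_integrable)
  have shift: "?k (t + h) (h + s) - ?k h (h + s) = ?k t s" for t h s by (simp add: ma_kernel_def)
  have "?k t \<in> stoch_integrable P M" for t by (rule T.wint_stoch_integrable[OF km kw])
  moreover have "(\<forall>t::'k \<Rightarrow> real^'n. tempered_stable \<alpha> (fin_dim_dist P X t)) \<and> (\<forall>t. tendsto_in_prob P X (X t) (at t)) \<and>
       (\<forall>h. \<forall>t::'k \<Rightarrow> real^'n. fin_dim_dist P (\<lambda>s \<omega>. X (s + h) \<omega> - X h \<omega>) t = fin_dim_dist P X t) \<and>
       (complex_of_real (q / \<alpha>) \<notin> complex_eigenvalues D \<longrightarrow> (\<forall>t. t \<noteq> 0 \<longrightarrow> full_law (distr P borel (X t))))"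
    if "\<forall>t. has_stoch_integral P M (?k t) (X t)" for X
  proof (intro conjI allI impI)
    have X: "has_stoch_integral P M (?k t) (X t)" for t using that by blast
    then have Xm[measurable]: "X t \<in> borel_measurable P" for t by (simp add: has_stoch_integral_def)
    show "tempered_stable \<alpha> (fin_dim_dist P X t)" for t :: "'k \<Rightarrow> real^'n"
      unfolding fin_dim_dist_def by (rule T.tempered_stable_integrals[OF km kw X])
    have dw: "T.wint (\<lambda>s. ?k t s - ?k h s) < \<infinity>" for t h by (rule T.wint_add(2)[OF km km kw kw])
    show "fin_dim_dist P (\<lambda>s \<omega>. X (s + h) \<omega> - X h \<omega>) t = fin_dim_dist P X t" for h and t :: "'k \<Rightarrow> real^'n"
      unfolding fin_dim_dist_def
      by (rule T.fin_dim_dist_eqI[where f = "\<lambda>j s. ?k (t j + h) s - ?k h s" and g = "\<lambda>j. ?k (t j)" and h = h])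
        (simp_all only: km kw X dw shift T.has_stoch_integral_diff borel_measurable_diff)
    show "tendsto_in_prob P X (X t) (at t)" for t
      unfolding tendsto_in_prob_def
    proof (intro allI impI)
      fix \<epsilon> :: real assume \<epsilon>: "0 < \<epsilon>"
      \<comment> \<open>The increment from t to s has the kernel of X (s - t) up to a translation of
        the integration variable, so continuity at t reduces to smallness of the kernel integral for
        small shifts.\<close>
      have bound: "measure P {\<omega>\<in>space P. \<epsilon> < dist (X s \<omega>) (X t \<omega>)} \<le> T.tailc \<epsilon> * enn2real (T.wint (?k (s - t)))" for s
      proof -
        have "T.wint (\<lambda>r. ?k s r - ?k t r) = (\<integral>\<^sup>+r. ennreal (wgt \<alpha> (norm (?k s r - ?k t r))) \<partial>distr lborel borel ((+) t))"
          unfolding T.wint_def lborel_distr_plus ..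
        also have "\<dots> = (\<integral>\<^sup>+r. ennreal (wgt \<alpha> (norm (?k s (t + r) - ?k t (t + r)))) \<partial>lborel)"
          by (rule nn_integral_distr) measurable
        also have "\<dots> = T.wint (?k (s - t))" unfolding T.wint_def using shift[of "s - t" t] by simp
        finally show ?thesis
          using T.has_stoch_integral_tail[OF _ dw T.has_stoch_integral_diff[OF X X] \<epsilon>, of s t] by (simp add: dist_norm)
      qed
      have "((\<lambda>s. T.tailc \<epsilon> * enn2real (T.wint (?k (s - t)))) \<longlongrightarrow> T.tailc \<epsilon> * 0) (at t)"
      proof (intro tendsto_mult_left order_tendstoI)
        fix a :: real assume "a < 0"
        then show "eventually (\<lambda>s. a < enn2real (T.wint (?k (s - t)))) (at t)" by (intro always_eventually allI) (auto intro: less_le_trans)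
      next
        fix a :: real assume "0 < a"
        then obtain \<delta> where \<delta>: "0 < \<delta>" "\<And>h. norm h < \<delta> \<Longrightarrow> T.wint (?k h) < ennreal a"
          using A.ma_kernel_integral_small unfolding T.wint_def by blast
        have "enn2real (T.wint (?k (s - t))) < a" if "dist s t < \<delta>" for s
        proof -
          have "T.wint (?k (s - t)) < ennreal a" using that by (intro \<delta>(2)) (simp add: dist_norm)
          then show ?thesis using \<open>0 < a\<close> by (cases "T.wint (?k (s - t))") (auto simp: ennreal_less_iff)
        qed
        then show "eventually (\<lambda>s. enn2real (T.wint (?k (s - t))) < a) (at t)"
          unfolding eventually_at using \<delta>(1) by blast
      qed
      then have lim: "((\<lambda>s. T.tailc \<epsilon> * enn2real (T.wint (?k (s - t)))) \<longlongrightarrow> 0) (at t)" by (simp only: mult_zero_right)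
      have "eventually (\<lambda>s. norm (measure P {\<omega>\<in>space P. \<epsilon> < dist (X s \<omega>) (X t \<omega>)}) \<le> T.tailc \<epsilon> * enn2real (T.wint (?k (s - t)))) (at t)"
        by (rule always_eventually, rule allI, simp only: real_norm_def abs_of_nonneg measure_nonneg, rule bound)
      then show "((\<lambda>s. measure P {\<omega>\<in>space P. \<epsilon> < dist (X s \<omega>) (X t \<omega>)}) \<longlongrightarrow> 0) (at t)"
        using lim by (rule Lim_null_comparison)
    qed
    fix t :: "real^'n" assume q: "complex_of_real (q / \<alpha>) \<notin> complex_eigenvalues D" and t: "t \<noteq> 0"
    have eig0: "0 \<notin> complex_eigenvalues B" using eigB[of 0] q by auto
    show "full_law (distr P borel (X t))"
      unfolding full_law_def
    proof (intro allI impI notI)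
      fix u c assume u: "u \<noteq> 0" and ae: "AE x in distr P borel (X t). u \<bullet> x = c"
      have "AE \<omega> in P. u \<bullet> X t \<omega> = c" using ae by (subst (asm) AE_distr_iff) auto
      then have "AE s in lborel. transpose (?k t s) *v u = 0" by (rule T.hyperplane_imp_kernel[OF km kw X])
      then have "u = 0" by (rule A.ma_kernel_kernel_trivial[OF _ t eig0])
      with u show False ..
    qed
  qed
  ultimately show ?thesis unfolding B_def by blast
qed

end
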